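(* Let $\mathcal T=(\Delta,\Sigma,\Upsilon)$ be a dicritical triplet at $(\mathbb C^2,0)$. Then there exist: (1) a system of residues $\Lambda$ such that $\mathcal Q=(\Delta,\Sigma,\Upsilon,\Lambda)$ is a dicritical quadruplet; (2) a $\mathcal Q$-logarithmic $1$-form $\eta$.
   Context: **Blow-ups.** A sequence of quadratic blow-ups $\pi:(\tilde M,\mathcal D)\to(\mathbb C^2,0)$ is a finite composition $\pi=\sigma_1\circ\cdots\circ\sigma_n$, where $\sigma_j:(\tilde M_j,\mathcal D_j)\to(\tilde M_{j-1},\mathcal D_{j-1})$ is the blow-up of a point $q_{j-1}\in\mathcal D_{j-1}$, $(\tilde M_0,\mathcal D_0)=(\mathbb C^2,0)$, $q_0=0$, $(\tilde M_n,\mathcal D_n)=(\tilde M,\mathcal D)$. Put $\pi_j=\sigma_1\circ\cdots\circ\sigma_j$, $\varsigma_j=\sigma_{j+1}\circ\cdots\circ\sigma_n$, $\mathcal D_j=\pi_j^{-1}(0)$; objects in $\tilde M_j$ are "at level $j$". "Component" means irreducible component of an exceptional divisor; regular points of the divisor are trace points, singular points are corners; $\mathrm{Val}(D)$ is the number of intersection points of $D\subset\mathcal D_n$ with other components of $\mathcal D_n$. An upper star (as in $\pi^*B$, $\sigma_j^*D$) denotes strict transform for curves. $\mathcal B_p$ is the set of complex analytic branches (irreducible germs of curves) at $p$, and $\mathcal B_p(C)$ the set of local branches at $p$ of a curve $C$; $\nu_p(S)$ is the order (multiplicity) of $S$ at $p$. For $B\in\mathcal B_0$, $\pi^*B$ is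 transverse to $\mathcal D$ if it is smooth and meets $\mathcal D$ transversally at a trace point; then $D^\pi(B)$ is the component it meets. For a finite set $\mathcal S\subset\mathcal B_0$, $\pi$ realizes the equisingularity class $\varepsilon(\mathcal S)$ if the $\pi^*B$, $B\in\mathcal S$, are disjoint and transverse to $\mathcal D$. For a component $D\subset\mathcal D$, the infinitesimal class $\kappa(D)$ consists, up to isomorphism over $(\mathbb C^2,0)$, of all $(\pi',D')$ with either $\pi'=\pi\circ\varsigma$, $D'=\varsigma^*D$, or $\pi=\pi'\circ\varsigma'$, $D=\varsigma'^*D'$ ($\varsigma,\varsigma'$ sequences of blow-ups); such $\pi'$ are its realizations. For a union $\mathcal D^*$ of components, a realization of $\kappa(\mathcal D^* )$ is a sequence of blow-ups that simultaneously realizes $\kappa(D)$ for all $D\subset\mathcal D^*$ and such that no two of the corresponding components intersect. Minimal means not factored by another realization. **Dicritical duplets.** A dicritical structure $\Delta$ with underlying sequence $\pi$, of height $h(\Delta)=n$, consists of decompositions $\mathcal D_j=\mathcal D_j^\delta\cup\mathcal D_j^\iota$ ($j=1,\dots,n$) into unions of components (dicritical / non-dicritical) with: (D.1) no common components in $\mathcal D_j^\delta$ and $\mathcal D_j^\iota$; (D.2) $D\subset\mathcal D^\delta_{j-1}$ iff $\sigma_j^*D\subset\mathcal D_j^\delta$ ($j\ge2$); (D.3) two components of $\mathcal D_n^\delta$ do not intersect. The blow-up $\sigma_j$ is dicritical if $\sigma_j^{-1}(q_{j-1})\subset\mathcal D_j^\delta$, non-dicritical otherwise. A configuration of separatrices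 $\Sigma$ framed on $\Delta$ is a finite set $\mathcal S_0=\mathcal S_0^\delta\sqcup\mathcal S_0^\iota\subset\mathcal B_0$ with its strict transforms $\mathcal S_j=\mathcal S_j^\delta\cup\mathcal S_j^\iota$ by $\pi_j$, such that: (S.1) $\pi$ realizes $\varepsilon(\mathcal S_0)$ and, for $S\in\mathcal S_0$, $S\in\mathcal S_0^\delta$ iff $D^\pi(S)\subset\mathcal D_n^\delta$; (S.2) every connected component of $\mathcal D_n^\iota$ contains $D^\pi(S)$ for some $S\in\mathcal S_0^\iota$; (S.3) if $D\subset\mathcal D_n^\delta$ has $\mathrm{Val}(D)=1$ there is $S\in\mathcal S_0^\delta$ with $D^\pi(S)=D$; (S.4) $\pi$ is a minimal sequence of blow-ups simultaneously realizing $\kappa(\mathcal D_n^\delta)$ and $\varepsilon(\mathcal S_0)$. Elements of $\mathcal S_0^\delta$ (resp. $\mathcal S_0^\iota$) are dicritical (resp. isolated) separatrices. $(\Delta,\Sigma)$ is a dicritical duplet; its support at level $j$ is $\mathcal Z_j=\mathcal S_j\cup\mathcal D_j^\iota$ (germ around $\mathcal D_j$; $\mathcal Z_0=\mathcal S_0$). Standing convention: the radial case ($n=1$, $\mathcal D_1=\mathcal D_1^\delta$) is excluded. **Indices.** A system of indices $\Upsilon$ for $(\Delta,\Sigma)$ assigns $I_p(S)\in\mathbb C$ to every $0\le j\le n$, $p\in\mathcal Z_j\cap\mathcal D_j$, $S\in\mathcal B_p(\mathcal Z_j)$, such that: (I.1) if $\tilde S=\sigma_j^*S$ and $\tilde p$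 is its point over $p$ ($p$ at level $j-1$), $I_{\tilde p}(\tilde S)=I_p(S)-\nu_p(S)^2$ if $p$ is the centre of $\sigma_j$, and $I_{\tilde p}(\tilde S)=I_p(S)$ otherwise; (I.2) $I_p(S)=0$ if $p$ is a regular point of $\mathcal Z_j$; (I.3) $\sum_{p\in D}I_p(D)=D\cdot D$ (self-intersection in $\tilde M_j$) for every component $D\subset\mathcal D_j^\iota$, $j\ge1$; (I.4) if $p$ is a singular point of $\mathcal Z_n$ with branches $S_1,S_2$, then $I_p(S_1),I_p(S_2)\in\mathbb C^*\setminus\mathbb Q_+$ and $I_p(S_2)=1/I_p(S_1)$. $(\Delta,\Sigma,\Upsilon)$ is a dicritical triplet. **Residues.** A system of residues $\Lambda$ for $(\Delta,\Sigma)$ assigns $\lambda_S\in\mathbb C^*$ to every irreducible component $S$ of $\mathcal Z_j$, $0\le j\le n$, such that: (R.1) $\lambda_{\sigma_{j+1}^*S}=\lambda_S$; (R.2) if $\sigma_{j+1}$ is a non-dicritical blow-up at $q$ and $D=\sigma_{j+1}^{-1}(q)$, then $\lambda_D=\sum_{S\subset\mathcal Z_j}\nu_q(S)\lambda_S\neq0$; (R.3) if $\sigma_{j+1}$ is a dicritical blow-up at $q$, then $\sum_{S\subset\mathcal Z_j}\nu_q(S)\lambda_S=0$. $\Upsilon$ and $\Lambda$ are consistent if for every $p\in\mathrm{Sing}(\mathcal Z_n)$ with branches $S_1,S_2$: $I_p(S_1)=-\lambda_{S_2}/\lambda_{S_1}$ and $I_p(S_2)=-\lambda_{S_1}/\lambda_{S_2}$;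 then $(\Delta,\Sigma,\Upsilon,\Lambda)$ is a dicritical quadruplet. **Logarithmic forms.** A germ of logarithmic $1$-form is $\eta=\sum_{S\in\mathcal S}\lambda_S\,df_S/f_S+\alpha$, with $\mathcal S\subset\mathcal B_0$ finite, $f_S$ an irreducible equation of $S$, $\lambda_S\in\mathbb C^*$, $\alpha$ a germ of closed holomorphic $1$-form. It defines a germ of foliation $\mathcal L$. The minimal reduction of singularities of a germ of foliation is the minimal sequence of blow-ups such that the strict transform foliation has finitely many singularities over the exceptional divisor, all simple (given by a vector field with non-nilpotent linear part whose eigenvalues have ratio outside $\mathbb Q_+$), has no singularities nor tangencies on non-invariant components, and two non-invariant components do not meet. $\Delta(\eta)$ is the dicritical structure over the minimal reduction of singularities of $\mathcal L$ whose dicritical components are the non-invariant ones; $\Sigma(\eta)$ has as level-$0$ set the polar branches $\mathcal S$ together with all isolated separatrices of $\mathcal L$ (invariant branches whose lift meets an invariant component); $\mathcal{DD}(\eta)=(\Delta(\eta),\Sigma(\eta))$. $\eta$ is $1$-faithful if $\nu_0(f\eta)=\nu_0(f)-1$, $f=\prod f_S$; it is faithful if its transforms are $1$-faithful along the reduction of singularities of $\mathcal L$ (at the centres where they have poles). **Dominance.** $\Delta'\ge\Delta$ if $n'=h(\Delta')\ge n=h(\Delta)$, the first $n$ blow-ups and the decompositions $\mathcal D_j^\delta\cup\mathcal D_j^\iota$, $j\le n$, coincide, and, if $n'>n$, $\sigma'_{n+1}\circ\cdots\circ\sigma'_{n'}$ is a composition of non-dicritical blow-ups, non-trivial only over finitely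 many trace points of components of $\mathcal D_n^\delta$. $(\Delta',\Sigma')\ge(\Delta,\Sigma)$ if $\Delta'\ge\Delta$; $\mathcal S_0'\supset\mathcal S_0$ and $\mathcal S'_0\setminus\mathcal S_0$ contains only isolated separatrices for $\Sigma'$; elements of $\mathcal S_0$ have the same type (dicritical/isolated) for both; and for $S\in\mathcal S_0'\setminus\mathcal S_0$, $D=D^\pi(S)\subset\mathcal D_n^\delta$ and $\pi^*S\cap D\notin\mathcal Z_n$. **$\mathcal Q$-logarithmic.** For a dicritical quadruplet $\mathcal Q=(\Delta,\Sigma,\Upsilon,\Lambda)$, a germ of closed meromorphic $1$-form $\eta$ is $\mathcal Q$-logarithmic if: (1) $\eta=\sum_{S\in\mathcal S_0}\lambda_S\,df_S/f_S+\alpha$ with $f_S$ local equations of the $S\in\mathcal S_0$, $\lambda_S$ the residues of $\Lambda$, $\alpha$ a germ of closed holomorphic $1$-form; (2) $\mathcal{DD}(\eta)\ge(\Delta,\Sigma)$; (3) $\eta$ is faithful. *)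

theory Defs
  imports
    "HOL-Computational_Algebra.Computational_Algebra"
    "HOL-Library.Sublist"
begin

section \<open>The local ring of germs of holomorphic functions at the origin of the plane\<close>

text \<open>
  A germ of holomorphic function is given by its convergent Taylor series. A double series is
  stored as a power series in \<open>y\<close> whose coefficients are power series in \<open>x\<close>, so the coefficient of
  \<open>x\<^sup>i y\<^sup>j\<close> in \<open>f\<close> is \<open>f $ j $ i\<close>.
\<close>

definition conv2 :: "complex fps fps \<Rightarrow> bool" where
  "conv2 f \<longleftrightarrow> (\<exists>C r. \<forall>i j. norm (f $ j $ i) \<le> C * r ^ (i + j))"

lemma conv2I: "(\<And>i j. norm (f $ j $ i) \<le> C * r ^ (i + j)) \<Longrightarrow> conv2 f"
  unfolding conv2_def by blast

lemma conv2E: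
  assumes "conv2 f"
  obtains C r where "C \<ge> 0" "r \<ge> 1" "\<And>i j. norm (f $ j $ i) \<le> C * r ^ (i + j)"
proof -
  obtain C r where *: "\<And>i j. norm (f $ j $ i) \<le> C * r ^ (i + j)"
    using assms unfolding conv2_def by blast
  have "norm (f $ j $ i) \<le> \<bar>C\<bar> * (max 1 \<bar>r\<bar>) ^ (i + j)" for i j
  proof -
    have "norm (f $ j $ i) \<le> \<bar>C * r ^ (i + j)\<bar>"
      using * abs_ge_self order_trans by blast
    also have "\<dots> = \<bar>C\<bar> * \<bar>r\<bar> ^ (i + j)"
      by (simp add: abs_mult power_abs)
    also have "\<dots> \<le> \<bar>C\<bar> * (max 1 \<bar>r\<bar>) ^ (i + j)"
      by (intro mult_left_mono power_mono) auto
    finally show ?thesis .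
  qed
  then show ?thesis
    using that[of "\<bar>C\<bar>" "max 1 \<bar>r\<bar>"] by auto
qed

lemma fps2_mult_nth:
  fixes f g :: "'a :: comm_ring_1 fps fps"
  shows "(f * g) $ j $ i = (\<Sum>b\<le>j. \<Sum>a\<le>i. f $ b $ a * g $ (j - b) $ (i - a))"
  by (simp add: fps_mult_nth fps_sum_nth atLeast0AtMost)

lemma Suc_le_two_power: "real (Suc n) \<le> 2 ^ n"
  by (induction n) auto

lemma conv2_mult:
  assumes "conv2 f" "conv2 g"
  shows "conv2 (f * g)"
proof -
  obtain C r where C: "C \<ge> 0" "r \<ge> 1" "\<And>i j. norm (f $ j $ i) \<le> C * r ^ (i + j)"
    using conv2E[OF assms(1)] by blast
  obtain D s where D: "D \<ge> 0" "s \<ge> 1" "\<And>i j. norm (g $ j $ i) \<le> D * s ^ (i + j)"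
    using conv2E[OF assms(2)] by blast
  define m where "m = max r s"
  have m: "m \<ge> 1" "r \<le> m" "s \<le> m" using C by (auto simp: m_def)
  have bnd: "norm (f $ b $ a * g $ (j - b) $ (i - a)) \<le> C * D * m ^ (i + j)"
    if "a \<le> i" "b \<le> j" for a b i j
  proof -
    have "norm (f $ b $ a * g $ (j - b) $ (i - a))
        \<le> (C * r ^ (a + b)) * (D * s ^ ((i - a) + (j - b)))"
      unfolding norm_mult using C D by (intro mult_mono) auto
    also have "\<dots> \<le> (C * m ^ (a + b)) * (D * m ^ ((i - a) + (j - b)))"
      using C D m by (intro mult_mono mult_left_mono power_mono) auto
    also have "\<dots> = C * D * m ^ ((a + b) + ((i - a) + (j - b)))"
      by (simp only: power_add mult_ac)
    also have "(a + b) + ((i - a) + (j - b)) = i + j"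
      using that by auto
    finally show ?thesis .
  qed
  show ?thesis
  proof (rule conv2I[where C = "C * D" and r = "2 * m"])
    fix i j
    have "norm ((f * g) $ j $ i) \<le> (\<Sum>b\<le>j. \<Sum>a\<le>i. C * D * m ^ (i + j))"
      unfolding fps2_mult_nth by (intro sum_norm_le) (use bnd in auto)
    also have "\<dots> = C * D * m ^ (i + j) * (real (Suc j) * real (Suc i))"
      by simp
    also have "\<dots> \<le> C * D * m ^ (i + j) * (2 ^ j * 2 ^ i)"
      using C(1) D(1) m by (intro mult_left_mono mult_mono Suc_le_two_power) auto
    also have "\<dots> = C * D * (2 * m) ^ (i + j)"
      by (simp add: power_add power_mult_distrib mult_ac)
    finally show "norm ((f * g) $ j $ i) \<le> C * D * (2 * m) ^ (i + j)" .
  qed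
qed

lemma conv2_add:
  assumes "conv2 f" "conv2 g"
  shows "conv2 (f + g)"
proof -
  obtain C r where C: "C \<ge> 0" "r \<ge> 1" "\<And>i j. norm (f $ j $ i) \<le> C * r ^ (i + j)"
    using conv2E[OF assms(1)] by blast
  obtain D s where D: "D \<ge> 0" "s \<ge> 1" "\<And>i j. norm (g $ j $ i) \<le> D * s ^ (i + j)"
    using conv2E[OF assms(2)] by blast
  show ?thesis
  proof (rule conv2I[where C = "C + D" and r = "max r s"])
    fix i j
    have "norm ((f + g) $ j $ i) \<le> C * r ^ (i + j) + D * s ^ (i + j)"
      using C(3)[of j i] D(3)[of j i] norm_triangle_ineq[of "f $ j $ i" "g $ j $ i"] by simp
    also have "\<dots> \<le> C * max r s ^ (i + j) + D * max r s ^ (i + j)"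
      using C D by (intro add_mono mult_left_mono power_mono) auto
    finally show "norm ((f + g) $ j $ i) \<le> (C + D) * max r s ^ (i + j)"
      by (simp add: algebra_simps)
  qed
qed

lemma conv2_uminus: "conv2 f \<Longrightarrow> conv2 (- f)"
  unfolding conv2_def by simp

lemma conv2_const [simp]: "conv2 (fps_const (fps_const c))"
  by (rule conv2I[where C = "norm c" and r = 1]) (auto simp: fps_const_def)

lemma conv2_0 [simp]: "conv2 0"
  by (rule conv2I[where C = 0 and r = 1]) auto

lemma conv2_1 [simp]: "conv2 1"
  by (rule conv2I[where C = 1 and r = 1]) (auto simp: fps_one_def)

typedef germ = "{f. conv2 f}"
  morphisms series Abs_germ
  using conv2_0 by blast

setup_lifting type_definition_germ

instantiation germ :: idom
begin

lift_definition zero_germ :: germ is 0 by simp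
lift_definition one_germ :: germ is 1 by simp
lift_definition plus_germ :: "germ \<Rightarrow> germ \<Rightarrow> germ" is "(+)" by (rule conv2_add)
lift_definition times_germ :: "germ \<Rightarrow> germ \<Rightarrow> germ" is "(*)" by (rule conv2_mult)
lift_definition uminus_germ :: "germ \<Rightarrow> germ" is uminus by (rule conv2_uminus)
lift_definition minus_germ :: "germ \<Rightarrow> germ \<Rightarrow> germ" is "(-)"
  using conv2_add conv2_uminus by fastforce

instance
  by (standard; transfer) (simp_all add: algebra_simps)

end

text \<open>Exact division; a quotient that does not exist is set to zero.\<close>

instantiation germ :: idom_divide
begin

definition divide_germ :: "germ \<Rightarrow> germ \<Rightarrow> germ" where
  "divide_germ f g = (if g \<noteq> 0 \<and> g dvd f then THE h. f = h * g else 0)"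

instance
  by standard (auto simp: divide_germ_def)

end

instance germ :: algebraic_semidom ..

lift_definition coeff2 :: "germ \<Rightarrow> nat \<Rightarrow> nat \<Rightarrow> complex" is "\<lambda>f i j. f $ j $ i" .

lemma germ_eqI: "(\<And>i j. coeff2 f i j = coeff2 g i j) \<Longrightarrow> f = g"
  by transfer (simp add: fps_eq_iff)

lemma coeff2_0 [simp]: "coeff2 0 i j = 0"
  by transfer simp

lemma coeff2_add [simp]: "coeff2 (f + g) i j = coeff2 f i j + coeff2 g i j"
  by transfer simp

lemma coeff2_mult:
  "coeff2 (f * g) i j = (\<Sum>b\<le>j. \<Sum>a\<le>i. coeff2 f a b * coeff2 g (i - a) (j - b))"
  by transfer (rule fps2_mult_nth)

definition val :: "germ \<Rightarrow> complex" where
  "val f = coeff2 f 0 0"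

lift_definition const :: "complex \<Rightarrow> germ" is "\<lambda>c. fps_const (fps_const c)" by simp

lift_definition X :: germ is "fps_const fps_X"
  by (rule conv2I[where C = 1 and r = 1]) (auto simp: fps_X_def)

lift_definition Y :: germ is "fps_X"
  by (rule conv2I[where C = 1 and r = 1]) (auto simp: fps_X_def)

lemma conv2_deriv_bound:
  assumes C: "C \<ge> 0" "(r::real) \<ge> 1" and "norm (z::complex) \<le> C * r ^ Suc (i + j)" and "k \<le> i + j"
  shows "norm (of_nat (Suc k) * z) \<le> (C * r) * (2 * r) ^ (i + j)"
proof -
  have "norm (of_nat (Suc k) * z) = real (Suc k) * norm z"
    by (simp only: norm_mult norm_of_nat)
  also have "\<dots> \<le> 2 ^ (i + j) * (C * r ^ Suc (i + j))"
  proof (intro mult_mono)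
    have "real (Suc k) \<le> real (Suc (i + j))" using assms by simp
    also have "\<dots> \<le> 2 ^ (i + j)" by (rule Suc_le_two_power)
    finally show "real (Suc k) \<le> 2 ^ (i + j)" .
  qed (use assms in auto)
  also have "\<dots> = (C * r) * (2 * r) ^ (i + j)"
    by (simp add: power_mult_distrib)
  finally show ?thesis .
qed

lift_definition dx :: "germ \<Rightarrow> germ"
  is "\<lambda>f. Abs_fps (\<lambda>j. Abs_fps (\<lambda>i. of_nat (Suc i) * f $ j $ Suc i))"
proof -
  fix f :: "complex fps fps" assume "conv2 f"
  then obtain C r where C: "C \<ge> 0" "r \<ge> 1" "\<And>i j. norm (f $ j $ i) \<le> C * r ^ (i + j)"
    using conv2E by blast
  show "conv2 (Abs_fps (\<lambda>j. Abs_fps (\<lambda>i. of_nat (Suc i) * f $ j $ Suc i)))"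
    using conv2_deriv_bound[OF C(1,2)] C(3)[of _ "Suc _"]
    by (intro conv2I[where C = "C * r" and r = "2 * r"]) (simp del: of_nat_Suc)
qed

lift_definition dy :: "germ \<Rightarrow> germ"
  is "\<lambda>f. Abs_fps (\<lambda>j. Abs_fps (\<lambda>i. of_nat (Suc j) * f $ Suc j $ i))"
proof -
  fix f :: "complex fps fps" assume "conv2 f"
  then obtain C r where C: "C \<ge> 0" "r \<ge> 1" "\<And>i j. norm (f $ j $ i) \<le> C * r ^ (i + j)"
    using conv2E by blast
  show "conv2 (Abs_fps (\<lambda>j. Abs_fps (\<lambda>i. of_nat (Suc j) * f $ Suc j $ i)))"
    using conv2_deriv_bound[OF C(1,2)] C(3)[of "Suc _" _]
    by (intro conv2I[where C = "C * r" and r = "2 * r"]) (simp del: of_nat_Suc)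
qed

definition ord :: "germ \<Rightarrow> nat" where
  "ord f = (LEAST n. \<exists>i j. i + j = n \<and> coeff2 f i j \<noteq> 0)"


section \<open>Blow-up of a point in coordinates\<close>

text \<open>
  The exceptional line of the blow-up of a point with coordinates \<open>(x, y)\<close> is the set of
  directions there. Around the direction \<open>y = t x\<close> the coordinates \<open>(u, v)\<close> with
  \<open>x = u, y = u (v + t)\<close> are used, around the direction \<open>x = 0\<close> those with \<open>x = u v, y = v\<close>. In
  these coordinates, again called \<open>(x, y)\<close>, the direction itself is the origin and the exceptional
  line has equation \<open>x = 0\<close>, respectively \<open>y = 0\<close>.
\<close>

datatype direction = Slope complex | Vertical

lift_definition blow_slope :: "complex \<Rightarrow> germ \<Rightarrow> germ"
  is "\<lambda>t f. Abs_fps (\<lambda>l. Abs_fps (\<lambda>k.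
        \<Sum>j\<le>k. f $ j $ (k - j) * (of_nat (j choose l) * t ^ (j - l))))"
proof -
  fix t :: complex and f :: "complex fps fps" assume "conv2 f"
  then obtain C r where C: "C \<ge> 0" "r \<ge> 1" "\<And>i j. norm (f $ j $ i) \<le> C * r ^ (i + j)"
    using conv2E by blast
  define T where "T = max 1 (norm t)"
  have T: "T \<ge> 1" "norm t \<le> T" by (auto simp: T_def)
  show "conv2 (Abs_fps (\<lambda>l. Abs_fps (\<lambda>k.
        \<Sum>j\<le>k. f $ j $ (k - j) * (of_nat (j choose l) * t ^ (j - l)))))"
  proof (rule conv2I[where C = C and r = "4 * r * T"])
    fix k l
    have bnd: "norm (f $ j $ (k - j) * (of_nat (j choose l) * t ^ (j - l)))
        \<le> C * r ^ k * (2 ^ k * T ^ k)" if "j \<le> k" for j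
    proof -
      have 1: "norm (f $ j $ (k - j)) \<le> C * r ^ k"
        using C(3)[of j "k - j"] that by simp
      have "real (j choose l) \<le> real (2 ^ j)"
        using binomial_le_pow2 by (intro of_nat_mono)
      also have "\<dots> \<le> 2 ^ k" using that by simp
      finally have 2: "norm (of_nat (j choose l) :: complex) \<le> 2 ^ k" by simp
      have "norm t ^ (j - l) \<le> T ^ (j - l)" using T by (intro power_mono) auto
      also have "\<dots> \<le> T ^ k" using T that by (intro power_increasing) auto
      finally have 3: "norm (t ^ (j - l)) \<le> T ^ k" by (simp add: norm_power)
      show ?thesis
        unfolding norm_mult using 1 2 3 C T by (intro mult_mono) auto
    qed
    have "norm (\<Sum>j\<le>k. f $ j $ (k - j) * (of_nat (j choose l) * t ^ (j - l)))
        \<le> (\<Sum>j\<le>k. C * r ^ k * (2 ^ k * T ^ k))"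
      using bnd by (intro sum_norm_le) auto
    also have "\<dots> = real (Suc k) * (C * r ^ k * (2 ^ k * T ^ k))"
      by simp
    also have "\<dots> \<le> 2 ^ k * (C * r ^ k * (2 ^ k * T ^ k))"
      using C T by (intro mult_right_mono Suc_le_two_power) auto
    also have "\<dots> = C * ((2 * 2) * r * T) ^ k"
      by (simp only: power_mult_distrib mult_ac)
    also have "\<dots> \<le> C * (4 * r * T) ^ (k + l)"
    proof -
      have "1 \<le> r * T" using C T mult_mono[of 1 r 1 T] by simp
      then show ?thesis using C by (intro mult_left_mono) (auto intro!: power_increasing)
    qed
    finally show "norm (Abs_fps (\<lambda>l. Abs_fps (\<lambda>k.
        \<Sum>j\<le>k. f $ j $ (k - j) * (of_nat (j choose l) * t ^ (j - l)))) $ l $ k)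
        \<le> C * (4 * r * T) ^ (k + l)"
      by simp
  qed
qed

lift_definition blow_vertical :: "germ \<Rightarrow> germ"
  is "\<lambda>f. Abs_fps (\<lambda>l. Abs_fps (\<lambda>k. if k \<le> l then f $ (l - k) $ k else 0))"
proof -
  fix f :: "complex fps fps" assume "conv2 f"
  then obtain C r where C: "C \<ge> 0" "r \<ge> 1" "\<And>i j. norm (f $ j $ i) \<le> C * r ^ (i + j)"
    using conv2E by blast
  show "conv2 (Abs_fps (\<lambda>l. Abs_fps (\<lambda>k. if k \<le> l then f $ (l - k) $ k else 0)))"
  proof (rule conv2I[where C = C and r = r])
    fix k l
    have "norm (f $ (l - k) $ k) \<le> C * r ^ (k + l)" if "k \<le> l"
    proof -
      have "norm (f $ (l - k) $ k) \<le> C * r ^ l"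
        using C(3)[of "l - k" k] that by simp
      also have "\<dots> \<le> C * r ^ (k + l)"
        using C by (intro mult_left_mono power_increasing) auto
      finally show ?thesis .
    qed
    then show "norm (Abs_fps (\<lambda>l. Abs_fps (\<lambda>k. if k \<le> l then f $ (l - k) $ k else 0)) $ l $ k)
        \<le> C * r ^ (k + l)"
      using C by simp
  qed
qed

fun blow :: "direction \<Rightarrow> germ \<Rightarrow> germ" where
  "blow (Slope t) = blow_slope t"
| "blow Vertical = blow_vertical"

lemma coeff2_blow_vertical:
  "coeff2 (blow_vertical f) k l = (if k \<le> l then coeff2 f k (l - k) else 0)"
  by transfer simp

lemma coeff2_blow_slope:
  "coeff2 (blow_slope t f) k l =
    (\<Sum>j\<le>k. coeff2 f (k - j) j * (of_nat (j choose l) * t ^ (j - l)))"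
  by transfer simp

lemma coeff2_blow_slope_poly:
  "coeff2 (blow_slope t f) k l = coeff (\<Sum>j\<le>k. smult (coeff2 f (k - j) j) ([:t, 1:] ^ j)) l"
proof -
  have "coeff ([:t, 1:] ^ j) l = of_nat (j choose l) * t ^ (j - l)" for j
  proof (cases "l \<le> j")
    case True
    then show ?thesis by (simp add: coeff_linear_poly_power)
  next
    case False
    then have "degree ([:t, 1:] ^ j) < l"
      by (simp add: degree_linear_power)
    then show ?thesis using False by (simp add: coeff_eq_0)
  qed
  then show ?thesis by (simp add: coeff2_blow_slope coeff_sum)
qed

lemma blow_slope_mult: "blow_slope t (f * g) = blow_slope t f * blow_slope t g"
proof (rule germ_eqI)
  fix k l
  define L where "L = [:t, 1:]"
  define P where "P = (\<lambda>f k. \<Sum>j\<le>k. smult (coeff2 f (k - j) j) (L ^ j))"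
  have coeffP: "coeff2 (blow_slope t f) k l = coeff (P f k) l" for f k l
    by (simp add: coeff2_blow_slope_poly P_def L_def)
  let ?h = "\<lambda>j b a. smult (coeff2 f a b * coeff2 g (k - j - a) (j - b)) (L ^ j)"
  let ?h' = "\<lambda>m b c. smult (coeff2 f (m - b) b * coeff2 g (k - m - c) c) (L ^ (b + c))"
  have "P (f * g) k = (\<Sum>j\<le>k. \<Sum>b\<le>j. \<Sum>a\<le>k - j. ?h j b a)"
    by (simp add: P_def coeff2_mult smult_sum)
  also have "\<dots> = (\<Sum>(j, b, a) \<in> (SIGMA j:{..k}. {..j} \<times> {..k - j}). ?h j b a)"
    by (simp add: sum.Sigma sum.cartesian_product)
  also have "\<dots> = (\<Sum>(m, b, c) \<in> (SIGMA m:{..k}. {..m} \<times> {..k - m}). ?h' m b c)"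
    by (rule sum.reindex_bij_witness[where i = "\<lambda>(m, b, c). (b + c, b, m - b)"
          and j = "\<lambda>(j, b, a). (a + b, b, j - b)"]) (auto simp: algebra_simps)
  also have "\<dots> = (\<Sum>m\<le>k. \<Sum>b\<le>m. \<Sum>c\<le>k - m. ?h' m b c)"
    by (simp add: sum.Sigma sum.cartesian_product)
  also have "\<dots> = (\<Sum>m\<le>k. P f m * P g (k - m))"
    by (simp add: P_def sum_product power_add mult_ac)
  finally have *: "P (f * g) k = (\<Sum>m\<le>k. P f m * P g (k - m))" .
  show "coeff2 (blow_slope t (f * g)) k l = coeff2 (blow_slope t f * blow_slope t g) k l"
    unfolding coeffP * coeff2_mult coeff_sum coeff_mult
    by (rule sum.swap)
qed

lemma blow_vertical_mult: "blow_vertical (f * g) = blow_vertical f * blow_vertical g"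
proof (rule germ_eqI)
  fix k l
  show "coeff2 (blow_vertical (f * g)) k l = coeff2 (blow_vertical f * blow_vertical g) k l"
  proof (cases "k \<le> l")
    case True
    let ?F = "\<lambda>a b. coeff2 (blow_vertical f) a b * coeff2 (blow_vertical g) (k - a) (l - b)"
    have "(\<Sum>b\<le>l. ?F a b) = (\<Sum>b\<le>l - k. coeff2 f a b * coeff2 g (k - a) (l - k - b))"
      if "a \<le> k" for a
    proof (rule sum.mono_neutral_cong_right[THEN trans])
      show "finite {..l}" by simp
      show "{a..a + (l - k)} \<subseteq> {..l}" using that True by auto
      show "\<forall>b\<in>{..l} - {a..a + (l - k)}. ?F a b = 0"
        using that True by (auto simp: coeff2_blow_vertical)
      show "?F a b = coeff2 f a (b - a) * coeff2 g (k - a) (l - k - (b - a))"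
        if "b \<in> {a..a + (l - k)}" for b
        using that \<open>a \<le> k\<close> True by (auto simp: coeff2_blow_vertical add.commute)
      show "(\<Sum>b = a..a + (l - k). coeff2 f a (b - a) * coeff2 g (k - a) (l - k - (b - a))) =
          (\<Sum>b\<le>l - k. coeff2 f a b * coeff2 g (k - a) (l - k - b))"
        by (rule sum.reindex_bij_witness[where i = "\<lambda>b. b + a" and j = "\<lambda>b. b - a"]) auto
    qed
    then have "(\<Sum>a\<le>k. \<Sum>b\<le>l. ?F a b) =
        (\<Sum>a\<le>k. \<Sum>b\<le>l - k. coeff2 f a b * coeff2 g (k - a) (l - k - b))"
      by (intro sum.cong[OF refl]) simp
    then show ?thesis
      using True by (simp add: coeff2_blow_vertical[of "f * g"] coeff2_mult sum.swap[of _ "{..k}"])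
  next
    case False
    have "coeff2 (blow_vertical f) a b * coeff2 (blow_vertical g) (k - a) (l - b) = 0"
      if "a \<le> k" "b \<le> l" for a b
      using that False by (auto simp: coeff2_blow_vertical)
    then show ?thesis
      using False
      by (auto simp: coeff2_blow_vertical[of "f * g"] coeff2_mult simp del: mult_eq_0_iff
          intro!: sum.neutral)
  qed
qed

lemma blow_mult: "blow t (f * g) = blow t f * blow t g"
  by (cases t) (simp_all add: blow_slope_mult blow_vertical_mult)

lemma blow_add: "blow t (f + g) = blow t f + blow t g"
  by (cases t; rule germ_eqI)
    (simp_all add: coeff2_blow_slope coeff2_blow_vertical algebra_simps sum.distrib)

lemma blow_eq_0_iff: "blow t f = 0 \<longleftrightarrow> f = 0"
proof
  assume *: "blow t f = 0"
  have "coeff2 f i j = 0" for i j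
  proof (cases t)
    case Vertical
    have "coeff2 (blow_vertical f) i (i + j) = 0" using * Vertical by simp
    then show ?thesis by (simp add: coeff2_blow_vertical)
  next
    case (Slope t')
    define k where "k = i + j"
    have "coeff2 f (k - m) m = 0" if "m \<le> k" for m
      using that
    proof (induction m rule: measure_induct_rule[where f = "\<lambda>m. k - m"])
      case (less m)
      have "coeff2 (blow_slope t' f) k m = 0" using * Slope by simp
      also have "coeff2 (blow_slope t' f) k m =
          (\<Sum>j\<le>k. if j = m then coeff2 f (k - m) m else 0)"
        unfolding coeff2_blow_slope
      proof (rule sum.cong)
        fix j assume j: "j \<in> {..k}"
        have "coeff2 f (k - j) j = 0" if "m < j"
          using less.IH[of j] less.prems j that by auto
        then show "coeff2 f (k - j) j * (of_nat (j choose m) * t' ^ (j - m)) =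
            (if j = m then coeff2 f (k - m) m else 0)"
          by (cases j m rule: linorder_cases) auto
      qed simp
      finally show ?case using less.prems by simp
    qed
    from this[of j] show ?thesis by (simp add: k_def)
  qed
  then show "f = 0" by (intro germ_eqI) simp
next
  assume "f = 0"
  then show "blow t f = 0"
    by (cases t) (auto intro!: germ_eqI simp: coeff2_blow_slope coeff2_blow_vertical)
qed

lemma coeff2_X: "coeff2 X i j = (if i = 1 \<and> j = 0 then 1 else 0)"
  by transfer (auto simp: fps_const_def fps_X_def)

lemma coeff2_Y: "coeff2 Y i j = (if i = 0 \<and> j = 1 then 1 else 0)"
  by transfer (auto simp: fps_X_def)

lemma coeff2_const: "coeff2 (const c) i j = (if i = 0 \<and> j = 0 then c else 0)"
  by transfer (auto simp: fps_const_def)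

lemma X_mult: "coeff2 (X * f) i j = (if i = 0 then 0 else coeff2 f (i - 1) j)"
  by transfer (auto simp: fps_X_mult_nth)

lemma Y_mult: "coeff2 (Y * f) i j = (if j = 0 then 0 else coeff2 f i (j - 1))"
  by transfer (auto simp: fps_X_mult_nth)

text \<open>Together with \<open>blow_mult\<close> and \<open>blow_add\<close>, the following rules show that \<^const>\<open>blow\<close> substitutes
  the formulas of the chart.\<close>

lemma blow_const: "blow t (const c) = const c"
proof (cases t)
  case (Slope s)
  have "(\<Sum>j\<le>k. coeff2 (const c) (k - j) j * (of_nat (j choose l) * s ^ (j - l))) =
      coeff2 (const c) k l" for k l
  proof -
    have "(\<Sum>j\<le>k. coeff2 (const c) (k - j) j * (of_nat (j choose l) * s ^ (j - l))) =
        (\<Sum>j\<le>k. if j = 0 then coeff2 (const c) k l else 0)"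
      by (intro sum.cong) (auto simp: coeff2_const)
    then show ?thesis by simp
  qed
  then show ?thesis using Slope by (auto intro!: germ_eqI simp: coeff2_blow_slope)
qed (auto intro!: germ_eqI simp: coeff2_blow_vertical coeff2_const)

lemma blow_X: "blow t X = (case t of Slope _ \<Rightarrow> X | Vertical \<Rightarrow> X * Y)"
proof (cases t)
  case (Slope s)
  have "(\<Sum>j\<le>k. coeff2 X (k - j) j * (of_nat (j choose l) * s ^ (j - l))) = coeff2 X k l" for k l
  proof -
    have "(\<Sum>j\<le>k. coeff2 X (k - j) j * (of_nat (j choose l) * s ^ (j - l))) =
        (\<Sum>j\<le>k. if j = 0 then coeff2 X k l else 0)"
      by (intro sum.cong) (auto simp: coeff2_X)
    then show ?thesis by simp
  qed
  then show ?thesis using Slope by (auto intro!: germ_eqI simp: coeff2_blow_slope)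
qed (auto intro!: germ_eqI simp: coeff2_blow_vertical coeff2_X coeff2_Y X_mult)

lemma blow_Y: "blow t Y = (case t of Slope s \<Rightarrow> X * (Y + const s) | Vertical \<Rightarrow> Y)"
proof (cases t)
  case (Slope s)
  have "(\<Sum>j\<le>k. coeff2 Y (k - j) j * (of_nat (j choose l) * s ^ (j - l))) =
      coeff2 (X * (Y + const s)) k l" for k l
  proof -
    have "(\<Sum>j\<le>k. coeff2 Y (k - j) j * (of_nat (j choose l) * s ^ (j - l))) =
        (\<Sum>j\<le>k. if j = 1 then coeff2 (X * (Y + const s)) k l else 0)"
      by (intro sum.cong) (auto simp: coeff2_Y coeff2_const X_mult binomial_eq_0)
    then show ?thesis by (auto simp: X_mult)
  qed
  then show ?thesis using Slope by (auto intro!: germ_eqI simp: coeff2_blow_slope)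
qed (auto intro!: germ_eqI simp: coeff2_blow_vertical coeff2_Y)


fun exc_line :: "direction \<Rightarrow> germ" where
  "exc_line (Slope t) = X"
| "exc_line Vertical = Y"

text \<open>Equation of the strict transform at a point of the exceptional line; it is a unit if the
  strict transform does not pass through that point.\<close>

definition strict1 :: "direction \<Rightarrow> germ \<Rightarrow> germ" where
  "strict1 t f = blow t f div exc_line t ^ ord f"

definition blow_fract :: "direction \<Rightarrow> germ fract \<Rightarrow> germ fract" where
  "blow_fract t z =
    (THE w. \<exists>a b. b \<noteq> 0 \<and> z = Fract a b \<and> w = Fract (blow t a) (blow t b))"

lemma blow_fract_Fract: "b \<noteq> 0 \<Longrightarrow> blow_fract t (Fract a b) = Fract (blow t a) (blow t b)"
  unfolding blow_fract_def
  by (rule the_equality) (auto simp: eq_fract blow_eq_0_iff simp flip: blow_mult)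

section \<open>Branches and infinitely near points\<close>

text \<open>A branch is given by the ideal of the germs of functions vanishing on it, which is the principal
  ideal of an irreducible germ, its equation.\<close>

type_synonym branch = "germ set"

definition curve :: "germ \<Rightarrow> germ set" where
  "curve f = {g. f dvd g}"

definition is_equation :: "branch \<Rightarrow> germ \<Rightarrow> bool" where
  "is_equation S f \<longleftrightarrow> irreducible f \<and> S = curve f"

definition branches :: "branch set" where
  "branches = {S. \<exists>f. is_equation S f}"

definition eqn :: "branch \<Rightarrow> germ" where
  "eqn S = (SOME f. is_equation S f)"

definition mult :: "branch \<Rightarrow> nat" where
  "mult S = ord (eqn S)"

text \<open>
  An infinitely near point of the origin is the list of the directions leading to it, the last one
  being a direction at the point \<open>butlast p\<close>; the origin is the empty list. Each infinitely near
  point comes with the coordinates obtained by iterating the charts above, so germs at it are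
  elements of type \<^typ>\<open>germ\<close>.
\<close>

type_synonym point = "direction list"

definition strict :: "point \<Rightarrow> germ \<Rightarrow> germ" where
  "strict p f = foldl (\<lambda>g t. strict1 t g) f p"

text \<open>A sequence of blow-ups is the list of its centres \<open>q\<^sub>0, \<dots>, q\<^bsub>n-1\<^esub>\<close>; \<open>points \<pi> j\<close> is the
  exceptional divisor at level \<open>j\<close>.\<close>

definition points :: "point list \<Rightarrow> nat \<Rightarrow> point set" where
  "points \<pi> j = {p. p \<notin> set (take j \<pi>) \<and> (p = [] \<or> butlast p \<in> set (take j \<pi>))}"

definition blowup_seq :: "point list \<Rightarrow> bool" where
  "blowup_seq \<pi> \<longleftrightarrow> \<pi> \<noteq> [] \<and> (\<forall>j<length \<pi>. \<pi> ! j \<in> points \<pi> j)"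

text \<open>A component of an exceptional divisor and all its strict transforms are labelled by the point
  whose blow-up created it.\<close>

definition components :: "point list \<Rightarrow> nat \<Rightarrow> point set" where
  "components \<pi> j = set (take j \<pi>)"

datatype comp = Sep branch | Exc point

text \<open>The local equation at a point of the strict transform of a branch at the origin or of an
  exceptional component; a unit if it does not pass through the point.\<close>

fun loc :: "comp \<Rightarrow> point \<Rightarrow> germ" where
  "loc (Sep S) p = strict p (eqn S)"
| "loc (Exc q) p =
    (if strict_prefix q p then strict (drop (Suc (length q)) p) (exc_line (p ! length q)) else 1)"

definition through :: "comp \<Rightarrow> point \<Rightarrow> bool" where
  "through c p \<longleftrightarrow> val (loc c p) = 0"

definition comps_at :: "point list \<Rightarrow> point \<Rightarrow> point set" where
  "comps_at \<pi> p = {D \<in> components \<pi> (length \<pi>). through (Exc D) p}"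

definition trace_point :: "point list \<Rightarrow> point \<Rightarrow> bool" where
  "trace_point \<pi> p \<longleftrightarrow> p \<in> points \<pi> (length \<pi>) \<and> card (comps_at \<pi> p) = 1"

definition intersecting :: "point list \<Rightarrow> point \<Rightarrow> point \<Rightarrow> bool" where
  "intersecting \<pi> D E \<longleftrightarrow>
    (\<exists>p \<in> points \<pi> (length \<pi>). through (Exc D) p \<and> through (Exc E) p)"

definition Val :: "point list \<Rightarrow> point \<Rightarrow> nat" where
  "Val \<pi> D = card {p \<in> points \<pi> (length \<pi>). through (Exc D) p \<and>
    (\<exists>E \<in> components \<pi> (length \<pi>). E \<noteq> D \<and> through (Exc E) p)}"

text \<open>The self-intersection number is \<open>-1\<close> when the component is created, and decreases by
  one at each blow-up of one of its points.\<close>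

definition self_int :: "point list \<Rightarrow> nat \<Rightarrow> point \<Rightarrow> int" where
  "self_int \<pi> j D = - 1 - int (card {k. k < j \<and> through (Exc D) (\<pi> ! k)})"

definition transverse_germs :: "germ \<Rightarrow> germ \<Rightarrow> bool" where
  "transverse_germs f g \<longleftrightarrow> val (dx f * dy g - dy f * dx g) \<noteq> 0"

definition transverse :: "point list \<Rightarrow> branch \<Rightarrow> bool" where
  "transverse \<pi> B \<longleftrightarrow> (\<exists>p D. trace_point \<pi> p \<and> D \<in> comps_at \<pi> p \<and> through (Sep B) p \<and>
    ord (loc (Sep B) p) = 1 \<and> transverse_germs (loc (Sep B) p) (loc (Exc D) p))"

definition meets :: "point list \<Rightarrow> branch \<Rightarrow> point \<Rightarrow> bool" where
  "meets \<pi> B D \<longleftrightarrow> (\<exists>p \<in> points \<pi> (length \<pi>). through (Sep B) p \<and> D \<in> comps_at \<pi> p)"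

definition comp_met :: "point list \<Rightarrow> branch \<Rightarrow> point" where
  "comp_met \<pi> B = (THE D. meets \<pi> B D)"

definition realizes_eps :: "branch set \<Rightarrow> point list \<Rightarrow> bool" where
  "realizes_eps \<S> \<pi> \<longleftrightarrow> blowup_seq \<pi> \<and> (\<forall>B\<in>\<S>. transverse \<pi> B) \<and>
    (\<forall>B\<in>\<S>. \<forall>B'\<in>\<S>. B \<noteq> B' \<longrightarrow>
      \<not> (\<exists>p \<in> points \<pi> (length \<pi>). through (Sep B) p \<and> through (Sep B') p))"

text \<open>Two sequences are isomorphic over the plane iff they blow up the same infinitely near points,
  possibly in a different order. \<open>factors \<pi> \<pi>'\<close> says that \<open>\<pi> = \<pi>' \<circ> \<varsigma>\<close> up to isomorphism.\<close>

definition iso_over :: "point list \<Rightarrow> point list \<Rightarrow> bool" where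
  "iso_over \<pi> \<pi>' \<longleftrightarrow> set \<pi> = set \<pi>'"

definition factors :: "point list \<Rightarrow> point list \<Rightarrow> bool" where
  "factors \<pi> \<pi>' \<longleftrightarrow> (\<exists>\<sigma>. blowup_seq (\<pi>' @ \<sigma>) \<and> iso_over \<pi> (\<pi>' @ \<sigma>))"

definition minimal_seq :: "(point list \<Rightarrow> bool) \<Rightarrow> point list \<Rightarrow> bool" where
  "minimal_seq P \<pi> \<longleftrightarrow> P \<pi> \<and> (\<forall>\<pi>'. P \<pi>' \<and> factors \<pi> \<pi>' \<longrightarrow> iso_over \<pi> \<pi>')"

definition kappa :: "point list \<Rightarrow> point \<Rightarrow> (point list \<times> point) set" where
  "kappa \<pi> D = {(\<pi>', D'). blowup_seq \<pi>' \<and> D' \<in> components \<pi>' (length \<pi>') \<and> D' = D \<and>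
    (factors \<pi>' \<pi> \<or> factors \<pi> \<pi>')}"

definition realizes_kappa :: "point list \<Rightarrow> point set \<Rightarrow> point list \<Rightarrow> bool" where
  "realizes_kappa \<pi> \<D> \<pi>' \<longleftrightarrow> blowup_seq \<pi>' \<and> (\<forall>D\<in>\<D>. (\<pi>', D) \<in> kappa \<pi> D) \<and>
    (\<forall>D\<in>\<D>. \<forall>E\<in>\<D>. D \<noteq> E \<longrightarrow> \<not> intersecting \<pi>' D E)"

section \<open>Dicritical duplets\<close>

text \<open>\<open>dic \<Delta> j\<close> and \<open>ndic \<Delta> j\<close> are the dicritical and the non-dicritical components at level \<open>j\<close>.\<close>

record dic_struct =
  centres :: "point list"
  dic :: "nat \<Rightarrow> point set"
  ndic :: "nat \<Rightarrow> point set"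

definition height :: "dic_struct \<Rightarrow> nat" where
  "height \<Delta> = length (centres \<Delta>)"

text \<open>There are no components at level \<open>0\<close>, so including this level only fixes both parts to be empty
  there.\<close>

definition dicritical_structure :: "dic_struct \<Rightarrow> bool" where
  "dicritical_structure \<Delta> \<longleftrightarrow>
    blowup_seq (centres \<Delta>) \<and>
    (\<forall>j\<le>height \<Delta>. dic \<Delta> j \<union> ndic \<Delta> j = components (centres \<Delta>) j) \<and>
    (\<forall>j\<le>height \<Delta>. dic \<Delta> j \<inter> ndic \<Delta> j = {}) \<and>
    (\<forall>j. 2 \<le> j \<and> j \<le> height \<Delta> \<longrightarrow>
      (\<forall>D \<in> components (centres \<Delta>) (j - 1). D \<in> dic \<Delta> (j - 1) \<longleftrightarrow> D \<in> dic \<Delta> j)) \<and>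
    (\<forall>D \<in> dic \<Delta> (height \<Delta>). \<forall>E \<in> dic \<Delta> (height \<Delta>).
      D \<noteq> E \<longrightarrow> \<not> intersecting (centres \<Delta>) D E)"

definition radial :: "dic_struct \<Rightarrow> bool" where
  "radial \<Delta> \<longleftrightarrow> height \<Delta> = 1 \<and> ndic \<Delta> 1 = {}"

text \<open>\<open>dsep\<close> and \<open>isep\<close> are the dicritical and the isolated separatrices.\<close>

record separatrices =
  dsep :: "branch set"
  isep :: "branch set"

definition all_sep :: "separatrices \<Rightarrow> branch set" where
  "all_sep \<Sigma> = dsep \<Sigma> \<union> isep \<Sigma>"

definition connected_comps :: "point list \<Rightarrow> point set \<Rightarrow> point set set" where
  "connected_comps \<pi> \<D> =
    {K. \<exists>D\<in>\<D>. K = {E. (D, E) \<in> {(D, E). D \<in> \<D> \<and> E \<in> \<D> \<and> intersecting \<pi> D E}\<^sup>*}}"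

definition framed :: "dic_struct \<Rightarrow> separatrices \<Rightarrow> bool" where
  "framed \<Delta> \<Sigma> \<longleftrightarrow>
    finite (all_sep \<Sigma>) \<and> all_sep \<Sigma> \<subseteq> branches \<and> dsep \<Sigma> \<inter> isep \<Sigma> = {} \<and>
    realizes_eps (all_sep \<Sigma>) (centres \<Delta>) \<and>
    (\<forall>S \<in> all_sep \<Sigma>. S \<in> dsep \<Sigma> \<longleftrightarrow> comp_met (centres \<Delta>) S \<in> dic \<Delta> (height \<Delta>)) \<and>
    (\<forall>K \<in> connected_comps (centres \<Delta>) (ndic \<Delta> (height \<Delta>)).
      \<exists>S \<in> isep \<Sigma>. comp_met (centres \<Delta>) S \<in> K) \<and>
    (\<forall>D \<in> dic \<Delta> (height \<Delta>). Val (centres \<Delta>) D = 1 \<longrightarrow>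
      (\<exists>S \<in> dsep \<Sigma>. comp_met (centres \<Delta>) S = D)) \<and>
    minimal_seq
      (\<lambda>\<pi>. realizes_kappa (centres \<Delta>) (dic \<Delta> (height \<Delta>)) \<pi> \<and> realizes_eps (all_sep \<Sigma>) \<pi>)
      (centres \<Delta>)"

definition dicritical_duplet :: "dic_struct \<Rightarrow> separatrices \<Rightarrow> bool" where
  "dicritical_duplet \<Delta> \<Sigma> \<longleftrightarrow> dicritical_structure \<Delta> \<and> framed \<Delta> \<Sigma> \<and> \<not> radial \<Delta>"

definition support :: "dic_struct \<Rightarrow> separatrices \<Rightarrow> nat \<Rightarrow> comp set" where
  "support \<Delta> \<Sigma> j = Sep ` all_sep \<Sigma> \<union> Exc ` ndic \<Delta> j"

definition support_branches :: "dic_struct \<Rightarrow> separatrices \<Rightarrow> nat \<Rightarrow> point \<Rightarrow> branch set" where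
  "support_branches \<Delta> \<Sigma> j p = {curve (loc c p) | c. c \<in> support \<Delta> \<Sigma> j \<and> through c p}"

definition regular_point :: "dic_struct \<Rightarrow> separatrices \<Rightarrow> nat \<Rightarrow> point \<Rightarrow> bool" where
  "regular_point \<Delta> \<Sigma> j p \<longleftrightarrow> (\<exists>S. support_branches \<Delta> \<Sigma> j p = {S} \<and> mult S = 1)"

definition singular_point :: "dic_struct \<Rightarrow> separatrices \<Rightarrow> nat \<Rightarrow> point \<Rightarrow> bool" where
  "singular_point \<Delta> \<Sigma> j p \<longleftrightarrow>
    support_branches \<Delta> \<Sigma> j p \<noteq> {} \<and> \<not> regular_point \<Delta> \<Sigma> j p"

section \<open>Indices and residues\<close>

definition pos_rat :: "complex set" where
  "pos_rat = {of_rat r | r. r > 0}"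

text \<open>\<open>I j p S\<close> is the index at level \<open>j\<close> of the local branch \<open>S\<close> at \<open>p\<close>. The sum of the indices along
  a component is taken over the points where the index is non-zero, which are finitely many.\<close>

definition index_system ::
  "dic_struct \<Rightarrow> separatrices \<Rightarrow> (nat \<Rightarrow> point \<Rightarrow> branch \<Rightarrow> complex) \<Rightarrow> bool" where
  "index_system \<Delta> \<Sigma> I \<longleftrightarrow>
    (\<forall>j<height \<Delta>. \<forall>p \<in> points (centres \<Delta>) j. \<forall>S \<in> support_branches \<Delta> \<Sigma> j p.
      (if p = centres \<Delta> ! j
       then \<forall>t. val (strict1 t (eqn S)) = 0 \<longrightarrow>
              I (Suc j) (p @ [t]) (curve (strict1 t (eqn S))) = I j p S - of_nat ((mult S)\<^sup>2)
       else I (Suc j) p S = I j p S)) \<and>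
    (\<forall>j\<le>height \<Delta>. \<forall>p \<in> points (centres \<Delta>) j. \<forall>S \<in> support_branches \<Delta> \<Sigma> j p.
      regular_point \<Delta> \<Sigma> j p \<longrightarrow> I j p S = 0) \<and>
    (\<forall>j\<in>{1..height \<Delta>}. \<forall>D \<in> ndic \<Delta> j.
      (\<Sum>p | p \<in> points (centres \<Delta>) j \<and> through (Exc D) p \<and> I j p (curve (loc (Exc D) p)) \<noteq> 0.
        I j p (curve (loc (Exc D) p))) = of_int (self_int (centres \<Delta>) j D)) \<and>
    (\<forall>p \<in> points (centres \<Delta>) (height \<Delta>). \<forall>S\<^sub>1 S\<^sub>2.
      singular_point \<Delta> \<Sigma> (height \<Delta>) p \<and> S\<^sub>1 \<noteq> S\<^sub>2 \<and>
      support_branches \<Delta> \<Sigma> (height \<Delta>) p = {S\<^sub>1, S\<^sub>2} \<longrightarrow>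
      I (height \<Delta>) p S\<^sub>1 \<in> - {0} - pos_rat \<and> I (height \<Delta>) p S\<^sub>2 \<in> - {0} - pos_rat \<and>
      I (height \<Delta>) p S\<^sub>2 = 1 / I (height \<Delta>) p S\<^sub>1)"

definition dicritical_triplet ::
  "dic_struct \<Rightarrow> separatrices \<Rightarrow> (nat \<Rightarrow> point \<Rightarrow> branch \<Rightarrow> complex) \<Rightarrow> bool" where
  "dicritical_triplet \<Delta> \<Sigma> \<Upsilon> \<longleftrightarrow> dicritical_duplet \<Delta> \<Sigma> \<and> index_system \<Delta> \<Sigma> \<Upsilon>"

text \<open>A component not passing through \<open>q\<close> has a unit as local equation, hence multiplicity zero there.\<close>

definition residue_system ::
  "dic_struct \<Rightarrow> separatrices \<Rightarrow> (nat \<Rightarrow> comp \<Rightarrow> complex) \<Rightarrow> bool" where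
  "residue_system \<Delta> \<Sigma> L \<longleftrightarrow>
    (\<forall>j\<le>height \<Delta>. \<forall>c \<in> support \<Delta> \<Sigma> j. L j c \<noteq> 0) \<and>
    (\<forall>j<height \<Delta>. \<forall>c \<in> support \<Delta> \<Sigma> j. L (Suc j) c = L j c) \<and>
    (\<forall>j<height \<Delta>. let q = centres \<Delta> ! j;
        s = (\<Sum>c \<in> support \<Delta> \<Sigma> j. of_nat (ord (loc c q)) * L j c) in
      if q \<in> dic \<Delta> (Suc j) then s = 0 else L (Suc j) (Exc q) = s \<and> s \<noteq> 0)"

definition consistent ::
  "dic_struct \<Rightarrow> separatrices \<Rightarrow> (nat \<Rightarrow> point \<Rightarrow> branch \<Rightarrow> complex) \<Rightarrow>
    (nat \<Rightarrow> comp \<Rightarrow> complex) \<Rightarrow> bool" where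
  "consistent \<Delta> \<Sigma> I L \<longleftrightarrow> (let n = height \<Delta> in
    \<forall>p \<in> points (centres \<Delta>) n. \<forall>c\<^sub>1 \<in> support \<Delta> \<Sigma> n. \<forall>c\<^sub>2 \<in> support \<Delta> \<Sigma> n.
      singular_point \<Delta> \<Sigma> n p \<and> c\<^sub>1 \<noteq> c\<^sub>2 \<and> through c\<^sub>1 p \<and> through c\<^sub>2 p \<longrightarrow>
      I n p (curve (loc c\<^sub>1 p)) = - L n c\<^sub>2 / L n c\<^sub>1 \<and>
      I n p (curve (loc c\<^sub>2 p)) = - L n c\<^sub>1 / L n c\<^sub>2)"

definition dicritical_quadruplet ::
  "dic_struct \<Rightarrow> separatrices \<Rightarrow> (nat \<Rightarrow> point \<Rightarrow> branch \<Rightarrow> complex) \<Rightarrow>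
    (nat \<Rightarrow> comp \<Rightarrow> complex) \<Rightarrow> bool" where
  "dicritical_quadruplet \<Delta> \<Sigma> \<Upsilon> \<Lambda> \<longleftrightarrow> dicritical_triplet \<Delta> \<Sigma> \<Upsilon> \<and>
    residue_system \<Delta> \<Sigma> \<Lambda> \<and> consistent \<Delta> \<Sigma> \<Upsilon> \<Lambda>"

section \<open>Meromorphic 1-forms and foliations\<close>

text \<open>The pair \<open>(A, B)\<close> stands for the meromorphic 1-form \<open>A dx + B dy\<close>.\<close>

type_synonym form = "germ fract \<times> germ fract"

abbreviation hol :: "germ \<Rightarrow> germ fract" where
  "hol f \<equiv> Fract f 1"

definition closed_holo :: "germ \<Rightarrow> germ \<Rightarrow> bool" where
  "closed_holo a b \<longleftrightarrow> dx b = dy a"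

text \<open>For \<open>\<omega> = a dx + b dy\<close> one has \<open>d(\<omega>/h) = (h d\<omega> - dh \<and> \<omega>)/h\<^sup>2\<close>.\<close>

definition closed_form :: "form \<Rightarrow> bool" where
  "closed_form \<eta> \<longleftrightarrow> (\<exists>a b h. h \<noteq> 0 \<and> \<eta> = (Fract a h, Fract b h) \<and>
    h * (dx b - dy a) = dx h * b - dy h * a)"

fun blow_form :: "direction \<Rightarrow> form \<Rightarrow> form" where
  "blow_form (Slope t) (A, B) =
    (blow_fract (Slope t) A + hol (Y + const t) * blow_fract (Slope t) B,
     hol X * blow_fract (Slope t) B)"
| "blow_form Vertical (A, B) =
    (hol Y * blow_fract Vertical A,
     hol X * blow_fract Vertical A + blow_fract Vertical B)"

definition transform :: "form \<Rightarrow> point \<Rightarrow> form" where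
  "transform \<eta> p = foldl (\<lambda>\<omega> t. blow_form t \<omega>) \<eta> p"

text \<open>The foliation defined by a non-zero meromorphic 1-form is represented by a proportional
  holomorphic 1-form with coprime coefficients, unique up to units. The foliation at an infinitely
  near point is the strict transform.\<close>

definition defines_foliation :: "form \<Rightarrow> germ \<times> germ \<Rightarrow> bool" where
  "defines_foliation \<eta> \<omega> \<longleftrightarrow> \<eta> \<noteq> (0, 0) \<and> coprime (fst \<omega>) (snd \<omega>) \<and>
    hol (fst \<omega>) * snd \<eta> = hol (snd \<omega>) * fst \<eta>"

definition foliation_at :: "form \<Rightarrow> point \<Rightarrow> germ \<times> germ" where
  "foliation_at \<eta> p = (SOME \<omega>. defines_foliation (transform \<eta> p) \<omega>)"

definition singular :: "germ \<times> germ \<Rightarrow> bool" where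
  "singular \<omega> \<longleftrightarrow> val (fst \<omega>) = 0 \<and> val (snd \<omega>) = 0"

text \<open>The foliation of \<open>a dx + b dy\<close> is given by the vector field \<open>b \<partial>\<^sub>x - a \<partial>\<^sub>y\<close>; \<open>\<mu>\<^sub>1, \<mu>\<^sub>2\<close> are
  the eigenvalues of its linear part, which have the trace as their sum and the determinant as their
  product.\<close>

definition simple_singularity :: "germ \<times> germ \<Rightarrow> bool" where
  "simple_singularity \<omega> \<longleftrightarrow> singular \<omega> \<and> (case \<omega> of (a, b) \<Rightarrow>
    \<exists>\<mu>\<^sub>1 \<mu>\<^sub>2. \<mu>\<^sub>1 + \<mu>\<^sub>2 = val (dx b) - val (dy a) \<and>
      \<mu>\<^sub>1 * \<mu>\<^sub>2 = val (dy b) * val (dx a) - val (dx b) * val (dy a) \<and>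
      \<mu>\<^sub>2 \<noteq> 0 \<and> \<mu>\<^sub>1 / \<mu>\<^sub>2 \<notin> pos_rat)"

text \<open>The coefficient of \<open>\<omega> \<and> df\<close>.\<close>

definition wedge :: "germ \<times> germ \<Rightarrow> germ \<Rightarrow> germ" where
  "wedge \<omega> f = fst \<omega> * dy f - snd \<omega> * dx f"

definition invariant :: "germ \<times> germ \<Rightarrow> germ \<Rightarrow> bool" where
  "invariant \<omega> f \<longleftrightarrow> f dvd wedge \<omega> f"

definition invariant_comp :: "form \<Rightarrow> point list \<Rightarrow> point \<Rightarrow> bool" where
  "invariant_comp \<eta> \<pi> D \<longleftrightarrow> (\<forall>p \<in> points \<pi> (length \<pi>). through (Exc D) p \<longrightarrow>
    invariant (foliation_at \<eta> p) (loc (Exc D) p))"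

definition reduces :: "form \<Rightarrow> point list \<Rightarrow> bool" where
  "reduces \<eta> \<pi> \<longleftrightarrow> \<eta> \<noteq> (0, 0) \<and> blowup_seq \<pi> \<and>
    (let P = points \<pi> (length \<pi>); N = {D \<in> components \<pi> (length \<pi>). \<not> invariant_comp \<eta> \<pi> D} in
      finite {p \<in> P. singular (foliation_at \<eta> p)} \<and>
      (\<forall>p\<in>P. singular (foliation_at \<eta> p) \<longrightarrow> simple_singularity (foliation_at \<eta> p)) \<and>
      (\<forall>D\<in>N. \<forall>p\<in>P. through (Exc D) p \<longrightarrow>
        \<not> singular (foliation_at \<eta> p) \<and> val (wedge (foliation_at \<eta> p) (loc (Exc D) p)) \<noteq> 0) \<and>
      (\<forall>D\<in>N. \<forall>E\<in>N. D \<noteq> E \<longrightarrow> \<not> intersecting \<pi> D E))"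

text \<open>Sequences of blow-ups are non-empty, so the minimal reduction of a regular or already simple germ
  is the blow-up of the origin.\<close>

definition minimal_reduction :: "form \<Rightarrow> point list \<Rightarrow> bool" where
  "minimal_reduction \<eta> \<pi> \<longleftrightarrow> minimal_seq (reduces \<eta>) \<pi>"

text \<open>A branch is polar iff the form does not extend to the localization of the ring of germs at the
  prime ideal of the branch.\<close>

definition polar_branches :: "form \<Rightarrow> branch set" where
  "polar_branches \<eta> = {S \<in> branches. \<not> (\<exists>a b h. h \<notin> S \<and> \<eta> = (Fract a h, Fract b h))}"

definition isolated_separatrices :: "form \<Rightarrow> point list \<Rightarrow> branch set" where
  "isolated_separatrices \<eta> \<pi> = {S \<in> branches. invariant (foliation_at \<eta> []) (eqn S) \<and>
    (\<exists>D. meets \<pi> S D \<and> invariant_comp \<eta> \<pi> D)}"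

text \<open>The minimal reduction is unique only up to the order of the blow-ups, hence so is the duplet of
  a form.\<close>

definition is_DD :: "form \<Rightarrow> dic_struct \<Rightarrow> separatrices \<Rightarrow> bool" where
  "is_DD \<eta> \<Delta> \<Sigma> \<longleftrightarrow> (let \<pi> = centres \<Delta> in
    minimal_reduction \<eta> \<pi> \<and>
    (\<forall>j\<le>height \<Delta>. dic \<Delta> j = {D \<in> components \<pi> j. \<not> invariant_comp \<eta> \<pi> D} \<and>
      ndic \<Delta> j = {D \<in> components \<pi> j. invariant_comp \<eta> \<pi> D}) \<and>
    all_sep \<Sigma> = polar_branches \<eta> \<union> isolated_separatrices \<eta> \<pi> \<and>
    dsep \<Sigma> = {S \<in> all_sep \<Sigma>. \<exists>D. meets \<pi> S D \<and> \<not> invariant_comp \<eta> \<pi> D} \<and>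
    isep \<Sigma> = {S \<in> all_sep \<Sigma>. \<exists>D. meets \<pi> S D \<and> invariant_comp \<eta> \<pi> D})"

definition form_ord :: "germ \<Rightarrow> germ \<Rightarrow> nat" where
  "form_ord a b = (LEAST n. \<exists>i j. i + j = n \<and> (coeff2 a i j \<noteq> 0 \<or> coeff2 b i j \<noteq> 0))"

definition one_faithful :: "form \<Rightarrow> bool" where
  "one_faithful \<eta> \<longleftrightarrow> finite (polar_branches \<eta>) \<and>
    (\<exists>F a b. (\<forall>S \<in> polar_branches \<eta>. is_equation S (F S)) \<and>
      (let f = \<Prod>S \<in> polar_branches \<eta>. F S in
        hol f * fst \<eta> = hol a \<and> hol f * snd \<eta> = hol b \<and> form_ord a b + 1 = ord f))"

definition faithful :: "form \<Rightarrow> bool" where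
  "faithful \<eta> \<longleftrightarrow> (\<exists>\<pi>. minimal_reduction \<eta> \<pi> \<and>
    (\<forall>q \<in> set \<pi>. polar_branches (transform \<eta> q) \<noteq> {} \<longrightarrow> one_faithful (transform \<eta> q)))"

section \<open>Dominance and logarithmic forms of a quadruplet\<close>

definition dominates_struct :: "dic_struct \<Rightarrow> dic_struct \<Rightarrow> bool" where
  "dominates_struct \<Delta>' \<Delta> \<longleftrightarrow>
    height \<Delta> \<le> height \<Delta>' \<and> take (height \<Delta>) (centres \<Delta>') = centres \<Delta> \<and>
    (\<forall>j\<in>{1..height \<Delta>}. dic \<Delta>' j = dic \<Delta> j \<and> ndic \<Delta>' j = ndic \<Delta> j) \<and>
    (\<forall>k. height \<Delta> \<le> k \<and> k < height \<Delta>' \<longrightarrow>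
      centres \<Delta>' ! k \<in> ndic \<Delta>' (Suc k) \<and>
      (\<exists>p. prefix p (centres \<Delta>' ! k) \<and> trace_point (centres \<Delta>) p \<and>
        (\<exists>D \<in> dic \<Delta> (height \<Delta>). through (Exc D) p)))"

text \<open>A new separatrix need not be transverse to the exceptional divisor of \<open>\<Delta>\<close>, so the last
  condition asks directly that it meets a dicritical component at a trace point off the support.\<close>

definition dominates ::
  "dic_struct \<Rightarrow> separatrices \<Rightarrow> dic_struct \<Rightarrow> separatrices \<Rightarrow> bool" where
  "dominates \<Delta>' \<Sigma>' \<Delta> \<Sigma> \<longleftrightarrow> dominates_struct \<Delta>' \<Delta> \<and>
    all_sep \<Sigma> \<subseteq> all_sep \<Sigma>' \<and> all_sep \<Sigma>' - all_sep \<Sigma> \<subseteq> isep \<Sigma>' \<and>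
    (\<forall>S \<in> all_sep \<Sigma>. (S \<in> dsep \<Sigma> \<longleftrightarrow> S \<in> dsep \<Sigma>') \<and> (S \<in> isep \<Sigma> \<longleftrightarrow> S \<in> isep \<Sigma>')) \<and>
    (\<forall>S \<in> all_sep \<Sigma>' - all_sep \<Sigma>.
      \<exists>p \<in> points (centres \<Delta>) (height \<Delta>). through (Sep S) p \<and>
        (\<exists>D \<in> dic \<Delta> (height \<Delta>). comps_at (centres \<Delta>) p = {D}) \<and>
        support_branches \<Delta> \<Sigma> (height \<Delta>) p = {})"

definition Q_logarithmic ::
  "dic_struct \<Rightarrow> separatrices \<Rightarrow> (nat \<Rightarrow> point \<Rightarrow> branch \<Rightarrow> complex) \<Rightarrow>
    (nat \<Rightarrow> comp \<Rightarrow> complex) \<Rightarrow> form \<Rightarrow> bool" where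
  "Q_logarithmic \<Delta> \<Sigma> \<Upsilon> \<Lambda> \<eta> \<longleftrightarrow>
    dicritical_quadruplet \<Delta> \<Sigma> \<Upsilon> \<Lambda> \<and> closed_form \<eta> \<and>
    (\<exists>F a b. (\<forall>S \<in> all_sep \<Sigma>. is_equation S (F S)) \<and> closed_holo a b \<and>
      fst \<eta> = (\<Sum>S \<in> all_sep \<Sigma>. hol (const (\<Lambda> 0 (Sep S))) * Fract (dx (F S)) (F S)) + hol a \<and>
      snd \<eta> = (\<Sum>S \<in> all_sep \<Sigma>. hol (const (\<Lambda> 0 (Sep S))) * Fract (dy (F S)) (F S)) + hol b) \<and>
    (\<exists>\<Delta>' \<Sigma>'. is_DD \<eta> \<Delta>' \<Sigma>' \<and> dominates \<Delta>' \<Sigma>' \<Delta> \<Sigma>) \<and>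
    faithful \<eta>"

end

theory Submission
  imports Defs
begin

text \<open>
  The residues are fixed at the last level. On a dicritical component \<open>D\<close> one chooses weights with sum
  zero at the intersection points with the support, such that all zeros of the rational function
  \<open>\<Sum>s. w\<^sub>s / (z - s)\<close> are simple; on a non-dicritical one the indices prescribe the ratios of
  the residues. The dual graph is a tree, so these ratios can be realized, and the index theorem
  makes the conditions on the residues hold at every level.

  With \<open>\<alpha> = 0\<close>, the form \<open>\<eta> = \<Sum>S. \<lambda>\<^sub>S df\<^sub>S / f\<^sub>S\<close> has at each point of the last level at most two polar
  components, so its foliation is regular or simple there, except at the zeros of the rational
  functions. There \<open>\<eta> = dg\<close> with \<open>g = w l\<^sup>2 + x\<^sup>M u\<close> up to a constant, where \<open>w, u\<close> are units, \<open>l = 0\<close> is smooth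
  and transverse to \<open>D = {x = 0}\<close>, and each blow-up lowers \<open>M\<close> by two, until the point is reduced.

  A minimal reduction is a part of the resulting sequence. It contains the sequence of \<open>\<Delta>\<close> by the
  minimality (S.4), because blowing up a regular point or a simple singularity creates invariant
  components only, and the separatrices in \<open>\<Sigma>\<close> through such a point are smooth, transverse to the
  divisor and disjoint.
\<close>

section \<open>The ring of germs\<close>

text \<open>Simple zeros are asked of the weights because they make the special points of a
  dicritical component computable: there a primitive \<open>g\<close> of the form has a
  \<open>y\<close>-derivative \<open>v\<close> that cuts out a smooth curve transverse to the
  component, and dividing \<open>g\<close> by \<open>v\<close> produces the square in the normal
  form. Non-zero weights with sum zero need two points on the component; this is where the exclusion
  of the radial case and the separatrices on dicritical components of valence one enter. The
  sequence built in this way may fail to be minimal, hence the passage to a smallest part, in which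
  the centres of \<Delta> have to be found again. Leaves are never integrated: invariant branches at
  a reduced point are compared by Weierstrass division, and a non-zero remainder contradicts either
  regularity or the condition on the eigenvalues. The same division gives primality of irreducible
  germs and unibranchness, through ideals in which \<open>X\<close> can be cancelled. Levels become
  prefix-closed sets of centres, so that the order of the blow-ups disappears.\<close>

lemma coeff2_1: "coeff2 1 i j = (if i = 0 \<and> j = 0 then 1 else 0)"
  by transfer (auto simp: fps_one_def)

lemma coeff2_minus [simp]: "coeff2 (f - g) i j = coeff2 f i j - coeff2 g i j"
  by transfer simp

lemma coeff2_uminus [simp]: "coeff2 (- f) i j = - coeff2 f i j"
  by transfer simp

lemma coeff2_sum: "coeff2 (sum f A) i j = (\<Sum>a\<in>A. coeff2 (f a) i j)"
  by (induction A rule: infinite_finite_induct) auto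

lemma const_0 [simp]: "const 0 = 0"
  by (rule germ_eqI) (simp add: coeff2_const)

lemma const_1 [simp]: "const 1 = 1"
  by (rule germ_eqI) (simp add: coeff2_const coeff2_1)

lemma coeff2_const_mult: "coeff2 (const c * f) i j = c * coeff2 f i j"
  by transfer (simp add: fps_mult_left_const_nth)

lemma const_mult: "const (a * b) = const a * const b"
  by (rule germ_eqI) (simp add: coeff2_const_mult coeff2_const)

lemma const_add: "const (a + b) = const a + const b"
  by (rule germ_eqI) (simp add: coeff2_const)

text \<open>Exchange of the coordinates. It carries the vertical chart to the chart of slope
  \<open>0\<close>, so that facts about a blow-up are proved in the slope chart and
  transported.\<close>

lift_definition swap :: "germ \<Rightarrow> germ" is "\<lambda>f. Abs_fps (\<lambda>j. Abs_fps (\<lambda>i. f $ i $ j))"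
proof -
  fix f :: "complex fps fps" assume "conv2 f"
  then obtain C r where "\<And>i j. norm (f $ j $ i) \<le> C * r ^ (i + j)"
    unfolding conv2_def by blast
  then show "conv2 (Abs_fps (\<lambda>j. Abs_fps (\<lambda>i. f $ i $ j)))"
    by (intro conv2I[where C = C and r = r]) (simp add: add.commute)
qed

lemma coeff2_swap [simp]: "coeff2 (swap f) i j = coeff2 f j i"
  by transfer simp

lemma swap_swap [simp]: "swap (swap f) = f"
  by (rule germ_eqI) simp

lemma swap_add: "swap (f + g) = swap f + swap g"
  by (rule germ_eqI) simp

lemma swap_mult: "swap (f * g) = swap f * swap g"
  by (rule germ_eqI) (simp add: coeff2_mult, rule sum.swap)

lemma swap_1 [simp]: "swap 1 = 1" and swap_0 [simp]: "swap 0 = 0"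
  and swap_X [simp]: "swap X = Y" and swap_Y [simp]: "swap Y = X"
  and swap_const [simp]: "swap (const c) = const c"
  by (rule germ_eqI; auto simp: coeff2_1 coeff2_X coeff2_Y coeff2_const)+

lemma swap_power: "swap (f ^ n) = swap f ^ n"
  by (induction n) (auto simp: swap_mult)

lemma swap_inj [simp]: "swap f = swap g \<longleftrightarrow> f = g"
  by (metis swap_swap)

lemma swap_eq_0_iff [simp]: "swap f = 0 \<longleftrightarrow> f = 0"
  by (metis swap_swap swap_0)

lemma swap_dvd_iff [simp]: "swap f dvd swap g \<longleftrightarrow> f dvd g"
  unfolding dvd_def by (metis swap_swap swap_mult)

lemma dvd_swap_iff: "f dvd swap g \<longleftrightarrow> swap f dvd g"
  by (metis swap_dvd_iff swap_swap)

lemma swap_unit_iff [simp]: "is_unit (swap f) \<longleftrightarrow> is_unit f"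
  by (metis swap_dvd_iff swap_1)

lemma irreducible_swap: "irreducible f \<Longrightarrow> irreducible (swap f)"
  unfolding irreducible_def by (metis swap_mult swap_swap swap_unit_iff swap_eq_0_iff)

text \<open>Restrictions to the lines \<open>x = 0\<close> and \<open>y = 0\<close>. Their kernels
  are generated by \<open>X\<close> and \<open>Y\<close>, which turns divisibility by an exceptional
  line into an identity of power series in one variable.\<close>

lift_definition rX :: "germ \<Rightarrow> complex fps" is "\<lambda>f. Abs_fps (\<lambda>j. f $ j $ 0)" .
definition rY :: "germ \<Rightarrow> complex fps" where "rY f = rX (swap f)"

lemma rX_nth [simp]: "rX f $ j = coeff2 f 0 j"
  by transfer simp

lemma rX_add: "rX (f + g) = rX f + rX g" and rX_minus: "rX (f - g) = rX f - rX g"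
  and rX_0 [simp]: "rX 0 = 0" and rX_X [simp]: "rX X = 0" and rX_Y [simp]: "rX Y = fps_X"
  and rX_1 [simp]: "rX 1 = 1" and rX_const [simp]: "rX (const c) = fps_const c"
  by (auto simp: fps_eq_iff coeff2_X coeff2_Y coeff2_1 coeff2_const fps_X_def)

lemma rX_mult: "rX (f * g) = rX f * rX g"
  by (simp add: fps_eq_iff coeff2_mult fps_mult_nth atLeast0AtMost)

lemma rX_power: "rX (f ^ n) = rX f ^ n"
  by (induction n) (auto simp: rX_mult)

lemma rY_nth [simp]: "rY f $ i = coeff2 f i 0"
  by (simp add: rY_def)

lemma rY_simps: "rY (f + g) = rY f + rY g" "rY (f * g) = rY f * rY g" "rY X = fps_X" "rY Y = 0"
  by (simp_all add: rY_def swap_add swap_mult rX_add rX_mult)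

lift_definition shX :: "germ \<Rightarrow> germ" is "\<lambda>f. Abs_fps (\<lambda>j. Abs_fps (\<lambda>i. f $ j $ Suc i))"
proof -
  fix f :: "complex fps fps" assume "conv2 f"
  then obtain C r where "\<And>i j. norm (f $ j $ i) \<le> C * r ^ (i + j)"
    unfolding conv2_def by blast
  note * = this
  have "norm (f $ j $ Suc i) \<le> C * r * r ^ (i + j)" for i j
    using *[of j "Suc i"] by (simp add: mult_ac)
  then show "conv2 (Abs_fps (\<lambda>j. Abs_fps (\<lambda>i. f $ j $ Suc i)))"
    by (intro conv2I[where C = "C * r" and r = r]) simp
qed

lemma coeff2_shX [simp]: "coeff2 (shX f) i j = coeff2 f (Suc i) j"
  by transfer simp

lemma X_dvd_iff: "X dvd f \<longleftrightarrow> rX f = 0"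
proof
  assume "rX f = 0"
  then have "coeff2 f 0 j = 0" for j by (metis rX_nth fps_zero_nth)
  then have "f = X * shX f" by (intro germ_eqI) (auto simp: X_mult)
  then show "X dvd f" by (rule dvdI)
qed (auto simp: dvd_def rX_mult)

lemma Y_dvd_iff: "Y dvd f \<longleftrightarrow> rY f = 0"
  by (metis X_dvd_iff rY_def swap_Y swap_dvd_iff)

lemma X_neq_0 [simp]: "X \<noteq> 0" and Y_neq_0 [simp]: "Y \<noteq> 0"
  using coeff2_X[of 1 0] coeff2_Y[of 0 1] by auto

lemma prime_elem_X: "prime_elem X"
  unfolding prime_elem_def by (auto simp: X_dvd_iff rX_mult)

lemma prime_elem_Y: "prime_elem Y"
  unfolding prime_elem_def
  by (auto simp: Y_dvd_iff rY_simps) (simp add: rY_def)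

lemma val_simps [simp]: "val (f + g) = val f + val g" "val (f - g) = val f - val g"
  "val (- f) = - val f" "val (f * g) = val f * val g" "val X = 0" "val Y = 0" "val 1 = 1"
  "val 0 = 0" "val (const c) = c"
  by (simp_all add: val_def coeff2_mult coeff2_X coeff2_Y coeff2_1 coeff2_const)

lemma val_power [simp]: "val (f ^ n) = val f ^ n"
  by (induction n) auto

lemma val_sum [simp]: "val (sum f A) = (\<Sum>a\<in>A. val (f a))"
  by (induction A rule: infinite_finite_induct) auto

lemma val_swap [simp]: "val (swap f) = val f"
  by (simp add: val_def)

lemma val_rX: "val f = rX f $ 0" and val_rY: "val f = rY f $ 0"
  by (simp_all add: val_def)

section \<open>Division with remainder\<close>

text \<open>Coefficients of the Weierstrass quotient of \<open>g\<close> by \<open>f\<close>, for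
  \<open>f\<close> whose restriction to \<open>x = 0\<close> starts with \<open>y^d\<close>.
  Comparing coefficients of \<open>x^k y^(j+d)\<close>, where the remainder has none, determines the
  one at \<open>(k, j)\<close> from those with smaller \<open>k\<close>, or with equal
  \<open>k\<close> and smaller \<open>j\<close>.\<close>

function wq :: "(nat \<Rightarrow> nat \<Rightarrow> complex) \<Rightarrow> (nat \<Rightarrow> nat \<Rightarrow> complex) \<Rightarrow> nat \<Rightarrow> nat \<Rightarrow> nat \<Rightarrow> complex"
  where "wq f g d k j = g k (j + d) - (\<Sum>b<j. wq f g d k b * f 0 (j + d - b)) -
    (\<Sum>i<k. \<Sum>b\<le>j + d. wq f g d i b * f (k - i) (j + d - b))"
  by pat_completeness auto
termination
  by (relation "measures [\<lambda>(f, g, d, k, j). k, \<lambda>(f, g, d, k, j). j]") auto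

declare wq.simps [simp del]

text \<open>A telescoping sum: with \<open>s = r + K * r\<close>, multiplication by
  \<open>s - r = K * r\<close> collapses it to \<open>r * (s ^ j - r ^ j)\<close>. The gain
  \<open>1 / K\<close> is what closes the induction in \<open>wq_bound\<close>.\<close>

lemma sum_mixed_powers_le:
  fixes r :: real
  assumes "r > 0" "K > 0"
  shows "(\<Sum>b<j. (r + K * r) ^ b * r ^ (j - b)) \<le> (r + K * r) ^ j / K"
proof -
  have "(K * r) * (\<Sum>b<j. (r + K * r) ^ b * r ^ (j - b)) = r * ((r + K * r) ^ j - r ^ j)"
  proof (induction j)
    case (Suc j)
    have "(\<Sum>b<Suc j. (r + K * r) ^ b * r ^ (Suc j - b)) =
        r * (\<Sum>b<j. (r + K * r) ^ b * r ^ (j - b)) + r * (r + K * r) ^ j"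
      by (simp add: sum_distrib_left Suc_diff_le mult_ac)
    then have "(K * r) * (\<Sum>b<Suc j. (r + K * r) ^ b * r ^ (Suc j - b)) =
        r * ((K * r) * (\<Sum>b<j. (r + K * r) ^ b * r ^ (j - b))) + (K * r) * r * (r + K * r) ^ j"
      by (simp only: algebra_simps)
    also have "\<dots> = r * (r * ((r + K * r) ^ j - r ^ j)) + (K * r) * r * (r + K * r) ^ j"
      by (simp only: Suc)
    finally show ?case by (simp add: algebra_simps)
  qed simp
  then have "r * (K * (\<Sum>b<j. (r + K * r) ^ b * r ^ (j - b))) = r * ((r + K * r) ^ j - r ^ j)"
    by (simp only: mult_ac)
  then have "K * (\<Sum>b<j. (r + K * r) ^ b * r ^ (j - b)) = (r + K * r) ^ j - r ^ j"
    using assms(1) mult_cancel_left by (metis less_irrefl)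
  then have "K * (\<Sum>b<j. (r + K * r) ^ b * r ^ (j - b)) \<le> (r + K * r) ^ j"
    using assms by simp
  then show ?thesis using assms by (simp add: field_simps)
qed

text \<open>Majorant for the recursion: \<open>A\<close> makes the term of \<open>g\<close> at most
  half of the bound, \<open>K\<close> makes the sum over the same power of \<open>x\<close> at most
  a quarter, and \<open>K'\<close>, chosen after \<open>s\<close>, does the same for the sum over
  lower powers.\<close>

lemma wq_bound:
  fixes d :: nat and C r D :: real
  assumes f: "\<And>i j. norm (f i j) \<le> C * r ^ (i + j)" and g: "\<And>i j. norm (g i j) \<le> D * r ^ (i + j)"
    and "C \<ge> 1" "D \<ge> 0" "r \<ge> 1"
  defines "K \<equiv> 4 * C * r ^ d" defines "s \<equiv> r + K * r"
  defines "K' \<equiv> 8 * C * s ^ d" defines "S \<equiv> r + K' * r" defines "A \<equiv> 2 * D * r ^ d"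
  shows "norm (wq f g d k j) \<le> A * S ^ k * s ^ j"
proof -
  have r: "r > 0" "C > 0" using assms by auto
  have K: "K \<ge> 1" unfolding K_def using assms mult_mono[of 1 "4 * C" 1 "r ^ d"] by simp
  have s: "s \<ge> r" "s > 0" using K r by (auto simp: s_def intro: add_pos_pos)
  have K': "K' > 0" using s r by (auto simp: K'_def)
  have S: "S \<ge> r" "S > 0" using K' r by (auto simp: S_def intro: add_pos_pos)
  have A: "A \<ge> 0" using assms by (simp add: A_def)
  show ?thesis
  proof (induction k arbitrary: j rule: less_induct)
    case (less k)
    note IHk = less.IH
    show ?case
    proof (induction j rule: less_induct)
      case (less j)
      have 1: "norm (g k (j + d)) \<le> A * S ^ k * s ^ j / 2"
      proof -
        have "norm (g k (j + d)) \<le> D * (r ^ k * r ^ j * r ^ d)"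
          using g[of k "j + d"] by (simp add: power_add mult_ac)
        also have "\<dots> \<le> D * (S ^ k * s ^ j * r ^ d)"
          using S s r assms by (intro mult_left_mono mult_right_mono mult_mono power_mono) auto
        finally show ?thesis by (simp add: A_def mult_ac)
      qed
      have "norm (\<Sum>b<j. wq f g d k b * f 0 (j + d - b)) \<le>
          (\<Sum>b<j. (A * S ^ k * C * r ^ d) * (s ^ b * r ^ (j - b)))"
      proof (rule sum_norm_le)
        fix b assume b: "b \<in> {..<j}"
        have "norm (wq f g d k b * f 0 (j + d - b)) \<le> (A * S ^ k * s ^ b) * (C * r ^ (j + d - b))"
          unfolding norm_mult using less[of b] f[of 0 "j + d - b"] b A S s
          by (intro mult_mono) auto
        also have "r ^ (j + d - b) = r ^ (j - b) * r ^ d" using b by (simp flip: power_add)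
        finally show "norm (wq f g d k b * f 0 (j + d - b)) \<le>
            (A * S ^ k * C * r ^ d) * (s ^ b * r ^ (j - b))"
          by (simp add: mult_ac)
      qed
      also have "\<dots> \<le> (A * S ^ k * C * r ^ d) * (s ^ j / K)"
        unfolding sum_distrib_left[symmetric] s_def using A S r assms K
        by (intro mult_left_mono sum_mixed_powers_le) auto
      also have "\<dots> = A * S ^ k * s ^ j / 4"
        using r by (simp add: K_def field_simps)
      finally have 2: "norm (\<Sum>b<j. wq f g d k b * f 0 (j + d - b)) \<le> A * S ^ k * s ^ j / 4" .
      have "norm (\<Sum>i<k. \<Sum>b\<le>j + d. wq f g d i b * f (k - i) (j + d - b)) \<le>
          (\<Sum>i<k. (2 * A * C * s ^ (j + d)) * (S ^ i * r ^ (k - i)))"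
      proof (rule sum_norm_le)
        fix i assume i: "i \<in> {..<k}"
        have "norm (\<Sum>b\<le>j + d. wq f g d i b * f (k - i) (j + d - b)) \<le>
            (\<Sum>b\<le>j + d. (A * C * (S ^ i * r ^ (k - i))) * (s ^ b * r ^ (j + d - b)))"
        proof (rule sum_norm_le)
          fix b assume b: "b \<in> {..j + d}"
          have "norm (wq f g d i b * f (k - i) (j + d - b)) \<le>
              (A * S ^ i * s ^ b) * (C * r ^ (k - i + (j + d - b)))"
            unfolding norm_mult using IHk[of i b] f[of "k - i" "j + d - b"] i A S s
            by (intro mult_mono) auto
          then show "norm (wq f g d i b * f (k - i) (j + d - b)) \<le>
              (A * C * (S ^ i * r ^ (k - i))) * (s ^ b * r ^ (j + d - b))"
            by (simp add: power_add mult_ac)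
        qed
        also have "\<dots> = (A * C * (S ^ i * r ^ (k - i))) *
            ((\<Sum>b<j + d. s ^ b * r ^ (j + d - b)) + s ^ (j + d))"
          unfolding sum_distrib_left[symmetric] by (simp flip: lessThan_Suc_atMost)
        also have "\<dots> \<le> (A * C * (S ^ i * r ^ (k - i))) * (2 * s ^ (j + d))"
        proof (intro mult_left_mono)
          have "(\<Sum>b<j + d. s ^ b * r ^ (j + d - b)) \<le> s ^ (j + d) / K"
            unfolding s_def using r K by (intro sum_mixed_powers_le) auto
          also have "\<dots> \<le> s ^ (j + d)" using K s by (simp add: field_simps)
          finally show "(\<Sum>b<j + d. s ^ b * r ^ (j + d - b)) + s ^ (j + d) \<le> 2 * s ^ (j + d)"
            by simp
          show "0 \<le> A * C * (S ^ i * r ^ (k - i))" using A S r by auto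
        qed
        finally show "norm (\<Sum>b\<le>j + d. wq f g d i b * f (k - i) (j + d - b)) \<le>
            (2 * A * C * s ^ (j + d)) * (S ^ i * r ^ (k - i))"
          by (simp add: mult_ac)
      qed
      also have "\<dots> \<le> (2 * A * C * s ^ (j + d)) * (S ^ k / K')"
        unfolding sum_distrib_left[symmetric] S_def using A s r K'
        by (intro mult_left_mono sum_mixed_powers_le) auto
      also have "\<dots> = A * S ^ k * s ^ j / 4"
        using r s by (simp add: K'_def power_add field_simps)
      finally have 3: "norm (\<Sum>i<k. \<Sum>b\<le>j + d. wq f g d i b * f (k - i) (j + d - b))
          \<le> A * S ^ k * s ^ j / 4" .
      have tri: "norm (a - b - c) \<le> norm a + norm b + norm c" for a b c :: complex
        by (meson add_right_mono norm_triangle_ineq4 order_trans)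
      have "norm (wq f g d k j) \<le> A * S ^ k * s ^ j / 2 + A * S ^ k * s ^ j / 4 + A * S ^ k * s ^ j / 4"
        unfolding wq.simps[of f g d k j] by (rule order_trans[OF tri add_mono[OF add_mono[OF 1 2] 3]])
      then show ?case by simp
    qed
  qed
qed

lemma weierstrass_division:
  assumes "rX f \<noteq> 0"
  obtains q r where "g = q * f + r" "\<And>i j. j \<ge> subdegree (rX f) \<Longrightarrow> coeff2 r i j = 0"
proof -
  define d where "d = subdegree (rX f)"
  define c where "c = coeff2 f 0 d"
  have c: "c \<noteq> 0" using nth_subdegree_nonzero[OF assms] by (simp add: c_def d_def)
  define F where "F = const (1 / c) * f"
  have F0: "coeff2 F 0 j = 0" if "j < d" for j
    using nth_less_subdegree_zero[of j "rX f"] that by (simp add: F_def coeff2_const_mult d_def)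
  have Fd: "coeff2 F 0 d = 1" using c by (simp add: F_def coeff2_const_mult c_def)
  have bd: "\<exists>C r. C \<ge> 0 \<and> r \<ge> 1 \<and> (\<forall>i j. norm (coeff2 h i j) \<le> C * r ^ (i + j))" for h
    by transfer (use conv2E in metis)
  obtain C r where C: "C \<ge> 0" "r \<ge> 1" "\<And>i j. norm (coeff2 F i j) \<le> C * r ^ (i + j)"
    using bd by blast
  obtain D t where D: "D \<ge> 0" "t \<ge> 1" "\<And>i j. norm (coeff2 g i j) \<le> D * t ^ (i + j)"
    using bd by blast
  \<comment> \<open>\<open>wq_bound\<close> takes one radius for both series and a constant at least
    \<open>1\<close> for the divisor.\<close>
  have "norm (coeff2 F i j) \<le> (1 + C) * max r t ^ (i + j)" for i j
    by (rule order_trans[OF C(3)], intro mult_mono power_mono) (use C D in auto)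
  moreover have "norm (coeff2 g i j) \<le> D * max r t ^ (i + j)" for i j
    by (rule order_trans[OF D(3)], intro mult_mono power_mono) (use C D in auto)
  ultimately have "\<exists>A S s. A \<ge> 0 \<and> S \<ge> 0 \<and> s \<ge> 0 \<and>
      (\<forall>k j. norm (wq (coeff2 F) (coeff2 g) d k j) \<le> A * S ^ k * s ^ j)"
    using C D wq_bound[of "coeff2 F" "1 + C" "max r t" "coeff2 g" D d]
    by (intro exI[of _ "2 * D * max r t ^ d"]
        exI[of _ "max r t + 8 * (1 + C) * (max r t + 4 * (1 + C) * max r t ^ d * max r t) ^ d * max r t"]
        exI[of _ "max r t + 4 * (1 + C) * max r t ^ d * max r t"] conjI allI)
      (simp_all add: add_nonneg_nonneg)
  then obtain A S s where A: "A \<ge> 0" "S \<ge> 0" "s \<ge> 0"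
      "\<And>k j. norm (wq (coeff2 F) (coeff2 g) d k j) \<le> A * S ^ k * s ^ j" by blast
  define Q where "Q = Abs_germ (Abs_fps (\<lambda>j. Abs_fps (\<lambda>k. wq (coeff2 F) (coeff2 g) d k j)))"
  have cv: "conv2 (Abs_fps (\<lambda>j. Abs_fps (\<lambda>k. wq (coeff2 F) (coeff2 g) d k j)))"
  proof (rule conv2I[where C = A and r = "max S s"])
    fix k j
    have "A * S ^ k * s ^ j \<le> A * (max S s ^ k * max S s ^ j)"
      unfolding mult.assoc using A by (intro mult_left_mono mult_mono power_mono) auto
    then show "norm (Abs_fps (\<lambda>j. Abs_fps (\<lambda>k. wq (coeff2 F) (coeff2 g) d k j)) $ j $ k)
        \<le> A * max S s ^ (k + j)"
      using A(4)[of k j] by (simp add: power_add)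
  qed
  have Q: "coeff2 Q k j = wq (coeff2 F) (coeff2 g) d k j" for k j
    using cv by (simp add: Q_def coeff2.rep_eq Abs_germ_inverse)
  have prod: "coeff2 (Q * F) k (j + d) = coeff2 g k (j + d)" for k j
  proof -
    have "coeff2 (Q * F) k (j + d) =
        (\<Sum>i<Suc k. \<Sum>b\<le>j + d. coeff2 Q i b * coeff2 F (k - i) (j + d - b))"
      by (simp only: coeff2_mult lessThan_Suc_atMost) (rule sum.swap)
    also have "\<dots> = (\<Sum>i<k. \<Sum>b\<le>j + d. coeff2 Q i b * coeff2 F (k - i) (j + d - b)) +
        (\<Sum>b\<le>j + d. coeff2 Q k b * coeff2 F 0 (j + d - b))" by simp
    also have "(\<Sum>b\<le>j + d. coeff2 Q k b * coeff2 F 0 (j + d - b)) =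
        (\<Sum>b<Suc j. coeff2 Q k b * coeff2 F 0 (j + d - b))"
      by (rule sum.mono_neutral_right) (auto simp: F0)
    also have "\<dots> = (\<Sum>b<j. coeff2 Q k b * coeff2 F 0 (j + d - b)) + coeff2 Q k j"
      by (simp add: Fd)
    finally show ?thesis
      unfolding Q wq.simps[of "coeff2 F" "coeff2 g" d k j] by simp
  qed
  show ?thesis
  proof (rule that[of "Q * const (1 / c)" "g - Q * F"])
    show "g = Q * const (1 / c) * f + (g - Q * F)" by (simp add: F_def algebra_simps)
    show "coeff2 (g - Q * F) i j = 0" if "j \<ge> subdegree (rX f)" for i j
      using prod[of i "j - d"] that by (simp add: d_def)
  qed
qed

text \<open>Division of \<open>1\<close> by a germ of Weierstrass degree \<open>0\<close> has
  remainder zero, so a non-zero value at the origin already gives an inverse.\<close>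

lemma is_unit_iff_val: "is_unit f \<longleftrightarrow> val f \<noteq> 0"
proof
  assume "is_unit f"
  then obtain g where "1 = f * g" by (auto simp: dvd_def)
  then have "1 = val f * val g" by (metis val_simps(4,7))
  then show "val f \<noteq> 0" by auto
next
  assume *: "val f \<noteq> 0"
  then have "rX f \<noteq> 0" "subdegree (rX f) = 0" by (metis val_rX fps_zero_nth, simp add: val_rX)
  then obtain q r where "1 = q * f + r" "\<And>i j. coeff2 r i j = 0"
    using weierstrass_division[of f 1] by (metis le0)
  then have "1 = q * f" by (metis germ_eqI coeff2_0 add.right_neutral)
  then show "is_unit f" by (metis dvd_triv_right)
qed

text \<open>The hypothesis \<open>sat\<close> lets powers of \<open>X\<close> be cancelled inside
  the ideal. A member prime to \<open>X\<close> of least Weierstrass degree is a generator: a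
  non-zero remainder, freed of its power of \<open>X\<close>, would have smaller degree. It is
  applied to ideal quotients and to preimages of ideals under a blow-up.\<close>

lemma saturated_ideal_principal:
  assumes add: "\<And>a b. a \<in> J \<Longrightarrow> b \<in> J \<Longrightarrow> a - b \<in> J" and mult: "\<And>a b. a \<in> J \<Longrightarrow> b * a \<in> J"
    and sat: "\<And>a. X * a \<in> J \<Longrightarrow> a \<in> J" and nz: "f \<in> J" "f \<noteq> 0"
  shows "\<exists>r\<in>J. \<not> X dvd r \<and> (\<forall>h\<in>J. r dvd h)"
proof -
  have red: "\<exists>a. a \<in> J \<and> \<not> X dvd a \<and> (\<exists>k. h = X ^ k * a)" if "h \<in> J" "h \<noteq> 0" for h
  proof -
    obtain i j where "coeff2 h i j \<noteq> 0" using \<open>h \<noteq> 0\<close> germ_eqI[of h 0] by auto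
    then show ?thesis using that
    proof (induction i arbitrary: h)
      case 0
      then have "\<not> X dvd h" by (metis X_dvd_iff rX_nth fps_zero_nth)
      then show ?case using 0 by (intro exI[of _ h] conjI exI[of _ 0]) auto
    next
      case (Suc i)
      show ?case
      proof (cases "X dvd h")
        case True
        then obtain a where a: "h = X * a" by (auto simp: dvd_def)
        then have "\<exists>b. b \<in> J \<and> \<not> X dvd b \<and> (\<exists>k. a = X ^ k * b)"
          using Suc.prems sat by (intro Suc.IH) (auto simp: X_mult)
        then obtain b k where "b \<in> J" "\<not> X dvd b" "a = X ^ k * b" by blast
        then show ?thesis using a by (intro exI[of _ b] conjI exI[of _ "Suc k"]) (auto simp: mult_ac)
      next
        case False
        then show ?thesis using Suc.prems by (intro exI[of _ h] conjI exI[of _ 0]) auto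
      qed
    qed
  qed
  define r where "r = arg_min (\<lambda>a. subdegree (rX a)) (\<lambda>a. a \<in> J \<and> \<not> X dvd a)"
  have "\<exists>a. a \<in> J \<and> \<not> X dvd a" using red nz by blast
  then have r: "r \<in> J" "\<not> X dvd r"
      "\<And>a. a \<in> J \<Longrightarrow> \<not> X dvd a \<Longrightarrow> subdegree (rX r) \<le> subdegree (rX a)"
    using arg_min_nat_lemma[of "\<lambda>a. a \<in> J \<and> \<not> X dvd a" _ "\<lambda>a. subdegree (rX a)"]
    unfolding r_def by blast+
  have "r dvd h" if "h \<in> J" for h
  proof -
    obtain q s where qs: "h = q * r + s" "\<And>i j. j \<ge> subdegree (rX r) \<Longrightarrow> coeff2 s i j = 0"
      using weierstrass_division[of r h] r(2) by (metis X_dvd_iff)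
    have "s \<in> J" using add[OF that mult[OF r(1), of q]] qs(1) by simp
    have "s = 0"
    proof (rule ccontr)
      assume "s \<noteq> 0"
      then obtain a k where a: "a \<in> J" "\<not> X dvd a" "s = X ^ k * a"
        using red \<open>s \<in> J\<close> by blast
      have Xk: "coeff2 (X ^ k * b) (i + k) j = coeff2 b i j" for b i j
        by (induction k arbitrary: i) (auto simp: X_mult mult.assoc)
      have "rX a \<noteq> 0" using a by (simp add: X_dvd_iff)
      from nth_subdegree_nonzero[OF this] have "coeff2 s (0 + k) (subdegree (rX a)) \<noteq> 0"
        unfolding a(3) Xk by simp
      then have "subdegree (rX a) < subdegree (rX r)" using qs(2)[of "subdegree (rX a)" "0 + k"] not_le by blast
      then show False using r(3)[of a] a by simp
    qed
    then show ?thesis using qs by simp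
  qed
  then show ?thesis using r by blast
qed

text \<open>For \<open>f\<close> prime to \<open>X\<close> the germs \<open>h\<close> with
  \<open>f dvd g * h\<close> form an ideal in which \<open>X\<close> cancels, so it has a generator
  \<open>r\<close>, and \<open>r dvd f\<close>. Irreducibility makes \<open>r\<close> a unit, and
  then \<open>f dvd g\<close>, or an associate of \<open>f\<close>, and then
  \<open>f dvd h\<close>.\<close>

lemma irreducible_imp_prime_elem_germ:
  fixes f :: germ
  assumes "irreducible f"
  shows "prime_elem f"
proof (rule prime_elemI)
  have f0: "f \<noteq> 0" "\<not> is_unit f" using assms by (auto simp: irreducible_def)
  show "f \<noteq> 0" "\<not> is_unit f" by fact+
  fix g h assume gh: "f dvd g * h"
  show "f dvd g \<or> f dvd h"
  proof (cases "X dvd f")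
    case True
    then obtain k where k: "f = X * k" by (auto simp: dvd_def)
    then have "is_unit k" using assms irreducibleD[of f X k] prime_elem_X by (auto simp: prime_elem_def)
    then have "f dvd X" "X dvd f" using k by (auto simp: mult_unit_dvd_iff)
    then show ?thesis using gh prime_elem_X by (meson dvd_trans prime_elem_dvd_mult_iff)
  next
    case False
    let ?J = "{h. f dvd g * h}"
    have sat: "a \<in> ?J" if a: "X * a \<in> ?J" for a
    proof -
      obtain k where k: "g * (X * a) = f * k" using a by (auto simp: dvd_def)
      then have "X dvd f * k" by (metis dvd_triv_left mult.left_commute)
      then obtain l where "k = X * l" using False prime_elem_X by (metis prime_elem_dvd_mult_iff dvdE)
      then have "X * (g * a) = X * (f * l)" using k by (simp add: mult_ac)
      then show ?thesis by (simp del: mult_cancel_right)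
    qed
    have sub: "a - b \<in> ?J" if "a \<in> ?J" "b \<in> ?J" for a b
      using that by (simp add: right_diff_distrib dvd_diff)
    have mul: "b * a \<in> ?J" if "a \<in> ?J" for a b
      using that by (simp add: mult.left_commute)
    have "\<exists>r\<in>?J. \<not> X dvd r \<and> (\<forall>h\<in>?J. r dvd h)"
    proof (rule saturated_ideal_principal)
      show "f \<in> ?J" by simp
    qed (fact sub mul sat f0(1))+
    then obtain r where r: "r \<in> ?J" "\<And>h. h \<in> ?J \<Longrightarrow> r dvd h" by blast
    then have r: "f dvd g * r" "\<And>h. f dvd g * h \<Longrightarrow> r dvd h" by auto
    have "r dvd f" using r(2) by simp
    then obtain q where q: "f = r * q" by (auto simp: dvd_def)
    then consider "is_unit r" | "is_unit q" using assms irreducibleD by blast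
    then show ?thesis
    proof cases
      case 1
      then show ?thesis using r(1) by (simp add: dvd_mult_unit_iff)
    next
      case 2
      then have "f dvd r" using q by (simp add: mult_unit_dvd_iff)
      then show ?thesis using r(2)[OF gh] dvd_trans by blast
    qed
  qed
qed

lemma coeff2_ord_nonzero:
  assumes "f \<noteq> 0"
  obtains j where "j \<le> ord f" "coeff2 f (ord f - j) j \<noteq> 0"
proof -
  obtain i j where "coeff2 f i j \<noteq> 0" using assms germ_eqI[of f 0] by auto
  then have "\<exists>n. \<exists>i j. i + j = n \<and> coeff2 f i j \<noteq> 0" by blast
  from LeastI_ex[OF this] obtain i j where "i + j = ord f" "coeff2 f i j \<noteq> 0"
    unfolding ord_def by blast
  then show ?thesis using that[of j] by (metis add_diff_cancel_right' le_add2)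
qed

lemma coeff2_less_ord: "i + j < ord f \<Longrightarrow> coeff2 f i j = 0"
  unfolding ord_def using not_less_Least by blast

lemma ord_geI: "f \<noteq> 0 \<Longrightarrow> (\<And>i j. i + j < n \<Longrightarrow> coeff2 f i j = 0) \<Longrightarrow> n \<le> ord f"
  by (metis coeff2_ord_nonzero le_add_diff_inverse2 not_le)

lemma ord_leI: "coeff2 f i j \<noteq> 0 \<Longrightarrow> ord f \<le> i + j"
  using coeff2_less_ord not_le by blast

lemma ord_eq_0_iff: "f \<noteq> 0 \<Longrightarrow> ord f = 0 \<longleftrightarrow> val f \<noteq> 0"
proof -
  assume "f \<noteq> 0"
  then obtain j where "j \<le> ord f" "coeff2 f (ord f - j) j \<noteq> 0" using coeff2_ord_nonzero by blast
  then show ?thesis using ord_leI[of f 0 0] by (auto simp: val_def)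
qed

lemma ord_swap [simp]: "ord (swap f) = ord f"
  unfolding ord_def by (metis (no_types, lifting) add.commute coeff2_swap)

lemma ord_unit: "is_unit f \<Longrightarrow> ord f = 0"
  by (metis is_unit_iff_val ord_eq_0_iff val_simps(8))

lemma X_power_mult: "coeff2 (X ^ k * f) i j = (if i < k then 0 else coeff2 f (i - k) j)"
  by (induction k arbitrary: i) (auto simp: X_mult mult.assoc)

lemma coeff2_swap_mono: "coeff2 (Y ^ k * f) i j = (if j < k then 0 else coeff2 f i (j - k))"
  by (induction k arbitrary: j) (auto simp: Y_mult mult.assoc)

lemma X_power_dvd_iff: "X ^ n dvd f \<longleftrightarrow> (\<forall>i<n. \<forall>j. coeff2 f i j = 0)"
proof
  assume "\<forall>i<n. \<forall>j. coeff2 f i j = 0"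
  then show "X ^ n dvd f"
  proof (induction n arbitrary: f)
    case (Suc n)
    then have "X dvd f" by (auto simp: X_dvd_iff fps_eq_iff)
    then obtain g where g: "f = X * g" by (auto simp: dvd_def)
    have "coeff2 g i j = 0" if "i < n" for i j
      using Suc.prems[rule_format, of "Suc i" j] that by (simp add: g X_mult)
    then show ?case using Suc.IH[of g] g by (simp add: mult_dvd_mono)
  qed simp
qed (auto simp: dvd_def X_power_mult)

text \<open>The tangent cone: the initial form at \<open>x = 1\<close>, a polynomial in the slope.
  Its roots are the finite tangent slopes, and a degree below \<open>ord f\<close> signals a
  vertical tangent.\<close>

definition tc :: "germ \<Rightarrow> complex poly" where
  "tc f = (\<Sum>j\<le>ord f. monom (coeff2 f (ord f - j) j) j)"

lemma coeff_tc: "coeff (tc f) j = (if j \<le> ord f then coeff2 f (ord f - j) j else 0)"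
  by (auto simp: tc_def coeff_sum coeff_monom)

lemma tc_neq_0: "f \<noteq> 0 \<Longrightarrow> tc f \<noteq> 0"
  by (metis coeff2_ord_nonzero coeff_tc coeff_0)

lemma X_ord_dvd_blow_slope: "X ^ ord f dvd blow_slope t f"
  by (auto simp: X_power_dvd_iff coeff2_blow_slope coeff2_less_ord)

lemma blow_slope_eq: "blow_slope t f = X ^ ord f * strict1 (Slope t) f"
  using X_ord_dvd_blow_slope[of f t] by (simp add: strict1_def)

lemma blow_vertical_swap: "blow_vertical f = swap (blow_slope 0 (swap f))"
proof (rule germ_eqI)
  fix i j
  have "coeff2 (blow_slope 0 (swap f)) j i =
      (\<Sum>l\<le>j. if l = i then coeff2 (swap f) (j - l) l else 0)"
    unfolding coeff2_blow_slope by (intro sum.cong) (auto simp: power_0_left binomial_eq_0)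
  then show "coeff2 (blow_vertical f) i j = coeff2 (swap (blow_slope 0 (swap f))) i j"
    by (simp add: coeff2_blow_vertical)
qed

lemma strict1_Vertical: "strict1 Vertical f = swap (strict1 (Slope 0) (swap f))"
proof -
  have "blow_vertical f = Y ^ ord f * swap (strict1 (Slope 0) (swap f))"
    unfolding blow_vertical_swap blow_slope_eq by (simp add: swap_mult swap_power)
  then show ?thesis by (simp add: strict1_def)
qed

lemma blow_eq: "blow t f = exc_line t ^ ord f * strict1 t f"
proof (cases t)
  case Vertical
  have "blow_vertical f = Y ^ ord f * swap (strict1 (Slope 0) (swap f))"
    unfolding blow_vertical_swap blow_slope_eq by (simp add: swap_mult swap_power)
  then show ?thesis using Vertical by (simp add: strict1_Vertical)
qed (simp add: blow_slope_eq)

lemma strict1_neq_0: "f \<noteq> 0 \<Longrightarrow> strict1 t f \<noteq> 0"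
  by (metis blow_eq blow_eq_0_iff mult_zero_right)

lemma pcompose_monom_smult: "pcompose (monom c n) q = smult c (q ^ n)"
  by (induction n) (auto simp: monom_0 monom_Suc pcompose_pCons pcompose_const mult_ac)

lemma pcompose_power: "pcompose (p ^ n) q = pcompose p q ^ n" for p :: "complex poly"
  by (induction n) (auto simp: pcompose_mult pcompose_1)

lemma rX_strict1_Slope:
  "rX (strict1 (Slope t) f) = fps_of_poly (pcompose (tc f) [:t, 1:])"
proof -
  have "coeff2 (strict1 (Slope t) f) 0 l = coeff2 (blow_slope t f) (ord f) l" for l
    by (simp add: blow_slope_eq X_power_mult)
  also have "\<And>l. coeff2 (blow_slope t f) (ord f) l = coeff (pcompose (tc f) [:t, 1:]) l"
    by (simp add: coeff2_blow_slope_poly tc_def pcompose_sum pcompose_monom_smult)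
  finally show ?thesis by (simp add: fps_eq_iff)
qed

lemma pcompose_linear_eq_0: "pcompose p [:t, 1:] = 0 \<longleftrightarrow> p = (0 :: complex poly)"
  by (simp add: pcompose_eq_0_iff)

lemma exc_line_not_dvd_strict1: "f \<noteq> 0 \<Longrightarrow> \<not> exc_line t dvd strict1 t f"
proof (cases t)
  case (Slope s)
  assume "f \<noteq> 0"
  then show ?thesis
    by (simp add: Slope X_dvd_iff rX_strict1_Slope pcompose_linear_eq_0 tc_neq_0)
next
  case Vertical
  assume "f \<noteq> 0"
  then have "\<not> X dvd strict1 (Slope 0) (swap f)"
    by (simp add: X_dvd_iff rX_strict1_Slope pcompose_linear_eq_0 tc_neq_0)
  then show ?thesis using Vertical
    by (simp add: strict1_Vertical dvd_swap_iff)
qed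

lemma prime_elem_exc_line: "prime_elem (exc_line t)"
  by (cases t) (auto simp: prime_elem_X prime_elem_Y)

text \<open>Exponent and cofactor are determined together once \<open>p\<close> divides neither
  cofactor. For an exceptional line this identifies order and strict transform from a formula for
  the pull-back.\<close>

lemma prime_power_eq_unique:
  fixes p :: "'a :: idom"
  assumes "p ^ m * a = p ^ n * b" "\<not> p dvd a" "\<not> p dvd b" "p \<noteq> 0"
  shows "m = n \<and> a = b"
  using assms(1)
proof (induction m n rule: diff_induct)
  case (1 m)
  then show ?case using assms by (cases m) (auto simp: mult.assoc)
next
  case (2 n)
  then show ?case using assms by (auto simp: mult.assoc)
next
  case (3 m n)
  then show ?case using assms by (auto simp: mult.assoc)
qed

text \<open>Both come from one factorization of the pull-back of \<open>f * g\<close>: the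
  exceptional line is prime, so it does not divide the product of the two strict transforms.\<close>

lemma ord_strict1_mult:
  assumes "f \<noteq> 0" "g \<noteq> 0"
  shows "ord (f * g) = ord f + ord g" "strict1 t (f * g) = strict1 t f * strict1 t g"
proof -
  have *: "ord (f * g) = ord f + ord g \<and> strict1 t (f * g) = strict1 t f * strict1 t g" for t
  proof (rule prime_power_eq_unique)
    show "exc_line t ^ ord (f * g) * strict1 t (f * g) =
        exc_line t ^ (ord f + ord g) * (strict1 t f * strict1 t g)"
      using blow_mult[of t f g] by (simp add: blow_eq power_add mult_ac)
    show "\<not> exc_line t dvd strict1 t (f * g)" using assms by (intro exc_line_not_dvd_strict1) simp
    show "\<not> exc_line t dvd strict1 t f * strict1 t g"
      using assms by (simp add: prime_elem_dvd_mult_iff[OF prime_elem_exc_line] exc_line_not_dvd_strict1)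
  qed (use prime_elem_exc_line[of t] in \<open>simp add: prime_elem_def\<close>)
  then show "ord (f * g) = ord f + ord g" "strict1 t (f * g) = strict1 t f * strict1 t g" by auto
qed

lemma strict1_unit: "is_unit f \<Longrightarrow> is_unit (strict1 t f)"
  by (metis ord_strict1_mult(2) dvdE dvdI is_unit_iff_val blow_eq ord_unit ord_eq_0_iff val_simps(8)
      mult.left_neutral power_0 dvd_def blow_mult blow_const const_1)

lemma ord_X [simp]: "ord X = 1" and ord_Y [simp]: "ord Y = 1"
proof -
  have "ord X \<le> 1" using ord_leI[of X 1 0] by (simp add: coeff2_X)
  moreover have "ord X \<noteq> 0" by (simp add: ord_eq_0_iff)
  ultimately show "ord X = 1" by simp
  then show "ord Y = 1" by (metis ord_swap swap_X)
qed

lemma ord_dvd_mono: "f dvd g \<Longrightarrow> g \<noteq> 0 \<Longrightarrow> ord f \<le> ord g"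
  by (auto simp: dvd_def ord_strict1_mult)

lemma ord_prod: "(\<And>a. a \<in> A \<Longrightarrow> f a \<noteq> 0) \<Longrightarrow> ord (prod f A) = (\<Sum>a\<in>A. ord (f a))"
proof (induction A rule: infinite_finite_induct)
  case (insert a A)
  then show ?case by (simp add: ord_strict1_mult prod_zero_iff)
qed (auto simp: ord_unit)

subsection \<open>Derivations\<close>

lemma dy_series: "series (dy f) = fps_deriv (series f)"
  by (simp add: dy.rep_eq fps_deriv_def fps_of_nat fps_eq_iff flip: of_nat_Suc)

lemma coeff2_dx [simp]: "coeff2 (dx f) i j = of_nat (Suc i) * coeff2 f (Suc i) j"
  by transfer simp

lemma coeff2_dy [simp]: "coeff2 (dy f) i j = of_nat (Suc j) * coeff2 f i (Suc j)"
  by transfer simp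

lemma dy_swap: "dy (swap f) = swap (dx f)" and dx_swap: "dx (swap f) = swap (dy f)"
  by (rule germ_eqI; simp)+

lemma dy_mult: "dy (f * g) = dy f * g + f * dy g"
proof -
  have "series (dy (f * g)) = series (dy f * g + f * dy g)"
    by (simp add: dy_series times_germ.rep_eq plus_germ.rep_eq)
  then show ?thesis by (simp add: series_inject)
qed

lemma dx_mult: "dx (f * g) = dx f * g + f * dx g"
proof -
  have "swap (dx (f * g)) = swap (dx f * g + f * dx g)"
    by (simp add: dy_mult swap_mult swap_add flip: dy_swap)
  then show ?thesis by simp
qed

lemma d_simps [simp]:
  "dx (f + g) = dx f + dx g" "dy (f + g) = dy f + dy g"
  "dx (f - g) = dx f - dx g" "dy (f - g) = dy f - dy g"
  "dx X = 1" "dy X = 0" "dx Y = 0" "dy Y = 1" "dx 0 = 0" "dy 0 = 0" "dx 1 = 0" "dy 1 = 0"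
  "dx (const c) = 0" "dy (const c) = 0"
  by (rule germ_eqI; auto simp: coeff2_X coeff2_Y coeff2_1 coeff2_const algebra_simps)+

lemma dx_power: "dx (f ^ Suc n) = of_nat (Suc n) * f ^ n * dx f"
  and dy_power: "dy (f ^ Suc n) = of_nat (Suc n) * f ^ n * dy f"
  by (induction n) (simp_all add: dx_mult dy_mult algebra_simps)

lemma dx_dy: "dx (dy f) = dy (dx f)"
  by (rule germ_eqI) (simp add: mult_ac)

text \<open>The polynomial in \<open>v\<close> multiplying \<open>u ^ k\<close> in
  \<open>f (u, u * (v + t))\<close>. The chain rule in the slope chart is checked on it by
  differentiating polynomials.\<close>

definition lev :: "complex \<Rightarrow> germ \<Rightarrow> nat \<Rightarrow> complex poly" where
  "lev t f k = (\<Sum>j\<le>k. smult (coeff2 f (k - j) j) ([:t, 1:] ^ j))"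

lemma coeff2_blow_lev: "coeff2 (blow_slope t f) k l = coeff (lev t f k) l"
  by (simp add: coeff2_blow_slope_poly lev_def)

lemma pderiv_sum: "pderiv (sum f A) = (\<Sum>a\<in>A. pderiv (f a))"
  by (induction A rule: infinite_finite_induct) (auto simp: pderiv_add)

lemma smult_sum_right: "smult c (sum f A) = (\<Sum>a\<in>A. smult c (f a))"
  by (induction A rule: infinite_finite_induct) (auto simp: smult_add_right)

lemma dy_blow_slope: "dy (blow_slope t f) = X * blow_slope t (dy f)"
proof (rule germ_eqI)
  fix k l
  have "pderiv (lev t f k) = (if k = 0 then 0 else lev t (dy f) (k - 1))"
  proof (cases k)
    case (Suc m)
    have "pderiv (lev t f (Suc m)) =
        (\<Sum>j\<le>Suc m. smult (of_nat j * coeff2 f (Suc m - j) j) ([:t, 1:] ^ (j - 1)))"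
      unfolding lev_def pderiv_sum
      by (intro sum.cong refl) (simp add: pderiv_smult pderiv_power pderiv_pCons mult.commute)
    also have "\<dots> = lev t (dy f) m"
      unfolding sum.atMost_Suc_shift lev_def by simp
    finally show ?thesis using Suc by simp
  qed (simp add: lev_def)
  then have "coeff (pderiv (lev t f k)) l = (if k = 0 then 0 else coeff (lev t (dy f) (k - 1)) l)"
    by simp
  then show "coeff2 (dy (blow_slope t f)) k l = coeff2 (X * blow_slope t (dy f)) k l"
    by (simp add: coeff2_blow_lev X_mult coeff_pderiv)
qed

lemma dx_blow_slope:
  "dx (blow_slope t f) = blow_slope t (dx f) + (Y + const t) * blow_slope t (dy f)"
proof (rule germ_eqI)
  fix k l
  have "smult (of_nat (Suc k)) (lev t f (Suc k)) = lev t (dx f) k + [:t, 1:] * lev t (dy f) k"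
  proof -
    have "[:t, 1:] * lev t (dy f) k =
        (\<Sum>j\<le>k. smult (of_nat (Suc j) * coeff2 f (Suc k - Suc j) (Suc j)) ([:t, 1:] ^ Suc j))"
      unfolding lev_def sum_distrib_left by (intro sum.cong) (auto simp: mult_ac)
    also have "\<dots> = (\<Sum>j\<le>Suc k. smult (of_nat j * coeff2 f (Suc k - j) j) ([:t, 1:] ^ j))"
      unfolding sum.atMost_Suc_shift by simp
    finally have 1: "[:t, 1:] * lev t (dy f) k = \<dots>" .
    have "lev t (dx f) k = (\<Sum>j\<le>k. smult (of_nat (Suc k - j) * coeff2 f (Suc k - j) j) ([:t, 1:] ^ j))"
      unfolding lev_def by (intro sum.cong) (auto simp: Suc_diff_le)
    also have "\<dots> = (\<Sum>j\<le>Suc k. smult (of_nat (Suc k - j) * coeff2 f (Suc k - j) j) ([:t, 1:] ^ j))"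
      by simp
    finally have 2: "lev t (dx f) k = \<dots>" .
    show ?thesis unfolding 1 2 unfolding lev_def smult_sum_right sum.distrib[symmetric]
    proof (intro sum.cong refl)
      fix j assume "j \<in> {..Suc k}"
      then have "(of_nat (Suc k) :: complex) = of_nat (Suc k - j) + of_nat j"
        by (simp flip: of_nat_add del: of_nat_Suc)
      then show "smult (of_nat (Suc k)) (smult (coeff2 f (Suc k - j) j) ([:t, 1:] ^ j)) =
          smult (of_nat (Suc k - j) * coeff2 f (Suc k - j) j) ([:t, 1:] ^ j) +
          smult (of_nat j * coeff2 f (Suc k - j) j) ([:t, 1:] ^ j)"
        by (simp only: smult_smult distrib_right smult_add_left)
    qed
  qed
  then have "coeff (smult (of_nat (Suc k)) (lev t f (Suc k))) l =
      coeff (lev t (dx f) k + [:t, 1:] * lev t (dy f) k) l" by simp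
  then show "coeff2 (dx (blow_slope t f)) k l =
      coeff2 (blow_slope t (dx f) + (Y + const t) * blow_slope t (dy f)) k l"
    by (simp add: coeff2_blow_lev Y_mult coeff2_const_mult distrib_right coeff_pCons split: nat.splits)
qed

lemma dx_blow_vertical: "dx (blow_vertical f) = Y * blow_vertical (dx f)"
  and dy_blow_vertical: "dy (blow_vertical f) = X * blow_vertical (dx f) + blow_vertical (dy f)"
  by (simp_all add: blow_vertical_swap dx_swap dy_swap dy_blow_slope dx_blow_slope swap_mult swap_add
      add.commute)

section \<open>Unibranchness\<close>

lemma blow_minus: "blow t (f - g) = blow t f - blow t g"
  using blow_add[of t "f - g" g] by simp

lemma blow_0 [simp]: "blow t 0 = 0" and blow_1 [simp]: "blow t 1 = 1"
  using blow_const[of t 0] blow_const[of t 1] by simp_all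

lemma blow_power: "blow t (f ^ n) = blow t f ^ n"
  by (induction n) (auto simp: blow_mult)

lemma blow_sum: "blow t (sum f A) = (\<Sum>a\<in>A. blow t (f a))"
  by (induction A rule: infinite_finite_induct) (auto simp: blow_add)

lemma blow_slope_hom:
  "blow_slope t (f + g) = blow_slope t f + blow_slope t g"
  "blow_slope t (f - g) = blow_slope t f - blow_slope t g"
  "blow_slope t (f * g) = blow_slope t f * blow_slope t g"
  "blow_slope t (f ^ n) = blow_slope t f ^ n"
  "blow_slope t (sum F A) = (\<Sum>a\<in>A. blow_slope t (F a))"
  "blow_slope t (const c) = const c" "blow_slope t X = X" "blow_slope t Y = X * (Y + const t)"
  using blow_add[of "Slope t"] blow_minus[of "Slope t"] blow_mult[of "Slope t"]
    blow_power[of "Slope t"] blow_sum[of "Slope t"] blow_const[of "Slope t"] blow_X[of "Slope t"]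
    blow_Y[of "Slope t"] by simp_all

lemma tc_mult:
  assumes "f \<noteq> 0" "g \<noteq> 0"
  shows "tc (f * g) = tc f * tc g"
proof -
  have "fps_of_poly (tc (f * g)) = fps_of_poly (tc f * tc g)"
    using arg_cong[OF ord_strict1_mult(2)[OF assms, of "Slope 0"], of rX]
    by (simp add: rX_mult rX_strict1_Slope fps_of_poly_mult)
  then show ?thesis by simp
qed

lift_definition col :: "germ \<Rightarrow> nat \<Rightarrow> germ" is "\<lambda>f j. fps_const (f $ j)"
proof -
  fix f :: "complex fps fps" and j assume "conv2 f"
  then obtain C r where C: "C \<ge> 0" "r \<ge> 1" "\<And>i j. norm (f $ j $ i) \<le> C * r ^ (i + j)"
    using conv2E by blast
  show "conv2 (fps_const (f $ j))"
    by (rule conv2I[where C = "C * r ^ j" and r = r])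
      (use C(1,2) C(3)[of j] in \<open>auto simp: power_add mult_ac\<close>)
qed

lemma coeff2_col: "coeff2 (col f j) i k = (if k = 0 then coeff2 f i j else 0)"
  by transfer auto

lemma blow_col: "blow_slope t (col f j) = col f j"
proof (rule germ_eqI)
  fix k l
  have "coeff2 (blow_slope t (col f j)) k l = (\<Sum>m\<le>k. if m = 0 then coeff2 (col f j) k l else 0)"
    unfolding coeff2_blow_slope by (intro sum.cong) (auto simp: coeff2_col)
  then show "coeff2 (blow_slope t (col f j)) k l = coeff2 (col f j) k l" by simp
qed

text \<open>The Weierstrass polynomial of \<open>g\<close>, homogenized, is a germ at the centre of the blow-up.\<close>

lemma push_down:
  assumes "\<not> X dvd g"
  obtains h where "g dvd blow_slope t h" "ord h = subdegree (rX g)"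
    "tc h = [:-t, 1:] ^ ord h" "h \<noteq> 0"
proof -
  define d where "d = subdegree (rX g)"
  have "rX g \<noteq> 0" using assms by (simp add: X_dvd_iff)
  from weierstrass_division[OF this, of "Y ^ d"] obtain q r where
    qr: "Y ^ d = q * g + r" "\<And>i j. j \<ge> d \<Longrightarrow> coeff2 r i j = 0" unfolding d_def by blast
  \<comment> \<open>Restricted to \<open>x = 0\<close>, both \<open>Y ^ d\<close> and
    \<open>q * g\<close> are divisible by \<open>y ^ d\<close>, while the remainder has degree below
    \<open>d\<close> in \<open>y\<close>; so it has no term free of \<open>x\<close>.\<close>
  have r0: "coeff2 r 0 j = 0" for j
  proof (cases "j < d")
    case True
    have "rX (Y ^ d) = rX q * rX g + rX r" by (metis qr(1) rX_add rX_mult)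
    then have "fps_X ^ d = rX q * rX g + rX r" by (simp add: rX_power)
    moreover have "rX g $ (j - i) = 0" for i
      using True by (intro nth_less_subdegree_zero) (simp add: d_def)
    then have "(rX q * rX g) $ j = 0" by (simp add: fps_mult_nth del: rX_nth)
    ultimately show ?thesis using True by (metis add_0 fps_add_nth fps_X_power_nth less_irrefl rX_nth)
  qed (use qr(2) in auto)
  have r: "r = (\<Sum>j<d. col r j * Y ^ j)"
  proof (rule germ_eqI)
    fix i k
    have "coeff2 (Y ^ j * col r j) i k = (if k = j then coeff2 r i j else 0)" for j
      by (auto simp: coeff2_swap_mono coeff2_col)
    then show "coeff2 r i k = coeff2 (\<Sum>j<d. col r j * Y ^ j) i k"
      using qr(2)[of k i] by (auto simp: coeff2_sum mult.commute)
  qed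
  have rx: "rX (Y ^ d - r) = fps_X ^ d" by (simp add: fps_eq_iff r0 rX_minus rX_power)
  \<comment> \<open>\<open>L\<close> pulls back to \<open>X * Y\<close>, so that a form of degree
    \<open>d\<close> in \<open>X\<close> and \<open>L\<close> acquires the factor
    \<open>X ^ d\<close>.\<close>
  define L where "L = Y - const t * X"
  define h where "h = L ^ d - (\<Sum>j<d. X ^ (d - j) * col r j * L ^ j)"
  have lin: "blow_slope t L = X * Y"
    unfolding L_def using blow_minus[of "Slope t" Y "const t * X"] blow_Y[of "Slope t"] blow_X[of "Slope t"]
      blow_const[of "Slope t" t] blow_mult[of "Slope t" "const t" X] by (simp add: algebra_simps)
  have "blow_slope t h = (X * Y) ^ d - (\<Sum>j<d. X ^ (d - j) * col r j * (X * Y) ^ j)"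
    by (simp add: h_def lin blow_col blow_slope_hom)
  also have "(\<Sum>j<d. X ^ (d - j) * col r j * (X * Y) ^ j) = X ^ d * (\<Sum>j<d. col r j * Y ^ j)"
    unfolding sum_distrib_left
  proof (intro sum.cong refl)
    fix j assume "j \<in> {..<d}"
    then have "X ^ d = X ^ (d - j) * X ^ j" by (simp flip: power_add)
    then show "X ^ (d - j) * col r j * (X * Y) ^ j = X ^ d * (col r j * Y ^ j)"
      by (simp add: power_mult_distrib mult_ac)
  qed
  finally have bh: "blow_slope t h = X ^ d * (Y ^ d - r)"
    unfolding r[symmetric] by (simp add: power_mult_distrib algebra_simps)
  have nX: "\<not> X dvd Y ^ d - r" by (simp add: X_dvd_iff rx)
  then have "Y ^ d - r \<noteq> 0" by auto
  then have "h \<noteq> 0" using bh blow_0[of "Slope t"] by auto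
  have "ord h = d \<and> strict1 (Slope t) h = Y ^ d - r"
  proof (rule prime_power_eq_unique)
    show "X ^ ord h * strict1 (Slope t) h = X ^ d * (Y ^ d - r)" using bh by (simp add: blow_slope_eq)
    show "\<not> X dvd strict1 (Slope t) h" using exc_line_not_dvd_strict1[OF \<open>h \<noteq> 0\<close>, of "Slope t"] by simp
  qed (use nX in auto)
  then have o: "ord h = d" and "fps_of_poly (pcompose (tc h) [:t, 1:]) = fps_of_poly (monom 1 d)"
    using rx by (auto simp: fps_of_poly_monom' simp flip: rX_strict1_Slope)
  then have "pcompose (tc h) [:t, 1:] = monom 1 d" by simp
  then have "pcompose (pcompose (tc h) [:t, 1:]) [:-t, 1:] = [:-t, 1:] ^ d"
    by (simp add: pcompose_monom_smult)
  then have tc: "tc h = [:-t, 1:] ^ ord h"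
    by (simp add: o pcompose_pCons flip: pcompose_assoc)
  have "g dvd blow_slope t h" using qr(1) by (simp add: bh)
  then show ?thesis using that[OF _ _ tc \<open>h \<noteq> 0\<close>] o d_def by simp
qed

lemma irreducible_factor_germ:
  fixes f :: germ
  assumes "f \<noteq> 0" "\<not> is_unit f"
  obtains g where "irreducible g" "g dvd f"
proof -
  have "\<exists>g. irreducible g \<and> g dvd f"
    using assms
  proof (induction "ord f" arbitrary: f rule: less_induct)
    case less
    show ?case
    proof (cases "irreducible f")
      case False
      then obtain a b where ab: "f = a * b" "\<not> is_unit a" "\<not> is_unit b"
        using less.prems by (auto simp: irreducible_def)
      then have "a \<noteq> 0" "b \<noteq> 0" using less.prems by auto
      then have "ord a < ord f"
        using ab ord_eq_0_iff[of b] by (simp add: ord_strict1_mult is_unit_iff_val)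
      then obtain g where "irreducible g" "g dvd a" using less.hyps ab \<open>a \<noteq> 0\<close> by blast
      then show ?thesis using ab by auto
    qed auto
  qed
  then show ?thesis using that by blast
qed

lemma irreducible_mult_unit:
  fixes p u :: germ
  assumes "irreducible p" "is_unit u"
  shows "irreducible (p * u)"
proof (rule irreducibleI)
  fix a b assume "p * u = a * b"
  moreover obtain v where "1 = u * v" using assms(2) by (auto simp: dvd_def)
  ultimately have "p = a * (b * v)" by (metis mult.assoc mult.right_neutral)
  then have "is_unit a \<or> is_unit (b * v)" using assms(1) irreducibleD by blast
  then show "is_unit a \<or> is_unit b" using is_unit_mult_iff by blast
qed (use assms in \<open>auto simp: irreducible_def is_unit_mult_iff\<close>)

lemma dvd_linear_power:
  fixes p :: "complex poly"
  assumes "p dvd [:- a, 1:] ^ n"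
  obtains c e where "c \<noteq> 0" "p = smult c ([:- a, 1:] ^ e)"
proof -
  have "p \<noteq> 0" using assms by auto
  then obtain q where q: "p = [:- a, 1:] ^ order a p * q" "\<not> [:- a, 1:] dvd q"
    using order_decomp by blast
  have "degree q = 0"
  proof (rule ccontr)
    assume "degree q \<noteq> 0"
    then obtain z where z: "poly q z = 0"
      using fundamental_theorem_of_algebra constant_degree by metis
    obtain u where "[:- a, 1:] ^ n = p * u" using assms by (auto simp: dvd_def)
    then have "poly ([:- a, 1:] ^ n) z = poly (p * u) z" by simp
    moreover have "poly p z = 0" using z q(1) by (metis poly_mult mult_zero_right)
    ultimately have "z = a" by simp
    then show False using z q(2) by (simp add: poly_eq_0_iff_dvd)
  qed
  then obtain c where c: "q = [:c:]" by (auto elim: degree_eq_zeroE)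
  then have "p = smult c ([:- a, 1:] ^ order a p)" using q(1) by simp
  moreover from this have "c \<noteq> 0" using \<open>p \<noteq> 0\<close> by (metis smult_0_left)
  ultimately show ?thesis using that by blast
qed

lemma val_strict1: "val (strict1 (Slope t) f) = poly (tc f) t"
  "val (strict1 Vertical f) = coeff (tc f) (ord f)"
proof -
  show *: "val (strict1 (Slope t) f) = poly (tc f) t" for t f
    by (simp add: val_rX rX_strict1_Slope poly_pcompose flip: poly_0_coeff_0 del: rX_nth)
  show "val (strict1 Vertical f) = coeff (tc f) (ord f)"
    by (simp add: strict1_Vertical * coeff_tc poly_0_coeff_0)
qed

lemma ord_irreducible: "irreducible f \<Longrightarrow> ord f > 0"
  using ord_eq_0_iff[of f] by (auto simp: irreducible_def is_unit_iff_val)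

lemma irreducible_X: "irreducible X" and irreducible_Y: "irreducible Y"
  by (simp_all add: prime_elem_imp_irreducible prime_elem_X prime_elem_Y)

text \<open>An irreducible factor \<open>g\<close> of the strict transform determines the ideal of
  all \<open>h\<close> with \<open>g dvd blow_slope t h\<close>. Its generator is a non-unit
  dividing \<open>f\<close>, so \<open>f\<close> generates it. The germ of \<open>push_down\<close>
  lies in it; hence the tangent cone of \<open>f\<close> divides a power of one linear form, and a
  comparison of degrees makes the strict transform an associate of \<open>g\<close>.\<close>

lemma unibranch_slope:
  assumes f: "irreducible f" and "\<not> is_unit (strict1 (Slope t) f)"
  shows "irreducible (strict1 (Slope t) f)"
    and "\<exists>a. a \<noteq> 0 \<and> tc f = smult a ([:- t, 1:] ^ ord f)"
    and "strict1 (Slope t) f dvd blow_slope t h \<longleftrightarrow> f dvd h"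
proof -
  define f1 where "f1 = strict1 (Slope t) f"
  have f0: "f \<noteq> 0" "\<not> is_unit f" using f by (auto simp: irreducible_def)
  have f1: "f1 \<noteq> 0" "\<not> is_unit f1" "\<not> X dvd f1"
    using assms strict1_neq_0[OF f0(1)] exc_line_not_dvd_strict1[OF f0(1), of "Slope t"]
    by (auto simp: f1_def)
  obtain g where g: "irreducible g" "g dvd f1" using irreducible_factor_germ[OF f1(1,2)] .
  have gX: "\<not> X dvd g" "\<not> g dvd X"
  proof -
    show "\<not> X dvd g" using g(2) f1(3) dvd_trans by blast
    show "\<not> g dvd X"
    proof
      assume "g dvd X"
      then obtain u where "X = g * u" by (auto simp: dvd_def)
      then have "is_unit u" using irreducibleD[OF irreducible_X] g(1) by (auto simp: irreducible_def)
      then have "X dvd g" using \<open>X = g * u\<close> mult_unit_dvd_iff dvd_refl by metis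
      then show False using \<open>\<not> X dvd g\<close> by blast
    qed
  qed
  have pg: "prime_elem g" using g irreducible_imp_prime_elem_germ by blast
  define J where "J = {h. g dvd blow_slope t h}"
  have fJ: "f \<in> J" using g(2) by (simp add: J_def blow_slope_eq flip: f1_def)
  have "\<exists>r\<in>J. \<not> X dvd r \<and> (\<forall>h\<in>J. r dvd h)"
  proof (rule saturated_ideal_principal)
    show "a - b \<in> J" if "a \<in> J" "b \<in> J" for a b
      using that by (simp add: J_def blow_slope_hom dvd_diff)
    show "b * a \<in> J" if "a \<in> J" for a b
      using that by (simp add: J_def blow_slope_hom)
    show "a \<in> J" if "X * a \<in> J" for a
      using that gX pg by (simp add: J_def blow_slope_hom prime_elem_dvd_mult_iff)
  qed (fact fJ f0)+
  then obtain r where r: "r \<in> J" "\<And>h. h \<in> J \<Longrightarrow> r dvd h" by blast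
  have "\<not> is_unit r"
  proof
    assume "is_unit r"
    then obtain u where "1 = r * u" by (auto simp: dvd_def)
    then have "1 = blow_slope t r * blow_slope t u"
      using blow_1[of "Slope t"] by (metis blow.simps(1) blow_mult)
    then have "is_unit g" using r(1) dvd_mult2[of g "blow_slope t r" "blow_slope t u"] by (simp add: J_def)
    then show False using g by (auto simp: irreducible_def)
  qed
  moreover obtain q where q: "f = r * q" using r(2)[OF fJ] by (auto simp: dvd_def)
  ultimately have "is_unit q" using f irreducibleD by blast
  then have fr: "f dvd r" using q by (simp add: mult_unit_dvd_iff)
  then have J: "h \<in> J \<longleftrightarrow> f dvd h" for h
  proof -
    have "blow_slope t f dvd blow_slope t h" if "f dvd h"
      using that by (auto simp: dvd_def blow_slope_hom)
    then show ?thesis using r fr fJ by (auto simp: J_def intro: dvd_trans)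
  qed
  obtain h where h: "g dvd blow_slope t h" "ord h = subdegree (rX g)"
      "tc h = [:-t, 1:] ^ ord h" "h \<noteq> 0" using push_down[OF gX(1)] .
  have "f dvd h" using J h(1) by (auto simp: J_def)
  then obtain k where k: "h = f * k" by (auto simp: dvd_def)
  then have "tc f dvd [:-t, 1:] ^ ord h" using h(3,4) f0 by (metis tc_mult dvd_triv_left mult_eq_0_iff)
  then obtain c e where e: "c \<noteq> 0" "tc f = smult c ([:- t, 1:] ^ e)" by (rule dvd_linear_power)
  have rf: "rX f1 = fps_const c * fps_X ^ e"
  proof -
    have "pcompose (tc f) [:t, 1:] = monom c e"
      by (simp add: e pcompose_smult pcompose_power pcompose_pCons monom_altdef)
    then show ?thesis by (simp add: f1_def rX_strict1_Slope fps_of_poly_monom)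
  qed
  obtain u where u: "f1 = g * u" using g(2) by (auto simp: dvd_def)
  have nz: "rX g \<noteq> 0" "rX u \<noteq> 0" using u f1(3) by (auto simp: X_dvd_iff rX_mult)
  have se: "subdegree (rX f1) = e" using e(1) by (simp add: rf)
  have "degree (tc f) \<le> ord f" by (rule degree_le) (simp add: coeff_tc)
  then have "e \<le> ord f" using e by (simp add: degree_linear_power)
  moreover have "ord f \<le> ord h" using \<open>f dvd h\<close> h(4) ord_dvd_mono by blast
  \<comment> \<open>Together with \<open>e \<le> ord f \<le> ord h\<close> this forces equality
    throughout, so the cofactor \<open>u\<close> is a unit.\<close>
  moreover have "e = ord h + subdegree (rX u)" using se nz by (simp add: u rX_mult h(2))
  ultimately have *: "e = ord f" "subdegree (rX u) = 0" by auto
  then have "is_unit u" using nz by (metis is_unit_iff_val val_rX nth_subdegree_nonzero)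
  then have fg: "f1 dvd g" using u by (simp add: mult_unit_dvd_iff)
  show "\<exists>a. a \<noteq> 0 \<and> tc f = smult a ([:- t, 1:] ^ ord f)" using e * by blast
  show "strict1 (Slope t) f dvd blow_slope t h \<longleftrightarrow> f dvd h" for h
    using J[of h] fg g(2) dvd_trans unfolding J_def f1_def by blast
  show "irreducible (strict1 (Slope t) f)"
    using irreducible_mult_unit[OF g(1) \<open>is_unit u\<close>] by (simp add: u flip: f1_def)
qed


lemma unibranch_vertical:
  assumes f: "irreducible f" and "\<not> is_unit (strict1 Vertical f)"
  shows "irreducible (strict1 Vertical f)"
    and "\<exists>a. a \<noteq> 0 \<and> tc f = [:a:]"
    and "strict1 Vertical f dvd blow_vertical h \<longleftrightarrow> f dvd h"
proof -
  have s: "irreducible (swap f)" "\<not> is_unit (strict1 (Slope 0) (swap f))"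
    using assms irreducible_swap by (auto simp: strict1_Vertical)
  note u = unibranch_slope[OF s]
  show "irreducible (strict1 Vertical f)" using irreducible_swap[OF u(1)] by (simp add: strict1_Vertical)
  show "strict1 Vertical f dvd blow_vertical h \<longleftrightarrow> f dvd h"
    using u(3)[of "swap h"] by (simp add: strict1_Vertical blow_vertical_swap)
  obtain a where a: "a \<noteq> 0" "tc (swap f) = monom a (ord f)" using u(2) by (auto simp: monom_altdef)
  have "coeff (tc f) j = coeff [:a:] j" for j
  proof (cases "j \<le> ord f")
    case True
    then have "coeff (tc f) j = coeff (tc (swap f)) (ord f - j)" by (simp add: coeff_tc)
    then show ?thesis using True by (auto simp: a coeff_pCons split: nat.splits)
  next
    case False
    then show ?thesis by (auto simp: coeff_tc coeff_pCons split: nat.splits)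
  qed
  then have "tc f = [:a:]" by (simp add: poly_eq_iff)
  then show "\<exists>a. a \<noteq> 0 \<and> tc f = [:a:]" using a by blast
qed

lemma irreducible_strict1: "irreducible f \<Longrightarrow> \<not> is_unit (strict1 t f) \<Longrightarrow> irreducible (strict1 t f)"
  by (cases t) (auto intro: unibranch_slope unibranch_vertical)

lemma strict1_dvd_blow_iff:
  "irreducible f \<Longrightarrow> \<not> is_unit (strict1 t f) \<Longrightarrow> strict1 t f dvd blow t h \<longleftrightarrow> f dvd h"
  by (cases t) (auto simp: unibranch_slope(3) unibranch_vertical(3))

text \<open>Existence comes from a root of the tangent cone, or from the vertical direction when the
  cone is constant; uniqueness from the cone being a power of a single linear form.\<close>

lemma unibranch:
  assumes f: "irreducible f"
  shows "\<exists>!t. \<not> is_unit (strict1 t f)"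
proof (rule ex_ex1I)
  have o: "ord f > 0" using ord_irreducible[OF f] .
  show "\<exists>t. \<not> is_unit (strict1 t f)"
  proof (cases "degree (tc f) = 0")
    case True
    then have "val (strict1 Vertical f) = 0" using o by (simp add: val_strict1 coeff_eq_0)
    then show ?thesis by (auto simp: is_unit_iff_val)
  next
    case False
    then obtain z where "poly (tc f) z = 0"
      using fundamental_theorem_of_algebra constant_degree by metis
    then have "val (strict1 (Slope z) f) = 0" by (simp add: val_strict1)
    then show ?thesis by (auto simp: is_unit_iff_val)
  qed
  fix s t assume st: "\<not> is_unit (strict1 s f)" "\<not> is_unit (strict1 t f)"
  have slope: "t' = Slope s'" if st': "\<not> is_unit (strict1 (Slope s') f)" "\<not> is_unit (strict1 t' f)" for s' t'
  proof -
    obtain a where a: "a \<noteq> 0" "tc f = smult a ([:- s', 1:] ^ ord f)"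
      using unibranch_slope(2)[OF f st'(1)] by blast
    show ?thesis
    proof (cases t')
      case (Slope u)
      then show ?thesis using st'(2) a o by (simp add: is_unit_iff_val val_strict1)
    next
      case Vertical
      have "coeff ([:- s', 1:] ^ ord f) (ord f) = 1" by (simp add: coeff_linear_power)
      then show ?thesis using st'(2) Vertical a by (simp add: is_unit_iff_val val_strict1)
    qed
  qed
  show "s = t"
  proof (cases s)
    case (Slope u)
    then show ?thesis using slope[of u t] st by simp
  next
    case Vertical
    then show ?thesis using slope[of _ s] st by (cases t) auto
  qed
qed

lemma assoc_strict1_imp:
  assumes "irreducible f" "irreducible g" "\<not> is_unit (strict1 t f)" "strict1 t f dvd strict1 t g"
  shows "f dvd g"
proof -
  have "strict1 t f dvd blow t g" using assms(4) by (simp add: blow_eq)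
  then show ?thesis using strict1_dvd_blow_iff assms by blast
qed

section \<open>Coprimality\<close>

text \<open>Induction on the order of \<open>a\<close>, splitting off one irreducible, hence prime,
  factor at a time.\<close>

lemma coprime_dvd_mult_germ:
  fixes a b c :: germ
  assumes "coprime a b" "a dvd b * c" "a \<noteq> 0"
  shows "a dvd c"
  using assms
proof (induction "ord a" arbitrary: a c rule: less_induct)
  case less
  show ?case
  proof (cases "is_unit a")
    case False
    then obtain p where p: "irreducible p" "p dvd a" using irreducible_factor_germ less.prems by blast
    then obtain a' where a': "a = p * a'" by (auto simp: dvd_def)
    have pp: "prime_elem p" "\<not> is_unit p" using p irreducible_imp_prime_elem_germ by (auto simp: irreducible_def)
    have "\<not> p dvd b" using less.prems(1) p pp(2) coprime_common_divisor by blast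
    moreover have "p dvd b * c" using p less.prems dvd_trans by blast
    ultimately have "p dvd c" using pp by (simp add: prime_elem_dvd_mult_iff)
    then obtain c' where c': "c = p * c'" by (rule dvdE)
    have nz: "a' \<noteq> 0" "p \<noteq> 0" using a' less.prems by auto
    have "p * a' dvd p * (b * c')" using less.prems(2) unfolding a' c' by (simp only: mult_ac)
    then have "a' dvd b * c'" using nz by simp
    moreover have "coprime a' b" using less.prems(1) coprime_divisors[of a' a b b] a' by simp
    moreover have "ord a' < ord a" using a' nz ord_irreducible[OF p(1)] by (simp add: ord_strict1_mult)
    ultimately have "a' dvd c'" using less.hyps nz by blast
    then show ?thesis by (simp add: a' c' mult_dvd_mono)
  qed (simp add: unit_imp_dvd)
qed

lemma coprime_rep:
  fixes a b :: germ
  assumes "(a, b) \<noteq> (0, 0)"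
  obtains g \<alpha> \<beta> where "a = g * \<alpha>" "b = g * \<beta>" "coprime \<alpha> \<beta>" "g \<noteq> 0"
proof -
  define w where "w = (if a = 0 then b else a)"
  have w: "w \<noteq> 0" using assms by (auto simp: w_def)
  have "\<exists>g \<alpha> \<beta>. a = g * \<alpha> \<and> b = g * \<beta> \<and> coprime \<alpha> \<beta> \<and> g \<noteq> 0"
    using assms
  proof (induction "ord (if a = 0 then b else a)" arbitrary: a b rule: less_induct)
    case less
    show ?case
    proof (cases "coprime a b")
      case False
      then obtain p where p: "p dvd a" "p dvd b" "\<not> is_unit p" by (auto simp: coprime_def)
      then obtain a' b' where ab: "a = p * a'" "b = p * b'" by (auto simp: dvd_def)
      have p0: "p \<noteq> 0" using less.prems ab by auto
      then have "ord (if a' = 0 then b' else a') < ord (if a = 0 then b else a)"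
        using less.prems p ord_eq_0_iff[of p] by (auto simp: ab ord_strict1_mult is_unit_iff_val)
      moreover have "(a', b') \<noteq> (0, 0)" using less.prems ab by auto
      ultimately obtain g \<alpha> \<beta> where "a' = g * \<alpha>" "b' = g * \<beta>" "coprime \<alpha> \<beta>" "g \<noteq> 0"
        using less.hyps by blast
      then show ?thesis using ab p0 by (intro exI[of _ "p * g"] exI[of _ \<alpha>] exI[of _ \<beta>]) (auto simp: mult_ac)
    next
      case True
      then show ?thesis by (metis mult_1 one_neq_zero)
    qed
  qed
  then show ?thesis using that by blast
qed

section \<open>Infinitely near points\<close>

declare loc.simps [simp del]

lemma loc_Nil [simp]: "loc (Sep S) [] = eqn S"
  by (simp add: loc.simps strict_def)

text \<open>The tangent direction of the new exceptional line at the origin of its chart: this line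
  is \<open>X = 0\<close> in the slope charts and \<open>Y = 0\<close> in the vertical one.
  Repeating \<open>cont t\<close> follows its strict transforms.\<close>

fun cont :: "direction \<Rightarrow> direction" where
  "cont Vertical = Slope 0"
| "cont (Slope _) = Vertical"

text \<open>The infinitely near points lying on the component created by the blow-up of \<open>q\<close>.\<close>

definition dpt :: "point \<Rightarrow> direction \<Rightarrow> nat \<Rightarrow> point" where
  "dpt q t k = q @ t # replicate k (cont t)"

lemma cont_neq [simp]: "cont t \<noteq> t" "t \<noteq> cont t"
  by (cases t; simp)+

lemma irreducible_exc_line: "irreducible (exc_line t)"
  by (cases t) (auto simp: irreducible_X irreducible_Y)

lemma exc_line_neq_0 [simp]: "exc_line t \<noteq> 0"
  by (cases t) auto

lemma val_exc_line [simp]: "val (exc_line t) = 0"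
  by (cases t) auto

lemma ord_exc_line [simp]: "ord (exc_line t) = 1"
  by (cases t) auto

lemma strict1_cont: "strict1 (cont t) (exc_line t) = exc_line t"
proof (cases t)
  case (Slope a)
  have "Y * strict1 Vertical X = Y * X"
    using blow_eq[of Vertical X] by (simp add: blow_X[of Vertical, simplified] mult.commute)
  then show ?thesis using Slope by simp
next
  case Vertical
  have "X * strict1 (Slope 0) Y = X * Y"
    using blow_eq[of "Slope 0" Y] by (simp add: blow_Y[of "Slope 0", simplified])
  then show ?thesis using Vertical by simp
qed

lemma strict1_exc_line_unit: "s \<noteq> cont t \<Longrightarrow> is_unit (strict1 s (exc_line t))"
  using unibranch[OF irreducible_exc_line, of t] strict1_cont[of t] irreducible_exc_line[of t]
  by (metis irreducible_not_unit)

lemma strict_Nil [simp]: "strict [] f = f" and strict_Cons [simp]: "strict (t # p) f = strict p (strict1 t f)"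
  and strict_append: "strict (p @ q) f = strict q (strict p f)"
  by (simp_all add: strict_def)

lemma strict_unit: "is_unit f \<Longrightarrow> is_unit (strict p f)"
  by (induction p arbitrary: f) (auto intro: strict1_unit)

lemma strict_exc_line: "strict (replicate k (cont t)) (exc_line t) = exc_line t"
  by (induction k) (auto simp: strict1_cont)

lemma strict_exc_line_unit:
  assumes "w \<noteq> replicate (length w) (cont t)"
  shows "is_unit (strict w (exc_line t))"
  using assms
proof (induction w)
  case (Cons s w)
  then show ?case
    by (cases "s = cont t") (auto simp: strict1_cont intro: strict_unit strict1_exc_line_unit)
qed simp

lemma loc_dpt [simp]: "loc (Exc q) (dpt q t k) = exc_line t"
  by (simp add: dpt_def strict_exc_line strict_prefix_def loc.simps)

lemma through_Exc_iff: "through (Exc q) p \<longleftrightarrow> (\<exists>t k. p = dpt q t k)"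
proof
  assume th: "through (Exc q) p"
  then have "strict_prefix q p" by (cases "strict_prefix q p") (auto simp: through_def loc.simps)
  then obtain t w where p: "p = q @ t # w" by (auto elim: strict_prefixE')
  then have "\<not> is_unit (strict w (exc_line t))" using th
    by (auto simp: through_def is_unit_iff_val strict_prefix_def loc.simps)
  then have "w = replicate (length w) (cont t)" using strict_exc_line_unit by blast
  then show "\<exists>t k. p = dpt q t k" using p unfolding dpt_def by metis
qed (auto simp: through_def)

lemma through_Exc_strict_prefix: "through (Exc q) p \<Longrightarrow> strict_prefix q p"
  by (auto simp: through_Exc_iff dpt_def strict_prefix_def)

lemma loc_snoc:
  assumes "c \<noteq> Exc p"
  shows "loc c (p @ [t]) = strict1 t (loc c p)"
proof (cases c)
  case (Exc q)
  have u: "strict1 t 1 = 1" using blow_eq[of t 1] by (simp add: ord_unit)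
  show ?thesis
  proof (cases "strict_prefix q p")
    case True
    then obtain s w where p: "p = q @ s # w" by (auto elim: strict_prefixE')
    then show ?thesis using Exc by (simp add: strict_append strict_prefix_def loc.simps)
  next
    case False
    then have "\<not> strict_prefix q (p @ [t])" using assms Exc by (auto simp: strict_prefix_def prefix_snoc)
    then show ?thesis using False Exc u by (simp add: loc.simps)
  qed
qed (simp add: strict_append loc.simps)

lemma loc_Exc_snoc [simp]: "loc (Exc p) (p @ [t]) = exc_line t"
  by (simp add: strict_prefix_def loc.simps)

lemma through_snoc_Exc [simp]: "through (Exc p) (p @ [t])"
  by (simp add: through_def)

lemma through_iff_not_unit: "through c p \<longleftrightarrow> \<not> is_unit (loc c p)"
  by (simp add: through_def is_unit_iff_val)

lemma through_snocD: "through c (p @ [t]) \<Longrightarrow> c = Exc p \<or> through c p"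
  using strict1_unit[of "loc c p" t] by (auto simp: through_iff_not_unit loc_snoc)

lemma through_SepD: "through (Sep S) p \<Longrightarrow> prefix q p \<Longrightarrow> through (Sep S) q"
  by (induction p rule: rev_induct) (auto simp: prefix_snoc dest: through_snocD)

lemma through_ExcD: "through (Exc D) p \<Longrightarrow> prefix q p \<Longrightarrow> strict_prefix D q \<Longrightarrow> through (Exc D) q"
proof (induction p rule: rev_induct)
  case (snoc t p)
  show ?case
  proof (cases "q = p @ [t]")
    case False
    then have "prefix q p" using snoc.prems by (simp add: prefix_snoc)
    then have "D \<noteq> p" using snoc.prems by auto
    then have "through (Exc D) p" using snoc.prems through_snocD by blast
    then show ?thesis using snoc \<open>prefix q p\<close> by blast
  qed (use snoc in simp)
qed (auto simp: strict_prefix_def)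

lemma eqn: "S \<in> branches \<Longrightarrow> irreducible (eqn S) \<and> S = curve (eqn S)"
proof -
  assume "S \<in> branches"
  then have "\<exists>f. is_equation S f" by (simp add: branches_def)
  from someI_ex[OF this] show ?thesis by (simp add: is_equation_def eqn_def)
qed

lemma curve_eq_iff: "curve f = curve g \<longleftrightarrow> f dvd g \<and> g dvd f"
  unfolding curve_def using dvd_trans by auto

lemma irreducible_dvd_irreducible: "irreducible f \<Longrightarrow> irreducible g \<Longrightarrow> f dvd g \<Longrightarrow> g dvd (f :: germ)"
proof -
  assume fg: "irreducible f" "irreducible g" "f dvd g"
  then obtain u where u: "g = f * u" by (auto simp: dvd_def)
  then have "is_unit u" using fg irreducibleD[of g f u] by (auto simp: irreducible_def)
  then show "g dvd f" by (simp add: u mult_unit_dvd_iff)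
qed

lemma irreducible_loc: "(\<forall>S. c = Sep S \<longrightarrow> S \<in> branches) \<Longrightarrow> through c p \<Longrightarrow> irreducible (loc c p)"
proof (cases c)
  case (Sep S)
  assume "\<forall>S. c = Sep S \<longrightarrow> S \<in> branches" "through c p"
  then show ?thesis unfolding Sep
  proof (induction p rule: rev_induct)
    case Nil
    then show ?case using eqn by simp
  next
    case (snoc t p)
    then have "through (Sep S) p" using through_snocD by blast
    then have "irreducible (loc (Sep S) p)" using snoc by simp
    then show ?case using snoc.prems irreducible_strict1[of "loc (Sep S) p" t]
      by (simp add: through_iff_not_unit loc_snoc)
  qed
next
  case (Exc q)
  assume "through c p"
  then show ?thesis using Exc irreducible_exc_line by (auto simp: through_Exc_iff)
qed

lemma loc_neq_0: "(\<forall>S. c = Sep S \<longrightarrow> S \<in> branches) \<Longrightarrow> loc c p \<noteq> 0"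
  using irreducible_loc[of c p] by (cases "through c p") (auto simp: through_def irreducible_def)

lemma Sep_path_unique:
  assumes "S \<in> branches" "through (Sep S) p" "through (Sep S) q" "length p \<le> length q"
  shows "prefix p q"
  using assms(2-)
proof (induction p arbitrary: q rule: rev_induct)
  case (snoc t p)
  have p: "through (Sep S) p" using snoc.prems through_snocD by blast
  then have "prefix p q" using snoc by auto
  then obtain v where v: "q = p @ v" by (auto simp: prefix_def)
  then obtain s w where q: "q = p @ s # w" using snoc.prems(3) by (cases v) auto
  then have "through (Sep S) (p @ [s])" using snoc.prems(2) through_SepD by simp
  moreover have "irreducible (loc (Sep S) p)" using irreducible_loc[of "Sep S"] assms(1) p by simp
  ultimately have "s = t" using snoc.prems(1) unibranch
    by (auto simp: through_iff_not_unit loc_snoc)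
  then show ?case using q by simp
qed simp

lemma Sep_path_exists:
  assumes "S \<in> branches" shows "\<exists>p. length p = n \<and> through (Sep S) p"
proof (induction n)
  case 0
  then show ?case using eqn[OF assms] by (auto simp: through_iff_not_unit irreducible_def)
next
  case (Suc n)
  then obtain p where p: "length p = n" "through (Sep S) p" by blast
  then obtain t where "\<not> is_unit (strict1 t (loc (Sep S) p))"
    using irreducible_loc[of "Sep S" p] assms unibranch by blast
  then show ?case using p
    by (intro exI[of _ "p @ [t]"]) (simp add: through_iff_not_unit loc_snoc)
qed

text \<open>Divisibility of local equations descends through each blow-up by
  \<open>assoc_strict1_imp\<close>, until it becomes divisibility of the equations at the
  origin.\<close>

lemma Sep_loc_inj:
  assumes "S \<in> branches" "S' \<in> branches" "through (Sep S) p" "loc (Sep S) p dvd loc (Sep S') p"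
  shows "S = S'"
proof -
  have ne: "x dvd y \<Longrightarrow> \<not> is_unit x \<Longrightarrow> \<not> is_unit y" for x y :: germ using dvd_unit_imp_unit by blast
  have "eqn S dvd eqn S'"
    using assms(3,4)
  proof (induction p rule: rev_induct)
    case (snoc t p)
    have th: "through (Sep S) p" "through (Sep S') p"
    proof -
      show "through (Sep S) p" using snoc.prems(1) through_snocD by blast
      have "through (Sep S') (p @ [t])" using snoc.prems ne unfolding through_iff_not_unit by blast
      then show "through (Sep S') p" using through_snocD by blast
    qed
    then have "irreducible (loc (Sep S) p)" "irreducible (loc (Sep S') p)"
      using irreducible_loc assms by auto
    then have "loc (Sep S) p dvd loc (Sep S') p"
      using assoc_strict1_imp[of "loc (Sep S) p" "loc (Sep S') p" t] snoc.prems
      by (simp add: loc_snoc through_iff_not_unit)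
    then show ?case using snoc.IH th by blast
  qed simp
  then have "curve (eqn S) = curve (eqn S')"
    using eqn[OF assms(1)] eqn[OF assms(2)] irreducible_dvd_irreducible curve_eq_iff by blast
  then show ?thesis using eqn[OF assms(1)] eqn[OF assms(2)] by simp
qed

text \<open>Traced back along the component, such a divisibility would persist down to the point
  where the line was created, and there a strict transform is not divisible by it.\<close>

lemma Exc_not_dvd_Sep:
  assumes "S \<in> branches" "through (Exc q) p"
  shows "\<not> loc (Exc q) p dvd loc (Sep S) p"
proof -
  obtain t k where p: "p = dpt q t k" using assms(2) by (auto simp: through_Exc_iff)
  show ?thesis unfolding p
  proof (induction k)
    case 0
    have "loc (Sep S) q \<noteq> 0" using loc_neq_0[of "Sep S"] assms by simp
    then show ?case
      using exc_line_not_dvd_strict1[of "loc (Sep S) q" t]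
      by (simp add: dpt_def loc_snoc)
  next
    case (Suc k)
    have sn: "dpt q t (Suc k) = dpt q t k @ [cont t]" by (simp add: dpt_def replicate_append_same)
    have ne: "q \<noteq> dpt q t k" by (simp add: dpt_def)
    show ?case
    proof
      assume *: "loc (Exc q) (dpt q t (Suc k)) dvd loc (Sep S) (dpt q t (Suc k))"
      then have "through (Sep S) (dpt q t (Suc k))"
        using dvd_unit_imp_unit irreducible_exc_line[of t]
        by (auto simp: through_iff_not_unit irreducible_def)
      then have "irreducible (loc (Sep S) (dpt q t k))"
        using irreducible_loc[of "Sep S"] assms(1) through_snocD unfolding sn by blast
      moreover have "strict1 (cont t) (exc_line t) dvd strict1 (cont t) (loc (Sep S) (dpt q t k))"
        using * loc_snoc[of "Sep S" "dpt q t k" "cont t"] by (simp add: strict1_cont sn[symmetric])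
      ultimately have "exc_line t dvd loc (Sep S) (dpt q t k)"
        using assoc_strict1_imp[of "exc_line t" _ "cont t"] irreducible_exc_line[of t] strict1_cont[of t]
        by (simp add: irreducible_def)
      then show False using Suc by simp
    qed
  qed
qed

lemma butlast_dpt: "butlast (dpt q t 0) = q" "butlast (dpt q t (Suc k)) = dpt q t k"
  by (simp_all add: dpt_def butlast_append flip: replicate_append_same)

lemma last_dpt: "last (dpt q t 0) = t" "last (dpt q t (Suc k)) = cont t"
  by (simp_all add: dpt_def flip: replicate_append_same)

lemma dpt_prefix_eq:
  assumes "prefix r (dpt q t k)" "strict_prefix q r"
  obtains j where "r = dpt q t j" "j \<le> k"
proof -
  obtain s w where "r = q @ s # w" using assms(2) by (auto elim: strict_prefixE')
  then have w: "r = q @ t # w" "prefix w (replicate k (cont t))"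
    using assms(1) by (auto simp: dpt_def)
  then obtain v where v: "replicate k (cont t) = w @ v" by (auto simp: prefix_def)
  have "length w \<le> k" using arg_cong[OF v, of length] by simp
  moreover have "w = take (length w) (replicate k (cont t))" using v by simp
  ultimately have "w = replicate (length w) (cont t)" by (simp add: min_def)
  then show ?thesis using that[of "length w"] w(1) \<open>length w \<le> k\<close> unfolding dpt_def by simp
qed

text \<open>On the path of the earlier component \<open>a\<close> all directions after the first are
  \<open>cont t\<close>. Leaving \<open>b\<close> in this direction and then following
  \<open>b\<close> once more would need \<open>cont (cont t)\<close>, so the point comes directly
  after \<open>b\<close>.\<close>

lemma two_comps:
  assumes "through (Exc a) p" "through (Exc b) p" "a \<noteq> b" "length a \<le> length b"
  shows "b = butlast p" "\<exists>t. last p = cont t \<and> loc (Exc a) p = exc_line t \<and> loc (Exc b) p = exc_line (cont t)"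
proof -
  obtain t k where p1: "p = dpt a t k" using assms(1) by (auto simp: through_Exc_iff)
  obtain s j where p2: "p = dpt b s j" using assms(2) by (auto simp: through_Exc_iff)
  note p = p1 p2
  have "prefix a b" using assms through_Exc_strict_prefix prefix_length_prefix
    by (metis strict_prefix_def)
  then have "strict_prefix a b" using assms by (simp add: strict_prefix_def)
  moreover have "prefix b (dpt a t k)" unfolding p(1)[symmetric] p(2) by (simp add: dpt_def)
  ultimately obtain i where b: "b = dpt a t i" "i \<le> k" using dpt_prefix_eq by blast
  have "replicate k (cont t) = replicate i (cont t) @ s # replicate j (cont s)"
    using p b by (simp add: dpt_def)
  then have st: "set (replicate i (cont t) @ s # replicate j (cont s)) \<subseteq> {cont t}"
    by (metis set_replicate_conv_if empty_subsetI order_refl)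
  then have s: "s = cont t" by simp
  have "j = 0"
  proof (rule ccontr)
    assume "j \<noteq> 0"
    then have "cont s \<in> {cont t}" using st by (auto simp: set_replicate_conv_if)
    then show False using s by simp
  qed
  then show "b = butlast p" using p(2) butlast_dpt by simp
  show "\<exists>t. last p = cont t \<and> loc (Exc a) p = exc_line t \<and> loc (Exc b) p = exc_line (cont t)"
    using p s \<open>j = 0\<close> loc_dpt last_dpt by metis
qed


section \<open>Sequences of blow-ups\<close>

text \<open>Up to the order of the blow-ups, a sequence is the prefix-closed set of its centres;
  \<open>pts\<close> then gives the exceptional divisor after all of them.\<close>

definition closed_pts :: "point set \<Rightarrow> bool" where
  "closed_pts A \<longleftrightarrow> (\<forall>x\<in>A. x \<noteq> [] \<longrightarrow> butlast x \<in> A)"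

definition pts :: "point set \<Rightarrow> point set" where
  "pts A = {p. p \<notin> A \<and> (p = [] \<or> butlast p \<in> A)}"

lemma points_eq: "points \<pi> j = pts (set (take j \<pi>))"
  by (auto simp: points_def pts_def)

lemma closed_ptsD: "closed_pts A \<Longrightarrow> x \<in> A \<Longrightarrow> prefix q x \<Longrightarrow> q \<in> A"
proof (induction x rule: rev_induct)
  case (snoc t x)
  then have "x \<in> A" by (force simp: closed_pts_def)
  then show ?case using snoc by (auto simp: prefix_snoc)
qed simp

lemma ptsD: "closed_pts A \<Longrightarrow> p \<in> pts A \<Longrightarrow> strict_prefix q p \<Longrightarrow> q \<in> A"
proof (cases p rule: rev_cases)
  case (snoc p' t)
  assume "closed_pts A" "p \<in> pts A" "strict_prefix q p"
  then show ?thesis using snoc closed_ptsD[of A p' q] by (auto simp: pts_def prefix_snoc strict_prefix_def)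
qed auto

lemma pts_antichain: "closed_pts A \<Longrightarrow> p \<in> pts A \<Longrightarrow> q \<in> pts A \<Longrightarrow> prefix q p \<Longrightarrow> q = p"
  using ptsD[of A p q] by (auto simp: strict_prefix_def pts_def)

lemma ex_prefix_pts:
  assumes "p \<notin> A"
  shows "\<exists>q. prefix q p \<and> q \<in> pts A"
  using assms
proof (induction p rule: rev_induct)
  case (snoc t p)
  show ?case
  proof (cases "p \<in> A")
    case True
    then show ?thesis using snoc.prems by (intro exI[of _ "p @ [t]"]) (auto simp: pts_def)
  next
    case False
    then show ?thesis using snoc.IH by (meson prefix_prefix)
  qed
qed (auto simp: pts_def)

lemma blowup_seq_snoc:
  "blowup_seq (\<pi> @ [q]) \<longleftrightarrow> (\<pi> = [] \<or> blowup_seq \<pi>) \<and> q \<in> pts (set \<pi>)"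
  unfolding blowup_seq_def points_eq by (auto simp: nth_append less_Suc_eq)

lemma blowup_seq_Nil [simp]: "\<not> blowup_seq []"
  by (simp add: blowup_seq_def)

lemma blowup_seq_single [simp]: "blowup_seq [q] \<longleftrightarrow> q = []"
  using blowup_seq_snoc[of "[]" q] by (auto simp: pts_def)

lemma blowup_seq_closed: "blowup_seq \<pi> \<Longrightarrow> closed_pts (set \<pi>) \<and> [] \<in> set \<pi> \<and> distinct \<pi>"
proof (induction \<pi> rule: rev_induct)
  case (snoc q \<pi>)
  then show ?case
    by (cases "\<pi> = []") (auto simp: blowup_seq_snoc closed_pts_def pts_def)
qed (simp add: blowup_seq_def)

lemma blowup_seq_take: "blowup_seq \<pi> \<Longrightarrow> 0 < j \<Longrightarrow> blowup_seq (take j \<pi>)"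
  unfolding blowup_seq_def points_eq by (auto simp: min_def)

lemma blowup_seq_filter:
  assumes "blowup_seq \<pi>" "closed_pts A" "[] \<in> A"
  shows "blowup_seq (filter (\<lambda>x. x \<in> A) \<pi>)"
  using assms(1)
proof (induction \<pi> rule: rev_induct)
  case (snoc q \<pi>)
  show ?case
  proof (cases "\<pi> = []")
    case True
    then show ?thesis using snoc.prems assms(3) by auto
  next
    case False
    then have b: "blowup_seq \<pi>" "q \<in> pts (set \<pi>)" using snoc.prems by (auto simp: blowup_seq_snoc)
    then have "blowup_seq (filter (\<lambda>x. x \<in> A) \<pi>)" using snoc.IH by blast
    then show ?thesis using b assms(2) by (auto simp: blowup_seq_snoc pts_def closed_pts_def)
  qed
qed (simp add: blowup_seq_def)

text \<open>The centres inside a prefix-closed set may be moved in front of all others; this is the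
  factorization in \<open>factors_filter\<close>.\<close>

lemma blowup_seq_filter_append:
  assumes "blowup_seq \<pi>" "closed_pts A" "[] \<in> A"
  shows "blowup_seq (filter (\<lambda>x. x \<in> A) \<pi> @ filter (\<lambda>x. x \<notin> A) \<pi>)"
proof -
  have "blowup_seq (filter (\<lambda>x. x \<in> A) \<pi> @ filter (\<lambda>x. x \<notin> A) (take j \<pi>))" if "j \<le> length \<pi>" for j
    using that
  proof (induction j)
    case 0
    then show ?case using blowup_seq_filter[OF assms] by simp
  next
    case (Suc j)
    let ?L = "filter (\<lambda>x. x \<in> A) \<pi> @ filter (\<lambda>x. x \<notin> A) (take j \<pi>)"
    have q: "\<pi> ! j \<in> pts (set (take j \<pi>))"
      using assms(1) Suc.prems by (simp add: blowup_seq_def points_eq)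
    show ?case
    proof (cases "\<pi> ! j \<in> A")
      case False
      have "\<pi> ! j \<in> pts (set ?L)"
        using q False assms(3) in_set_takeD[of _ j \<pi>] by (auto simp: pts_def)
      then show ?thesis using Suc False
        by (simp add: take_Suc_conv_app_nth blowup_seq_snoc flip: append_assoc)
    qed (use Suc in \<open>simp add: take_Suc_conv_app_nth\<close>)
  qed
  from this[of "length \<pi>"] show ?thesis by simp
qed

lemma factors_filter:
  assumes "blowup_seq \<pi>" "closed_pts A" "[] \<in> A"
  shows "factors \<pi> (filter (\<lambda>x. x \<in> A) \<pi>)"
  unfolding factors_def iso_over_def
  using blowup_seq_filter_append[OF assms] by (intro exI[of _ "filter (\<lambda>x. x \<notin> A) \<pi>"]) auto

lemma factorsD: "factors \<pi> \<pi>' \<Longrightarrow> set \<pi>' \<subseteq> set \<pi>"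
  by (auto simp: factors_def iso_over_def)

section \<open>Points of a component\<close>

lemma dpt_inj: "dpt q t k = dpt q s j \<Longrightarrow> t = s \<and> k = j"
  by (auto simp: dpt_def dest: arg_cong[of _ _ length])

lemma prefix_dpt: "j \<le> k \<Longrightarrow> prefix (dpt q t j) (dpt q t k)"
  by (auto simp: dpt_def prefix_def intro!: exI[of _ "replicate (k - j) (cont t)"] simp flip: replicate_add)

text \<open>The number of successive centres on the component of \<open>q\<close> over the direction
  \<open>t\<close>; \<open>endpt\<close> is the point of the component left there after all blow-ups
  in \<open>A\<close>.\<close>

definition endk :: "point set \<Rightarrow> point \<Rightarrow> direction \<Rightarrow> nat" where
  "endk A q t = (LEAST k. dpt q t k \<notin> A)"

definition endpt :: "point set \<Rightarrow> point \<Rightarrow> direction \<Rightarrow> point" where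
  "endpt A q t = dpt q t (endk A q t)"

lemma inj_dpt: "inj (dpt q t)"
  by (auto intro!: injI dest: dpt_inj)

lemma endpt:
  assumes "finite A" "closed_pts A" "q \<in> A"
  shows "dpt q t k \<in> A \<longleftrightarrow> k < endk A q t" "endpt A q t \<in> pts A"
proof -
  have "\<exists>k. dpt q t k \<notin> A"
    using assms(1) finite_imageD[of "dpt q t" UNIV] inj_dpt finite_subset[of "range (dpt q t)" A]
    by (metis image_subsetI infinite_UNIV_nat inj_dpt)
  from LeastI_ex[OF this] have n: "dpt q t (endk A q t) \<notin> A" by (simp add: endk_def)
  show *: "dpt q t k \<in> A \<longleftrightarrow> k < endk A q t" for k
  proof
    assume "dpt q t k \<in> A"
    then show "k < endk A q t"
      using n closed_ptsD[OF assms(2) _ prefix_dpt, of q t k "endk A q t"] by (meson not_le)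
  next
    assume "k < endk A q t"
    then show "dpt q t k \<in> A" unfolding endk_def using not_less_Least by blast
  qed
  show "endpt A q t \<in> pts A"
    using n * assms(3) butlast_dpt by (cases "endk A q t") (auto simp: pts_def endpt_def)
qed

lemma through_Exc_pts_iff:
  assumes "finite A" "closed_pts A"
  shows "p \<in> pts A \<and> through (Exc q) p \<longleftrightarrow> q \<in> A \<and> (\<exists>t. p = endpt A q t)"
proof
  assume *: "p \<in> pts A \<and> through (Exc q) p"
  then have q: "q \<in> A" using ptsD assms through_Exc_strict_prefix by blast
  obtain t k where p: "p = dpt q t k" using * by (auto simp: through_Exc_iff)
  have e: "endpt A q t \<in> pts A" using endpt assms q by blast
  have "prefix p (endpt A q t) \<or> prefix (endpt A q t) p"
    unfolding p endpt_def using prefix_dpt by (meson linear)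
  then have "p = endpt A q t" using pts_antichain[OF assms(2)] * e by blast
  then show "q \<in> A \<and> (\<exists>t. p = endpt A q t)" using q by blast
next
  assume "q \<in> A \<and> (\<exists>t. p = endpt A q t)"
  then show "p \<in> pts A \<and> through (Exc q) p"
    using endpt(2)[OF assms] by (auto simp: endpt_def through_Exc_iff)
qed

lemma endpt_inj: "endpt A q t = endpt A q s \<Longrightarrow> t = s"
  by (auto simp: endpt_def dest: dpt_inj)

text \<open>By \<open>two_comps\<close> the later component is the predecessor of the common point,
  and its position on the earlier one fixes the last direction.\<close>

lemma comps_unique_pt:
  assumes "closed_pts A" "u \<noteq> v" "p \<in> pts A" "p' \<in> pts A"
    and "through (Exc u) p" "through (Exc v) p" "through (Exc u) p'" "through (Exc v) p'"
  shows "p = p'"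
proof -
  have aux: "p = p'" if th: "length u \<le> length v" "u \<noteq> v" "through (Exc u) p" "through (Exc v) p"
      "through (Exc u) p'" "through (Exc v) p'" for u v
  proof -
    have "v = butlast p" "v = butlast p'" using two_comps(1)[of u _ v] that by auto
    moreover have "p \<noteq> []" "p' \<noteq> []" using that(3,5)[THEN through_Exc_strict_prefix] by auto
    moreover have "last p = last p'"
    proof -
      obtain t k where p: "p = dpt u t k" using th(3) by (auto simp: through_Exc_iff)
      obtain s j where p': "p' = dpt u s j" using th(5) by (auto simp: through_Exc_iff)
      have "k \<noteq> 0" "j \<noteq> 0" using p p' \<open>v = butlast p\<close> \<open>v = butlast p'\<close> \<open>u \<noteq> v\<close> butlast_dpt by (metis)+
      then obtain k' j' where kj: "k = Suc k'" "j = Suc j'" by (meson not0_implies_Suc)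
      then have "dpt u t k' = dpt u s j'" using p p' \<open>v = butlast p\<close> \<open>v = butlast p'\<close> butlast_dpt by metis
      then have "t = s" using dpt_inj by blast
      then show ?thesis using p p' kj last_dpt by simp
    qed
    ultimately show "p = p'" by (metis append_butlast_last_id)
  qed
  show ?thesis using aux[of u v] aux[of v u] assms by (cases "length u \<le> length v") auto
qed

lemma at_most_two_comps:
  assumes "through (Exc a) p" "through (Exc b) p" "through (Exc c) p"
  shows "a = b \<or> b = c \<or> a = c"
proof (rule ccontr)
  assume *: "\<not> ?thesis"
  have "butlast p \<in> {x, y}" if "through (Exc x) p" "through (Exc y) p" "x \<noteq> y" for x y
    using two_comps(1)[OF that] two_comps(1)[OF that(2,1)] that(3) by (metis insertCI linear)
  then have "butlast p \<in> {a, b}" "butlast p \<in> {b, c}" "butlast p \<in> {a, c}" using assms * by blast+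
  then show False using * by auto
qed

section \<open>Solving ratio equations on the dual graph\<close>

definition meet :: "point set \<Rightarrow> point \<Rightarrow> point \<Rightarrow> bool" where
  "meet A u v \<longleftrightarrow> u \<noteq> v \<and> (\<exists>p\<in>pts A. through (Exc u) p \<and> through (Exc v) p)"

lemma meet_sym: "meet A u v \<longleftrightarrow> meet A v u"
  by (auto simp: meet_def)

text \<open>The dual graph is a tree: blowing up a trace point adds a leaf, blowing up a corner subdivides
  an edge.\<close>

lemma dual_graph_ratios:
  fixes \<kappa> :: "point \<Rightarrow> point \<Rightarrow> complex"
  assumes "\<pi> = [] \<or> blowup_seq \<pi>"
    and "\<And>u v. meet (set \<pi>) u v \<Longrightarrow> \<kappa> u v * \<kappa> v u = 1"
  shows "\<exists>\<mu>. (\<forall>u. \<mu> u \<noteq> 0) \<and> (\<forall>u v. meet (set \<pi>) u v \<longrightarrow> \<mu> v = \<kappa> u v * \<mu> u)"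
  using assms
proof (induction \<pi> arbitrary: \<kappa> rule: rev_induct)
  case Nil
  have "\<not> meet {} u v" for u v
    by (auto simp: meet_def pts_def dest!: through_Exc_strict_prefix)
  then show ?case by (intro exI[of _ "\<lambda>_. 1"]) simp
next
  case (snoc q \<pi>)
  let ?A = "set \<pi>" let ?B = "set (\<pi> @ [q])"
  have b: "\<pi> = [] \<or> blowup_seq \<pi>" "q \<in> pts ?A" using snoc.prems(1) by (auto simp: blowup_seq_snoc)
  have cA: "closed_pts ?A" using b(1) blowup_seq_closed by (auto simp: closed_pts_def)
  have cB: "closed_pts ?B" using snoc.prems(1) blowup_seq_closed by blast
  have qA: "q \<notin> ?A" using b(2) by (simp add: pts_def)
  have ptsB: "p \<in> pts ?A \<and> p \<noteq> q \<or> (\<exists>t. p = q @ [t])" if "p \<in> pts ?B" for p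
    using that by (cases p rule: rev_cases) (auto simp: pts_def)
  have qt: "q @ [t] \<in> pts ?B" for t
    using qA closed_ptsD[OF cA, of "q @ [t]" q] by (auto simp: pts_def)
  have meetB: "meet ?B u v \<longleftrightarrow> meet ?A u v \<and> \<not> (through (Exc u) q \<and> through (Exc v) q)"
    if "u \<noteq> q" "v \<noteq> q" for u v
  proof
    assume "meet ?B u v"
    then obtain p where p: "u \<noteq> v" "p \<in> pts ?B" "through (Exc u) p" "through (Exc v) p"
      by (auto simp: meet_def)
    have "\<not> (\<exists>t. p = q @ [t])" using at_most_two_comps[of u p v q] p that by auto
    then have pA: "p \<in> pts ?A" "p \<noteq> q" using ptsB[OF p(2)] by auto
    then show "meet ?A u v \<and> \<not> (through (Exc u) q \<and> through (Exc v) q)"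
      using p comps_unique_pt[OF cA p(1) pA(1) b(2)] by (auto simp: meet_def)
  next
    assume *: "meet ?A u v \<and> \<not> (through (Exc u) q \<and> through (Exc v) q)"
    then obtain p where p: "u \<noteq> v" "p \<in> pts ?A" "through (Exc u) p" "through (Exc v) p"
      by (auto simp: meet_def)
    then have "p \<noteq> q" using * by blast
    then have "p \<in> pts ?B" using p(2) by (auto simp: pts_def)
    then show "meet ?B u v" using p by (auto simp: meet_def)
  qed
  have meetq: "through (Exc u) q \<and> u \<noteq> q \<longleftrightarrow> meet ?B u q" for u
  proof
    assume *: "through (Exc u) q \<and> u \<noteq> q"
    then obtain t k where "q = dpt u t k" by (auto simp: through_Exc_iff)
    then have "q @ [cont t] = dpt u t (Suc k)" by (simp add: dpt_def replicate_append_same)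
    then have "through (Exc u) (q @ [cont t])" by (auto simp: through_Exc_iff)
    then show "meet ?B u q" using * qt by (auto simp: meet_def)
  next
    assume "meet ?B u q"
    then obtain p where p: "u \<noteq> q" "p \<in> pts ?B" "through (Exc u) p" "through (Exc q) p"
      by (auto simp: meet_def)
    have "\<not> p \<in> pts ?A" using ptsD[OF cA _ through_Exc_strict_prefix[OF p(4)]] qA by blast
    then obtain t where "p = q @ [t]" using ptsB[OF p(2)] by auto
    then show "through (Exc u) q \<and> u \<noteq> q" using p through_snocD by blast
  qed
  \<comment> \<open>If \<open>q\<close> is a corner of \<open>u\<close> and \<open>v\<close>, the
    new vertex subdivides their edge. Before the blow-up this edge must therefore carry the product
    of the two new ratios.\<close>
  define \<kappa>' where "\<kappa>' = (\<lambda>u v. if through (Exc u) q \<and> through (Exc v) q then \<kappa> u q * \<kappa> q v else \<kappa> u v)"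
  have mA: "u \<noteq> q \<and> v \<noteq> q" if "meet ?A u v" for u v
    using that qA ptsD[OF cA] through_Exc_strict_prefix by (auto simp: meet_def)
  have "\<kappa>' u v * \<kappa>' v u = 1" if m: "meet ?A u v" for u v
  proof (cases "through (Exc u) q \<and> through (Exc v) q")
    case True
    then have "\<kappa> u q * \<kappa> q u = 1" "\<kappa> v q * \<kappa> q v = 1"
      using meetq mA[OF m] snoc.prems(2) by auto
    then have "(\<kappa> u q * \<kappa> q u) * (\<kappa> v q * \<kappa> q v) = 1" by simp
    then show ?thesis using True by (simp add: \<kappa>'_def mult_ac)
  next
    case False
    then show ?thesis using m mA[OF m] meetB[of u v] snoc.prems(2)[of u v] by (auto simp: \<kappa>'_def)
  qed
  then obtain \<mu> where \<mu>: "\<And>u. \<mu> u \<noteq> 0" "\<And>u v. meet ?A u v \<Longrightarrow> \<mu> v = \<kappa>' u v * \<mu> u"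
    using snoc.IH[OF b(1), of \<kappa>'] by blast
  \<comment> \<open>The value at the new vertex. At a corner both neighbours give the same value
    because of the product in \<open>\<kappa>'\<close>; the default \<open>1\<close> is for the
    blow-up of the origin.\<close>
  define m where "m = (if \<exists>u. through (Exc u) q then let u = (SOME u. through (Exc u) q) in \<kappa> u q * \<mu> u else 1)"
  have kq: "\<kappa> u q \<noteq> 0 \<and> \<kappa> q u \<noteq> 0 \<and> \<kappa> u q * \<kappa> q u = 1" if "through (Exc u) q" for u
  proof -
    have "u \<noteq> q" using through_Exc_strict_prefix[OF that] by auto
    then have "\<kappa> u q * \<kappa> q u = 1" using meetq that snoc.prems(2) by blast
    then show ?thesis by auto
  qed
  have m: "m = \<kappa> u q * \<mu> u" if u: "through (Exc u) q" for u
  proof -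
    define w where "w = (SOME u. through (Exc u) q)"
    have w: "through (Exc w) q" unfolding w_def using u by (rule someI)
    have mw: "m = \<kappa> w q * \<mu> w" using u by (auto simp: m_def w_def Let_def)
    show ?thesis
    proof (cases "u = w")
      case False
      have "meet ?A w u" using False w u b(2) by (auto simp: meet_def)
      then have "\<mu> u = \<kappa> w q * \<kappa> q u * \<mu> w" using \<mu>(2) w u by (simp add: \<kappa>'_def)
      then have "\<kappa> u q * \<mu> u = (\<kappa> u q * \<kappa> q u) * (\<kappa> w q * \<mu> w)" by (simp add: mult_ac)
      then show ?thesis using kq[OF u] mw by simp
    qed (use mw in simp)
  qed
  have m0: "m \<noteq> 0"
  proof (cases "\<exists>u. through (Exc u) q")
    case True
    then obtain u where "through (Exc u) q" by blast
    then show ?thesis using m kq \<mu>(1) by simp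
  qed (simp add: m_def)
  show ?case
  proof (intro exI[of _ "\<mu>(q := m)"] conjI allI impI)
    show "(\<mu>(q := m)) u \<noteq> 0" for u using \<mu>(1) m0 by simp
    fix u v assume uv: "meet ?B u v"
    consider "u = q" "v \<noteq> q" | "v = q" "u \<noteq> q" | "u \<noteq> q" "v \<noteq> q" using uv by (auto simp: meet_def)
    then show "(\<mu>(q := m)) v = \<kappa> u v * (\<mu>(q := m)) u"
    proof cases
      case 1
      then have "through (Exc v) q" using meetq uv meet_sym by blast
      then have "\<kappa> q v * m = (\<kappa> v q * \<kappa> q v) * \<mu> v" using m by simp
      then show ?thesis using kq[OF \<open>through (Exc v) q\<close>] 1 by simp
    next
      case 2
      then have "through (Exc u) q" using meetq uv by blast
      then show ?thesis using m 2 by simp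
    next
      case 3
      then show ?thesis using \<mu>(2) meetB uv by (auto simp: \<kappa>'_def)
    qed
  qed
qed

section \<open>Forms and foliations\<close>

lemma hol_hom: "hol (f + g) = hol f + hol g" "hol (f - g) = hol f - hol g" "hol (- f) = - hol f"
  "hol (f * g) = hol f * hol g" "hol 0 = 0" "hol 1 = 1"
  by (simp_all add: Zero_fract_def One_fract_def)

declare add_fract [simp del] minus_fract [simp del] diff_fract [simp del] mult_fract [simp del]
  inverse_fract [simp del] divide_fract [simp del]

lemma hol_eq_iff [simp]: "hol f = hol g \<longleftrightarrow> f = g"
  by (simp add: eq_fract)

lemma hol_eq_0_iff [simp]: "hol f = 0 \<longleftrightarrow> f = 0"
  using hol_eq_iff[of f 0] by (simp only: hol_hom)

lemma hol_sum: "hol (sum f A) = (\<Sum>a\<in>A. hol (f a))"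
  by (induction A rule: infinite_finite_induct) (simp_all add: hol_hom)

lemma Fract_conv: "Fract a b = hol a / hol b"
  by (simp add: divide_fract)

lemma fract_cases_hol:
  obtains a b where "z = hol a / hol b" "b \<noteq> 0"
proof -
  obtain a b where "z = Fract a b" "b \<noteq> 0" by (cases z)
  then show ?thesis using that[of a b] Fract_conv[of a b] by simp
qed

lemma blow_fract_div: "b \<noteq> 0 \<Longrightarrow> blow_fract t (hol a / hol b) = hol (blow t a) / hol (blow t b)"
  by (simp add: blow_fract_Fract divide_fract)

lemma blow_fract_hol [simp]: "blow_fract t (hol a) = hol (blow t a)"
  using blow_fract_Fract[of 1 t a] by simp

lemma blow_fract_hom:
  "blow_fract t (x + y) = blow_fract t x + blow_fract t y"
  "blow_fract t (x * y) = blow_fract t x * blow_fract t y"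
proof -
  obtain a b where x: "x = hol a / hol b" "b \<noteq> 0" by (rule fract_cases_hol)
  obtain c d where y: "y = hol c / hol d" "d \<noteq> 0" by (rule fract_cases_hol)
  have nz: "blow t b \<noteq> 0" "blow t d \<noteq> 0" using x y by (auto simp: blow_eq_0_iff)
  have 1: "x + y = hol (a * d + c * b) / hol (b * d)" "x * y = hol (a * c) / hol (b * d)"
    using x y unfolding hol_hom by (simp_all add: add_frac_eq)
  show "blow_fract t (x + y) = blow_fract t x + blow_fract t y"
    unfolding 1 unfolding x y using x(2) y(2) nz
    by (simp add: blow_fract_div blow_add blow_mult) (simp add: hol_hom add_frac_eq)
  show "blow_fract t (x * y) = blow_fract t x * blow_fract t y"
    unfolding 1 unfolding x y using x(2) y(2) nz
    by (simp add: blow_fract_div blow_mult) (simp add: hol_hom)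
qed

lemma blow_fract_eq_0_iff: "blow_fract t x = 0 \<longleftrightarrow> x = 0"
proof -
  obtain a b where x: "x = hol a / hol b" "b \<noteq> 0" by (rule fract_cases_hol)
  then show ?thesis by (simp add: blow_fract_div blow_eq_0_iff)
qed

lemma blow_fract_0 [simp]: "blow_fract t 0 = 0"
  by (simp add: blow_fract_eq_0_iff)

fun dl :: "(germ \<Rightarrow> germ) \<Rightarrow> germ \<Rightarrow> germ fract" where
  "dl D f = hol (D f) / hol f"

declare dl.simps [simp del]

lemma dl_mult:
  assumes "f \<noteq> 0" "g \<noteq> 0"
  shows "dl dx (f * g) = dl dx f + dl dx g" "dl dy (f * g) = dl dy f + dl dy g"
  using assms by (simp_all add: dl.simps dx_mult dy_mult hol_hom add_divide_distrib)

lemma dl_power: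
  assumes "f \<noteq> 0"
  shows "dl dx (f ^ n) = of_nat n * dl dx f" "dl dy (f ^ n) = of_nat n * dl dy f"
  using assms
proof (induction n)
  case 0
  { case 1 then show ?case by (simp add: dl.simps hol_hom) next
    case 2 then show ?case by (simp add: dl.simps hol_hom) }
next
  case (Suc n)
  { case 1 then show ?case using Suc assms by (simp add: dl_mult distrib_right) next
    case 2 then show ?case using Suc assms by (simp add: dl_mult distrib_right) }
qed

lemma blow_form_dl:
  assumes "f \<noteq> 0"
  shows "blow_form t (dl dx f, dl dy f) = (dl dx (blow t f), dl dy (blow t f))"
proof -
  have "blow t f \<noteq> 0" using assms by (simp add: blow_eq_0_iff)
  then show ?thesis using assms
    by (cases t) (auto simp: dl.simps blow_fract_div dx_blow_slope dy_blow_slope dx_blow_vertical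
        dy_blow_vertical hol_hom add_divide_distrib)
qed

lemma blow_form_add: "blow_form t (a + c, b + d) =
    (fst (blow_form t (a, b)) + fst (blow_form t (c, d)), snd (blow_form t (a, b)) + snd (blow_form t (c, d)))"
  by (cases t) (auto simp: blow_fract_hom algebra_simps)

lemma blow_form_0: "blow_form t (0, 0) = (0, 0)"
  by (cases t) (auto simp: blow_fract_eq_0_iff)

lemma blow_form_const: "blow_form t (hol (const c) * a, hol (const c) * b) =
    (hol (const c) * fst (blow_form t (a, b)), hol (const c) * snd (blow_form t (a, b)))"
  by (cases t) (use blow_const[of t c] in \<open>auto simp: blow_fract_hom algebra_simps\<close>)

lemma blow_form_sum: "blow_form t (\<Sum>c\<in>C. hol (const (L c)) * a c, \<Sum>c\<in>C. hol (const (L c)) * b c) =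
   (\<Sum>c\<in>C. hol (const (L c)) * fst (blow_form t (a c, b c)), \<Sum>c\<in>C. hol (const (L c)) * snd (blow_form t (a c, b c)))"
  by (induction C rule: infinite_finite_induct)
    (auto simp: blow_form_0 blow_form_add blow_form_const)

lemma blow_form_eq_0_iff: "blow_form t \<eta> = (0, 0) \<longleftrightarrow> \<eta> = (0, 0)"
  by (cases \<eta>; cases t) (auto simp: blow_fract_eq_0_iff)

lemma transform_Nil [simp]: "transform \<eta> [] = \<eta>"
  and transform_snoc: "transform \<eta> (p @ [t]) = blow_form t (transform \<eta> p)"
  by (simp_all add: transform_def)

lemma transform_neq_0: "\<eta> \<noteq> (0, 0) \<Longrightarrow> transform \<eta> p \<noteq> (0, 0)"
  by (induction p rule: rev_induct) (auto simp: transform_snoc blow_form_eq_0_iff)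

text \<open>Coprimality is dropped, so that pull-backs and numerators can represent the foliation
  directly; \<open>fol_factor\<close> recovers the coprime pair up to a common factor.\<close>

definition proportional :: "form \<Rightarrow> germ \<times> germ \<Rightarrow> bool" where
  "proportional \<eta> \<omega> \<longleftrightarrow> \<omega> \<noteq> (0, 0) \<and> hol (fst \<omega>) * snd \<eta> = hol (snd \<omega>) * fst \<eta>"

lemma ex_proportional:
  assumes "\<eta> \<noteq> (0, 0)" shows "\<exists>\<omega>. proportional \<eta> \<omega>"
proof -
  obtain a b where x: "fst \<eta> = hol a / hol b" "b \<noteq> 0" by (rule fract_cases_hol)
  obtain c d where y: "snd \<eta> = hol c / hol d" "d \<noteq> 0" by (rule fract_cases_hol)
  have "(a * d, c * b) \<noteq> (0, 0)" using assms x y by (cases \<eta>) (auto simp: hol_hom)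
  then have "proportional \<eta> (a * d, c * b)" using x y by (simp add: proportional_def hol_hom)
  then show ?thesis by blast
qed

lemma fol_coprime_proportional:
  assumes "\<eta> \<noteq> (0, 0)"
  shows "coprime (fst (foliation_at \<eta> p)) (snd (foliation_at \<eta> p))"
    "proportional (transform \<eta> p) (foliation_at \<eta> p)"
proof -
  have nz: "transform \<eta> p \<noteq> (0, 0)" using transform_neq_0 assms by blast
  obtain a b where ab: "proportional (transform \<eta> p) (a, b)" using ex_proportional[OF nz] by auto
  then have "(a, b) \<noteq> (0, 0)" by (simp add: proportional_def)
  then obtain g \<alpha> \<beta> where g: "a = g * \<alpha>" "b = g * \<beta>" "coprime \<alpha> \<beta>" "g \<noteq> 0" by (rule coprime_rep)
  then have "defines_foliation (transform \<eta> p) (\<alpha>, \<beta>)"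
    using ab nz by (auto simp: proportional_def defines_foliation_def hol_hom)
  then have "defines_foliation (transform \<eta> p) (foliation_at \<eta> p)"
    unfolding foliation_at_def by (rule someI)
  then show "coprime (fst (foliation_at \<eta> p)) (snd (foliation_at \<eta> p))"
      "proportional (transform \<eta> p) (foliation_at \<eta> p)"
    by (auto simp: defines_foliation_def proportional_def)
qed

lemma fol_factor:
  assumes "\<eta> \<noteq> (0, 0)" "proportional (transform \<eta> p) (A, B)"
  obtains g where "g \<noteq> 0" "A = g * fst (foliation_at \<eta> p)" "B = g * snd (foliation_at \<eta> p)"
proof -
  obtain \<alpha> \<beta> where f: "foliation_at \<eta> p = (\<alpha>, \<beta>)" by (cases "foliation_at \<eta> p")
  have cp: "coprime \<alpha> \<beta>" "proportional (transform \<eta> p) (\<alpha>, \<beta>)" using fol_coprime_proportional[OF assms(1), of p] f by auto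
  obtain u v where uv: "transform \<eta> p = (u, v)" "(u, v) \<noteq> (0, 0)"
    using transform_neq_0[OF assms(1), of p] by (cases "transform \<eta> p") auto
  have e: "hol A * v = hol B * u" "hol \<alpha> * v = hol \<beta> * u" using assms(2) cp(2) uv by (auto simp: proportional_def)
  have "hol A * (hol \<beta> * u) = hol \<alpha> * (hol B * u)"
    unfolding e[symmetric] by (simp only: mult.left_commute)
  moreover have "hol \<beta> * (hol A * v) = hol B * (hol \<alpha> * v)"
    unfolding e by (simp only: mult.left_commute)
  ultimately have "hol A * hol \<beta> * u = hol \<alpha> * hol B * u" "hol A * hol \<beta> * v = hol \<alpha> * hol B * v"
    by (simp_all only: mult_ac)
  then have "hol (A * \<beta>) = hol (\<alpha> * B)" using uv(2) by (auto simp: hol_hom)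
  then have AB: "A * \<beta> = \<alpha> * B" by simp
  have "\<exists>g. A = g * \<alpha> \<and> B = g * \<beta>"
  proof (cases "\<alpha> = 0")
    case True
    then have "is_unit \<beta>" using cp by simp
    then obtain k where "1 = \<beta> * k" by (auto simp: dvd_def)
    then have "B = (B * k) * \<beta>" by (simp add: mult_ac)
    moreover have "A = 0" using AB True \<open>is_unit \<beta>\<close> by auto
    ultimately show ?thesis using True by (intro exI[of _ "B * k"]) simp
  next
    case False
    have "\<alpha> dvd \<beta> * A" using AB by (metis dvd_triv_left mult.commute)
    then have "\<alpha> dvd A" using coprime_dvd_mult_germ[OF cp(1)] False by blast
    then obtain g where g: "A = g * \<alpha>" by (auto simp: dvd_def mult.commute)
    then have "\<alpha> * (g * \<beta>) = \<alpha> * B" using AB by (simp add: mult_ac)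
    then show ?thesis using False g by auto
  qed
  then show ?thesis using that assms(2) f by (auto simp: proportional_def)
qed

fun blow_pair :: "direction \<Rightarrow> germ \<times> germ \<Rightarrow> germ \<times> germ" where
  "blow_pair (Slope t) (a, b) = (blow_slope t a + (Y + const t) * blow_slope t b, X * blow_slope t b)"
| "blow_pair Vertical (a, b) = (Y * blow_vertical a, X * blow_vertical a + blow_vertical b)"

lemma proportional_blow:
  assumes "proportional \<eta> \<omega>" shows "proportional (blow_form t \<eta>) (blow_pair t \<omega>)"
proof -
  obtain a b where o: "\<omega> = (a, b)" by (cases \<omega>)
  obtain u v where e: "\<eta> = (u, v)" by (cases \<eta>)
  have "hol a * v = hol b * u" "(a, b) \<noteq> (0, 0)" using assms o e by (auto simp: proportional_def)
  then have "blow_fract t (hol a * v) = blow_fract t (hol b * u)" "(a, b) \<noteq> (0, 0)" by auto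
  then have h: "hol (blow t a) * blow_fract t v = hol (blow t b) * blow_fract t u" "a \<noteq> 0 \<or> b \<noteq> 0"
    by (auto simp: blow_fract_hom)
  show ?thesis
  proof (cases t)
    case (Slope s)
    have nz: "blow_pair t \<omega> \<noteq> (0, 0)"
      using h(2) blow_eq_0_iff[of "Slope s" a] blow_eq_0_iff[of "Slope s" b] by (auto simp: Slope o)
    let ?y = "hol (Y + const s)"
    have "(hol (blow t a) + ?y * hol (blow t b)) * (hol X * blow_fract t v) =
        hol X * (hol (blow t a) * blow_fract t v) + hol X * ?y * hol (blow t b) * blow_fract t v"
      by (simp add: algebra_simps)
    also have "\<dots> = (hol X * hol (blow t b)) * (blow_fract t u + ?y * blow_fract t v)"
      unfolding h(1) by (simp add: algebra_simps)
    finally show ?thesis using nz by (simp add: proportional_def o e Slope hol_hom)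
  next
    case Vertical
    have nz: "blow_pair t \<omega> \<noteq> (0, 0)"
      using h(2) blow_eq_0_iff[of Vertical a] blow_eq_0_iff[of Vertical b] by (auto simp: Vertical o)
    have "(hol Y * hol (blow t a)) * (hol X * blow_fract t u + blow_fract t v) =
        hol X * hol Y * hol (blow t a) * blow_fract t u + hol Y * (hol (blow t a) * blow_fract t v)"
      by (simp add: algebra_simps)
    also have "\<dots> = (hol X * hol (blow t a) + hol (blow t b)) * (hol Y * blow_fract t u)"
      unfolding h(1) by (simp add: algebra_simps)
    finally show ?thesis using nz by (simp add: proportional_def o e Vertical hol_hom)
  qed
qed

lemma wedge_mult_right: "wedge \<omega> (f * g) = f * wedge \<omega> g + g * wedge \<omega> f"
  by (simp add: wedge_def dx_mult dy_mult algebra_simps)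

lemma wedge_scale: "wedge (g * a, g * b) f = g * wedge (a, b) f"
  by (simp add: wedge_def algebra_simps)

text \<open>The extra factor is the Jacobian determinant of the chart.\<close>

lemma wedge_blow: "wedge (blow_pair t \<omega>) (blow t f) = exc_line t * blow t (wedge \<omega> f)"
proof (cases \<omega>)
  case (Pair a b)
  have v: "blow_vertical (u - w) = blow_vertical u - blow_vertical w"
      "blow_vertical (u * w) = blow_vertical u * blow_vertical w" for u w
    using blow_minus[of Vertical] blow_mult[of Vertical] by auto
  show ?thesis using Pair
    by (cases t) (simp_all add: wedge_def dx_blow_slope dy_blow_slope dx_blow_vertical dy_blow_vertical
        blow_slope_hom v algebra_simps)
qed

lemma wedge_blow_exc_line: "exc_line t dvd wedge (blow_pair t \<omega>) (exc_line t)"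
  by (cases \<omega>; cases t) (auto simp: wedge_def)

lemma wedge_power_dvd: "e dvd wedge \<omega> e \<Longrightarrow> e ^ n dvd wedge \<omega> (e ^ n)"
proof (induction n)
  case (Suc n)
  have "e ^ Suc n dvd e * wedge \<omega> (e ^ n)" "e ^ Suc n dvd e ^ n * wedge \<omega> e"
    using Suc by (auto simp: mult_dvd_mono mult.commute)
  then show ?case by (simp only: power_Suc wedge_mult_right dvd_add)
qed simp

text \<open>The full pull-back of \<open>f\<close> is invariant by \<open>wedge_blow\<close>, and so
  are the powers of the exceptional line; the product rule then leaves the strict transform.\<close>

lemma dvd_wedge_strict1:
  assumes "f \<noteq> 0" "f dvd wedge \<omega> f"
  shows "strict1 t f dvd wedge (blow_pair t \<omega>) (strict1 t f)"
proof -
  let ?e = "exc_line t" let ?n = "ord f" let ?\<omega> = "blow_pair t \<omega>"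
  have "blow t f dvd blow t (wedge \<omega> f)" using assms(2) by (auto simp: dvd_def blow_mult)
  then have "?e ^ ?n * strict1 t f dvd wedge ?\<omega> (?e ^ ?n * strict1 t f)"
    unfolding wedge_blow[of t \<omega> f, symmetric, unfolded blow_eq[of t f]] using blow_eq[of t f]
    by (metis dvd_mult wedge_blow)
  moreover have "?e ^ ?n * strict1 t f dvd strict1 t f * wedge ?\<omega> (?e ^ ?n)"
    using wedge_power_dvd[OF wedge_blow_exc_line] by (simp add: mult.commute mult_dvd_mono)
  ultimately have "?e ^ ?n * strict1 t f dvd ?e ^ ?n * wedge ?\<omega> (strict1 t f)"
    unfolding wedge_mult_right by (simp add: dvd_add_left_iff)
  then show ?thesis by simp
qed

lemma irreducible_dvd_mult:
  fixes f :: germ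
  shows "irreducible f \<Longrightarrow> f dvd a * b \<longleftrightarrow> f dvd a \<or> f dvd b"
  using irreducible_imp_prime_elem_germ prime_elem_dvd_mult_iff by blast

lemma strict1_not_dvd_exc_line:
  assumes "irreducible f" "\<not> is_unit (strict1 t f)"
  shows "\<not> strict1 t f dvd exc_line t"
  using exc_line_not_dvd_strict1[of f t] irreducible_dvd_irreducible[OF irreducible_strict1[OF assms] irreducible_exc_line]
    assms(1) by (auto simp: irreducible_def)

lemma not_both_dvd_blow_pair:
  assumes "irreducible f" "\<not> is_unit (strict1 t f)" "coprime a b"
  shows "\<not> (strict1 t f dvd fst (blow_pair t (a, b)) \<and> strict1 t f dvd snd (blow_pair t (a, b)))"
proof
  let ?f = "strict1 t f"
  assume *: "?f dvd fst (blow_pair t (a, b)) \<and> ?f dvd snd (blow_pair t (a, b))"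
  have i: "irreducible ?f" "\<not> ?f dvd exc_line t"
    using irreducible_strict1 strict1_not_dvd_exc_line assms by auto
  have "?f dvd blow t a \<and> ?f dvd blow t b"
  proof (cases t)
    case (Slope s)
    then have "?f dvd blow t b" using * i by (auto simp: irreducible_dvd_mult)
    moreover from this have "?f dvd blow t a"
      using * Slope dvd_add_left_iff[of ?f "(Y + const s) * blow t b" "blow t a"] by auto
    ultimately show ?thesis by blast
  next
    case Vertical
    then have "?f dvd blow t a" using * i by (auto simp: irreducible_dvd_mult)
    moreover from this have "?f dvd blow t b"
      using * Vertical dvd_add_right_iff[of ?f "X * blow t a" "blow t b"] by auto
    ultimately show ?thesis by blast
  qed
  then have "f dvd a" "f dvd b" using strict1_dvd_blow_iff assms by blast+
  then show False using assms(1,3) by (auto simp: irreducible_def coprime_def)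
qed

text \<open>The pull-back of the pair may differ from the coprime one by a factor \<open>g\<close>.
  The strict transform does not divide \<open>g\<close>, for otherwise \<open>f\<close> would divide
  both coefficients before the blow-up.\<close>

lemma invariant_strict1:
  assumes "\<eta> \<noteq> (0, 0)" "irreducible f" "invariant (foliation_at \<eta> p) f" "\<not> is_unit (strict1 t f)"
  shows "invariant (foliation_at \<eta> (p @ [t])) (strict1 t f)"
proof -
  let ?f = "strict1 t f"
  obtain a b where ab: "foliation_at \<eta> p = (a, b)" by (cases "foliation_at \<eta> p")
  have cp: "coprime a b" "proportional (transform \<eta> p) (a, b)" using fol_coprime_proportional[OF assms(1), of p] ab by auto
  have pr: "proportional (transform \<eta> (p @ [t])) (blow_pair t (a, b))"
    unfolding transform_snoc using proportional_blow cp by blast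
  obtain A B where AB: "blow_pair t (a, b) = (A, B)" by (cases "blow_pair t (a, b)")
  obtain g where g: "A = g * fst (foliation_at \<eta> (p @ [t]))" "B = g * snd (foliation_at \<eta> (p @ [t]))"
    using fol_factor[OF assms(1)] pr AB by metis
  have "?f dvd wedge (A, B) ?f"
    using dvd_wedge_strict1[of f "(a, b)" t] assms ab AB by (auto simp: invariant_def irreducible_def)
  then have "?f dvd g * wedge (foliation_at \<eta> (p @ [t])) ?f"
    unfolding g using wedge_scale[of g "fst (foliation_at \<eta> (p @ [t]))" "snd (foliation_at \<eta> (p @ [t]))"] by simp
  moreover have "\<not> ?f dvd g"
    using not_both_dvd_blow_pair[OF assms(2,4) cp(1)] AB g by auto
  ultimately show ?thesis
    using irreducible_dvd_mult[OF irreducible_strict1[OF assms(2,4)]] by (simp add: invariant_def)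
qed

lemma invariant_loc:
  assumes "\<eta> \<noteq> (0, 0)" "\<forall>S. c = Sep S \<longrightarrow> S \<in> branches" "c \<noteq> Exc p"
    "invariant (foliation_at \<eta> p) (loc c p)" "through c (p @ [t])"
  shows "invariant (foliation_at \<eta> (p @ [t])) (loc c (p @ [t]))"
proof -
  have "through c p" using assms through_snocD by blast
  then have "irreducible (loc c p)" using irreducible_loc assms by blast
  then show ?thesis using invariant_strict1[OF assms(1) _ assms(4)] assms(3,5)
    by (simp add: loc_snoc through_iff_not_unit)
qed

lemma invariant_Sep:
  assumes "\<eta> \<noteq> (0, 0)" "S \<in> branches" "invariant (foliation_at \<eta> []) (eqn S)" "through (Sep S) p"
  shows "invariant (foliation_at \<eta> p) (loc (Sep S) p)"
  using assms(4)
proof (induction p rule: rev_induct)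
  case (snoc t p)
  then show ?case using invariant_loc[of \<eta> "Sep S" p t] assms(1,2) through_snocD by blast
qed (use assms in simp)

section \<open>Regular points and simple singularities\<close>

definition sred :: "germ \<times> germ \<Rightarrow> bool" where
  "sred \<omega> \<longleftrightarrow> \<not> singular \<omega> \<or> simple_singularity \<omega>"

lemma simple_scale:
  assumes "simple_singularity (g * a, g * b)" "val g \<noteq> 0"
  shows "simple_singularity (a, b)"
proof -
  have v: "val a = 0" "val b = 0" using assms by (auto simp: simple_singularity_def singular_def)
  obtain m1 m2 where m: "m1 + m2 = val g * (val (dx b) - val (dy a))"
      "m1 * m2 = (val g)\<^sup>2 * (val (dy b) * val (dx a) - val (dx b) * val (dy a))" "m2 \<noteq> 0" "m1 / m2 \<notin> pos_rat"
    using assms v by (auto simp: simple_singularity_def dx_mult dy_mult algebra_simps power2_eq_square)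
  let ?m1 = "m1 / val g" and ?m2 = "m2 / val g"
  have "?m1 + ?m2 = val (dx b) - val (dy a)" using m(1) assms(2) by (simp add: field_simps)
  moreover have "?m1 * ?m2 = val (dy b) * val (dx a) - val (dx b) * val (dy a)"
    using m(2) assms(2) by (simp add: field_simps power2_eq_square)
  moreover have "?m2 \<noteq> 0" "?m1 / ?m2 \<notin> pos_rat" using m assms(2) by auto
  ultimately show ?thesis using v unfolding simple_singularity_def singular_def by fastforce
qed

lemma sred_factor:
  assumes "sred (g * a, g * b)" shows "sred (a, b)"
proof (cases "val g = 0")
  case True
  then have "simple_singularity (g * a, g * b)" using assms by (auto simp: sred_def singular_def)
  \<comment> \<open>With \<open>g\<close> and both coefficients vanishing at the origin the linear
    part would be zero, against the non-zero eigenvalue.\<close>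
  then have "val a \<noteq> 0 \<or> val b \<noteq> 0"
    using True by (auto simp: simple_singularity_def dx_mult dy_mult)
  then show ?thesis by (auto simp: sred_def singular_def)
next
  case False
  then show ?thesis using assms simple_scale[of g a b] by (auto simp: sred_def singular_def)
qed

lemma sred_fol:
  assumes "\<eta> \<noteq> (0, 0)" "proportional (transform \<eta> p) (A, B)" "sred (A, B)"
  shows "sred (foliation_at \<eta> p)"
  using assms fol_factor[OF assms(1,2)] sred_factor by (metis prod.collapse)

text \<open>The shape of a closed form with one smooth pole, multiplied by its equation: at the
  point it equals \<open>l\<close> times the differential of \<open>f\<close>, so the pole is the
  leaf.\<close>

lemma regular_log:
  assumes "\<eta> \<noteq> (0, 0)" "proportional (transform \<eta> p) (const l * dx f + f * u, const l * dy f + f * v)"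
    and "l \<noteq> 0" "val f = 0" "val (dx f) \<noteq> 0 \<or> val (dy f) \<noteq> 0"
  shows "\<not> singular (foliation_at \<eta> p)" "invariant (foliation_at \<eta> p) f"
    "val (dx f * dy g - dy f * dx g) \<noteq> 0 \<Longrightarrow> val (wedge (foliation_at \<eta> p) g) \<noteq> 0"
proof -
  let ?A = "const l * dx f + f * u" and ?B = "const l * dy f + f * v"
  obtain h where h: "?A = h * fst (foliation_at \<eta> p)" "?B = h * snd (foliation_at \<eta> p)"
    using fol_factor[OF assms(1,2)] by metis
  have w: "wedge (?A, ?B) k = h * wedge (foliation_at \<eta> p) k" for k
    unfolding h using wedge_scale[of h "fst (foliation_at \<eta> p)" "snd (foliation_at \<eta> p)"] by simp
  have "val ?A \<noteq> 0 \<or> val ?B \<noteq> 0" using assms by simp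
  then have *: "val h \<noteq> 0" "\<not> singular (foliation_at \<eta> p)" unfolding h by (auto simp: singular_def)
  then show "\<not> singular (foliation_at \<eta> p)" by blast
  have "f dvd wedge (?A, ?B) f" by (auto simp: wedge_def algebra_simps)
  then show "invariant (foliation_at \<eta> p) f"
    unfolding w invariant_def using * is_unit_iff_val by (metis dvd_mult_unit_iff mult.commute)
  show "val (wedge (foliation_at \<eta> p) g) \<noteq> 0" if "val (dx f * dy g - dy f * dx g) \<noteq> 0"
  proof -
    have "val (wedge (?A, ?B) g) = l * val (dx f * dy g - dy f * dx g)"
      using assms by (simp add: wedge_def algebra_simps)
    then show ?thesis using that assms(3) w[of g] by auto
  qed
qed

text \<open>The shape of a closed form with two transverse poles, cleared of denominators. With
  \<open>J\<close> the Jacobian of \<open>f1\<close> and \<open>f2\<close>, the eigenvalues are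
  \<open>l2 * J\<close> and \<open>- l1 * J\<close>; their product is non-zero, which also makes the
  common factor \<open>h\<close> a unit.\<close>

lemma simple_log:
  assumes "\<eta> \<noteq> (0, 0)"
    and "proportional (transform \<eta> p) (const l1 * f2 * dx f1 + const l2 * f1 * dx f2 + f1 * f2 * u,
      const l1 * f2 * dy f1 + const l2 * f1 * dy f2 + f1 * f2 * v)"
    and "l1 \<noteq> 0" "l2 \<noteq> 0" "- l1 / l2 \<notin> pos_rat" "val f1 = 0" "val f2 = 0"
      "val (dx f1 * dy f2 - dy f1 * dx f2) \<noteq> 0"
  shows "simple_singularity (foliation_at \<eta> p)"
    "invariant (foliation_at \<eta> p) f1" "invariant (foliation_at \<eta> p) f2"
proof -
  let ?A = "const l1 * f2 * dx f1 + const l2 * f1 * dx f2 + f1 * f2 * u"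
    and ?B = "const l1 * f2 * dy f1 + const l2 * f1 * dy f2 + f1 * f2 * v"
  define x1 x2 y1 y2 where d: "x1 = val (dx f1)" "x2 = val (dx f2)" "y1 = val (dy f1)" "y2 = val (dy f2)"
  define J where "J = x1 * y2 - y1 * x2"
  have J: "J \<noteq> 0" using assms(8) by (simp add: J_def d)
  obtain a b where ab: "foliation_at \<eta> p = (a, b)" by (cases "foliation_at \<eta> p")
  obtain h where h: "?A = h * a" "?B = h * b"
    using fol_factor[OF assms(1,2)] ab by (metis fst_conv snd_conv)
  have w: "wedge (?A, ?B) k = h * wedge (a, b) k" for k unfolding h by (rule wedge_scale)
  have lin: "val (dx ?A) = (l1 + l2) * x1 * x2" "val (dy ?A) = l1 * y2 * x1 + l2 * y1 * x2"
      "val (dx ?B) = l1 * x2 * y1 + l2 * x1 * y2" "val (dy ?B) = (l1 + l2) * y1 * y2"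
    using assms(6,7) by (simp_all add: dx_mult dy_mult d algebra_simps)
  have v0: "val ?A = 0" "val ?B = 0" using assms by auto
  have tr: "val (dx ?B) - val (dy ?A) = l2 * J + - l1 * J"
    and dt: "val (dy ?B) * val (dx ?A) - val (dx ?B) * val (dy ?A) = (l2 * J) * (- l1 * J)"
    unfolding lin J_def by (simp_all add: algebra_simps)
  have hu: "val h \<noteq> 0"
  proof
    assume "val h = 0"
    then have "val (dy (h * b)) * val (dx (h * a)) - val (dx (h * b)) * val (dy (h * a)) = 0"
      by (simp add: dx_mult dy_mult)
    then show False using dt J assms(3,4) unfolding h by auto
  qed
  have "simple_singularity (?A, ?B)"
    unfolding simple_singularity_def singular_def fst_conv snd_conv prod.case
    using v0 tr dt J assms(3-5)
    by (intro conjI exI[of _ "- l1 * J"] exI[of _ "l2 * J"]) (simp_all add: add.commute mult.commute)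
  then show "simple_singularity (foliation_at \<eta> p)" using simple_scale hu unfolding h ab by blast
  have "f1 dvd wedge (?A, ?B) f1" "f2 dvd wedge (?A, ?B) f2" by (auto simp: wedge_def algebra_simps)
  then show "invariant (foliation_at \<eta> p) f1" "invariant (foliation_at \<eta> p) f2"
    unfolding w invariant_def ab using hu is_unit_iff_val by (metis dvd_mult_unit_iff mult.commute)+
qed

section \<open>Logarithmic forms at infinitely near points\<close>

lemma const_sum: "const (sum f A) = (\<Sum>a\<in>A. const (f a))"
  by (induction A rule: infinite_finite_induct) (auto simp: const_add)

lemma of_nat_fract: "(of_nat n :: germ fract) = hol (const (of_nat n))"
  by (induction n) (simp_all add: hol_hom const_add)

text \<open>All exceptional lines created on the way to \<open>p\<close> are listed, whether or not
  they still pass through \<open>p\<close>; exceptional components outside the list have local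
  equation \<open>1\<close> there.\<close>

definition cset :: "branch set \<Rightarrow> point \<Rightarrow> comp set" where
  "cset S0 p = Sep ` S0 \<union> Exc ` {q. strict_prefix q p}"

lemma finite_strict_prefixes: "finite {q. strict_prefix q (p :: 'a list)}"
  by (rule finite_subset[of _ "set (prefixes p)"]) (auto simp: strict_prefix_def)

lemma cset_Nil [simp]: "cset S0 [] = Sep ` S0"
  by (auto simp: cset_def)

lemma cset_snoc: "cset S0 (p @ [t]) = insert (Exc p) (cset S0 p)"
  by (auto simp: cset_def strict_prefix_def prefix_snoc)

lemma Exc_notin_cset [simp]: "Exc p \<notin> cset S0 p"
  by (auto simp: cset_def)

text \<open>Differentiating a non-zero term of lowest order gives a derivative of smaller order than
  \<open>f\<close>.\<close>

lemma not_dvd_both_derivatives: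
  assumes "f \<noteq> 0" "val f = 0"
  shows "\<not> (f dvd dx f \<and> f dvd dy f)"
proof
  assume d: "f dvd dx f \<and> f dvd dy f"
  have o: "ord f > 0" using assms ord_eq_0_iff by auto
  obtain j where j: "j \<le> ord f" "coeff2 f (ord f - j) j \<noteq> 0" using coeff2_ord_nonzero assms by blast
  show False
  proof (cases "j = 0")
    case True
    then have "coeff2 (dx f) (ord f - 1) 0 \<noteq> 0" using j o by simp
    then have "dx f \<noteq> 0" "ord (dx f) \<le> ord f - 1" using ord_leI by fastforce+
    then show False using d ord_dvd_mono[of f "dx f"] o by simp
  next
    case False
    then have "coeff2 (dy f) (ord f - j) (j - 1) \<noteq> 0" using j by simp
    then have "dy f \<noteq> 0" "ord (dy f) \<le> ord f - 1"
      using ord_leI[of "dy f" "ord f - j" "j - 1"] j False by (metis coeff2_0, simp)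
    then show False using d ord_dvd_mono[of f "dy f"] o by simp
  qed
qed

lemma unit_log_derivative:
  assumes "is_unit f"
  obtains u v where "f * u = dx f" "f * v = dy f" "dl dx f = hol u" "dl dy f = hol v" "dx v = dy u"
proof -
  obtain g where g: "1 = f * g" using assms by (auto simp: dvd_def)
  define u v where uv: "u = g * dx f" "v = g * dy f"
  have f: "f * u = dx f" "f * v = dy f" using g by (simp_all add: uv flip: mult.assoc)
  have f0: "f \<noteq> 0" using g by auto
  have "hol f * hol u = hol (dx f)" "hol f * hol v = hol (dy f)" using f by (simp_all flip: hol_hom(4))
  then have d: "dl dx f = hol u" "dl dy f = hol v" using f0 by (simp_all add: dl.simps field_simps)
  have "dx (f * v) = dy (f * u)" by (simp add: f dx_dy)
  then have "dx f * v + f * dx v = dy f * u + f * dy u" by (simp add: dx_mult dy_mult)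
  moreover have "dx f * v = dy f * u" by (simp add: mult_ac flip: f)
  ultimately have "dx v = dy u" using f0 by simp
  then show ?thesis using that f d by blast
qed

lemma fraction_sum:
  assumes "finite C" "\<And>c. c \<in> C \<Longrightarrow> f c \<noteq> 0"
  shows "hol (prod f C) * ((\<Sum>c\<in>C. hol (const (l c)) * dl D (f c)) + hol u) =
    hol ((\<Sum>c\<in>C. const (l c) * D (f c) * prod f (C - {c})) + prod f C * u)"
proof -
  have "hol (prod f C) * (hol (const (l c)) * dl D (f c)) = hol (const (l c) * D (f c) * prod f (C - {c}))"
    if "c \<in> C" for c
  proof -
    have "prod f C = f c * prod f (C - {c})" using prod.remove[OF assms(1) that] .
    then show ?thesis using assms(2)[OF that] by (simp add: hol_hom dl.simps)
  qed
  then show ?thesis unfolding distrib_left sum_distrib_left hol_hom(1) hol_sum hol_hom(4)[of "prod f C" u]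
    by (simp cong: sum.cong)
qed

lemma Fract_eqI: "hol F * x = hol n \<Longrightarrow> F \<noteq> 0 \<Longrightarrow> x = Fract n F"
  by (simp add: Fract_conv[of n F] nonzero_eq_divide_eq mult.commute)

lemma irreducible_dvd_prod:
  fixes g :: germ
  assumes "irreducible g" "g dvd prod f A"
  shows "\<exists>a\<in>A. g dvd f a"
  using assms(2)
proof (induction A rule: infinite_finite_induct)
  case (insert x F)
  then show ?case using irreducible_dvd_mult[OF assms(1)] by auto
qed (use assms(1) in \<open>auto simp: irreducible_def\<close>)

lemma tc_1: "tc 1 = 1"
  by (auto simp: poly_eq_iff coeff_tc ord_unit coeff2_1 coeff_1)

lemma tc_prod: "(\<And>c. c \<in> A \<Longrightarrow> f c \<noteq> 0) \<Longrightarrow> tc (prod f A) = (\<Prod>c\<in>A. tc (f c))"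
proof (induction A rule: infinite_finite_induct)
  case (insert x F)
  then have "prod f F \<noteq> 0" by (simp add: prod_zero_iff)
  then show ?case using insert by (simp add: tc_mult)
qed (simp_all add: tc_1)

section \<open>Orders of vanishing, tangent slopes and logarithmic derivatives\<close>

definition vanish :: "nat \<Rightarrow> germ \<Rightarrow> bool" where
  "vanish n f \<longleftrightarrow> (\<forall>i j. i + j < n \<longrightarrow> coeff2 f i j = 0)"

lemma vanish_ord: "vanish (ord f) f"
  by (simp add: vanish_def coeff2_less_ord)

lemma vanish_iff: "vanish n f \<longleftrightarrow> f = 0 \<or> n \<le> ord f"
  using ord_geI[of f n] coeff2_less_ord[of _ _ f] by (auto simp: vanish_def)

lemma vanish_mult: "vanish m f \<Longrightarrow> vanish n g \<Longrightarrow> vanish (m + n) (f * g)"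
  by (cases "f = 0 \<or> g = 0") (auto simp: vanish_iff ord_strict1_mult)

lemma vanish_add: "vanish n f \<Longrightarrow> vanish n g \<Longrightarrow> vanish n (f + g)"
  by (auto simp: vanish_def)

lemma vanish_sum: "(\<And>a. a \<in> A \<Longrightarrow> vanish n (f a)) \<Longrightarrow> vanish n (sum f A)"
  by (auto simp: vanish_def coeff2_sum)

lemma vanish_d: "vanish n f \<Longrightarrow> vanish (n - 1) (dx f)" "vanish n f \<Longrightarrow> vanish (n - 1) (dy f)"
  by (auto simp: vanish_def)

lemma vanish_dvd: "vanish n f \<Longrightarrow> X ^ n dvd blow_slope t f"
  using blow_slope_eq[of t f] blow_slope_hom(2)[of t 0 0] by (auto simp: vanish_iff le_imp_power_dvd)

lemma form_ord_eqI:
  assumes "vanish n a" "vanish n b" "\<not> (vanish (Suc n) a \<and> vanish (Suc n) b)"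
  shows "form_ord a b = n"
  unfolding form_ord_def
proof (rule Least_equality)
  show "\<exists>i j. i + j = n \<and> (coeff2 a i j \<noteq> 0 \<or> coeff2 b i j \<noteq> 0)"
    using assms unfolding vanish_def by (metis less_Suc_eq)
next
  fix m assume "\<exists>i j. i + j = m \<and> (coeff2 a i j \<noteq> 0 \<or> coeff2 b i j \<noteq> 0)"
  then show "n \<le> m" using assms by (auto simp: vanish_def not_less[symmetric])
qed

text \<open>Direction of the tangent of a branch, if it is not vertical.\<close>

definition tslope :: "germ \<Rightarrow> complex option" where
  "tslope f = (if \<exists>s. \<not> is_unit (strict1 (Slope s) f) then Some (THE s. \<not> is_unit (strict1 (Slope s) f)) else None)"

lemma tslope_Some:
  assumes "irreducible f" shows "tslope f = Some s \<longleftrightarrow> \<not> is_unit (strict1 (Slope s) f)"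
proof -
  have "u = s" if "\<not> is_unit (strict1 (Slope s) f)" "\<not> is_unit (strict1 (Slope u) f)" for s u
    using unibranch[OF assms] that by blast
  then have "(THE s. \<not> is_unit (strict1 (Slope s) f)) = s" if "\<not> is_unit (strict1 (Slope s) f)" for s
    using that by (intro the_equality) auto
  then show ?thesis by (auto simp: tslope_def)
qed

lemma tc_tslope:
  assumes "irreducible f"
  obtains a where "a \<noteq> 0"
    "tc f = (case tslope f of None \<Rightarrow> [:a:] | Some s \<Rightarrow> smult a ([:- s, 1:] ^ ord f))"
proof (cases "tslope f")
  case None
  then have "\<not> is_unit (strict1 Vertical f)"
    using unibranch[OF assms] tslope_Some[OF assms] by (metis direction.exhaust option.distinct(1))
  then show ?thesis using unibranch_vertical(2)[OF assms] that None by auto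
next
  case (Some s)
  then have "\<not> is_unit (strict1 (Slope s) f)" using tslope_Some[OF assms] by blast
  then show ?thesis using unibranch_slope(2)[OF assms] that Some by auto
qed

text \<open>A tangent slope for germs that may be units: an irreducible germ has its
  \<open>tslope\<close>, a unit counts as having none. Both occur, since \<open>cset\<close> keeps
  components that have left the point.\<close>

definition tcform :: "germ \<Rightarrow> complex option \<Rightarrow> bool" where
  "tcform f so \<longleftrightarrow> (\<exists>a. a \<noteq> 0 \<and> tc f = (case so of None \<Rightarrow> [:a:] | Some s \<Rightarrow> smult a ([:- s, 1:] ^ ord f))) \<and>
    (so \<noteq> None \<longrightarrow> ord f > 0)"

lemma tcform_irreducible: "irreducible f \<Longrightarrow> tcform f (tslope f)"
  using tc_tslope[of f] ord_irreducible[of f] by (auto simp: tcform_def)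

lemma tcform_unit: "is_unit f \<Longrightarrow> tcform f None"
  by (auto simp: tcform_def tc_def ord_unit is_unit_iff_val val_def monom_0)

lemma solve_two:
  fixes b x y n :: complex
  assumes "b \<noteq> 0" "b * x = n" "b * y + x = 0"
  shows "x = n / b \<and> y = - n / b\<^sup>2"
proof -
  have x: "x = n / b" using assms by (simp add: nonzero_eq_divide_eq mult.commute)
  have "y * b = - x" using assms(3) by (simp add: eq_neg_iff_add_eq_0 mult.commute)
  then have "y = - x / b" using nonzero_eq_divide_eq[OF assms(1), of y "- x"] by blast
  then show ?thesis using x by (simp add: power2_eq_square)
qed

text \<open>On the exceptional line the strict transform restricts to
  \<open>a * (y + z - s) ^ ord f\<close>, or to a constant if \<open>so = None\<close>; the formulas
  are the value and the derivative at \<open>y = 0\<close> of its logarithmic derivative.\<close>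

lemma log_derivative_slope:
  assumes "tcform f so" "strict1 (Slope z) f * v = dy (strict1 (Slope z) f)" "so \<noteq> Some z"
  shows "val v = (case so of None \<Rightarrow> 0 | Some s \<Rightarrow> of_nat (ord f) / (z - s))"
    "val (dy v) = (case so of None \<Rightarrow> 0 | Some s \<Rightarrow> - of_nat (ord f) / (z - s)\<^sup>2)"
proof -
  obtain a where a: "a \<noteq> 0"
      "tc f = (case so of None \<Rightarrow> [:a:] | Some s \<Rightarrow> smult a ([:- s, 1:] ^ ord f))"
    using assms(1) by (auto simp: tcform_def)
  have rdy: "rX (dy g) = fps_deriv (rX g)" for g
    by (simp add: fps_eq_iff)
  have e: "rX (strict1 (Slope z) f) * rX v = fps_deriv (rX (strict1 (Slope z) f))"
    using arg_cong[OF assms(2), of rX] by (simp add: rX_mult rdy)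
  have "rX v $ 0 = (case so of None \<Rightarrow> 0 | Some s \<Rightarrow> of_nat (ord f) / (z - s)) \<and>
    rX v $ 1 = (case so of None \<Rightarrow> 0 | Some s \<Rightarrow> - of_nat (ord f) / (z - s)\<^sup>2)"
  proof (cases so)
    case None
    then have "rX (strict1 (Slope z) f) = fps_const a"
      using a by (simp add: rX_strict1_Slope fps_of_poly_const)
    then show ?thesis using e a None by simp
  next
    case (Some s)
    define b where "b = z - s"
    have b: "b \<noteq> 0" using Some assms(3) by (auto simp: b_def)
    define p :: "complex fps" where "p = fps_const b + fps_X"
    have "pcompose (tc f) [:z, 1:] = smult a ([:b, 1:] ^ ord f)"
      using a Some by (simp add: pcompose_smult pcompose_power pcompose_pCons b_def)
    then have r: "rX (strict1 (Slope z) f) = fps_const a * p ^ ord f"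
      by (simp add: rX_strict1_Slope fps_of_poly_smult fps_of_poly_power fps_of_poly_pCons mult.commute p_def)
    obtain n where n: "ord f = Suc n" using assms(1) Some by (cases "ord f") (auto simp: tcform_def)
    have p0: "p \<noteq> 0" using b by (auto simp: p_def fps_eq_iff intro!: exI[of _ 0])
    have dp: "fps_deriv p = 1" by (simp add: p_def)
    have d: "fps_deriv (p ^ Suc n) = of_nat (Suc n) * p ^ n" for n
    proof (induction n)
      case (Suc n)
      have "fps_deriv (p ^ Suc (Suc n)) = p ^ Suc n + p * fps_deriv (p ^ Suc n)" by (simp add: dp)
      also have "\<dots> = p ^ Suc n + p * (of_nat (Suc n) * p ^ n)" by (simp only: Suc)
      finally show ?case by (simp add: algebra_simps)
    qed (simp add: dp)
    have "fps_deriv (fps_const a * p ^ Suc n) = fps_const a * fps_deriv (p ^ Suc n)" by simp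
    then have "fps_const a * p ^ Suc n * rX v = fps_const a * (of_nat (Suc n) * p ^ n)"
      using e unfolding r n d by (simp only:)
    then have "(fps_const a * p ^ n) * (p * rX v) = (fps_const a * p ^ n) * of_nat (Suc n)"
      by (simp only: mult_ac power_Suc)
    moreover have "fps_const a * p ^ n \<noteq> 0" using a p0 by simp
    ultimately have pv: "p * rX v = of_nat (Suc n)" using mult_left_cancel by blast
    have "(p * rX v) $ 0 = b * rX v $ 0" by (simp add: p_def del: rX_nth)
    moreover have "(p * rX v) $ 1 = b * rX v $ 1 + rX v $ 0"
      by (simp add: p_def distrib_right del: rX_nth)
    ultimately have "b * rX v $ 0 = of_nat (ord f)" "b * rX v $ 1 + rX v $ 0 = 0"
      unfolding pv n by (simp_all add: fps_of_nat[symmetric] del: rX_nth of_nat_Suc)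
    then show ?thesis using solve_two[OF b] by (simp add: Some b_def del: rX_nth)
  qed
  then show "val v = (case so of None \<Rightarrow> 0 | Some s \<Rightarrow> of_nat (ord f) / (z - s))"
    "val (dy v) = (case so of None \<Rightarrow> 0 | Some s \<Rightarrow> - of_nat (ord f) / (z - s)\<^sup>2)"
    by (simp_all add: val_def)
qed

text \<open>The point at infinity of the exceptional line: the logarithmic derivative is read off
  from the two top coefficients of the tangent cone.\<close>

lemma log_derivative_vertical:
  assumes "tcform f so" "strict1 Vertical f * u = dx (strict1 Vertical f)" "so = None \<Longrightarrow> ord f = 0"
  shows "val u = (case so of None \<Rightarrow> 0 | Some s \<Rightarrow> - of_nat (ord f) * s)"
proof -
  have c1: "val (dx (strict1 Vertical f)) = coeff (tc (swap f)) 1"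
  proof -
    have "val (dx (strict1 Vertical f)) = rX (strict1 (Slope 0) (swap f)) $ 1"
      by (simp add: val_def strict1_Vertical)
    then show ?thesis by (simp add: rX_strict1_Slope del: rX_nth)
  qed
  have au: "val (strict1 Vertical f) * val u = val (dx (strict1 Vertical f))"
    using arg_cong[OF assms(2), of val] by simp
  obtain a where a: "a \<noteq> 0"
      "tc f = (case so of None \<Rightarrow> [:a:] | Some s \<Rightarrow> smult a ([:- s, 1:] ^ ord f))"
    using assms(1) by (auto simp: tcform_def)
  have v: "val (strict1 Vertical f) = a"
    using a assms(3) by (auto simp: val_strict1 coeff_linear_power split: option.splits)
  show ?thesis
  proof (cases so)
    case None
    then have "coeff (tc (swap f)) 1 = 0" using assms(3) by (simp add: coeff_tc)
    then show ?thesis using au v a c1 None by simp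
  next
    case (Some s)
    obtain n where n: "ord f = Suc n" using assms(1) Some by (cases "ord f") (auto simp: tcform_def)
    have "coeff (tc (swap f)) 1 = coeff (tc f) n" by (simp add: coeff_tc n)
    also have "\<dots> = a * (of_nat (ord f) * (- s))"
      using a Some by (simp add: n coeff_linear_poly_power del: power_Suc)
    finally have "a * val u = a * (of_nat (ord f) * (- s))" using au v c1 by simp
    then have "val u = of_nat (ord f) * (- s)" using a(1) mult_left_cancel by blast
    then show ?thesis using Some by simp
  qed
qed

lemma cset_loc_inj:
  assumes br: "S0 \<subseteq> branches" and asm: "c \<in> cset S0 p" "d \<in> cset S0 p" "through c p" "loc c p dvd loc d p" "through d p"
  shows "c = d"
proof -
  have i: "irreducible (loc c p)" "irreducible (loc d p)"
    by (rule irreducible_loc; use asm br in \<open>auto simp: cset_def\<close>)+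
  then have dc: "loc d p dvd loc c p" using irreducible_dvd_irreducible asm(4) by blast
  consider S S' where "c = Sep S" "d = Sep S'" | S q where "c = Sep S" "d = Exc q"
    | S q where "c = Exc q" "d = Sep S" | q q' where "c = Exc q" "d = Exc q'"
    by (cases c; cases d) auto
  then show ?thesis
  proof cases
    case 1
    then show ?thesis using Sep_loc_inj[of S S' p] asm br by (auto simp: cset_def)
  next
    case 2
    then show ?thesis using Exc_not_dvd_Sep[of S q p] asm dc br by (auto simp: cset_def)
  next
    case 3
    then show ?thesis using Exc_not_dvd_Sep[of S q p] asm br by (auto simp: cset_def)
  next
    case 4
    have False if th: "a \<noteq> b" "length a \<le> length b" "through (Exc a) p" "through (Exc b) p"
        "loc (Exc a) p dvd loc (Exc b) p" for a b
    proof -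
      obtain t where "exc_line t dvd exc_line (cont t)" using two_comps(2)[OF th(3,4,1,2)] th(5) by metis
      then show False by (cases t) (auto simp: X_dvd_iff Y_dvd_iff rY_simps)
    qed
    then show ?thesis using asm dc 4 by (metis linear)
  qed
qed

text \<open>\<open>L_Exc\<close> extends the residues to every infinitely near point by the rule for
  pull-backs; a dicritical component simply receives residue zero.\<close>

locale log_form =
  fixes S0 :: "branch set" and L :: "comp \<Rightarrow> complex"
  assumes fin: "finite S0" and br: "S0 \<subseteq> branches" and ne: "S0 \<noteq> {}"
    and L_Sep: "\<And>S. S \<in> S0 \<Longrightarrow> L (Sep S) \<noteq> 0"
    and L_Exc: "\<And>q. L (Exc q) = (\<Sum>c\<in>cset S0 q. of_nat (ord (loc c q)) * L c)"
begin

definition eta :: form where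
  "eta = (\<Sum>S\<in>S0. hol (const (L (Sep S))) * Fract (dx (eqn S)) (eqn S),
          \<Sum>S\<in>S0. hol (const (L (Sep S))) * Fract (dy (eqn S)) (eqn S))"

lemma finite_cset [simp]: "finite (cset S0 p)"
  by (simp add: cset_def fin finite_strict_prefixes)

lemma cset_branches: "c \<in> cset S0 p \<Longrightarrow> \<forall>S. c = Sep S \<longrightarrow> S \<in> branches"
  using br by (auto simp: cset_def)

lemma loc_nz: "c \<in> cset S0 p \<Longrightarrow> loc c p \<noteq> 0"
  using loc_neq_0 cset_branches by blast

lemma loc_nz': "c \<in> cset S0 p \<Longrightarrow> loc c q \<noteq> 0"
  using loc_neq_0 cset_branches by blast

text \<open>Each \<open>df / f\<close> pulls back to \<open>ord f\<close> times that of the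
  exceptional line plus that of the strict transform; by \<open>L_Exc\<close> the first parts add up
  to the coefficient \<open>L (Exc p)\<close>.\<close>

lemma transform_eta:
  "transform eta p = (\<Sum>c\<in>cset S0 p. hol (const (L c)) * dl dx (loc c p),
    \<Sum>c\<in>cset S0 p. hol (const (L c)) * dl dy (loc c p))"
proof (induction p rule: rev_induct)
  case Nil
  have "inj_on Sep S0" by (auto simp: inj_on_def)
  then show ?case
    by (simp add: eta_def sum.reindex dl.simps divide_fract)
next
  case (snoc t p)
  let ?e = "exc_line t"
  have step: "hol (const (L c)) * dl D (blow t (loc c p)) =
      hol (const (of_nat (ord (loc c p)) * L c)) * dl D ?e + hol (const (L c)) * dl D (loc c (p @ [t]))"
    if c: "c \<in> cset S0 p" and D: "D = dx \<or> D = dy" for c D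
  proof -
    have "c \<noteq> Exc p" using c by auto
    then have "blow t (loc c p) = ?e ^ ord (loc c p) * loc c (p @ [t])"
      by (simp add: blow_eq loc_snoc)
    moreover have "loc c (p @ [t]) \<noteq> 0" using loc_nz' c by blast
    ultimately have "dl D (blow t (loc c p)) = of_nat (ord (loc c p)) * dl D ?e + dl D (loc c (p @ [t]))"
      using D by (auto simp: dl_mult dl_power)
    then show ?thesis by (simp add: of_nat_fract distrib_left const_mult hol_hom(4) mult_ac)
  qed
  have tot: "(\<Sum>c\<in>cset S0 p. hol (const (L c)) * dl D (blow t (loc c p))) =
      (\<Sum>c\<in>cset S0 (p @ [t]). hol (const (L c)) * dl D (loc c (p @ [t])))" if D: "D = dx \<or> D = dy" for D
  proof -
    have "(\<Sum>c\<in>cset S0 p. hol (const (L c)) * dl D (blow t (loc c p))) =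
        (\<Sum>c\<in>cset S0 p. hol (const (of_nat (ord (loc c p)) * L c)) * dl D ?e) +
        (\<Sum>c\<in>cset S0 p. hol (const (L c)) * dl D (loc c (p @ [t])))"
      unfolding sum.distrib[symmetric] using step D by (intro sum.cong) auto
    also have "(\<Sum>c\<in>cset S0 p. hol (const (of_nat (ord (loc c p)) * L c)) * dl D ?e) =
        hol (const (L (Exc p))) * dl D ?e"
      by (simp only: L_Exc[of p] const_sum hol_sum sum_distrib_right)
    finally show ?thesis by (simp add: cset_snoc)
  qed
  have f: "fst (blow_form t (dl dx (loc c p), dl dy (loc c p))) = dl dx (blow t (loc c p))"
    "snd (blow_form t (dl dx (loc c p), dl dy (loc c p))) = dl dy (blow t (loc c p))"
    if "c \<in> cset S0 p" for c
    using blow_form_dl[OF loc_nz[OF that]] by auto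
  show ?case unfolding transform_snoc snoc blow_form_sum
    using f tot[of dx] tot[of dy] by (simp cong: sum.cong)
qed

definition polar_at :: "point \<Rightarrow> comp set" where
  "polar_at p = {c \<in> cset S0 p. through c p \<and> L c \<noteq> 0}"

lemma finite_polar_at [simp]: "finite (polar_at p)"
  by (simp add: polar_at_def)

lemma polar_at_irreducible: "c \<in> polar_at p \<Longrightarrow> irreducible (loc c p)"
  using irreducible_loc cset_branches by (auto simp: polar_at_def)

lemmas loc_inj = cset_loc_inj[OF br]

lemma transform_eta_split:
  obtains u v where "dx v = dy u"
    "transform eta p = ((\<Sum>c\<in>polar_at p. hol (const (L c)) * dl dx (loc c p)) + hol u,
      (\<Sum>c\<in>polar_at p. hol (const (L c)) * dl dy (loc c p)) + hol v)"
proof -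
  let ?R = "cset S0 p - polar_at p"
  have "\<exists>u v. hol (const (L c)) * dl dx (loc c p) = hol u \<and>
      hol (const (L c)) * dl dy (loc c p) = hol v \<and> dx v = dy u" if c: "c \<in> ?R" for c
  proof (cases "L c = 0")
    case True
    then show ?thesis by (intro exI[of _ 0]) (simp add: hol_hom)
  next
    case False
    then have "is_unit (loc c p)" using c by (auto simp: polar_at_def through_iff_not_unit)
    then obtain u v where "dl dx (loc c p) = hol u" "dl dy (loc c p) = hol v" "dx v = dy u"
      using unit_log_derivative by metis
    then show ?thesis
      by (intro exI[of _ "const (L c) * u"] exI[of _ "const (L c) * v"]) (simp add: hol_hom dx_mult dy_mult)
  qed
  then obtain u v where uv: "\<And>c. c \<in> ?R \<Longrightarrow> hol (const (L c)) * dl dx (loc c p) = hol (u c) \<and>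
      hol (const (L c)) * dl dy (loc c p) = hol (v c) \<and> dx (v c) = dy (u c)" by metis
  have dsum: "dx (sum v A) = (\<Sum>c\<in>A. dx (v c))" "dy (sum u A) = (\<Sum>c\<in>A. dy (u c))" for A
    by (induction A rule: infinite_finite_induct) auto
  have split: "(\<Sum>c\<in>cset S0 p. g c) = (\<Sum>c\<in>polar_at p. g c) + (\<Sum>c\<in>?R. g c)" for g :: "comp \<Rightarrow> germ fract"
    by (subst sum.subset_diff[of "polar_at p"]) (auto simp: polar_at_def add.commute)
  show ?thesis
  proof (rule that[of "sum v ?R" "sum u ?R"])
    show "dx (sum v ?R) = dy (sum u ?R)" unfolding dsum using uv by (intro sum.cong) blast+
    show "transform eta p = ((\<Sum>c\<in>polar_at p. hol (const (L c)) * dl dx (loc c p)) + hol (sum u ?R),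
      (\<Sum>c\<in>polar_at p. hol (const (L c)) * dl dy (loc c p)) + hol (sum v ?R))"
      unfolding transform_eta split hol_sum prod.inject using uv
      by (intro conjI arg_cong2[of _ _ _ _ "(+)"] refl sum.cong) blast+
  qed
qed

text \<open>A coefficient of the form times the product of the polar equations, where
  \<open>D\<close> is \<open>dx\<close> or \<open>dy\<close> and \<open>u\<close> collects the
  holomorphic part.\<close>

definition num :: "(germ \<Rightarrow> germ) \<Rightarrow> point \<Rightarrow> germ \<Rightarrow> germ" where
  "num D p u = (\<Sum>c\<in>polar_at p. const (L c) * D (loc c p) * (\<Prod>d\<in>polar_at p - {c}. loc d p)) +
     (\<Prod>c\<in>polar_at p. loc c p) * u"

lemma polar_prod_nz: "(\<Prod>c\<in>polar_at p. loc c p) \<noteq> 0"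
  using loc_nz by (auto simp: polar_at_def)

lemma transform_num:
  obtains u v where "dx v = dy u"
    "hol (\<Prod>c\<in>polar_at p. loc c p) * fst (transform eta p) = hol (num dx p u)"
    "hol (\<Prod>c\<in>polar_at p. loc c p) * snd (transform eta p) = hol (num dy p v)"
proof -
  obtain u v where uv: "dx v = dy u"
    "transform eta p = ((\<Sum>c\<in>polar_at p. hol (const (L c)) * dl dx (loc c p)) + hol u,
      (\<Sum>c\<in>polar_at p. hol (const (L c)) * dl dy (loc c p)) + hol v)" by (rule transform_eta_split)
  have nz: "loc c p \<noteq> 0" if "c \<in> polar_at p" for c using that loc_nz by (auto simp: polar_at_def)
  show ?thesis using that[of v u] uv
    fraction_sum[OF finite_polar_at nz, where l=L and D=dx and u=u]
    fraction_sum[OF finite_polar_at nz, where l=L and D=dy and u=v]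
    by (simp add: num_def)
qed

lemma num_split:
  assumes c: "c \<in> polar_at p"
  obtains k where "num D p w = const (L c) * D (loc c p) * (\<Prod>d\<in>polar_at p - {c}. loc d p) + loc c p * k"
proof -
  let ?f = "\<Prod>c\<in>polar_at p. loc c p" and ?g = "loc c p" and ?F = "\<Prod>d\<in>polar_at p - {c}. loc d p"
  have "num D p w - const (L c) * D ?g * ?F =
      (\<Sum>e\<in>polar_at p - {c}. const (L e) * D (loc e p) * (\<Prod>d\<in>polar_at p - {e}. loc d p)) + ?f * w"
    unfolding num_def using sum.remove[OF finite_polar_at c, of "\<lambda>c. const (L c) * D (loc c p) * (\<Prod>d\<in>polar_at p - {c}. loc d p)"]
    by simp
  moreover have "?g dvd (\<Sum>e\<in>polar_at p - {c}. const (L e) * D (loc e p) * (\<Prod>d\<in>polar_at p - {e}. loc d p))"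
    by (rule dvd_sum) (use c in \<open>auto intro!: dvd_mult dvd_prodI\<close>)
  moreover have "?g dvd ?f * w"
    using dvd_prodI[OF finite_polar_at c, of "\<lambda>c. loc c p"] by (rule dvd_mult2)
  ultimately have "?g dvd num D p w - const (L c) * D ?g * ?F" by (simp only: dvd_add)
  then obtain k where "num D p w - const (L c) * D ?g * ?F = ?g * k" by (auto elim: dvdE)
  then have "num D p w = const (L c) * D ?g * ?F + ?g * k" by (simp add: diff_eq_eq add.commute)
  then show ?thesis by (rule that)
qed

text \<open>Modulo the equation of \<open>c\<close> the numerators become \<open>L c\<close> times
  its derivatives times the other polar equations; this irreducible germ divides neither the other
  equations nor both of its own derivatives.\<close>

lemma polar_not_dvd_num:
  assumes c: "c \<in> polar_at p"
  shows "\<not> (loc c p dvd num dx p u \<and> loc c p dvd num dy p v)"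
proof
  let ?g = "loc c p" and ?F = "\<Prod>d\<in>polar_at p - {c}. loc d p"
  assume *: "?g dvd num dx p u \<and> ?g dvd num dy p v"
  have i: "irreducible ?g" using polar_at_irreducible c by blast
  have "\<not> ?g dvd ?F"
  proof
    assume "?g dvd ?F"
    then obtain d where "d \<in> polar_at p - {c}" "?g dvd loc d p"
      using irreducible_dvd_prod[OF i] by blast
    then show False using loc_inj[of c p d] c by (auto simp: polar_at_def)
  qed
  moreover have "\<not> (?g dvd dx ?g \<and> ?g dvd dy ?g)"
    using not_dvd_both_derivatives[of ?g] i c by (auto simp: irreducible_def polar_at_def through_def)
  moreover have "\<not> ?g dvd const (L c)"
    using c i by (auto simp: polar_at_def irreducible_def is_unit_iff_val dest: dvd_unit_imp_unit)
  moreover obtain k1 where "num dx p u = const (L c) * dx ?g * ?F + ?g * k1" using num_split[OF c] .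
  then have "?g dvd const (L c) * dx ?g * ?F" using * by (simp add: dvd_add_left_iff)
  moreover obtain k2 where "num dy p v = const (L c) * dy ?g * ?F + ?g * k2" using num_split[OF c] .
  then have "?g dvd const (L c) * dy ?g * ?F" using * by (simp add: dvd_add_left_iff)
  ultimately show False using irreducible_dvd_mult[OF i] by blast
qed

lemma polar_branches_transform: "polar_branches (transform eta p) = (\<lambda>c. curve (loc c p)) ` polar_at p"
proof (intro set_eqI iffI)
  let ?f = "\<Prod>c\<in>polar_at p. loc c p"
  obtain u v where uv: "hol ?f * fst (transform eta p) = hol (num dx p u)"
    "hol ?f * snd (transform eta p) = hol (num dy p v)" by (rule transform_num)
  fix S
  { assume S: "S \<in> polar_branches (transform eta p)"
    then have "S \<in> branches" by (simp add: polar_branches_def)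
    then obtain g where g: "irreducible g" "S = curve g" by (auto simp: branches_def is_equation_def)
    have "transform eta p = (Fract (num dx p u) ?f, Fract (num dy p v) ?f)"
      using Fract_eqI[OF uv(1) polar_prod_nz] Fract_eqI[OF uv(2) polar_prod_nz] by (metis prod.collapse)
    then have "?f \<in> S" using S unfolding polar_branches_def by blast
    then have "g dvd ?f" using g by (simp add: curve_def)
    then obtain c where c: "c \<in> polar_at p" "g dvd loc c p"
      using irreducible_dvd_prod[OF g(1)] by blast
    then have "S = curve (loc c p)"
      using g irreducible_dvd_irreducible[OF g(1) polar_at_irreducible] curve_eq_iff by blast
    then show "S \<in> (\<lambda>c. curve (loc c p)) ` polar_at p" using c by blast }
  { assume "S \<in> (\<lambda>c. curve (loc c p)) ` polar_at p"
    then obtain c where c: "c \<in> polar_at p" "S = curve (loc c p)" by blast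
    let ?g = "loc c p"
    have i: "irreducible ?g" using polar_at_irreducible c by blast
    have "False" if h: "h \<notin> S" "transform eta p = (Fract a h, Fract b h)" for a b h
    proof -
      have h0: "h \<noteq> 0" "\<not> ?g dvd h" using h(1) c by (auto simp: curve_def)
      have "hol ?f * (hol a / hol h) = hol (num dx p u)" "hol ?f * (hol b / hol h) = hol (num dy p v)"
        using uv h(2) Fract_conv[of a h] Fract_conv[of b h] by simp_all
      then have "hol (?f * a) = hol (num dx p u * h)" "hol (?f * b) = hol (num dy p v * h)"
        using h0 by (simp_all add: hol_hom(4) field_simps)
      then have "?f * a = num dx p u * h" "?f * b = num dy p v * h" by simp_all
      note fh = this
      have "?g dvd ?f" using dvd_prodI[OF finite_polar_at c(1), of "\<lambda>c. loc c p"] .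
      then have "?g dvd num dx p u * h" "?g dvd num dy p v * h" unfolding fh[symmetric] by simp_all
      then have "?g dvd num dx p u" "?g dvd num dy p v" using irreducible_dvd_mult[OF i] h0 by auto
      then show False using polar_not_dvd_num[OF c(1)] by blast
    qed
    moreover have "S \<in> branches" using c i by (auto simp: branches_def is_equation_def)
    ultimately show "S \<in> polar_branches (transform eta p)" by (auto simp: polar_branches_def) }
qed

lemma polar_branches_eta: "polar_branches eta = S0"
proof -
  have "polar_at [] = Sep ` S0"
    using br L_Sep eqn by (auto simp: polar_at_def through_iff_not_unit irreducible_def)
  then have "polar_branches eta = (\<lambda>S. curve (eqn S)) ` S0"
    using polar_branches_transform[of "[]"] by (simp add: image_image)
  also have "\<dots> = id ` S0" using eqn br by (intro image_cong) auto
  finally show ?thesis by simp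
qed

lemma eta_nz: "eta \<noteq> (0, 0)"
proof
  assume "eta = (0, 0)"
  then have "eta = (Fract 0 1, Fract 0 1)" by (simp add: Zero_fract_def)
  moreover obtain S where S: "S \<in> S0" using ne by blast
  moreover have "1 \<notin> S" using eqn[of S] S br by (auto simp: curve_def irreducible_def)
  ultimately have "S \<notin> polar_branches eta" unfolding polar_branches_def by blast
  then show False using S polar_branches_eta by simp
qed

lemma proportional_num:
  assumes "polar_at p \<noteq> {}"
  obtains u v where "proportional (transform eta p) (num dx p u, num dy p v)"
proof -
  obtain u v where uv: "hol (\<Prod>c\<in>polar_at p. loc c p) * fst (transform eta p) = hol (num dx p u)"
    "hol (\<Prod>c\<in>polar_at p. loc c p) * snd (transform eta p) = hol (num dy p v)" by (rule transform_num)
  let ?f = "\<Prod>c\<in>polar_at p. loc c p"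
  have f: "hol ?f \<noteq> 0" using polar_prod_nz by simp
  have "(num dx p u, num dy p v) \<noteq> (0, 0)"
  proof
    assume "(num dx p u, num dy p v) = (0, 0)"
    then have "transform eta p = (0, 0)" using uv f by (auto simp: prod_eq_iff hol_hom)
    then show False using transform_neq_0[OF eta_nz] by blast
  qed
  then have "proportional (transform eta p) (num dx p u, num dy p v)"
    unfolding proportional_def fst_conv snd_conv uv[symmetric] by (simp add: mult_ac)
  then show ?thesis using that by blast
qed

lemma polar_invariant:
  assumes c: "c \<in> polar_at p"
  shows "invariant (foliation_at eta p) (loc c p)"
proof -
  let ?g = "loc c p" and ?F = "\<Prod>d\<in>polar_at p - {c}. loc d p"
  obtain u v where "proportional (transform eta p) (num dx p u, num dy p v)"
    using proportional_num[of p] c by blast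
  then obtain h where h: "num dx p u = h * fst (foliation_at eta p)" "num dy p v = h * snd (foliation_at eta p)"
    using fol_factor[OF eta_nz] by blast
  obtain k1 where k1: "num dx p u = const (L c) * dx ?g * ?F + ?g * k1" using num_split[OF c] .
  obtain k2 where k2: "num dy p v = const (L c) * dy ?g * ?F + ?g * k2" using num_split[OF c] .
  have "h * wedge (foliation_at eta p) ?g = wedge (num dx p u, num dy p v) ?g"
    using wedge_scale[of h "fst (foliation_at eta p)" "snd (foliation_at eta p)" ?g] h by simp
  also have "\<dots> = ?g * (k1 * dy ?g - k2 * dx ?g)" unfolding k1 k2 wedge_def by (simp add: algebra_simps)
  finally have "?g dvd h * wedge (foliation_at eta p) ?g" by simp
  moreover have "\<not> ?g dvd h" using polar_not_dvd_num[OF c, of u v] h by auto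
  ultimately show ?thesis
    unfolding invariant_def using irreducible_dvd_mult[OF polar_at_irreducible[OF c]] by blast
qed

lemma S0_invariant: "S \<in> S0 \<Longrightarrow> invariant (foliation_at eta []) (eqn S)"
proof -
  assume S: "S \<in> S0"
  then have "Sep S \<in> polar_at []"
    using eqn[of S] br L_Sep by (auto simp: polar_at_def through_iff_not_unit irreducible_def)
  then show ?thesis using polar_invariant[of "Sep S" "[]"] by simp
qed

text \<open>Residue of the form along an exceptional line at the direction of slope \<open>s\<close>.\<close>

definition rho :: "point \<Rightarrow> complex \<Rightarrow> complex" where
  "rho q s = (\<Sum>c | c \<in> polar_at q \<and> tslope (loc c q) = Some s. of_nat (ord (loc c q)) * L c)"

definition slopes :: "point \<Rightarrow> complex set" where
  "slopes q = {s. \<exists>c\<in>polar_at q. tslope (loc c q) = Some s}"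

lemma finite_slopes [simp]: "finite (slopes q)"
proof -
  have "slopes q \<subseteq> (\<lambda>c. the (tslope (loc c q))) ` polar_at q" by (force simp: slopes_def)
  then show ?thesis using finite_subset finite_polar_at by blast
qed

lemma rho_sum: "(\<Sum>c\<in>polar_at q. case tslope (loc c q) of None \<Rightarrow> 0 | Some s \<Rightarrow> L c * of_nat (ord (loc c q)) * g s)
   = (\<Sum>s\<in>slopes q. rho q s * g s)"
proof -
  let ?P = "{c \<in> polar_at q. tslope (loc c q) \<noteq> None}"
  let ?h = "\<lambda>c. case tslope (loc c q) of None \<Rightarrow> 0 | Some s \<Rightarrow> L c * of_nat (ord (loc c q)) * g s"
  have "sum ?h (polar_at q) = sum ?h ?P" by (rule sum.mono_neutral_right) auto
  also have "\<dots> = (\<Sum>s\<in>slopes q. \<Sum>c | c \<in> ?P \<and> the (tslope (loc c q)) = s. ?h c)"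
    by (rule sum.group[symmetric]) (simp, simp, force simp: slopes_def)
  also have "\<dots> = (\<Sum>s\<in>slopes q. rho q s * g s)"
    unfolding rho_def sum_distrib_right
    by (intro sum.cong refl) (auto simp: mult_ac)
  finally show ?thesis .
qed

lemma num_vanish:
  assumes "\<And>f n. vanish n f \<Longrightarrow> vanish (n - 1) (D f)"
  shows "vanish (ord (\<Prod>c\<in>polar_at q. loc c q) - 1) (num D q u)"
proof -
  let ?N = "ord (\<Prod>c\<in>polar_at q. loc c q)"
  have nz: "loc c q \<noteq> 0" if "c \<in> polar_at q" for c using that loc_nz by (auto simp: polar_at_def)
  have "vanish (?N - 1) (const (L c) * D (loc c q) * (\<Prod>d\<in>polar_at q - {c}. loc d q))"
    if c: "c \<in> polar_at q" for c
  proof -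
    let ?F = "\<Prod>d\<in>polar_at q - {c}. loc d q"
    have pF: "(\<Prod>c\<in>polar_at q. loc c q) = loc c q * ?F" using c by (simp add: prod.remove)
    have "?N = ord (loc c q) + ord ?F"
      unfolding pF using nz c by (intro ord_strict1_mult) (auto simp: prod_zero_iff)
    moreover have "ord (loc c q) > 0" using ord_irreducible polar_at_irreducible c by blast
    moreover have "vanish (0 + (ord (loc c q) - 1) + ord ?F) (const (L c) * D (loc c q) * ?F)"
      by (intro vanish_mult vanish_ord assms) (simp add: vanish_def)
    ultimately show ?thesis by simp
  qed
  moreover have "vanish (?N - 1) ((\<Prod>c\<in>polar_at q. loc c q) * u)"
    using vanish_mult[OF vanish_ord, of 0 u] by (auto simp: vanish_def)
  ultimately show ?thesis unfolding num_def by (intro vanish_add vanish_sum)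
qed

lemma tcform_loc:
  assumes "c \<in> cset S0 q"
  obtains so where "tcform (loc c q) so" "through c q \<longrightarrow> so = tslope (loc c q)" "\<not> through c q \<longrightarrow> so = None \<and> ord (loc c q) = 0"
proof (cases "through c q")
  case True
  then show ?thesis using that tcform_irreducible irreducible_loc cset_branches assms by blast
next
  case False
  then have "is_unit (loc c q)" by (simp add: through_iff_not_unit)
  then show ?thesis using that[of None] tcform_unit ord_unit False by blast
qed

lemma transform_hol:
  assumes "L (Exc q) = 0" "\<And>c. c \<in> polar_at q \<Longrightarrow> is_unit (loc c (q @ [t]))"
    and v: "\<And>c. c \<in> cset S0 q \<Longrightarrow> L c \<noteq> 0 \<Longrightarrow> loc c (q @ [t]) * v c = dy (loc c (q @ [t]))"
    and u: "\<And>c. c \<in> cset S0 q \<Longrightarrow> L c \<noteq> 0 \<Longrightarrow> loc c (q @ [t]) * u c = dx (loc c (q @ [t]))"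
  shows "transform eta (q @ [t]) = (hol (\<Sum>c\<in>cset S0 q. const (L c) * u c), hol (\<Sum>c\<in>cset S0 q. const (L c) * v c))"
proof -
  have dl: "hol (const (L c)) * dl D (loc c (q @ [t])) = hol (const (L c) * w c)"
    if "c \<in> cset S0 q" "L c \<noteq> 0 \<Longrightarrow> loc c (q @ [t]) * w c = D (loc c (q @ [t]))" for c D w
  proof (cases "L c = 0")
    case False
    have "hol (loc c (q @ [t])) * hol (w c) = hol (D (loc c (q @ [t])))"
      using that(2)[OF False] by (simp flip: hol_hom(4))
    then have "dl D (loc c (q @ [t])) = hol (w c)" using loc_nz'[OF that(1), of "q @ [t]"]
      by (simp add: dl.simps nonzero_divide_eq_eq mult.commute)
    then show ?thesis by (simp add: hol_hom(4))
  qed (simp add: hol_hom)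
  have "(\<Sum>c\<in>cset S0 (q @ [t]). hol (const (L c)) * dl D (loc c (q @ [t]))) = hol (\<Sum>c\<in>cset S0 q. const (L c) * w c)"
    if "\<And>c. c \<in> cset S0 q \<Longrightarrow> L c \<noteq> 0 \<Longrightarrow> loc c (q @ [t]) * w c = D (loc c (q @ [t]))" for D w
  proof -
    have "(\<Sum>c\<in>cset S0 (q @ [t]). hol (const (L c)) * dl D (loc c (q @ [t]))) =
        (\<Sum>c\<in>cset S0 q. hol (const (L c)) * dl D (loc c (q @ [t])))"
      by (simp add: cset_snoc assms(1) hol_hom)
    also have "\<dots> = hol (\<Sum>c\<in>cset S0 q. const (L c) * w c)"
      unfolding hol_sum using dl that by (intro sum.cong) auto
    finally show ?thesis .
  qed
  then show ?thesis unfolding transform_eta using u v by blast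
qed

lemma ex_log_derivatives:
  assumes "L (Exc q) = 0" "\<And>c. c \<in> polar_at q \<Longrightarrow> is_unit (loc c (q @ [t]))"
  obtains u v where "\<And>c. c \<in> cset S0 q \<Longrightarrow> L c \<noteq> 0 \<Longrightarrow> loc c (q @ [t]) * v c = dy (loc c (q @ [t]))"
    "\<And>c. c \<in> cset S0 q \<Longrightarrow> L c \<noteq> 0 \<Longrightarrow> loc c (q @ [t]) * u c = dx (loc c (q @ [t]))"
    "\<And>c. c \<in> cset S0 q \<Longrightarrow> L c \<noteq> 0 \<Longrightarrow> dx (v c) = dy (u c)"
proof -
  have "\<exists>u v. loc c (q @ [t]) * v = dy (loc c (q @ [t])) \<and> loc c (q @ [t]) * u = dx (loc c (q @ [t])) \<and> dx v = dy u"
    if c: "c \<in> cset S0 q" "L c \<noteq> 0" for c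
  proof -
    have "is_unit (loc c (q @ [t]))"
    proof (cases "through c q")
      case False
      moreover have "c \<noteq> Exc q" using c by auto
      ultimately show ?thesis using through_snocD[of c q t] by (auto simp: through_iff_not_unit)
    qed (use c assms(2) in \<open>auto simp: polar_at_def\<close>)
    then show ?thesis using unit_log_derivative by metis
  qed
  then obtain u v where "\<And>c. c \<in> cset S0 q \<Longrightarrow> L c \<noteq> 0 \<Longrightarrow> loc c (q @ [t]) * v c = dy (loc c (q @ [t])) \<and>
      loc c (q @ [t]) * u c = dx (loc c (q @ [t])) \<and> dx (v c) = dy (u c)" by metis
  then show ?thesis using that by blast
qed

text \<open>Residue zero along the exceptional line and a direction off the polar tangents make the
  form holomorphic. It restricts to this line as the rational function with residues
  \<open>rho q s\<close>, and \<open>val v\<close>, \<open>val (dy v)\<close> are its value and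
  derivative at \<open>z\<close>.\<close>

lemma dicritical_slope:
  assumes "L (Exc q) = 0" "z \<notin> slopes q"
  obtains u v where "transform eta (q @ [Slope z]) = (hol u, hol v)" "dx v = dy u"
    "val v = (\<Sum>s\<in>slopes q. rho q s / (z - s))" "val (dy v) = - (\<Sum>s\<in>slopes q. rho q s / (z - s)\<^sup>2)"
proof -
  have lq: "loc c (q @ [Slope z]) = strict1 (Slope z) (loc c q)" if "c \<in> cset S0 q" for c
    using that by (intro loc_snoc) auto
  have un: "is_unit (loc c (q @ [Slope z]))" if c: "c \<in> polar_at q" for c
    using tslope_Some[OF polar_at_irreducible[OF c], of z] assms(2) c lq[of c] by (auto simp: slopes_def polar_at_def)
  obtain u v where uv: "\<And>c. c \<in> cset S0 q \<Longrightarrow> L c \<noteq> 0 \<Longrightarrow> loc c (q @ [Slope z]) * v c = dy (loc c (q @ [Slope z]))"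
    "\<And>c. c \<in> cset S0 q \<Longrightarrow> L c \<noteq> 0 \<Longrightarrow> loc c (q @ [Slope z]) * u c = dx (loc c (q @ [Slope z]))"
    "\<And>c. c \<in> cset S0 q \<Longrightarrow> L c \<noteq> 0 \<Longrightarrow> dx (v c) = dy (u c)"
    using ex_log_derivatives[OF assms(1), of "Slope z"] un by metis
  have vals: "L c * val (v c) = (if c \<in> polar_at q then case tslope (loc c q) of None \<Rightarrow> 0 | Some s \<Rightarrow> L c * of_nat (ord (loc c q)) * (1 / (z - s)) else 0)"
    "L c * val (dy (v c)) = (if c \<in> polar_at q then case tslope (loc c q) of None \<Rightarrow> 0 | Some s \<Rightarrow> L c * of_nat (ord (loc c q)) * (- 1 / (z - s)\<^sup>2) else 0)"
    if c: "c \<in> cset S0 q" for c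
  proof -
    obtain so where so: "tcform (loc c q) so" "through c q \<longrightarrow> so = tslope (loc c q)"
        "\<not> through c q \<longrightarrow> so = None \<and> ord (loc c q) = 0" using tcform_loc[OF c] .
    have "so \<noteq> Some z" if "L c \<noteq> 0" using so that assms(2) c by (auto simp: slopes_def polar_at_def)
    then have *: "val (v c) = (case so of None \<Rightarrow> 0 | Some s \<Rightarrow> of_nat (ord (loc c q)) / (z - s))"
       "val (dy (v c)) = (case so of None \<Rightarrow> 0 | Some s \<Rightarrow> - of_nat (ord (loc c q)) / (z - s)\<^sup>2)" if "L c \<noteq> 0"
      using log_derivative_slope[OF so(1)] uv(1)[OF c] lq[OF c] that by auto
    show "L c * val (v c) = (if c \<in> polar_at q then case tslope (loc c q) of None \<Rightarrow> 0 | Some s \<Rightarrow> L c * of_nat (ord (loc c q)) * (1 / (z - s)) else 0)"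
      "L c * val (dy (v c)) = (if c \<in> polar_at q then case tslope (loc c q) of None \<Rightarrow> 0 | Some s \<Rightarrow> L c * of_nat (ord (loc c q)) * (- 1 / (z - s)\<^sup>2) else 0)"
      using * so c by (cases "L c = 0"; cases "through c q"; auto simp: polar_at_def split: option.splits)+
  qed
  have pc: "polar_at q \<subseteq> cset S0 q" by (auto simp: polar_at_def)
  have dys: "dy (\<Sum>c\<in>A. const (L c) * v c) = (\<Sum>c\<in>A. const (L c) * dy (v c))"
    "dx (\<Sum>c\<in>A. const (L c) * v c) = (\<Sum>c\<in>A. const (L c) * dx (v c))"
    "dy (\<Sum>c\<in>A. const (L c) * u c) = (\<Sum>c\<in>A. const (L c) * dy (u c))" for A
    by (induction A rule: infinite_finite_induct) (auto simp: dy_mult dx_mult)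
  have ite: "(\<Sum>c\<in>cset S0 q. if c \<in> polar_at q then h c else 0) = sum h (polar_at q)" for h :: "comp \<Rightarrow> complex"
    using pc by (simp add: sum.If_cases Int_absorb1)
  have tr: "transform eta (q @ [Slope z]) =
      (hol (\<Sum>c\<in>cset S0 q. const (L c) * u c), hol (\<Sum>c\<in>cset S0 q. const (L c) * v c))"
    by (rule transform_hol[OF assms(1)]) (fact un uv)+
  show ?thesis
  proof (rule that[OF tr])
    show "dx (\<Sum>c\<in>cset S0 q. const (L c) * v c) = dy (\<Sum>c\<in>cset S0 q. const (L c) * u c)"
      unfolding dys by (intro sum.cong refl) (use uv(3) in \<open>metis const_0 mult_zero_left\<close>)
    have "val (\<Sum>c\<in>cset S0 q. const (L c) * v c) = (\<Sum>c\<in>cset S0 q. L c * val (v c))" by simp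
    also have "\<dots> = (\<Sum>s\<in>slopes q. rho q s * (1 / (z - s)))"
      unfolding rho_sum[symmetric] ite[symmetric] using vals(1) by (intro sum.cong) auto
    finally show "val (\<Sum>c\<in>cset S0 q. const (L c) * v c) = (\<Sum>s\<in>slopes q. rho q s / (z - s))" by simp
    have "val (dy (\<Sum>c\<in>cset S0 q. const (L c) * v c)) = (\<Sum>c\<in>cset S0 q. L c * val (dy (v c)))" by (simp add: dys)
    also have "\<dots> = (\<Sum>s\<in>slopes q. rho q s * (- 1 / (z - s)\<^sup>2))"
      unfolding rho_sum[symmetric] ite[symmetric] using vals(2) by (intro sum.cong) auto
    finally show "val (dy (\<Sum>c\<in>cset S0 q. const (L c) * v c)) = - (\<Sum>s\<in>slopes q. rho q s / (z - s)\<^sup>2)"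
      by (simp add: sum_negf)
  qed
qed

text \<open>The counterpart at infinity: in the coordinate \<open>1 / z\<close> a rational form with
  residues \<open>rho q s\<close> of sum zero takes the value given here.\<close>

lemma dicritical_vertical:
  assumes "L (Exc q) = 0" "\<And>c. c \<in> polar_at q \<Longrightarrow> tslope (loc c q) \<noteq> None"
  obtains u v where "transform eta (q @ [Vertical]) = (hol u, hol v)"
    "val u = - (\<Sum>s\<in>slopes q. rho q s * s)"
proof -
  have lq: "loc c (q @ [Vertical]) = strict1 Vertical (loc c q)" if "c \<in> cset S0 q" for c
    using that by (intro loc_snoc) auto
  have un: "is_unit (loc c (q @ [Vertical]))" if c: "c \<in> polar_at q" for c
  proof -
    obtain s where "tslope (loc c q) = Some s" using assms(2)[OF c] by auto
    then have "\<not> is_unit (strict1 (Slope s) (loc c q))" using tslope_Some[OF polar_at_irreducible[OF c]] by blast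
    then have "is_unit (strict1 Vertical (loc c q))" using unibranch[OF polar_at_irreducible[OF c]] by blast
    then show ?thesis using lq c by (simp add: polar_at_def)
  qed
  obtain u v where uv: "\<And>c. c \<in> cset S0 q \<Longrightarrow> L c \<noteq> 0 \<Longrightarrow> loc c (q @ [Vertical]) * v c = dy (loc c (q @ [Vertical]))"
    "\<And>c. c \<in> cset S0 q \<Longrightarrow> L c \<noteq> 0 \<Longrightarrow> loc c (q @ [Vertical]) * u c = dx (loc c (q @ [Vertical]))"
    using ex_log_derivatives[OF assms(1), of Vertical] un by metis
  have vals: "L c * val (u c) = (if c \<in> polar_at q then case tslope (loc c q) of None \<Rightarrow> 0 | Some s \<Rightarrow> L c * of_nat (ord (loc c q)) * (- s) else 0)"
    if c: "c \<in> cset S0 q" for c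
  proof -
    obtain so where so: "tcform (loc c q) so" "through c q \<longrightarrow> so = tslope (loc c q)"
        "\<not> through c q \<longrightarrow> so = None \<and> ord (loc c q) = 0" using tcform_loc[OF c] .
    have "so = None \<Longrightarrow> ord (loc c q) = 0" if "L c \<noteq> 0"
      using so that assms(2)[of c] c by (cases "through c q") (auto simp: polar_at_def)
    then have "val (u c) = (case so of None \<Rightarrow> 0 | Some s \<Rightarrow> - of_nat (ord (loc c q)) * s)" if "L c \<noteq> 0"
      using log_derivative_vertical[OF so(1)] uv(2)[OF c] lq[OF c] that by auto
    then show ?thesis
      using so c by (cases "L c = 0"; cases "through c q"; auto simp: polar_at_def split: option.splits)
  qed
  have ite: "(\<Sum>c\<in>cset S0 q. if c \<in> polar_at q then h c else 0) = sum h (polar_at q)" for h :: "comp \<Rightarrow> complex"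
    by (simp add: sum.If_cases) (rule sum.cong, auto simp: polar_at_def)
  have tr: "transform eta (q @ [Vertical]) =
      (hol (\<Sum>c\<in>cset S0 q. const (L c) * u c), hol (\<Sum>c\<in>cset S0 q. const (L c) * v c))"
    by (rule transform_hol[OF assms(1)]) (fact un uv)+
  show ?thesis
  proof (rule that[OF tr])
    have "val (\<Sum>c\<in>cset S0 q. const (L c) * u c) = (\<Sum>c\<in>cset S0 q. L c * val (u c))" by simp
    also have "\<dots> = (\<Sum>s\<in>slopes q. rho q s * (- s))"
      unfolding rho_sum[symmetric] ite[symmetric] using vals by (intro sum.cong) auto
    finally show "val (\<Sum>c\<in>cset S0 q. const (L c) * u c) = - (\<Sum>s\<in>slopes q. rho q s * s)"
      by (simp add: sum_negf)
  qed
qed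

text \<open>Numerators vanishing to the order \<open>N\<close> of the denominator would make the
  pulled-back form have a denominator prime to the exceptional line and a
  \<open>dy\<close>-coefficient divisible by \<open>X\<close>. The first contradicts a pole along
  this line, the second a non-zero restriction to it.\<close>

lemma one_faithful_transform:
  assumes ne: "polar_at q \<noteq> {}" and nd: "L (Exc q) \<noteq> 0 \<or> (\<exists>z. z \<notin> slopes q \<and> (\<Sum>s\<in>slopes q. rho q s / (z - s)) \<noteq> 0)"
  shows "one_faithful (transform eta q)"
proof -
  let ?f = "\<Prod>c\<in>polar_at q. loc c q"
  have nz: "loc c q \<noteq> 0" if "c \<in> polar_at q" for c using that loc_nz by (auto simp: polar_at_def)
  define N where "N = ord ?f"
  have N: "N = (\<Sum>c\<in>polar_at q. ord (loc c q))" unfolding N_def using nz by (rule ord_prod)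
  have N0: "N > 0"
    using ne ord_irreducible[OF polar_at_irreducible] finite_polar_at[of q] unfolding N by (simp add: sum_pos)
  obtain u v where uv: "hol ?f * fst (transform eta q) = hol (num dx q u)"
    "hol ?f * snd (transform eta q) = hol (num dy q v)" by (rule transform_num)
  have key: "\<not> (vanish N (num dx q u) \<and> vanish N (num dy q v))"
  proof
    assume van: "vanish N (num dx q u) \<and> vanish N (num dy q v)"
    define H where "H = (\<lambda>z. strict1 (Slope z) ?f)"
    have HX: "\<not> X dvd H z" for z
      using exc_line_not_dvd_strict1[OF polar_prod_nz, of "Slope z" q] by (simp add: H_def)
    have ex: "\<exists>k1 k2. hol (H z) * fst (transform eta (q @ [Slope z])) = hol k1 \<and>
        hol (H z) * snd (transform eta (q @ [Slope z])) = hol (X * k2)" for z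
    proof -
      have "X ^ N dvd blow_slope z (num dx q u)" "X ^ N dvd blow_slope z (num dy q v)"
        using vanish_dvd van by blast+
      then obtain a b where a: "blow_slope z (num dx q u) = X ^ N * a"
        and b: "blow_slope z (num dy q v) = X ^ N * b" by (auto elim!: dvdE)
      define G where "G = H z"
      have bG: "blow_slope z ?f = X ^ N * G" by (simp add: blow_slope_eq G_def H_def N_def)
      have e: "hol (X ^ N) * (hol G * blow_fract (Slope z) (fst (transform eta q))) = hol (X ^ N) * hol a"
        "hol (X ^ N) * (hol G * blow_fract (Slope z) (snd (transform eta q))) = hol (X ^ N) * hol b"
        using arg_cong[OF uv(1), of "blow_fract (Slope z)"] arg_cong[OF uv(2), of "blow_fract (Slope z)"]
        by (simp_all add: blow_fract_hom a b bG hol_hom(4) mult.assoc)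
      have XN: "hol (X ^ N) \<noteq> 0" by simp
      have e': "hol G * blow_fract (Slope z) (fst (transform eta q)) = hol a"
        "hol G * blow_fract (Slope z) (snd (transform eta q)) = hol b"
        using e mult_left_cancel[OF XN] by blast+
      have "transform eta (q @ [Slope z]) = (blow_fract (Slope z) (fst (transform eta q)) +
          hol (Y + const z) * blow_fract (Slope z) (snd (transform eta q)), hol X * blow_fract (Slope z) (snd (transform eta q)))"
        unfolding transform_snoc by (cases "transform eta q") simp
      then have "hol G * fst (transform eta (q @ [Slope z])) = hol (a + (Y + const z) * b)"
        "hol G * snd (transform eta (q @ [Slope z])) = hol (X * b)"
        using e' by (simp_all add: distrib_left mult.left_commute hol_hom)
      then show ?thesis unfolding G_def by blast
    qed
    show False
    proof (cases "L (Exc q) = 0")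
      case False
      \<comment> \<open>Any slope would do: the line created at \<open>q\<close> is a pole at each
        of its points and has equation \<open>X\<close> in this chart.\<close>
      then have "Exc q \<in> polar_at (q @ [Slope 0])" by (simp add: polar_at_def cset_snoc)
      then have "curve X \<in> polar_branches (transform eta (q @ [Slope 0]))"
        unfolding polar_branches_transform by (force intro!: image_eqI[of _ _ "Exc q"])
      moreover obtain k1 k2 where k: "hol (H 0) * fst (transform eta (q @ [Slope 0])) = hol k1"
        "hol (H 0) * snd (transform eta (q @ [Slope 0])) = hol (X * k2)" using ex[of 0] by blast
      have H0: "H 0 \<noteq> 0" using HX[of 0] by auto
      have "transform eta (q @ [Slope 0]) = (Fract k1 (H 0), Fract (X * k2) (H 0))"
        by (intro prod_eqI) (simp_all only: fst_conv snd_conv Fract_eqI[OF k(1) H0] Fract_eqI[OF k(2) H0])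
      moreover have "H 0 \<notin> curve X" using HX by (simp add: curve_def)
      ultimately show False unfolding polar_branches_def by blast
    next
      case True
      then obtain z where z: "z \<notin> slopes q" "(\<Sum>s\<in>slopes q. rho q s / (z - s)) \<noteq> 0" using nd by blast
      obtain u v where u: "transform eta (q @ [Slope z]) = (hol u, hol v)"
        "val v = (\<Sum>s\<in>slopes q. rho q s / (z - s))" using dicritical_slope[OF True z(1)] by blast
      obtain k2 where k2: "hol (H z) * snd (transform eta (q @ [Slope z])) = hol (X * k2)" using ex[of z] by blast
      then have "hol (H z * v) = hol (X * k2)" using u by (simp add: hol_hom(4))
      then have "H z * v = X * k2" by simp
      from arg_cong[OF this, of val] have "val (H z) * val v = 0" by simp
      moreover have "val (H z) \<noteq> 0"
      proof
        assume "val (H z) = 0"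
        then have "poly (tc ?f) z = 0" by (simp add: H_def val_strict1)
        moreover have "tc ?f = (\<Prod>c\<in>polar_at q. tc (loc c q))" using nz by (rule tc_prod)
        ultimately obtain c where c: "c \<in> polar_at q" "poly (tc (loc c q)) z = 0"
          by (auto simp: poly_prod)
        then have "\<not> is_unit (strict1 (Slope z) (loc c q))" by (simp add: is_unit_iff_val val_strict1)
        then show False using z(1) tslope_Some[OF polar_at_irreducible] c by (auto simp: slopes_def)
      qed
      ultimately show False using u(2) z(2) by simp
    qed
  qed
  have fo: "form_ord (num dx q u) (num dy q v) = N - 1"
    using num_vanish[of dx q u] num_vanish[of dy q v] vanish_d key N0
    by (intro form_ord_eqI) (simp_all add: N_def)
  have inj: "inj_on (\<lambda>c. curve (loc c q)) (polar_at q)"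
  proof (rule inj_onI)
    fix c d assume "c \<in> polar_at q" "d \<in> polar_at q" "curve (loc c q) = curve (loc d q)"
    then show "c = d" using loc_inj[of c q d] by (auto simp: curve_eq_iff polar_at_def)
  qed
  define F where "F = (\<lambda>S. loc (the_inv_into (polar_at q) (\<lambda>c. curve (loc c q)) S) q)"
  have F: "F (curve (loc c q)) = loc c q" if "c \<in> polar_at q" for c
    using the_inv_into_f_f[OF inj that] by (simp add: F_def)
  have "(\<Prod>S\<in>polar_branches (transform eta q). F S) = ?f"
    unfolding polar_branches_transform prod.reindex[OF inj] using F by (intro prod.cong) auto
  moreover have "\<forall>S\<in>polar_branches (transform eta q). is_equation S (F S)"
    unfolding polar_branches_transform using F polar_at_irreducible by (auto simp: is_equation_def)
  moreover have "finite (polar_branches (transform eta q))" by (simp add: polar_branches_transform)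
  ultimately show ?thesis
    unfolding one_faithful_def Let_def using uv fo N0 unfolding N_def
    by (intro conjI exI[of _ F] exI[of _ "num dx q u"] exI[of _ "num dy q v"]) auto
qed

end

section \<open>Residues with simple zeros\<close>

text \<open>The weights are the coefficients of the partial fractions of \<open>p / (\<Prod>s\<in>T. z - s)\<close> for a polynomial \<open>p\<close>
  with simple roots off \<open>T\<close>; \<open>b\<close> tells whether infinity is a pole as well.\<close>

lemma ex_simple_weights:
  fixes T :: "complex set"
  assumes T: "finite T" and card: "card T \<ge> 1" "\<not> b \<Longrightarrow> card T \<ge> 2"
  shows "\<exists>w. (\<forall>s\<in>T. w s \<noteq> 0) \<and> (if b then sum w T \<noteq> 0 else sum w T = 0 \<and> (\<Sum>s\<in>T. w s * s) \<noteq> 0) \<and>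
    finite {z. z \<notin> T \<and> (\<Sum>s\<in>T. w s / (z - s)) = 0} \<and>
    (\<forall>z. z \<notin> T \<longrightarrow> (\<Sum>s\<in>T. w s / (z - s)) = 0 \<longrightarrow> (\<Sum>s\<in>T. w s / (z - s)\<^sup>2) \<noteq> 0)"
proof -
  define m where "m = card T"
  \<comment> \<open>\<open>sum w T\<close> is the coefficient of \<open>P\<close> of degree
    \<open>card T - 1\<close>: it is non-zero in the first case and zero in the second, where the
    next one is non-zero, so that the form has neither a pole nor a zero at infinity.\<close>
  define d where "d = (if b then m - 1 else m - 2)"
  have "infinite (UNIV - T)" using T infinite_UNIV_char_0[where 'a=complex] by simp
  then obtain R where R: "R \<subseteq> UNIV - T" "finite R" "card R = d"
    using infinite_arbitrarily_large by blast
  define P where "P = (\<Prod>a\<in>R. [:- a, 1:])"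
  define Q where "Q = (\<Prod>s\<in>T. [:- s, 1:])"
  define Q' where "Q' = (\<lambda>s. \<Prod>s'\<in>T - {s}. [:- s', 1:])"
  \<comment> \<open>The residues of \<open>P / Q\<close> at its simple poles.\<close>
  define w where "w = (\<lambda>s. poly P s / poly (Q' s) s)"
  have deg: "degree (\<Prod>a\<in>B. [:- a, 1:]) = card B \<and> coeff (\<Prod>a\<in>B. [:- a, 1:]) (card B) = 1"
    if "finite B" for B :: "complex set"
  proof -
    have 1: "degree (\<Prod>a\<in>B. [:- a, 1:]) = card B"
      using degree_prod_eq_sum_degree[of B "\<lambda>a. [:- a, 1:]"] by simp
    moreover have "lead_coeff (\<Prod>a\<in>B. [:- a, 1:]) = 1" by (simp add: lead_coeff_prod)
    ultimately show ?thesis by simp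
  qed
  have Q: "Q = [:- s, 1:] * Q' s" if "s \<in> T" for s
    unfolding Q_def Q'_def using T that by (rule prod.remove)
  have Qp: "poly Q z = (z - s) * poly (Q' s) z" if "s \<in> T" for s z
  proof -
    have "poly ([:- s, 1:] * Q' s) z = (z - s) * poly (Q' s) z" by (simp add: algebra_simps)
    then show ?thesis by (simp only: Q[OF that])
  qed
  have Q0: "poly Q z = 0 \<longleftrightarrow> z \<in> T" for z using T by (auto simp: Q_def poly_prod)
  have Q's: "poly (Q' s) s \<noteq> 0" for s using T by (auto simp: Q'_def poly_prod)
  have P0: "poly P z = 0 \<longleftrightarrow> z \<in> R" for z using R by (auto simp: P_def poly_prod)
  have w0: "w s \<noteq> 0" if "s \<in> T" for s using that Q's R P0 by (auto simp: w_def)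
  have m1: "m \<ge> 1" using card by (simp add: m_def)
  have degQ': "degree (Q' s) = m - 1" "coeff (Q' s) (m - 1) = 1" if "s \<in> T" for s
    using deg[of "T - {s}"] T that by (auto simp: Q'_def m_def)
  have dm: "d < m" using m1 card(2) by (auto simp: d_def m_def)
  \<comment> \<open>Lagrange interpolation: both sides have degree below \<open>card T\<close> and
    agree on \<open>T\<close>.\<close>
  have LQ: "(\<Sum>s\<in>T. smult (w s) (Q' s)) = P"
  proof (rule poly_eqI_degree[of T])
    show "poly (\<Sum>s\<in>T. smult (w s) (Q' s)) x = poly P x" if x: "x \<in> T" for x
    proof -
      have "poly (Q' s) x = 0" if "s \<in> T - {x}" for s using that x T by (auto simp: Q'_def poly_prod)
      then have "poly (\<Sum>s\<in>T. smult (w s) (Q' s)) x = w x * poly (Q' x) x"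
        using T x by (simp add: poly_sum sum.remove[of T x])
      then show ?thesis using Q's by (simp add: w_def)
    qed
    have "degree (\<Sum>s\<in>T. smult (w s) (Q' s)) \<le> m - 1"
      by (rule degree_sum_le) (use T degQ' in \<open>auto intro: order_trans[OF degree_smult_le]\<close>)
    then show "degree (\<Sum>s\<in>T. smult (w s) (Q' s)) < card T" using m1 by (simp add: m_def)
    show "degree P < card T" using deg[OF R(2)] R(3) dm by (simp add: P_def m_def)
  qed
  have frac: "(\<Sum>s\<in>T. w s / (z - s)) = poly P z / poly Q z" if z: "z \<notin> T" for z
  proof -
    have "w s / (z - s) = w s * poly (Q' s) z / poly Q z" if "s \<in> T" for s
    proof -
      have "poly Q z \<noteq> 0" using Q0 z by blast
      then show ?thesis unfolding Qp[OF that] by simp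
    qed
    then show ?thesis unfolding LQ[symmetric] by (simp add: poly_sum sum_divide_distrib)
  qed
  have c1: "sum w T = coeff P (m - 1)"
    unfolding LQ[symmetric] using degQ' by (simp add: coeff_sum)
  have "if b then sum w T \<noteq> 0 else sum w T = 0 \<and> (\<Sum>s\<in>T. w s * s) \<noteq> 0"
  proof (cases b)
    case True
    then show ?thesis using c1 deg[OF R(2)] R(3) by (simp add: d_def P_def)
  next
    case False
    then have m2: "m \<ge> 2" using card by (simp add: m_def)
    have s0: "sum w T = 0" unfolding c1
      using deg[OF R(2)] R(3) False m2 by (intro coeff_eq_0) (auto simp: P_def d_def)
    have X: "[:0, 1:] * Q' s = Q + smult s (Q' s)" if "s \<in> T" for s
      unfolding Q[OF that] by (simp add: algebra_simps)
    have "[:0, 1:] * P = (\<Sum>s\<in>T. smult (w s) ([:0, 1:] * Q' s))"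
      unfolding LQ[symmetric] by (simp add: sum_distrib_left smult_sum_right)
    also have "\<dots> = (\<Sum>s\<in>T. smult (w s) Q + smult (w s * s) (Q' s))"
      by (intro sum.cong refl) (simp only: X smult_add_right smult_smult)
    also have "\<dots> = (\<Sum>s\<in>T. smult (w s * s) (Q' s))"
      by (simp add: sum.distrib smult_sum[symmetric] s0)
    finally have "coeff ([:0, 1:] * P) (m - 1) = (\<Sum>s\<in>T. w s * s)"
      using degQ' by (simp add: coeff_sum del: mult_pCons_left)
    moreover have "coeff ([:0, 1:] * P) (m - 1) = 1"
    proof -
      have "m - 1 = Suc d" using m2 False by (simp add: d_def)
      then show ?thesis using deg[OF R(2)] R(3) by (simp add: P_def)
    qed
    ultimately show ?thesis using False s0 by simp
  qed
  moreover have "finite {z. z \<notin> T \<and> (\<Sum>s\<in>T. w s / (z - s)) = 0}"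
  proof (rule finite_subset[OF _ R(2)])
    show "{z. z \<notin> T \<and> (\<Sum>s\<in>T. w s / (z - s)) = 0} \<subseteq> R" using frac P0 Q0 by auto
  qed
  moreover have "(\<Sum>s\<in>T. w s / (z - s)\<^sup>2) \<noteq> 0" if z: "z \<notin> T" "(\<Sum>s\<in>T. w s / (z - s)) = 0" for z
  proof -
    have zR: "z \<in> R" using frac[OF z(1)] z P0 Q0 by auto
    \<comment> \<open>The value of \<open>P1\<close> at \<open>z\<close> is the derivative of
      \<open>P\<close> at this simple root. The computation below turns it into
      \<open>- poly Q z\<close> times the sum of \<open>w s / (z - s)^2\<close>.\<close>
    define P1 where "P1 = (\<Prod>a\<in>R - {z}. [:- a, 1:])"
    have P1: "P = [:- z, 1:] * P1" unfolding P_def P1_def using R zR by (intro prod.remove)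
    have X: "[:- z, 1:] * Q' s = Q + smult (s - z) (Q' s)" if "s \<in> T" for s
      unfolding Q[OF that] by (simp add: algebra_simps smult_diff_left)
    have sz: "s - z \<noteq> 0" if "s \<in> T" for s using that z by auto
    have "[:- z, 1:] * (\<Sum>s\<in>T. smult (w s / (s - z)) (Q' s)) =
        (\<Sum>s\<in>T. smult (w s / (s - z)) Q + smult (w s) (Q' s))"
      unfolding sum_distrib_left
    proof (intro sum.cong refl)
      fix s assume s: "s \<in> T"
      have "[:- z, 1:] * smult (w s / (s - z)) (Q' s) = smult (w s / (s - z)) (Q + smult (s - z) (Q' s))"
        using X[OF s] by (simp only: mult_smult_right)
      then show "[:- z, 1:] * smult (w s / (s - z)) (Q' s) = smult (w s / (s - z)) Q + smult (w s) (Q' s)"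
        using sz[OF s] by (simp only: smult_add_right smult_smult) simp
    qed
    also have "\<dots> = smult (\<Sum>s\<in>T. w s / (s - z)) Q + P"
      by (simp only: sum.distrib smult_sum[symmetric] LQ)
    also have "(\<Sum>s\<in>T. w s / (s - z)) = - (\<Sum>s\<in>T. w s / (z - s))"
      unfolding sum_negf[symmetric] by (intro sum.cong refl) (metis minus_diff_eq divide_minus_right)
    finally have "[:- z, 1:] * (\<Sum>s\<in>T. smult (w s / (s - z)) (Q' s)) = [:- z, 1:] * P1"
      using z(2) P1 by simp
    then have "(\<Sum>s\<in>T. smult (w s / (s - z)) (Q' s)) = P1"
      by (metis mult_left_cancel pCons_eq_0_iff one_neq_zero)
    from arg_cong[OF this, of "\<lambda>p. poly p z"]
    have "poly P1 z = (\<Sum>s\<in>T. w s / (s - z) * poly (Q' s) z)" by (simp add: poly_sum)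
    also have "\<dots> = (\<Sum>s\<in>T. - poly Q z * (w s / (z - s)\<^sup>2))"
    proof (intro sum.cong refl)
      fix s assume s: "s \<in> T"
      have "poly Q z = (z - s) * poly (Q' s) z" by (rule Qp[OF s])
      moreover have "w s / (s - z) = - (w s / (z - s))" by (metis minus_diff_eq divide_minus_right)
      moreover have "z - s \<noteq> 0" using sz[OF s] by auto
      ultimately show "w s / (s - z) * poly (Q' s) z = - poly Q z * (w s / (z - s)\<^sup>2)"
        by (simp add: power2_eq_square)
    qed
    also have "\<dots> = - poly Q z * (\<Sum>s\<in>T. w s / (z - s)\<^sup>2)" by (simp add: sum_distrib_left)
    finally have "poly P1 z = - poly Q z * (\<Sum>s\<in>T. w s / (z - s)\<^sup>2)" .
    moreover have "poly P1 z \<noteq> 0" using R by (auto simp: P1_def poly_prod)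
    ultimately show ?thesis by auto
  qed
  ultimately show ?thesis using w0 by blast
qed

section \<open>From residues at the last level to residues at every level\<close>

definition rl :: "direction \<Rightarrow> germ \<Rightarrow> complex fps" where
  "rl t = (case t of Slope _ \<Rightarrow> rX | Vertical \<Rightarrow> rY)"

text \<open>Intersection number with the exceptional line.\<close>

definition iord :: "direction \<Rightarrow> germ \<Rightarrow> nat" where
  "iord t f = subdegree (rl t f)"

text \<open>Noether's formula for a smooth curve: blowing up the point lowers the intersection
  number with the line by the multiplicity of \<open>f\<close>.\<close>

lemma iord_strict1_cont:
  assumes "\<not> exc_line t dvd f"
  shows "iord t f = iord t (strict1 (cont t) f) + ord f"
proof -
  have main: "subdegree (rX f) = subdegree (rX (strict1 Vertical f)) + ord f" if "\<not> X dvd f" for f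
  proof -
    have f0: "f \<noteq> 0" using that by auto
    have "rX (blow_vertical f) = rX f" by (simp add: fps_eq_iff coeff2_blow_vertical)
    then have e: "rX f = fps_X ^ ord f * rX (strict1 Vertical f)"
      using blow_eq[of Vertical f] by (simp add: rX_mult rX_power)
    then have "rX (strict1 Vertical f) \<noteq> 0" using that by (auto simp: X_dvd_iff)
    then show ?thesis unfolding e by (simp add: subdegree_mult)
  qed
  show ?thesis
  proof (cases t)
    case (Slope s)
    then show ?thesis using main assms by (simp add: iord_def rl_def)
  next
    case Vertical
    then have "\<not> X dvd swap f" using assms by (simp add: dvd_swap_iff)
    from main[OF this] show ?thesis using Vertical
      by (simp add: iord_def rl_def rY_def strict1_Vertical)
  qed
qed

lemma iord_cont: "iord t (exc_line (cont t)) = 1"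
  by (cases t) (auto simp: iord_def rl_def rY_simps)

lemma iord_unit: "is_unit f \<Longrightarrow> iord t f = 0"
  by (cases t) (auto simp: iord_def rl_def is_unit_iff_val val_def intro!: subdegree_eq_0)

lemma iord_strict1_tangent:
  assumes "irreducible f" "\<not> is_unit (strict1 t f)"
  shows "iord t (strict1 t f) = ord f"
proof -
  have main: "subdegree (rX (strict1 (Slope s) f)) = ord f" if f: "irreducible f" "\<not> is_unit (strict1 (Slope s) f)" for f s
  proof -
    obtain a where a: "a \<noteq> 0" "tc f = smult a ([:- s, 1:] ^ ord f)" using unibranch_slope(2)[OF f] by blast
    then have "pcompose (tc f) [:s, 1:] = monom a (ord f)"
      by (simp add: pcompose_smult pcompose_power pcompose_pCons monom_altdef)
    then show ?thesis using a by (simp add: rX_strict1_Slope fps_of_poly_monom)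
  qed
  show ?thesis
  proof (cases t)
    case (Slope s)
    then show ?thesis using main assms by (simp add: iord_def rl_def)
  next
    case Vertical
    then have "irreducible (swap f)" "\<not> is_unit (strict1 (Slope 0) (swap f))"
      using assms irreducible_swap by (auto simp: strict1_Vertical)
    from main[OF this] show ?thesis using Vertical
      by (simp add: iord_def rl_def rY_def strict1_Vertical)
  qed
qed

text \<open>By unibranchness a single direction contributes, with the whole multiplicity.\<close>

lemma sum_iord_strict1:
  assumes "irreducible f \<or> is_unit f" "finite F" "\<And>t. t \<notin> F \<Longrightarrow> is_unit (strict1 t f)"
  shows "(\<Sum>t\<in>F. iord t (strict1 t f)) = ord f"
proof (cases "is_unit f")
  case True
  then show ?thesis by (simp add: iord_unit strict1_unit ord_unit)
next
  case False
  then have f: "irreducible f" using assms by blast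
  then obtain t where t: "\<not> is_unit (strict1 t f)" "\<And>s. s \<noteq> t \<Longrightarrow> is_unit (strict1 s f)"
    using unibranch by blast
  then have "t \<in> F" using assms(3) by blast
  then have "(\<Sum>t\<in>F. iord t (strict1 t f)) = iord t (strict1 t f) + (\<Sum>s\<in>F - {t}. iord s (strict1 s f))"
    using assms(2) by (simp add: sum.remove)
  also have "(\<Sum>s\<in>F - {t}. iord s (strict1 s f)) = 0" using t by (simp add: iord_unit)
  finally show ?thesis using iord_strict1_tangent[OF f t(1)] by simp
qed

lemma dpt_Suc: "dpt q t (Suc k) = dpt q t k @ [cont t]"
  by (simp add: dpt_def replicate_append_same)

lemma dpt_0: "dpt q t 0 = q @ [t]"
  by (simp add: dpt_def)

text \<open>Intersection number of the component of \<open>q\<close>, at its point over the direction \<open>t\<close>, with the other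
  components weighted by \<open>M\<close>.\<close>

definition acc :: "branch set \<Rightarrow> (comp \<Rightarrow> complex) \<Rightarrow> point \<Rightarrow> direction \<Rightarrow> nat \<Rightarrow> complex" where
  "acc S0 M q t k = (\<Sum>c\<in>cset S0 (dpt q t k) - {Exc q}. M c * of_nat (iord t (loc c (dpt q t k))))"

text \<open>The failure of the residue conditions (R.2) and (R.3) at \<open>q\<close>.\<close>

definition defect :: "branch set \<Rightarrow> (comp \<Rightarrow> complex) \<Rightarrow> point \<Rightarrow> complex" where
  "defect S0 M q = M (Exc q) - (\<Sum>c\<in>cset S0 q. of_nat (ord (loc c q)) * M c)"

lemma finite_cset': "finite S0 \<Longrightarrow> finite (cset S0 p)"
  by (simp add: cset_def finite_strict_prefixes)

lemma cset_loc_cases: "S0 \<subseteq> branches \<Longrightarrow> c \<in> cset S0 q \<Longrightarrow> irreducible (loc c p) \<or> is_unit (loc c p)"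
  using irreducible_loc[of c p] by (auto simp: through_iff_not_unit cset_def)

lemma exc_line_not_dvd_cont: "\<not> exc_line t dvd exc_line (cont t)" "\<not> exc_line (cont t) dvd exc_line t"
  by (cases t; simp add: X_dvd_iff Y_dvd_iff rY_simps)+

lemma Exc_not_dvd_Exc:
  assumes "through (Exc a) p" "through (Exc b) p" "a \<noteq> b"
  shows "\<not> loc (Exc a) p dvd loc (Exc b) p"
proof (cases "length a \<le> length b")
  case True
  then obtain t where "loc (Exc a) p = exc_line t" "loc (Exc b) p = exc_line (cont t)"
    using two_comps(2)[OF assms] by blast
  then show ?thesis using exc_line_not_dvd_cont by simp
next
  case False
  then obtain t where "loc (Exc b) p = exc_line t" "loc (Exc a) p = exc_line (cont t)"
    using two_comps(2)[OF assms(2,1)] assms(3) by auto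
  then show ?thesis using exc_line_not_dvd_cont by simp
qed

text \<open>Every other component loses its multiplicity by Noether's formula, and the new one,
  which meets the line once, adds its own weight. This is the defect, except that the component of
  \<open>q\<close>, of multiplicity one, is left out of the sum.\<close>

lemma acc_Suc:
  assumes S0: "finite S0" "S0 \<subseteq> branches"
  shows "acc S0 M q t (Suc k) = acc S0 M q t k + defect S0 M (dpt q t k) + M (Exc q)"
proof -
  let ?p = "dpt q t k"
  have fin: "finite (cset S0 ?p)" using finite_cset' S0 by blast
  have ne: "q \<noteq> ?p" by (simp add: dpt_def)
  have qin: "Exc q \<in> cset S0 ?p" by (auto simp: cset_def dpt_def strict_prefix_def)
  have cs: "cset S0 (dpt q t (Suc k)) - {Exc q} = insert (Exc ?p) (cset S0 ?p - {Exc q})"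
    using ne by (auto simp: dpt_Suc cset_snoc)
  have lc: "loc (Exc ?p) (dpt q t (Suc k)) = exc_line (cont t)" by (simp add: dpt_Suc)
  have lq: "loc c (dpt q t (Suc k)) = strict1 (cont t) (loc c ?p)" if "c \<in> cset S0 ?p" for c
    unfolding dpt_Suc using that by (intro loc_snoc) auto
  have nd: "\<not> exc_line t dvd loc c ?p" if c: "c \<in> cset S0 ?p - {Exc q}" for c
  proof
    assume d: "exc_line t dvd loc c ?p"
    show False
    proof (cases c)
      case (Sep S)
      then show False using Exc_not_dvd_Sep[of S q ?p] d c S0 by (auto simp: cset_def through_Exc_iff)
    next
      case (Exc r)
      have th: "through (Exc q) ?p" by (auto simp: through_Exc_iff)
      have "\<not> is_unit (loc c ?p)" using d dvd_unit_imp_unit irreducible_exc_line[of t] by (auto simp: irreducible_def)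
      then have thr: "through (Exc r) ?p" using Exc by (simp add: through_iff_not_unit)
      have "r \<noteq> q" using c Exc by auto
      then show False using Exc_not_dvd_Exc[OF th thr] d Exc by simp
    qed
  qed
  have "acc S0 M q t (Suc k) = M (Exc ?p) + (\<Sum>c\<in>cset S0 ?p - {Exc q}. M c * of_nat (iord t (strict1 (cont t) (loc c ?p))))"
    unfolding acc_def cs using fin lq by (subst sum.insert) (auto simp: lc iord_cont intro!: sum.cong)
  also have "(\<Sum>c\<in>cset S0 ?p - {Exc q}. M c * of_nat (iord t (strict1 (cont t) (loc c ?p)))) =
      (\<Sum>c\<in>cset S0 ?p - {Exc q}. M c * of_nat (iord t (loc c ?p)) - of_nat (ord (loc c ?p)) * M c)"
    using iord_strict1_cont[OF nd] by (intro sum.cong refl) (simp add: algebra_simps)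
  also have "\<dots> = acc S0 M q t k - ((\<Sum>c\<in>cset S0 ?p. of_nat (ord (loc c ?p)) * M c) - M (Exc q))"
    unfolding sum_subtractf acc_def using fin qin by (simp add: sum.remove[of _ "Exc q"])
  finally show ?thesis by (simp add: defect_def)
qed

lemma acc_eq:
  assumes S0: "finite S0" "S0 \<subseteq> branches"
  shows "acc S0 M q t k = acc S0 M q t 0 + (\<Sum>i<k. defect S0 M (dpt q t i)) + of_nat k * M (Exc q)"
  by (induction k) (auto simp: acc_Suc[OF S0] algebra_simps)

lemma sum_acc_0:
  assumes S0: "finite S0" "S0 \<subseteq> branches" and F: "finite F" "\<And>t c. t \<notin> F \<Longrightarrow> c \<in> cset S0 q \<Longrightarrow> \<not> through c (q @ [t])"
  shows "(\<Sum>t\<in>F. acc S0 M q t 0) = M (Exc q) - defect S0 M q"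
proof -
  have lq: "loc c (q @ [t]) = strict1 t (loc c q)" if "c \<in> cset S0 q" for c t
    using that by (intro loc_snoc) auto
  have a: "acc S0 M q t 0 = (\<Sum>c\<in>cset S0 q. M c * of_nat (iord t (strict1 t (loc c q))))" for t
    unfolding acc_def dpt_0 cset_snoc by (intro sum.cong) (auto simp: lq)
  have "(\<Sum>t\<in>F. acc S0 M q t 0) = (\<Sum>c\<in>cset S0 q. M c * of_nat (\<Sum>t\<in>F. iord t (strict1 t (loc c q))))"
    unfolding a by (subst sum.swap) (simp add: sum_distrib_left)
  also have "\<dots> = (\<Sum>c\<in>cset S0 q. of_nat (ord (loc c q)) * M c)"
  proof (intro sum.cong refl)
    fix c assume c: "c \<in> cset S0 q"
    have "is_unit (strict1 t (loc c q))" if "t \<notin> F" for t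
      using F(2)[OF that c] lq[OF c] by (simp add: through_iff_not_unit)
    then show "M c * of_nat (\<Sum>t\<in>F. iord t (strict1 t (loc c q))) = of_nat (ord (loc c q)) * M c"
      using sum_iord_strict1[OF cset_loc_cases[OF S0(2) c] F(1)] by simp
  qed
  finally show ?thesis by (simp add: defect_def)
qed

text \<open>The hypothesis on the sums is the index theorem (I.3) for the component of \<open>q\<close>. Each blow-up of a
  point of this component changes the intersection number by the defect there, so that the sum of
  the defects along the component vanishes; descending induction removes all but the one at \<open>q\<close>.\<close>

lemma defect_0:
  assumes S0: "finite S0" "S0 \<subseteq> branches" and A: "finite A" "closed_pts A"
    and F: "\<And>q. q \<in> A \<Longrightarrow> finite (F q)" "\<And>q t c. q \<in> A \<Longrightarrow> t \<notin> F q \<Longrightarrow> c \<in> cset S0 q \<Longrightarrow> \<not> through c (q @ [t])"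
    and eq: "\<And>q. q \<in> A \<Longrightarrow> (\<Sum>t\<in>F q. acc S0 M q t (endk A q t)) = M (Exc q) * (1 + of_nat (\<Sum>t\<in>F q. endk A q t))"
    and q: "q \<in> A"
  shows "defect S0 M q = 0"
proof -
  \<comment> \<open>A bound for the lengths, so that the induction can descend from the longest
    centres.\<close>
  define B where "B = Max (length ` A)"
  have B: "length x \<le> B" if "x \<in> A" for x using that A by (simp add: B_def)
  show ?thesis using q
  proof (induction "B - length q" arbitrary: q rule: less_induct)
    case less
    have d: "defect S0 M (dpt q t i) = 0" if "i < endk A q t" for t i
    proof -
      have "dpt q t i \<in> A" using endpt(1)[OF A less.prems] that by blast
      moreover have "length (dpt q t i) > length q" by (simp add: dpt_def)
      ultimately show ?thesis using less.hyps[of "dpt q t i"] B[of "dpt q t i"] by auto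
    qed
    have "(\<Sum>t\<in>F q. acc S0 M q t (endk A q t)) = (\<Sum>t\<in>F q. acc S0 M q t 0 + of_nat (endk A q t) * M (Exc q))"
    proof (intro sum.cong refl)
      fix t
      have "(\<Sum>i<endk A q t. defect S0 M (dpt q t i)) = 0" using d by (intro sum.neutral) auto
      then show "acc S0 M q t (endk A q t) = acc S0 M q t 0 + of_nat (endk A q t) * M (Exc q)"
        using acc_eq[OF S0, of M q t "endk A q t"] by simp
    qed
    also have "\<dots> = M (Exc q) - defect S0 M q + M (Exc q) * of_nat (\<Sum>t\<in>F q. endk A q t)"
      using sum_acc_0[OF S0 F(1)[OF less.prems], of q M] F(2)[OF less.prems]
      by (simp add: sum.distrib sum_distrib_left mult.commute)
    finally show ?case using eq[OF less.prems] by (simp add: algebra_simps)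
  qed
qed

text \<open>By (R.3) the sum vanishes on a dicritical component, so these need not be told apart here.\<close>

function lamE :: "branch set \<Rightarrow> (branch \<Rightarrow> complex) \<Rightarrow> point \<Rightarrow> complex" where
  "lamE S0 l q = (\<Sum>S\<in>S0. of_nat (ord (loc (Sep S) q)) * l S) +
     (\<Sum>r\<in>{r. strict_prefix r q}. of_nat (ord (loc (Exc r) q)) * lamE S0 l r)"
  by pat_completeness auto
termination
  by (relation "measure (\<lambda>(S0, l, q). length q)") (auto dest: prefix_length_less)

declare lamE.simps [simp del]

definition lam :: "branch set \<Rightarrow> (branch \<Rightarrow> complex) \<Rightarrow> comp \<Rightarrow> complex" where
  "lam S0 l c = (case c of Sep S \<Rightarrow> l S | Exc q \<Rightarrow> lamE S0 l q)"

lemma lam_Exc: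
  assumes "finite S0"
  shows "lam S0 l (Exc q) = (\<Sum>c\<in>cset S0 q. of_nat (ord (loc c q)) * lam S0 l c)"
proof -
  have "(\<Sum>c\<in>cset S0 q. of_nat (ord (loc c q)) * lam S0 l c) =
      (\<Sum>c\<in>Sep ` S0. of_nat (ord (loc c q)) * lam S0 l c) + (\<Sum>c\<in>Exc ` {r. strict_prefix r q}. of_nat (ord (loc c q)) * lam S0 l c)"
    unfolding cset_def using assms by (intro sum.union_disjoint) (auto simp: finite_strict_prefixes)
  also have "\<dots> = lamE S0 l q"
    unfolding lamE.simps[of S0 l q] by (subst (1 2) sum.reindex) (auto simp: lam_def inj_on_def)
  finally show ?thesis by (simp add: lam_def)
qed

text \<open>Vanishing defects say that \<open>M\<close> satisfies on \<open>A\<close> the recursion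
  that defines \<open>lam\<close>.\<close>

lemma lam_eqI:
  assumes S0: "finite S0" and A: "closed_pts A"
    and M: "\<And>S. S \<in> S0 \<Longrightarrow> M (Sep S) = l S" "\<And>q. q \<in> A \<Longrightarrow> defect S0 M q = 0"
    and q: "q \<in> A"
  shows "lam S0 l (Exc q) = M (Exc q)"
  using q
proof (induction "length q" arbitrary: q rule: less_induct)
  case less
  have "lam S0 l c = M c" if "c \<in> cset S0 q" for c
  proof (cases c)
    case (Sep S)
    then show ?thesis using that M(1) by (auto simp: cset_def lam_def)
  next
    case (Exc r)
    then have "strict_prefix r q" using that by (auto simp: cset_def)
    then show ?thesis using less.hyps[of r] closed_ptsD[OF A less.prems, of r] Exc prefix_length_less
      by (auto simp: strict_prefix_def)
  qed
  then show ?case unfolding lam_Exc[OF S0] using M(2)[OF less.prems] by (simp add: defect_def)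
qed

section \<open>Construction of the residues\<close>

lemma cset_neq: "c \<in> cset S0 p \<Longrightarrow> c \<noteq> Exc p"
  by auto

lemma iord_transverse:
  assumes "val f = 0" "transverse_germs f (exc_line t)"
  shows "iord t f = 1"
proof -
  have 1: "subdegree g = 1" if "g $ 0 = 0" "g $ 1 \<noteq> 0" for g :: "complex fps"
    using that by (intro subdegreeI) auto
  show ?thesis
    using assms 1[of "rX f"] 1[of "rY f"]
    by (cases t) (auto simp: iord_def rl_def transverse_germs_def val_def)
qed

locale triplet =
  fixes \<Delta> :: dic_struct and \<Sigma> :: separatrices and I :: "nat \<Rightarrow> point \<Rightarrow> branch \<Rightarrow> complex"
  assumes tri: "dicritical_triplet \<Delta> \<Sigma> I"
begin

definition A :: "point set" where "A = set (centres \<Delta>)"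
definition S0 :: "branch set" where "S0 = all_sep \<Sigma>"
definition D0 :: "point set" where "D0 = dic \<Delta> (height \<Delta>)"
definition N0 :: "point set" where "N0 = ndic \<Delta> (height \<Delta>)"

lemma struct: "dicritical_structure \<Delta>" and framed: "framed \<Delta> \<Sigma>" and nonradial: "\<not> radial \<Delta>"
  and index: "index_system \<Delta> \<Sigma> I"
  using tri by (auto simp: dicritical_triplet_def dicritical_duplet_def)

lemma bs: "blowup_seq (centres \<Delta>)"
  using struct by (simp add: dicritical_structure_def)

lemma closedA: "closed_pts A" and NilA: "[] \<in> A" and finA [simp]: "finite A"
  and dist: "distinct (centres \<Delta>)"
  using blowup_seq_closed[OF bs] by (auto simp: A_def)

lemma points_n: "points (centres \<Delta>) (height \<Delta>) = pts A" "points (centres \<Delta>) (length (centres \<Delta>)) = pts A"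
  by (simp_all add: points_eq height_def A_def)

lemma comps_n: "components (centres \<Delta>) (height \<Delta>) = A" "components (centres \<Delta>) (length (centres \<Delta>)) = A"
  by (simp_all add: components_def height_def A_def)

lemma DN: "D0 \<union> N0 = A" "D0 \<inter> N0 = {}"
  using struct comps_n by (auto simp: dicritical_structure_def D0_def N0_def)

text \<open>The type of a component is preserved from each level to the next, so the last level
  decides it; induction runs downwards from there.\<close>

lemma dic_level:
  assumes "j \<le> height \<Delta>"
  shows "dic \<Delta> j = D0 \<inter> set (take j (centres \<Delta>))" "ndic \<Delta> j = N0 \<inter> set (take j (centres \<Delta>))"
proof -
  have un: "dic \<Delta> i \<union> ndic \<Delta> i = set (take i (centres \<Delta>))" "dic \<Delta> i \<inter> ndic \<Delta> i = {}" if "i \<le> height \<Delta>" for i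
    using struct that by (auto simp: dicritical_structure_def components_def)
  have st: "D \<in> dic \<Delta> (i - 1) \<longleftrightarrow> D \<in> dic \<Delta> i"
    if "2 \<le> i" "i \<le> height \<Delta>" "D \<in> set (take (i - 1) (centres \<Delta>))" for D i
    using struct that by (auto simp: dicritical_structure_def components_def)
  have "D \<in> dic \<Delta> j \<longleftrightarrow> D \<in> D0" if "D \<in> set (take j (centres \<Delta>))" for D
    using assms
  proof (induction rule: inc_induct)
    case (step i)
    have "j \<ge> 1" using that by (cases j) auto
    then have "2 \<le> Suc i" using step by simp
    moreover have "D \<in> set (take i (centres \<Delta>))"
      using that step(1) set_take_subset_set_take by (metis subsetD)
    ultimately show ?case using step(3) st[of "Suc i" D] step(2) by simp
  qed (simp add: D0_def)
  then show "dic \<Delta> j = D0 \<inter> set (take j (centres \<Delta>))" "ndic \<Delta> j = N0 \<inter> set (take j (centres \<Delta>))"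
  proof -
    assume m: "\<And>D. D \<in> set (take j (centres \<Delta>)) \<Longrightarrow> D \<in> dic \<Delta> j \<longleftrightarrow> D \<in> D0"
    have T: "set (take j (centres \<Delta>)) \<subseteq> A" by (simp add: A_def set_take_subset)
    show "dic \<Delta> j = D0 \<inter> set (take j (centres \<Delta>))" using m un[OF assms] by blast
    show "ndic \<Delta> j = N0 \<inter> set (take j (centres \<Delta>))" using m un[OF assms] DN T by blast
  qed
qed

lemma dicritical_disjoint:
  "D \<in> D0 \<Longrightarrow> E \<in> D0 \<Longrightarrow> p \<in> pts A \<Longrightarrow> through (Exc D) p \<Longrightarrow> through (Exc E) p \<Longrightarrow> D = E"
proof (rule ccontr)
  assume *: "D \<in> D0" "E \<in> D0" "p \<in> pts A" "through (Exc D) p" "through (Exc E) p" "D \<noteq> E"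
  then have "\<not> intersecting (centres \<Delta>) D E"
    using struct by (simp add: dicritical_structure_def D0_def)
  then show False using * unfolding intersecting_def points_n by blast
qed

lemma finS: "finite S0" and brS: "S0 \<subseteq> branches"
  using framed by (auto simp: framed_def S0_def)

lemma through_pts_in: "p \<in> pts A \<Longrightarrow> through (Exc D) p \<Longrightarrow> D \<in> A"
  using ptsD[OF closedA] through_Exc_strict_prefix by blast

lemma comps_at_eq: "p \<in> pts A \<Longrightarrow> comps_at (centres \<Delta>) p = {D. through (Exc D) p}"
  using through_pts_in by (auto simp: comps_at_def comps_n)

lemma Sep_point_unique:
  assumes "S \<in> branches" "p \<in> pts A" "q \<in> pts A" "through (Sep S) p" "through (Sep S) q"
  shows "p = q"
  using assms pts_antichain[OF closedA] Sep_path_unique by (metis linear)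

lemma ex_sep_point:
  assumes "S \<in> S0"
  shows "\<exists>p D. p \<in> pts A \<and> through (Sep S) p \<and> (\<forall>E. through (Exc E) p \<longleftrightarrow> E = D) \<and>
    ord (loc (Sep S) p) = 1 \<and> transverse_germs (loc (Sep S) p) (loc (Exc D) p)"
proof -
  have "transverse (centres \<Delta>) S" using framed assms by (auto simp: framed_def realizes_eps_def S0_def)
  then obtain p D where p: "trace_point (centres \<Delta>) p" "D \<in> comps_at (centres \<Delta>) p" "through (Sep S) p"
    "ord (loc (Sep S) p) = 1" "transverse_germs (loc (Sep S) p) (loc (Exc D) p)"
    by (auto simp: transverse_def)
  then have pA: "p \<in> pts A" "card (comps_at (centres \<Delta>) p) = 1" by (auto simp: trace_point_def points_n)
  then obtain D' where "comps_at (centres \<Delta>) p = {D'}" by (auto simp: card_1_singleton_iff)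
  then have "{E. through (Exc E) p} = {D}" using p(2) comps_at_eq[OF pA(1)] by auto
  then have "\<forall>E. through (Exc E) p \<longleftrightarrow> E = D" by blast
  then show ?thesis using p pA by blast
qed

text \<open>Both choices are forced on \<open>S0\<close>: a separatrix passes through one point of
  the last level, which is a trace point and so lies on one component.\<close>

definition sp :: "branch \<Rightarrow> point" where
  "sp S = (SOME p. p \<in> pts A \<and> through (Sep S) p)"

definition sD :: "branch \<Rightarrow> point" where
  "sD S = (SOME D. through (Exc D) (sp S))"

lemma sp:
  assumes "S \<in> S0"
  shows "sp S \<in> pts A" "through (Sep S) (sp S)" "through (Exc E) (sp S) \<longleftrightarrow> E = sD S"
    "ord (loc (Sep S) (sp S)) = 1" "transverse_germs (loc (Sep S) (sp S)) (loc (Exc (sD S)) (sp S))"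
proof -
  obtain p D where p: "p \<in> pts A" "through (Sep S) p" "\<And>E. through (Exc E) p \<longleftrightarrow> E = D"
      "ord (loc (Sep S) p) = 1" "transverse_germs (loc (Sep S) p) (loc (Exc D) p)"
    using ex_sep_point[OF assms] by blast
  have "sp S \<in> pts A \<and> through (Sep S) (sp S)" unfolding sp_def by (rule someI[of _ p]) (use p in blast)
  then have e: "sp S = p" using Sep_point_unique brS assms p by blast
  then have "sD S = D" using p(3) by (simp add: sD_def)
  then show "sp S \<in> pts A" "through (Sep S) (sp S)" "through (Exc E) (sp S) \<longleftrightarrow> E = sD S"
    "ord (loc (Sep S) (sp S)) = 1" "transverse_germs (loc (Sep S) (sp S)) (loc (Exc (sD S)) (sp S))"
    using p e by auto
qed

lemma sp_iff: "S \<in> S0 \<Longrightarrow> p \<in> pts A \<Longrightarrow> through (Sep S) p \<longleftrightarrow> p = sp S"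
  using Sep_point_unique[of S p "sp S"] sp(1,2)[of S] brS by auto

lemma sp_inj: "S \<in> S0 \<Longrightarrow> S' \<in> S0 \<Longrightarrow> sp S = sp S' \<Longrightarrow> S = S'"
proof (rule ccontr)
  assume S: "S \<in> S0" "S' \<in> S0" "sp S = sp S'" "S \<noteq> S'"
  have "realizes_eps S0 (centres \<Delta>)" using framed by (simp add: framed_def S0_def)
  then have "\<not> (\<exists>p\<in>pts A. through (Sep S) p \<and> through (Sep S') p)"
    using S unfolding realizes_eps_def points_n by blast
  then show False using sp(1,2)[OF S(1)] sp(2)[OF S(2)] S(3) by auto
qed

lemma sD_in: "S \<in> S0 \<Longrightarrow> sD S \<in> A"
  using sp(1)[of S] sp(3)[of S "sD S"] through_pts_in by simp

lemma meets_iff: "S \<in> S0 \<Longrightarrow> meets (centres \<Delta>) S D \<longleftrightarrow> D = sD S"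
  unfolding meets_def points_n using sp(1,2,3)[of S] sp_iff[of S] comps_at_eq by auto

lemma comp_met: "S \<in> S0 \<Longrightarrow> comp_met (centres \<Delta>) S = sD S"
  by (simp add: comp_met_def meets_iff)

lemma sep_types: "S \<in> S0 \<Longrightarrow> S \<in> dsep \<Sigma> \<longleftrightarrow> sD S \<in> D0" "S \<in> S0 \<Longrightarrow> S \<in> isep \<Sigma> \<longleftrightarrow> sD S \<in> N0"
proof -
  have f: "\<forall>S\<in>S0. S \<in> dsep \<Sigma> \<longleftrightarrow> comp_met (centres \<Delta>) S \<in> D0" "dsep \<Sigma> \<inter> isep \<Sigma> = {}"
    using framed by (simp_all add: framed_def S0_def D0_def)
  then show d: "S \<in> S0 \<Longrightarrow> S \<in> dsep \<Sigma> \<longleftrightarrow> sD S \<in> D0" using comp_met by simp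
  have "S \<in> S0 \<Longrightarrow> S \<in> isep \<Sigma> \<longleftrightarrow> S \<notin> dsep \<Sigma>" using f(2) by (auto simp: S0_def all_sep_def)
  then show "S \<in> S0 \<Longrightarrow> S \<in> isep \<Sigma> \<longleftrightarrow> sD S \<in> N0" using d sD_in[of S] DN by blast
qed

section \<open>Neighbours of a component at the last level\<close>

definition nbr :: "point \<Rightarrow> direction \<Rightarrow> comp \<Rightarrow> bool" where
  "nbr D t c \<longleftrightarrow> c \<in> cset S0 (endpt A D t) \<and> c \<noteq> Exc D \<and> through c (endpt A D t)"

lemma endptA: "D \<in> A \<Longrightarrow> endpt A D t \<in> pts A" "through (Exc D) (endpt A D t)"
  using endpt[OF finA closedA] by (auto simp: endpt_def through_Exc_iff)

lemma loc_endpt: "loc (Exc D) (endpt A D t) = exc_line t"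
  by (simp add: endpt_def)

lemma at_endpt:
  assumes "p \<in> pts A" "through (Exc D) p"
  obtains t where "p = endpt A D t"
  using through_Exc_pts_iff[OF finA closedA] assms by blast

lemma Exc_in_cset: "through (Exc D) p \<Longrightarrow> Exc D \<in> cset S0 p"
  using through_Exc_strict_prefix by (auto simp: cset_def)

text \<open>Normal crossings at the last level: separatrices pass through trace points, no two of
  them meet, and at most two components share a point.\<close>

lemma unique_other:
  assumes "p \<in> pts A" "through (Exc D) p" "c \<in> cset S0 p" "d \<in> cset S0 p" "c \<noteq> Exc D" "d \<noteq> Exc D"
    "through c p" "through d p"
  shows "c = d"
proof -
  have S: "E = sD S \<and> p = sp S" if "Sep S \<in> cset S0 p" "through (Sep S) p" "through (Exc E) p" for S E
    using that sp_iff[of S p] sp(3)[of S E] assms(1) by (auto simp: cset_def)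
  show ?thesis
  proof (cases c; cases d)
    fix S S' assume "c = Sep S" "d = Sep S'"
    then show ?thesis using S assms sp_inj[of S S'] by (auto simp: cset_def)
  next
    fix S E assume "c = Sep S" "d = Exc E"
    then show ?thesis using S[of S D] S[of S E] assms by auto
  next
    fix S E assume "c = Exc E" "d = Sep S"
    then show ?thesis using S[of S D] S[of S E] assms by auto
  next
    fix E F assume "c = Exc E" "d = Exc F"
    then show ?thesis using at_most_two_comps[of D p E F] assms by auto
  qed
qed

lemma nbr_unique: "D \<in> A \<Longrightarrow> nbr D t c \<Longrightarrow> nbr D t d \<Longrightarrow> c = d"
  using unique_other[OF endptA] by (auto simp: nbr_def)

lemma nbr_dir_unique:
  assumes "D \<in> A" "nbr D t c" "nbr D s c"
  shows "t = s"
proof -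
  have "endpt A D t = endpt A D s"
  proof (cases c)
    case (Sep S)
    then show ?thesis using assms sp_iff[of S] endptA by (auto simp: nbr_def cset_def)
  next
    case (Exc E)
    then show ?thesis
      using comps_unique_pt[OF closedA, of D E] assms endptA by (auto simp: nbr_def)
  qed
  then show ?thesis by (rule endpt_inj)
qed

definition TD :: "point \<Rightarrow> direction set" where
  "TD D = {t. \<exists>c. nbr D t c}"

lemma finite_TD: "D \<in> A \<Longrightarrow> finite (TD D)"
proof -
  assume D: "D \<in> A"
  define f where "f = (\<lambda>t. SOME c. nbr D t c)"
  have f: "nbr D t (f t)" if "t \<in> TD D" for t using that someI_ex[of "nbr D t"] by (auto simp: TD_def f_def)
  have "inj_on f (TD D)" using f nbr_dir_unique[OF D] by (metis inj_onI)
  moreover have "f ` TD D \<subseteq> Sep ` S0 \<union> Exc ` A"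
  proof
    fix c assume "c \<in> f ` TD D"
    then obtain t where t: "nbr D t c" using f by blast
    then show "c \<in> Sep ` S0 \<union> Exc ` A"
      using ptsD[OF closedA endptA(1)[OF D]] by (auto simp: nbr_def cset_def)
  qed
  ultimately show ?thesis using finS inj_on_finite by (metis finA finite_UnI finite_imageI)
qed

text \<open>A finite set of directions that suffices for the sums along \<open>D\<close>: those
  blown up further, and those along which some curve passes right after the blow-up of
  \<open>D\<close>.\<close>

definition FT :: "point \<Rightarrow> direction set" where
  "FT D = {t. D @ [t] \<in> A} \<union> {t. \<exists>c\<in>cset S0 D. through c (D @ [t])}"

lemma finite_FT: "finite (FT D)"
proof -
  have "inj_on (\<lambda>t. D @ [t]) {t. D @ [t] \<in> A}" by (auto simp: inj_on_def)
  then have 1: "finite {t. D @ [t] \<in> A}" using finite_imageD[of "\<lambda>t. D @ [t]"] finite_subset[OF _ finA]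
    by (metis (no_types, lifting) image_subsetI mem_Collect_eq)
  have "finite {t. through c (D @ [t])}" if c: "c \<in> cset S0 D" for c
  proof (cases "through c D")
    case True
    have "irreducible (loc c D)" using irreducible_loc[of c D] c brS True by (auto simp: cset_def)
    then obtain s where "\<And>t. \<not> is_unit (strict1 t (loc c D)) \<Longrightarrow> t = s" using unibranch by blast
    moreover have "loc c (D @ [t]) = strict1 t (loc c D)" for t using c by (intro loc_snoc) auto
    ultimately have "{t. through c (D @ [t])} \<subseteq> {s}" by (auto simp: through_iff_not_unit)
    then show ?thesis using finite_subset by blast
  next
    case False
    then have "{t. through c (D @ [t])} = {}" using through_snocD[of c D] cset_neq[OF c] by blast
    then show ?thesis by simp
  qed
  then have "finite (\<Union>c\<in>cset S0 D. {t. through c (D @ [t])})" using finite_cset'[OF finS] by blast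
  moreover have "{t. \<exists>c\<in>cset S0 D. through c (D @ [t])} = (\<Union>c\<in>cset S0 D. {t. through c (D @ [t])})" by blast
  ultimately show ?thesis using 1 by (simp add: FT_def)
qed

lemma endk_0_iff: "D \<in> A \<Longrightarrow> endk A D t = 0 \<longleftrightarrow> D @ [t] \<notin> A"
  using endpt(1)[OF finA closedA, of D t 0] by (simp add: dpt_0)

lemma endpt_notin: "D \<in> A \<Longrightarrow> D @ [t] \<notin> A \<Longrightarrow> endpt A D t = D @ [t]"
  using endk_0_iff[of D t] by (auto simp: endpt_def dpt_0)

lemma TD_subset_FT:
  assumes "D \<in> A" shows "TD D \<subseteq> FT D"
proof
  fix t assume "t \<in> TD D"
  then obtain c where c: "nbr D t c" by (auto simp: TD_def)
  show "t \<in> FT D"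
  proof (cases "endk A D t = 0")
    case True
    then have "endpt A D t = D @ [t]" by (simp add: endpt_def dpt_0)
    then show ?thesis using c by (auto simp: FT_def nbr_def cset_snoc)
  next
    case False
    then show ?thesis using endk_0_iff[OF assms] by (auto simp: FT_def)
  qed
qed

lemma nbr_butlast:
  assumes "endk A D t = Suc k"
  shows "nbr D t (Exc (dpt D t k))"
proof -
  have "endpt A D t = dpt D t k @ [cont t]" using assms by (simp add: endpt_def dpt_Suc)
  moreover have "dpt D t k \<noteq> D" by (simp add: dpt_def)
  ultimately show ?thesis by (simp add: nbr_def cset_snoc)
qed

lemma blown_direction:
  assumes "D \<in> A" "D @ [t] \<in> A"
  shows "t \<in> TD D"
proof -
  obtain k where k: "endk A D t = Suc k" using endk_0_iff[OF assms(1)] assms(2) by (cases "endk A D t") auto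
  then have "nbr D t (Exc (dpt D t k))" by (rule nbr_butlast)
  then show ?thesis by (auto simp: TD_def)
qed

lemma comp_direction:
  assumes "D \<in> A" "c \<in> cset S0 D" "through c (D @ [t])"
  shows "t \<in> TD D"
proof (cases "D @ [t] \<in> A")
  case True
  then show ?thesis using blown_direction assms by blast
next
  case False
  then have "endpt A D t = D @ [t]" using endpt_notin assms(1) by blast
  then have "nbr D t c" using assms by (auto simp: nbr_def cset_snoc)
  then show ?thesis by (auto simp: TD_def)
qed

text \<open>A neighbouring component always exists: over the origin because the radial case is
  excluded, elsewhere because the preceding component, or a later one blown up in between, touches
  \<open>D\<close>. If it is the only one, \<open>D\<close> has valence one and a dicritical
  separatrix gives the second direction.\<close>

lemma card_TD:
  assumes D: "D \<in> D0" shows "card (TD D) \<ge> 2"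
proof -
  have DA: "D \<in> A" using D DN by blast
  let ?T = "{t. \<exists>E. nbr D t (Exc E)}"
  have sub: "?T \<subseteq> TD D" by (auto simp: TD_def)
  have fT: "finite ?T" using finite_subset[OF sub finite_TD[OF DA]] .
  have "{p \<in> pts A. through (Exc D) p \<and> (\<exists>E\<in>A. E \<noteq> D \<and> through (Exc E) p)} = endpt A D ` ?T"
  proof (intro set_eqI iffI)
    fix p assume p: "p \<in> {p \<in> pts A. through (Exc D) p \<and> (\<exists>E\<in>A. E \<noteq> D \<and> through (Exc E) p)}"
    then obtain t where t: "p = endpt A D t" using at_endpt by blast
    then show "p \<in> endpt A D ` ?T" using p Exc_in_cset by (auto simp: nbr_def)
  next
    fix p assume "p \<in> endpt A D ` ?T"
    then obtain t E where t: "p = endpt A D t" "nbr D t (Exc E)" by blast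
    then have "p \<in> pts A" "through (Exc D) p" "through (Exc E) p" "E \<noteq> D"
      using endptA(1)[OF DA] endptA(2) by (auto simp: nbr_def)
    then show "p \<in> {p \<in> pts A. through (Exc D) p \<and> (\<exists>E\<in>A. E \<noteq> D \<and> through (Exc E) p)}"
      using through_pts_in by blast
  qed
  then have Val: "Val (centres \<Delta>) D = card ?T"
    by (simp add: Val_def points_n comps_n card_image inj_on_def endpt_inj)
  have "?T \<noteq> {}"
  proof (cases "D = []")
    case True
    have "length (centres \<Delta>) \<noteq> 1"
    proof
      assume l: "length (centres \<Delta>) = 1"
      then have "A = {[]}" using NilA by (auto simp: A_def length_Suc_conv)
      then have "N0 = {}" using D True DN by auto
      then show False using nonradial l by (simp add: radial_def N0_def height_def)
    qed
    then have l: "length (centres \<Delta>) > 1" using bs by (cases "length (centres \<Delta>)") (auto simp: blowup_seq_def)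
    then have "centres \<Delta> ! 1 \<in> points (centres \<Delta>) 1" using bs by (simp add: blowup_seq_def)
    moreover have "centres \<Delta> ! 0 \<in> points (centres \<Delta>) 0" using bs by (auto simp: blowup_seq_def)
    moreover have "set (take (Suc 0) (centres \<Delta>)) = {centres \<Delta> ! 0}"
      using l by (cases "centres \<Delta>") auto
    ultimately have "butlast (centres \<Delta> ! 1) = []" "centres \<Delta> ! 1 \<noteq> []"
      using l by (auto simp: points_def)
    then obtain t where "centres \<Delta> ! 1 = [] @ [t]" by (metis append_butlast_last_id)
    then have "[] @ [t] \<in> A" using l by (metis A_def nth_mem One_nat_def)
    then obtain k where "endk A [] t = Suc k" using endk_0_iff[OF NilA] by (cases "endk A [] t") auto
    then have "nbr [] t (Exc (dpt [] t k))" by (rule nbr_butlast)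
    then show ?thesis using True by auto
  next
    case False
    define r where "r = butlast D"
    obtain t where t: "D = r @ [t]" using False r_def by (metis append_butlast_last_id)
    have th: "through (Exc r) (D @ [cont t])"
      using t by (auto simp: through_Exc_iff dpt_def intro!: exI[of _ t] exI[of _ 1])
    show ?thesis
    proof (cases "D @ [cont t] \<in> A")
      case True
      then obtain k where "endk A D (cont t) = Suc k" using endk_0_iff[OF DA] by (cases "endk A D (cont t)") auto
      then have "nbr D (cont t) (Exc (dpt D (cont t) k))" by (rule nbr_butlast)
      then show ?thesis by auto
    next
      case False
      then have "endpt A D (cont t) = D @ [cont t]" using endpt_notin DA by blast
      then have "nbr D (cont t) (Exc r)" using th t Exc_in_cset[OF th] by (auto simp: nbr_def)
      then show ?thesis by auto
    qed
  qed
  then have "card ?T \<noteq> 0" using fT by simp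
  show ?thesis
  proof (cases "card ?T = 1")
    case True
    then obtain S where S: "S \<in> dsep \<Sigma>" "comp_met (centres \<Delta>) S = D"
      using framed D Val by (auto simp: framed_def D0_def)
    then have S0: "S \<in> S0" by (simp add: S0_def all_sep_def)
    then have sD: "sD S = D" using S comp_met by simp
    then obtain t where t: "sp S = endpt A D t" using sp(1,3)[OF S0] at_endpt by metis
    then have n: "nbr D t (Sep S)" using sp[OF S0] S0 by (auto simp: nbr_def cset_def)
    have "t \<notin> ?T" using nbr_unique[OF DA n] by auto
    then have "card (insert t ?T) = 2" using True fT by simp
    moreover have "insert t ?T \<subseteq> TD D" using n sub by (auto simp: TD_def)
    ultimately show ?thesis using card_mono[OF finite_TD[OF DA]] by metis
  next
    case False
    then show ?thesis using \<open>card ?T \<noteq> 0\<close> card_mono[OF finite_TD[OF DA] sub] by linarith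
  qed
qed

text \<open>Conditions on the form with residues \<open>w\<close> on the projective line, with
  \<open>Vertical\<close> as infinity: finitely many zeros, all simple, and none at infinity. If
  infinity is not a pole, the sum of \<open>w (Slope s) * s\<close> is, up to sign, the value
  there.\<close>

definition simple_weights :: "direction set \<Rightarrow> (direction \<Rightarrow> complex) \<Rightarrow> bool" where
  "simple_weights T w \<longleftrightarrow> (\<forall>t\<in>T. w t \<noteq> 0) \<and> sum w T = 0 \<and>
    (Vertical \<notin> T \<longrightarrow> (\<Sum>s | Slope s \<in> T. w (Slope s) * s) \<noteq> 0) \<and>
    finite {z. Slope z \<notin> T \<and> (\<Sum>s | Slope s \<in> T. w (Slope s) / (z - s)) = 0} \<and>
    (\<forall>z. Slope z \<notin> T \<longrightarrow> (\<Sum>s | Slope s \<in> T. w (Slope s) / (z - s)) = 0 \<longrightarrow>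
       (\<Sum>s | Slope s \<in> T. w (Slope s) / (z - s)\<^sup>2) \<noteq> 0)"

lemma ex_weights:
  assumes D: "D \<in> D0" shows "\<exists>w. simple_weights (TD D) w"
proof -
  let ?T = "TD D" let ?Ts = "{s. Slope s \<in> ?T}"
  have fT: "finite ?T" using finite_TD D DN by blast
  have eq: "?T = Slope ` ?Ts \<union> (if Vertical \<in> ?T then {Vertical} else {})"
  proof (rule set_eqI)
    fix t show "t \<in> ?T \<longleftrightarrow> t \<in> Slope ` ?Ts \<union> (if Vertical \<in> ?T then {Vertical} else {})"
      by (cases t) auto
  qed
  have inj: "inj_on Slope X" for X by (auto simp: inj_on_def)
  have fTs: "finite ?Ts" using finite_imageD[OF finite_subset[OF _ fT] inj, of ?Ts] by blast
  have split: "sum g ?T = (\<Sum>s\<in>?Ts. g (Slope s)) + (if Vertical \<in> ?T then g Vertical else 0)" for g :: "direction \<Rightarrow> 'a :: comm_monoid_add"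
    by (subst eq, subst sum.union_disjoint) (use fTs in \<open>auto simp: sum.reindex[OF inj]\<close>)
  have "card ?T = card ?Ts + (if Vertical \<in> ?T then 1 else 0)"
    using split[of "\<lambda>_. 1 :: nat"] by simp
  then obtain w where w: "\<forall>s\<in>?Ts. w s \<noteq> 0"
      "if Vertical \<in> ?T then sum w ?Ts \<noteq> 0 else sum w ?Ts = 0 \<and> (\<Sum>s\<in>?Ts. w s * s) \<noteq> 0"
      "finite {z. z \<notin> ?Ts \<and> (\<Sum>s\<in>?Ts. w s / (z - s)) = 0}"
      "\<forall>z. z \<notin> ?Ts \<longrightarrow> (\<Sum>s\<in>?Ts. w s / (z - s)) = 0 \<longrightarrow> (\<Sum>s\<in>?Ts. w s / (z - s)\<^sup>2) \<noteq> 0"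
    using ex_simple_weights[OF fTs, of "Vertical \<in> ?T"] card_TD[OF D] by (auto split: if_splits)
  \<comment> \<open>The weight at infinity makes the total vanish; without a pole there, the finite
    weights already do.\<close>
  define W where "W = (\<lambda>t. case t of Slope s \<Rightarrow> w s | Vertical \<Rightarrow> - sum w ?Ts)"
  have WS: "W (Slope s) = w s" for s by (simp add: W_def)
  have "W t \<noteq> 0" if "t \<in> ?T" for t
    using that w(1,2) by (cases t) (auto simp: W_def)
  moreover have "sum W ?T = 0" using w(2) by (simp add: split W_def split: if_splits)
  ultimately have "simple_weights ?T W"
    unfolding simple_weights_def WS using w(2-4) by (auto split: if_splits)
  then show ?thesis by blast
qed

section \<open>Ratios of residues prescribed by weights and indices\<close>

definition W :: "point \<Rightarrow> direction \<Rightarrow> complex" where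
  "W D = (SOME w. simple_weights (TD D) w)"

lemma W: "D \<in> D0 \<Longrightarrow> simple_weights (TD D) (W D)"
  unfolding W_def using ex_weights by (rule someI_ex)

abbreviation idx :: "point \<Rightarrow> comp \<Rightarrow> complex" where
  "idx p c \<equiv> I (height \<Delta>) p (curve (loc c p))"

text \<open>The residue of a neighbour of \<open>D\<close> is to be \<open>ratio D t * mu D\<close>.
  On a non-dicritical component \<open>mu D\<close> is the residue itself, and consistency requires
  the index to be minus the quotient of the residues; hence the sign.\<close>

definition ratio :: "point \<Rightarrow> direction \<Rightarrow> complex" where
  "ratio D t = (if D \<in> D0 then W D t else - idx (endpt A D t) (Exc D))"

definition mdir :: "point \<Rightarrow> comp \<Rightarrow> direction" where
  "mdir D c = (SOME t. nbr D t c)"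

lemma mdir: "D \<in> A \<Longrightarrow> nbr D t c \<Longrightarrow> mdir D c = t"
  unfolding mdir_def using nbr_dir_unique by (blast intro: some_equality)

lemma meet_nbr:
  assumes "meet A u v"
  obtains t where "u \<in> A" "v \<in> A" "u \<noteq> v" "nbr u t (Exc v)"
proof -
  obtain p where p: "u \<noteq> v" "p \<in> pts A" "through (Exc u) p" "through (Exc v) p"
    using assms by (auto simp: meet_def)
  obtain t where "p = endpt A u t" using at_endpt p by blast
  then have "nbr u t (Exc v)" using p Exc_in_cset[OF p(4)] by (simp add: nbr_def)
  then show ?thesis using that through_pts_in[OF p(2,3)] through_pts_in[OF p(2,4)] p(1) by blast
qed

lemma support_n: "support \<Delta> \<Sigma> (height \<Delta>) = Sep ` S0 \<union> Exc ` N0"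
  by (simp add: support_def S0_def N0_def)

lemma support_branches_eq:
  assumes "p \<in> pts A"
  shows "support_branches \<Delta> \<Sigma> (height \<Delta>) p = (\<lambda>c. curve (loc c p)) ` {c \<in> cset S0 p. through c p \<and> c \<notin> Exc ` D0}"
proof -
  have "c \<in> support \<Delta> \<Sigma> (height \<Delta>) \<and> through c p \<longleftrightarrow> c \<in> cset S0 p \<and> through c p \<and> c \<notin> Exc ` D0" for c
  proof (cases c)
    case (Sep S)
    then show ?thesis by (auto simp: support_n cset_def)
  next
    case (Exc q)
    have "through (Exc q) p \<Longrightarrow> q \<in> N0 \<longleftrightarrow> q \<notin> D0" using through_pts_in[OF assms, of q] DN by blast
    then show ?thesis using Exc Exc_in_cset[of q p] by (auto simp: support_n)
  qed
  then have "{c. c \<in> support \<Delta> \<Sigma> (height \<Delta>) \<and> through c p} = {c \<in> cset S0 p. through c p \<and> c \<notin> Exc ` D0}"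
    by blast
  then show ?thesis unfolding support_branches_def by auto
qed

lemma mult_curve: "irreducible f \<Longrightarrow> mult (curve f) = ord f"
proof -
  assume f: "irreducible f"
  then have "curve f \<in> branches" by (auto simp: branches_def is_equation_def)
  then have e: "irreducible (eqn (curve f))" "curve f = curve (eqn (curve f))" using eqn by auto
  then have "f dvd eqn (curve f)" "eqn (curve f) dvd f" using curve_eq_iff by blast+
  then show ?thesis unfolding mult_def using ord_dvd_mono f e
    by (metis dual_order.antisym irreducible_def)
qed

lemma distinct_curves:
  assumes "c \<in> cset S0 p" "d \<in> cset S0 p" "through c p" "through d p" "c \<noteq> d"
  shows "curve (loc c p) \<noteq> curve (loc d p)"
  using cset_loc_inj[OF brS assms(1,2,3) _ assms(4)] assms(5) by (auto simp: curve_eq_iff)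

text \<open>As neither curve is dicritical, both belong to the support, so the point is singular
  with exactly these two branches and the index conditions apply to them.\<close>

lemma singular_pair:
  assumes D: "D \<in> N0" and c: "nbr D t c" "c \<notin> Exc ` D0"
  defines "p \<equiv> endpt A D t"
  shows "singular_point \<Delta> \<Sigma> (height \<Delta>) p" "idx p (Exc D) \<in> - {0} - pos_rat" "idx p c \<in> - {0} - pos_rat"
    "idx p c = 1 / idx p (Exc D)"
proof -
  have DA: "D \<in> A" using D DN by blast
  have p: "p \<in> pts A" "through (Exc D) p" using endptA DA by (auto simp: p_def)
  have DD: "Exc D \<in> cset S0 p" using Exc_in_cset p by blast
  have c': "c \<in> cset S0 p" "c \<noteq> Exc D" "through c p" using c by (auto simp: nbr_def p_def)
  have "{c \<in> cset S0 p. through c p \<and> c \<notin> Exc ` D0} = {Exc D, c}"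
  proof (intro equalityI subsetI)
    fix d assume "d \<in> {c \<in> cset S0 p. through c p \<and> c \<notin> Exc ` D0}"
    then have "d \<in> cset S0 p" "through d p" by auto
    then show "d \<in> {Exc D, c}" using unique_other[OF p c'(1) _ c'(2) _ c'(3)] by blast
  next
    have "Exc D \<notin> Exc ` D0" using D DN by auto
    moreover fix d assume "d \<in> {Exc D, c}"
    ultimately show "d \<in> {c \<in> cset S0 p. through c p \<and> c \<notin> Exc ` D0}" using DD p c' c(2) by blast
  qed
  then have sb: "support_branches \<Delta> \<Sigma> (height \<Delta>) p = {curve (loc (Exc D) p), curve (loc c p)}"
    using support_branches_eq[OF p(1)] by simp
  have ne: "curve (loc (Exc D) p) \<noteq> curve (loc c p)" using distinct_curves DD c' p by metis
  have "\<not> regular_point \<Delta> \<Sigma> (height \<Delta>) p" using sb ne by (auto simp: regular_point_def doubleton_eq_iff)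
  then show sing: "singular_point \<Delta> \<Sigma> (height \<Delta>) p" using sb by (auto simp: singular_point_def)
  have "\<forall>p \<in> pts A. \<forall>S\<^sub>1 S\<^sub>2. singular_point \<Delta> \<Sigma> (height \<Delta>) p \<and> S\<^sub>1 \<noteq> S\<^sub>2 \<and>
      support_branches \<Delta> \<Sigma> (height \<Delta>) p = {S\<^sub>1, S\<^sub>2} \<longrightarrow>
      I (height \<Delta>) p S\<^sub>1 \<in> - {0} - pos_rat \<and> I (height \<Delta>) p S\<^sub>2 \<in> - {0} - pos_rat \<and>
      I (height \<Delta>) p S\<^sub>2 = 1 / I (height \<Delta>) p S\<^sub>1"
    using index unfolding index_system_def points_n by blast
  then show "idx p (Exc D) \<in> - {0} - pos_rat" "idx p c \<in> - {0} - pos_rat" "idx p c = 1 / idx p (Exc D)"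
    using p(1) sing ne sb by blast+
qed

lemma regular_idx:
  assumes D: "D \<in> N0" and c: "\<And>c. nbr D t c \<Longrightarrow> c \<in> Exc ` D0"
  shows "idx (endpt A D t) (Exc D) = 0"
proof -
  let ?p = "endpt A D t"
  have DA: "D \<in> A" using D DN by blast
  have p: "?p \<in> pts A" "through (Exc D) ?p" using endptA DA by auto
  have "{c \<in> cset S0 ?p. through c ?p \<and> c \<notin> Exc ` D0} = {Exc D}"
    using c Exc_in_cset[OF p(2)] p(2) D DN by (auto simp: nbr_def)
  then have sb: "support_branches \<Delta> \<Sigma> (height \<Delta>) ?p = {curve (loc (Exc D) ?p)}"
    using support_branches_eq[OF p(1)] by simp
  have "mult (curve (loc (Exc D) ?p)) = 1"
    using mult_curve[OF irreducible_exc_line] by (simp add: loc_endpt)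
  then have "regular_point \<Delta> \<Sigma> (height \<Delta>) ?p" using sb by (auto simp: regular_point_def)
  moreover have "\<forall>p \<in> pts A. \<forall>S \<in> support_branches \<Delta> \<Sigma> (height \<Delta>) p.
      regular_point \<Delta> \<Sigma> (height \<Delta>) p \<longrightarrow> I (height \<Delta>) p S = 0"
    using index unfolding index_system_def points_n[symmetric] by blast
  ultimately show ?thesis using p(1) sb by blast
qed


lemma W_nz: "D \<in> D0 \<Longrightarrow> nbr D t c \<Longrightarrow> W D t \<noteq> 0"
  using W by (auto simp: simple_weights_def TD_def)

lemma nbr_dic: "D \<in> D0 \<Longrightarrow> nbr D t (Exc v) \<Longrightarrow> v \<in> N0"
proof -
  assume D: "D \<in> D0" "nbr D t (Exc v)"
  have p: "endpt A D t \<in> pts A" "through (Exc D) (endpt A D t)" "through (Exc v) (endpt A D t)" "v \<noteq> D"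
    using endptA(1)[of D t] endptA(2) D DN by (auto simp: nbr_def)
  then show ?thesis using dicritical_disjoint[of D v] D through_pts_in DN by blast
qed

text \<open>The ratio of the residues of two adjacent components. A dicritical component has residue zero; there
  \<open>mu\<close> is the common factor of the weights instead.\<close>

definition kap :: "point \<Rightarrow> point \<Rightarrow> complex" where
  "kap u v = (if u \<in> D0 then W u (mdir u (Exc v)) else if v \<in> D0 then 1 / W v (mdir v (Exc u))
     else - idx (endpt A u (mdir u (Exc v))) (Exc u))"

text \<open>Between two non-dicritical components the indices are mutually inverse; otherwise one
  ratio is a weight and the other its inverse by definition. Two dicritical components are never
  adjacent.\<close>

lemma kap_inv:
  assumes "meet A u v" shows "kap u v * kap v u = 1"
proof -
  obtain t where t: "u \<in> A" "v \<in> A" "u \<noteq> v" "nbr u t (Exc v)" using meet_nbr[OF assms] .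
  obtain s where s: "nbr v s (Exc u)" using meet_nbr assms meet_sym by metis
  have md: "mdir u (Exc v) = t" "mdir v (Exc u) = s" using mdir t s by auto
  have pe: "endpt A u t = endpt A v s"
    using comps_unique_pt[OF closedA t(3) endptA(1)[OF t(1)] endptA(1)[OF t(2)]] t(4) s endptA(2)
    by (auto simp: nbr_def)
  consider "u \<in> D0" | "v \<in> D0" "u \<notin> D0" | "u \<in> N0" "v \<in> N0" "u \<notin> D0" "v \<notin> D0" using t DN by blast
  then show ?thesis
  proof cases
    case 1
    then have "v \<notin> D0" using nbr_dic t DN by blast
    then show ?thesis using 1 W_nz[OF 1 t(4)] by (simp add: kap_def md)
  next
    case 2
    then show ?thesis using W_nz[OF 2(1) s] by (simp add: kap_def md)
  next
    case 3
    have "Exc v \<notin> Exc ` D0" using 3 by auto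
    note sp = singular_pair[OF 3(1) t(4) this]
    then show ?thesis using 3 by (simp add: kap_def md pe[symmetric])
  qed
qed

lemma ex_mu: "\<exists>\<mu>. (\<forall>u. \<mu> u \<noteq> 0) \<and> (\<forall>u v. meet A u v \<longrightarrow> \<mu> v = kap u v * \<mu> u)"
  using dual_graph_ratios[of "centres \<Delta>" kap] bs kap_inv by (auto simp: A_def)

definition mu :: "point \<Rightarrow> complex" where
  "mu = (SOME \<mu>. (\<forall>u. \<mu> u \<noteq> 0) \<and> (\<forall>u v. meet A u v \<longrightarrow> \<mu> v = kap u v * \<mu> u))"

lemma mu: "mu u \<noteq> 0" "meet A u v \<Longrightarrow> mu v = kap u v * mu u"
  using someI_ex[OF ex_mu] unfolding mu_def[symmetric] by auto

text \<open>The residues as dictated by the last level alone; that they obey the conditions at lower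
  levels is the content of \<open>defect_M\<close>.\<close>

definition M :: "comp \<Rightarrow> complex" where
  "M c = (case c of Exc q \<Rightarrow> if q \<in> D0 then 0 else mu q |
     Sep S \<Rightarrow> ratio (sD S) (mdir (sD S) (Sep S)) * mu (sD S))"

lemma sep_nbr:
  assumes S: "S \<in> S0"
  shows "nbr (sD S) (mdir (sD S) (Sep S)) (Sep S)" "endpt A (sD S) (mdir (sD S) (Sep S)) = sp S"
proof -
  have th: "through (Exc (sD S)) (sp S)" using sp(3)[OF S, of "sD S"] by simp
  obtain t where t: "sp S = endpt A (sD S) t" using at_endpt[OF sp(1)[OF S] th] .
  have n: "nbr (sD S) t (Sep S)" using sp(2)[OF S] t S by (simp add: nbr_def cset_def)
  then have "mdir (sD S) (Sep S) = t" using mdir sD_in[OF S] by blast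
  then show "nbr (sD S) (mdir (sD S) (Sep S)) (Sep S)" "endpt A (sD S) (mdir (sD S) (Sep S)) = sp S"
    using n t by simp_all
qed

lemma nbr_Sep:
  assumes "D \<in> A" "nbr D t (Sep S)"
  shows "S \<in> S0" "D = sD S" "t = mdir (sD S) (Sep S)" "endpt A D t = sp S"
proof -
  show S: "S \<in> S0" using assms by (auto simp: nbr_def cset_def)
  show e: "endpt A D t = sp S" using sp_iff[OF S endptA(1)[OF assms(1)]] assms by (simp add: nbr_def)
  show D: "D = sD S" using sp(3)[OF S, of D] e endptA(2)[of D t] by simp
  show "t = mdir (sD S) (Sep S)" using mdir[OF assms] D by simp
qed

lemma M_nbr:
  assumes D: "D \<in> A" "nbr D t c" and c: "D \<in> D0 \<or> c \<notin> Exc ` D0"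
  shows "M c = ratio D t * mu D"
proof (cases c)
  case (Sep S)
  then show ?thesis using nbr_Sep[of D t S] D by (simp add: M_def)
next
  case (Exc v)
  have v: "v \<notin> D0" using c Exc nbr_dic[of D t v] D DN by auto
  have "v \<noteq> D" "through (Exc v) (endpt A D t)" using D Exc by (auto simp: nbr_def)
  then have "meet A D v" using endptA(1)[OF D(1)] endptA(2) by (auto simp: meet_def)
  then have "mu v = kap D v * mu D" by (rule mu)
  moreover have "kap D v = ratio D t" using v mdir[OF D] Exc by (simp add: kap_def ratio_def)
  ultimately show ?thesis using v Exc by (simp add: M_def)
qed

lemma ratio_nz:
  assumes "D \<in> A" "nbr D t c" "D \<in> D0 \<or> c \<notin> Exc ` D0"
  shows "ratio D t \<noteq> 0"
  using W_nz singular_pair(2)[of D t c] assms DN by (auto simp: ratio_def)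

lemma M_nz: "c \<in> Sep ` S0 \<union> Exc ` N0 \<Longrightarrow> M c \<noteq> 0"
proof (cases c)
  case (Sep S)
  assume "c \<in> Sep ` S0 \<union> Exc ` N0"
  then have S: "S \<in> S0" using Sep by auto
  have "ratio (sD S) (mdir (sD S) (Sep S)) \<noteq> 0"
    using ratio_nz[OF sD_in[OF S] sep_nbr(1)[OF S]] by auto
  then show ?thesis using Sep mu(1) by (simp add: M_def)
next
  case (Exc q)
  assume "c \<in> Sep ` S0 \<union> Exc ` N0"
  then have "q \<notin> D0" using Exc DN by auto
  then show ?thesis using Exc mu(1) by (simp add: M_def)
qed

lemma iord_cong: "exc_line t = exc_line s \<Longrightarrow> iord t f = iord s f"
proof -
  have "X \<noteq> Y" using coeff2_X[of 1 0] coeff2_Y[of 1 0] by auto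
  then show "exc_line t = exc_line s \<Longrightarrow> iord t f = iord s f"
    by (cases t; cases s) (auto simp: iord_def rl_def)
qed

text \<open>Transversality in numbers: of a separatrix to its component, or of the two axes at a
  corner.\<close>

lemma iord_nbr:
  assumes D: "D \<in> A" "nbr D t c"
  shows "iord t (loc c (endpt A D t)) = 1"
proof (cases c)
  case (Sep S)
  have n: "nbr D t (Sep S)" using D Sep by simp
  note S = nbr_Sep[OF D(1) n]
  have "val (loc (Sep S) (sp S)) = 0" using sp(2)[OF S(1)] by (simp add: through_def)
  moreover have "loc (Exc (sD S)) (sp S) = exc_line t" using loc_endpt[of D t] S by simp
  ultimately show ?thesis using iord_transverse sp(5)[OF S(1)] S Sep by simp
next
  case (Exc v)
  let ?p = "endpt A D t"
  have th: "through (Exc D) ?p" "through (Exc v) ?p" "D \<noteq> v" using D Exc endptA(2) by (auto simp: nbr_def)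
  have cc: "exc_line (cont (cont s)) = exc_line s" for s by (cases s) auto
  show ?thesis
  proof (cases "length D \<le> length v")
    case True
    obtain s where s: "loc (Exc D) ?p = exc_line s" "loc (Exc v) ?p = exc_line (cont s)"
      using two_comps(2)[OF th True] by blast
    then have "iord t (loc c ?p) = iord s (loc c ?p)" using loc_endpt[of D t] by (intro iord_cong) simp
    then show ?thesis using s Exc iord_cont by simp
  next
    case False
    obtain s where s: "loc (Exc v) ?p = exc_line s" "loc (Exc D) ?p = exc_line (cont s)"
      using two_comps(2)[OF th(2,1)] th(3) False by auto
    then have "iord t (loc c ?p) = iord (cont s) (loc c ?p)" using loc_endpt[of D t] by (intro iord_cong) simp
    also have "\<dots> = iord (cont s) (exc_line (cont (cont s)))" using s Exc cc by simp
    finally show ?thesis using iord_cont by simp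
  qed
qed

section \<open>The index theorem along a component\<close>

lemma acc_end:
  assumes D: "D \<in> A"
  shows "nbr D t c \<Longrightarrow> acc S0 m D t (endk A D t) = m c" "(\<And>c. \<not> nbr D t c) \<Longrightarrow> acc S0 m D t (endk A D t) = 0"
proof -
  let ?p = "endpt A D t"
  have fin: "finite (cset S0 ?p - {Exc D})" using finite_cset'[OF finS] by blast
  have a: "acc S0 m D t (endk A D t) = (\<Sum>c\<in>cset S0 ?p - {Exc D}. m c * of_nat (iord t (loc c ?p)))"
    by (simp add: acc_def endpt_def)
  have u: "iord t (loc d ?p) = 0" if "d \<in> cset S0 ?p - {Exc D}" "\<not> nbr D t d" for d
    using that iord_unit by (auto simp: nbr_def through_iff_not_unit)
  { assume c: "nbr D t c"
    then have "acc S0 m D t (endk A D t) = (\<Sum>d\<in>{c}. m d * of_nat (iord t (loc d ?p)))"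
      unfolding a
    proof (intro sum.mono_neutral_right fin ballI)
      show "{c} \<subseteq> cset S0 ?p - {Exc D}" using c by (simp add: nbr_def)
      fix d assume d: "d \<in> cset S0 ?p - {Exc D} - {c}"
      then have "\<not> nbr D t d" using nbr_unique[OF D c, of d] by blast
      then show "m d * of_nat (iord t (loc d ?p)) = 0" using u[of d] d by simp
    qed
    then show "acc S0 m D t (endk A D t) = m c" using iord_nbr[OF D c] by simp }
  { assume "\<And>c. \<not> nbr D t c"
    then show "acc S0 m D t (endk A D t) = 0" unfolding a using u by (intro sum.neutral) auto }
qed

text \<open>A centre on the component is determined by its direction and its height over it. By
  definition the self-intersection is minus one minus this number.\<close>

lemma card_through:
  assumes D: "D \<in> A"
  shows "card {k. k < height \<Delta> \<and> through (Exc D) (centres \<Delta> ! k)} = (\<Sum>t\<in>FT D. endk A D t)"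
proof -
  have "inj_on ((!) (centres \<Delta>)) {k. k < height \<Delta> \<and> through (Exc D) (centres \<Delta> ! k)}"
    using dist by (auto simp: inj_on_def height_def nth_eq_iff_index_eq)
  then have "card {k. k < height \<Delta> \<and> through (Exc D) (centres \<Delta> ! k)} =
      card ((!) (centres \<Delta>) ` {k. k < height \<Delta> \<and> through (Exc D) (centres \<Delta> ! k)})"
    by (rule card_image[symmetric])
  also have "(!) (centres \<Delta>) ` {k. k < height \<Delta> \<and> through (Exc D) (centres \<Delta> ! k)} = {x \<in> A. through (Exc D) x}"
    by (auto simp: A_def height_def in_set_conv_nth)
  also have "\<dots> = (\<lambda>(t, k). dpt D t k) ` (SIGMA t:FT D. {..<endk A D t})"
  proof (intro set_eqI iffI)
    fix x assume "x \<in> {x \<in> A. through (Exc D) x}"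
    then obtain t k where x: "x = dpt D t k" "x \<in> A" by (auto simp: through_Exc_iff)
    then have "dpt D t 0 \<in> A" using closed_ptsD[OF closedA _ prefix_dpt[of 0 k D t]] by simp
    then have "t \<in> FT D" by (simp add: FT_def dpt_0)
    then show "x \<in> (\<lambda>(t, k). dpt D t k) ` (SIGMA t:FT D. {..<endk A D t})"
      using x endpt(1)[OF finA closedA D] by force
  next
    fix x assume "x \<in> (\<lambda>(t, k). dpt D t k) ` (SIGMA t:FT D. {..<endk A D t})"
    then show "x \<in> {x \<in> A. through (Exc D) x}"
      using endpt(1)[OF finA closedA D] by (auto simp: through_Exc_iff)
  qed
  also have "card \<dots> = card (SIGMA t:FT D. {..<endk A D t})"
    by (rule card_image) (auto simp: inj_on_def dest: dpt_inj)
  also have "\<dots> = (\<Sum>t\<in>FT D. endk A D t)" using finite_FT by simp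
  finally show ?thesis .
qed

lemma sum_acc_dic:
  assumes D: "D \<in> D0"
  shows "(\<Sum>t\<in>FT D. acc S0 M D t (endk A D t)) = 0"
proof -
  have DA: "D \<in> A" using D DN by blast
  have "acc S0 M D t (endk A D t) = (if t \<in> TD D then W D t * mu D else 0)" for t
  proof (cases "t \<in> TD D")
    case True
    then obtain c where c: "nbr D t c" by (auto simp: TD_def)
    show ?thesis using acc_end(1)[OF DA c, of M] M_nbr[OF DA c] D True by (simp add: ratio_def)
  next
    case False
    then have "\<not> nbr D t c" for c by (auto simp: TD_def)
    then have "acc S0 M D t (endk A D t) = 0" by (rule acc_end(2)[OF DA])
    then show ?thesis using False by simp
  qed
  then have "(\<Sum>t\<in>FT D. acc S0 M D t (endk A D t)) = (\<Sum>t\<in>TD D. W D t * mu D)"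
    using TD_subset_FT[OF DA] finite_FT[of D]
    by (simp add: sum.If_cases Int_absorb1)
  then show ?thesis using W[OF D] by (simp add: simple_weights_def flip: sum_distrib_right)
qed

text \<open>At each point the intersection number is minus the index times \<open>mu D\<close>.
  Dicritical neighbours fit in as well: their residue is zero, and the point is then a regular point
  of the support, of index zero. The sum of the indices is the self-intersection.\<close>

lemma sum_acc_ndic:
  assumes D: "D \<in> N0"
  shows "(\<Sum>t\<in>FT D. acc S0 M D t (endk A D t)) = mu D * (1 + of_nat (\<Sum>t\<in>FT D. endk A D t))"
proof -
  have DA: "D \<in> A" "D \<notin> D0" using D DN by auto
  let ?i = "\<lambda>t. idx (endpt A D t) (Exc D)"
  have a: "acc S0 M D t (endk A D t) = - ?i t * mu D" for t
  proof (cases "\<exists>c. nbr D t c \<and> c \<notin> Exc ` D0")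
    case True
    then obtain c where c: "nbr D t c" "c \<notin> Exc ` D0" by blast
    then show ?thesis using acc_end(1)[OF DA(1) c(1)] M_nbr[OF DA(1) c(1)] DA by (simp add: ratio_def)
  next
    case False
    then have 0: "?i t = 0" using regular_idx[OF D] by blast
    show ?thesis
    proof (cases "\<exists>c. nbr D t c")
      case True
      then obtain v where v: "nbr D t (Exc v)" "v \<in> D0" using False by blast
      then show ?thesis using acc_end(1)[OF DA(1) v(1)] 0 by (simp add: M_def)
    next
      case False
      then show ?thesis using acc_end(2)[OF DA(1)] 0 by simp
    qed
  qed
  have "(\<Sum>p | p \<in> pts A \<and> through (Exc D) p \<and> idx p (Exc D) \<noteq> 0. idx p (Exc D)) = of_int (self_int (centres \<Delta>) (height \<Delta>) D)"
  proof -
    have "height \<Delta> \<in> {1..height \<Delta>}" using bs by (cases "centres \<Delta>") (auto simp: height_def)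
    then show ?thesis using index D unfolding index_system_def N0_def points_n[symmetric] by blast
  qed
  moreover have "{p. p \<in> pts A \<and> through (Exc D) p \<and> idx p (Exc D) \<noteq> 0} = endpt A D ` {t \<in> FT D. ?i t \<noteq> 0}"
  proof (intro set_eqI iffI)
    fix p assume p: "p \<in> {p. p \<in> pts A \<and> through (Exc D) p \<and> idx p (Exc D) \<noteq> 0}"
    then obtain t where t: "p = endpt A D t" using at_endpt by blast
    then obtain c where "nbr D t c" using p regular_idx[OF D] by blast
    then show "p \<in> endpt A D ` {t \<in> FT D. ?i t \<noteq> 0}" using t p TD_subset_FT[OF DA(1)] by (auto simp: TD_def)
  qed (use endptA(1)[OF DA(1)] endptA(2) in auto)
  moreover have "inj_on (endpt A D) {t \<in> FT D. ?i t \<noteq> 0}" by (auto intro: inj_onI endpt_inj)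
  ultimately have "(\<Sum>t | t \<in> FT D \<and> ?i t \<noteq> 0. ?i t) = of_int (self_int (centres \<Delta>) (height \<Delta>) D)"
    by (simp add: sum.reindex)
  moreover have "(\<Sum>t | t \<in> FT D \<and> ?i t \<noteq> 0. ?i t) = (\<Sum>t\<in>FT D. ?i t)"
    using finite_FT by (intro sum.mono_neutral_left) auto
  ultimately have "(\<Sum>t\<in>FT D. ?i t) = - 1 - of_nat (\<Sum>t\<in>FT D. endk A D t)"
    using card_through[OF DA(1)] by (simp add: self_int_def)
  then have "- (\<Sum>t\<in>FT D. ?i t) * mu D = (1 + of_nat (\<Sum>t\<in>FT D. endk A D t)) * mu D" by simp
  then show ?thesis
    unfolding a sum_distrib_right[symmetric] sum_negf by (simp only: mult.commute)
qed

lemma defect_M: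
  assumes "q \<in> A" shows "defect S0 M q = 0"
proof (rule defect_0[OF finS brS finA closedA, of FT])
  show "finite (FT q)" for q by (rule finite_FT)
  show "\<not> through c (q @ [t])" if "q \<in> A" "t \<notin> FT q" "c \<in> cset S0 q" for q t c
    using that by (auto simp: FT_def)
  show "(\<Sum>t\<in>FT q. acc S0 M q t (endk A q t)) = M (Exc q) * (1 + of_nat (\<Sum>t\<in>FT q. endk A q t))" if "q \<in> A" for q
    using sum_acc_dic[of q] sum_acc_ndic[of q] that DN by (auto simp: M_def)
qed (fact assms)

text \<open>Defined at all infinitely near points, also outside \<open>A\<close>, as
  \<open>log_form\<close> demands; on \<open>A\<close> it agrees with \<open>M\<close> because the
  defects vanish.\<close>

definition L :: "comp \<Rightarrow> complex" where
  "L = lam S0 (\<lambda>S. M (Sep S))"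

lemma L_eq: "q \<in> A \<Longrightarrow> L (Exc q) = M (Exc q)" "L (Sep S) = M (Sep S)"
  using lam_eqI[OF finS closedA, of M "\<lambda>S. M (Sep S)"] defect_M by (auto simp: L_def lam_def)

lemma L_dic: "q \<in> D0 \<Longrightarrow> L (Exc q) = 0" and L_ndic: "q \<in> N0 \<Longrightarrow> L (Exc q) \<noteq> 0"
proof -
  show "q \<in> D0 \<Longrightarrow> L (Exc q) = 0" using L_eq(1)[of q] DN by (auto simp: M_def)
  show "q \<in> N0 \<Longrightarrow> L (Exc q) \<noteq> 0" using L_eq(1)[of q] DN M_nz[of "Exc q"] by auto
qed

lemma lam_empty: "lam {} l (Exc q) = 0"
proof (induction "length q" arbitrary: q rule: less_induct)
  case less
  have "lam {} l c = 0" if "c \<in> cset {} q" for c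
    using that less prefix_length_less by (auto simp: cset_def)
  then show ?case by (simp add: lam_Exc)
qed

text \<open>Without separatrices all residues vanish, so every component is dicritical; yet the
  component of the origin would have a neighbour, which cannot be dicritical.\<close>

lemma S0_ne: "S0 \<noteq> {}"
proof
  assume e: "S0 = {}"
  then have "L (Exc q) = 0" for q by (simp add: L_def lam_empty)
  then have "N0 = {}" using L_ndic by blast
  then have D: "[] \<in> D0" using NilA DN by blast
  have "TD [] \<noteq> {}" using card_TD[OF D] by auto
  then obtain t c where c: "nbr [] t c" by (auto simp: TD_def)
  then show False using nbr_dic[OF D, of t] \<open>N0 = {}\<close> e by (cases c) (auto simp: nbr_def cset_def)
qed

sublocale log_form S0 L
proof
  show "finite S0" "S0 \<subseteq> branches" "S0 \<noteq> {}" using finS brS S0_ne by auto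
  show "L (Sep S) \<noteq> 0" if "S \<in> S0" for S using M_nz that by (simp add: L_eq)
  show "L (Exc q) = (\<Sum>c\<in>cset S0 q. of_nat (ord (loc c q)) * L c)" for q
    unfolding L_def by (rule lam_Exc[OF finS])
qed

lemma L_nbr:
  assumes D: "D \<in> A" "nbr D t c" and c: "D \<in> D0 \<or> c \<notin> Exc ` D0"
  shows "L c = ratio D t * mu D"
proof -
  have "L c = M c"
    using D ptsD[OF closedA endptA(1)[OF D(1)]] by (cases c) (auto simp: L_eq nbr_def cset_def)
  then show ?thesis using M_nbr[OF assms] by simp
qed

text \<open>The sums over the support and over \<open>cset\<close> differ only by dicritical
  components, whose residue is zero, and by components not on the way to \<open>q\<close>, whose
  multiplicity there is zero.\<close>

lemma residues: "residue_system \<Delta> \<Sigma> (\<lambda>j. L)"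
  unfolding residue_system_def
proof (intro conjI allI ballI impI)
  fix j c assume j: "j \<le> height \<Delta>" "c \<in> support \<Delta> \<Sigma> j"
  then show "L c \<noteq> 0" using L_Sep L_ndic dic_level(2)[OF j(1)] by (auto simp: support_def S0_def)
next
  fix j assume j: "j < height \<Delta>"
  define q where "q = centres \<Delta> ! j"
  have q: "q \<in> A" using j by (simp add: q_def A_def height_def)
  have qp: "q \<in> pts (set (take j (centres \<Delta>)))" using bs j by (simp add: blowup_seq_def points_eq q_def height_def)
  have cl: "closed_pts (set (take j (centres \<Delta>)))"
    using blowup_seq_closed[OF blowup_seq_take[OF bs], of j] by (cases j) (auto simp: closed_pts_def)
  have nd: "ndic \<Delta> j = N0 \<inter> set (take j (centres \<Delta>))" using dic_level(2) j by simp
  have "(\<Sum>c\<in>support \<Delta> \<Sigma> j. of_nat (ord (loc c q)) * L c) =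
      (\<Sum>c\<in>Sep ` S0 \<union> Exc ` set (take j (centres \<Delta>)). of_nat (ord (loc c q)) * L c)"
  proof (rule sum.mono_neutral_left)
    show "finite (Sep ` S0 \<union> Exc ` set (take j (centres \<Delta>)))" using finS by simp
    show "support \<Delta> \<Sigma> j \<subseteq> Sep ` S0 \<union> Exc ` set (take j (centres \<Delta>))" by (auto simp: support_def nd S0_def)
    show "\<forall>c\<in>Sep ` S0 \<union> Exc ` set (take j (centres \<Delta>)) - support \<Delta> \<Sigma> j. of_nat (ord (loc c q)) * L c = 0"
    proof
      fix c assume c: "c \<in> Sep ` S0 \<union> Exc ` set (take j (centres \<Delta>)) - support \<Delta> \<Sigma> j"
      then obtain x where x: "c = Exc x" "x \<in> set (take j (centres \<Delta>))" "x \<notin> N0"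
        by (auto simp: support_def nd S0_def)
      then have "x \<in> D0" using DN in_set_takeD[OF x(2)] by (auto simp: A_def)
      then show "of_nat (ord (loc c q)) * L c = 0" using L_dic x by simp
    qed
  qed
  also have "\<dots> = (\<Sum>c\<in>cset S0 q. of_nat (ord (loc c q)) * L c)"
  proof (rule sum.mono_neutral_right)
    show "finite (Sep ` S0 \<union> Exc ` set (take j (centres \<Delta>)))" using finS by simp
    show "cset S0 q \<subseteq> Sep ` S0 \<union> Exc ` set (take j (centres \<Delta>))" using ptsD[OF cl qp] by (auto simp: cset_def)
    show "\<forall>c\<in>Sep ` S0 \<union> Exc ` set (take j (centres \<Delta>)) - cset S0 q. of_nat (ord (loc c q)) * L c = 0"
      by (auto simp: cset_def loc.simps ord_unit)
  qed
  finally have s: "(\<Sum>c\<in>support \<Delta> \<Sigma> j. of_nat (ord (loc c q)) * L c) = L (Exc q)" using L_Exc by simp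
  have dq: "q \<in> dic \<Delta> (Suc j) \<longleftrightarrow> q \<in> D0"
    using dic_level(1)[of "Suc j"] j by (auto simp: q_def height_def take_Suc_conv_app_nth)
  show "let q = centres \<Delta> ! j; s = \<Sum>c\<in>support \<Delta> \<Sigma> j. of_nat (ord (loc c q)) * L c in
      if q \<in> dic \<Delta> (Suc j) then s = 0 else L (Exc q) = s \<and> s \<noteq> 0"
    unfolding Let_def q_def[symmetric] s using dq L_dic L_ndic q DN by auto
qed simp

lemma consistent: "consistent \<Delta> \<Sigma> I (\<lambda>j. L)"
  unfolding consistent_def Let_def points_n support_n
proof (intro ballI impI)
  fix p c1 c2 assume p: "p \<in> pts A" and c: "c1 \<in> Sep ` S0 \<union> Exc ` N0" "c2 \<in> Sep ` S0 \<union> Exc ` N0"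
    and *: "singular_point \<Delta> \<Sigma> (height \<Delta>) p \<and> c1 \<noteq> c2 \<and> through c1 p \<and> through c2 p"
  have key: "idx p (Exc u) = - L d / L (Exc u) \<and> idx p d = - L (Exc u) / L d"
    if u: "u \<in> N0" "through (Exc u) p" and d: "d \<in> Sep ` S0 \<union> Exc ` N0" "through d p" "d \<noteq> Exc u" for u d
  proof -
    have uA: "u \<in> A" "u \<notin> D0" using u DN by auto
    obtain t where t: "p = endpt A u t" using at_endpt p u by blast
    have n: "nbr u t d" using d Exc_in_cset t by (auto simp: nbr_def cset_def)
    have dn: "d \<notin> Exc ` D0" using d DN by auto
    have "L d = - idx p (Exc u) * mu u" using L_nbr[OF uA(1) n] dn uA t by (simp add: ratio_def)
    moreover have "L (Exc u) = mu u" using L_eq(1) uA by (simp add: M_def)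
    moreover have "idx p d = 1 / idx p (Exc u)" "idx p (Exc u) \<noteq> 0"
      using singular_pair[OF u(1) n dn] t by auto
    ultimately show ?thesis using mu(1)[of u] by simp
  qed
  show "idx p c1 = - L c2 / L c1 \<and> idx p c2 = - L c1 / L c2"
  proof (cases c1)
    case (Exc u)
    then show ?thesis using key[of u c2] c * by auto
  next
    case (Sep S)
    then have S: "S \<in> S0" "p = sp S" using c * sp_iff[OF _ p] by auto
    show ?thesis
    proof (cases c2)
      case (Exc u)
      then show ?thesis using key[of u c1] c * by auto
    next
      case (Sep S')
      then have "S' \<in> S0" "p = sp S'" using c * sp_iff[OF _ p] by auto
      then show ?thesis using S sp_inj \<open>c1 = Sep S\<close> Sep * by blast
    qed
  qed
qed

lemma quadruplet: "dicritical_quadruplet \<Delta> \<Sigma> I (\<lambda>j. L)"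
  using tri residues consistent by (simp add: dicritical_quadruplet_def)

end

section \<open>Invariant curves at reduced points\<close>

text \<open>Pull-back of a 1-form under the exchange of coordinates.\<close>

definition sw :: "germ \<times> germ \<Rightarrow> germ \<times> germ" where
  "sw \<omega> = (swap (snd \<omega>), swap (fst \<omega>))"

lemma swap_minus: "swap (f - g) = swap f - swap g"
  by (rule germ_eqI) simp

lemma wedge_sw: "wedge (sw \<omega>) (swap f) = - swap (wedge \<omega> f)"
  by (simp add: wedge_def sw_def dx_swap dy_swap swap_minus swap_mult)

lemma invariant_sw: "invariant (sw \<omega>) (swap f) \<longleftrightarrow> invariant \<omega> f"
  by (simp add: invariant_def wedge_sw)

lemma sred_sw: assumes "sred \<omega>" shows "sred (sw \<omega>)"
proof (cases "singular \<omega>")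
  case True
  obtain a b where ab: "\<omega> = (a, b)" by fastforce
  have "simple_singularity \<omega>" using assms True by (simp add: sred_def)
  then obtain m1 m2 where m: "m1 + m2 = val (dx b) - val (dy a)"
      "m1 * m2 = val (dy b) * val (dx a) - val (dx b) * val (dy a)" "m2 \<noteq> 0" "m1 / m2 \<notin> pos_rat"
    by (auto simp: simple_singularity_def ab)
  have "- m1 + - m2 = val (dx (swap a)) - val (dy (swap b))" "- m2 \<noteq> 0" "- m1 / - m2 \<notin> pos_rat"
    "- m1 * - m2 = val (dy (swap a)) * val (dx (swap b)) - val (dx (swap a)) * val (dy (swap b))"
    using m by (auto simp: dx_swap dy_swap algebra_simps)
  then have "simple_singularity (sw \<omega>)"
    using True unfolding simple_singularity_def sw_def ab prod.case fst_conv snd_conv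
    by (intro conjI exI[of _ "- m1"] exI[of _ "- m2"]) (auto simp: singular_def)
  then show ?thesis by (simp add: sred_def)
qed (auto simp: sred_def singular_def sw_def)

lemma val_dvd: "g dvd f \<Longrightarrow> val g = 0 \<Longrightarrow> val f = 0"
  by (auto elim: dvdE)

lemma smooth_irreducible:
  assumes "val g = 0" "val (dx g) \<noteq> 0 \<or> val (dy g) \<noteq> 0"
  shows "irreducible g"
proof (rule irreducibleI)
  show "g \<noteq> 0" using assms by auto
  show "\<not> is_unit g" using assms by (simp add: is_unit_iff_val)
  fix a b assume g: "g = a * b"
  show "is_unit a \<or> is_unit b"
  proof (rule ccontr)
    assume "\<not> (is_unit a \<or> is_unit b)"
    then have "val a = 0" "val b = 0" by (auto simp: is_unit_iff_val)
    then show False using assms(2) g by (simp add: dx_mult dy_mult)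
  qed
qed

lemma smooth_not_dvd_X: "val g = 0 \<Longrightarrow> val (dy g) \<noteq> 0 \<Longrightarrow> \<not> g dvd X"
proof
  assume g: "val g = 0" "val (dy g) \<noteq> 0" "g dvd X"
  then obtain c where c: "X = g * c" by (auto elim: dvdE)
  have "\<not> X dvd g"
  proof
    assume "X dvd g"
    then obtain k where "g = X * k" by (auto elim: dvdE)
    then show False using g(2) by (simp add: dy_mult)
  qed
  then have "X dvd c" using prime_elem_dvd_multD[OF prime_elem_X, of g c] c by auto
  then obtain k where "c = X * k" by (auto elim: dvdE)
  then have "X * 1 = X * (g * k)" using c by (simp add: mult_ac)
  then have "1 = g * k" using mult_left_cancel[OF X_neq_0] by blast
  then have "val (g * k) = 1" by (simp flip: \<open>1 = g * k\<close>)
  then show False using g(1) by simp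
qed

lemma X_power_form:
  assumes "r \<noteq> 0" "dy r = 0"
  obtains k u where "r = X ^ k * u" "val u \<noteq> 0"
proof -
  have z: "coeff2 r i j = 0" if "j \<noteq> 0" for i j
  proof -
    have "coeff2 (dy r) i (j - 1) = 0" using assms(2) by simp
    then show ?thesis using that of_nat_neq_0[of "j - 1"] by (simp del: of_nat_Suc)
  qed
  obtain j where j: "j \<le> ord r" "coeff2 r (ord r - j) j \<noteq> 0" using coeff2_ord_nonzero assms by blast
  then have r: "coeff2 r (ord r) 0 \<noteq> 0" using z by (cases "j = 0") auto
  have "X ^ ord r dvd r"
    unfolding X_power_dvd_iff using z coeff2_less_ord[of _ 0 r] by (metis add.right_neutral)
  then obtain u where u: "r = X ^ ord r * u" by (auto elim: dvdE)
  have "coeff2 r (ord r) 0 = val u" by (subst u) (simp add: X_power_mult val_def)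
  then show ?thesis using that u r by metis
qed

lemma smooth_division:
  assumes "val g = 0" "val (dy g) \<noteq> 0"
  obtains q r where "f = q * g + r" "dy r = 0"
proof -
  have g1: "rX g $ 1 \<noteq> 0" "rX g $ 0 = 0" using assms by (simp_all add: val_def)
  then have s: "subdegree (rX g) = 1"
    by (intro subdegreeI) (auto simp del: rX_nth)
  then have "rX g \<noteq> 0" by auto
  then obtain q r where "f = q * g + r" "\<And>i j. j \<ge> 1 \<Longrightarrow> coeff2 r i j = 0"
    using weierstrass_division[of g f] s by metis
  moreover from this(2) have "dy r = 0" by (intro germ_eqI) simp
  ultimately show ?thesis using that by blast
qed

lemma wedge_add: "wedge \<omega> (f + g) = wedge \<omega> f + wedge \<omega> g"
  by (simp add: wedge_def algebra_simps)

text \<open>Dividing \<open>f\<close> by the smooth invariant curve \<open>g\<close> leaves a remainder depending on \<open>x\<close> only; its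
  lowest order term gives a relation among the coefficients of the foliation.\<close>

lemma invariant_remainder:
  assumes g: "val g = 0" "val (dy g) \<noteq> 0" "invariant (a, b) g" and f: "invariant (a, b) f" "val f = 0"
    and n: "\<not> g dvd f"
  obtains m u h where "val u \<noteq> 0" "wedge (a, b) f = f * h" "g dvd b * (of_nat (Suc m) * u + X * dx u) + X * u * h"
proof -
  obtain q r where qr: "f = q * g + r" "dy r = 0" using smooth_division[OF g(1,2)] .
  have "r \<noteq> 0" using n qr by auto
  then obtain k u where k: "r = X ^ k * u" "val u \<noteq> 0" using X_power_form qr(2) by blast
  have "val r = 0" using f(2) g(1) qr by simp
  then obtain m where m: "k = Suc m" using k by (cases k) auto
  obtain h where h: "wedge (a, b) f = f * h" using f by (auto simp: invariant_def elim: dvdE)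
  obtain h2 where h2: "wedge (a, b) g = g * h2" using g by (auto simp: invariant_def elim: dvdE)
  have "wedge (a, b) f = q * (g * h2) + g * wedge (a, b) q - b * dx r"
    unfolding qr(1) wedge_add wedge_mult_right h2 using qr(2) by (simp add: wedge_def)
  then have "b * dx r + r * h = g * (q * h2 + wedge (a, b) q - q * h)"
    using h unfolding qr(1) by (simp add: algebra_simps)
  moreover have "dx r = X ^ m * (of_nat (Suc m) * u + X * dx u)"
    unfolding k m dx_mult dx_power by (simp add: algebra_simps del: of_nat_Suc)
  moreover have "r = X ^ m * (X * u)" unfolding k m by (simp add: mult_ac)
  ultimately have "g dvd X ^ m * (b * (of_nat (Suc m) * u + X * dx u) + X * u * h)"
    by (simp add: distrib_left mult_ac del: of_nat_Suc)
  moreover have "\<not> g dvd X ^ m"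
    using smooth_not_dvd_X[OF g(1,2)] prime_elem_dvd_power[OF irreducible_imp_prime_elem_germ[OF smooth_irreducible]] g
    by blast
  ultimately have "g dvd b * (of_nat (Suc m) * u + X * dx u) + X * u * h"
    using irreducible_dvd_mult[OF smooth_irreducible] g by blast
  then show ?thesis using that k h by blast
qed

lemma of_nat_const: "(of_nat n :: germ) = const (of_nat n)"
  by (induction n) (simp_all add: const_add)

text \<open>For \<open>g\<close> transverse to \<open>x = 0\<close>, an invariant \<open>f\<close>
  not divisible by \<open>g\<close> would by \<open>invariant_remainder\<close> make
  \<open>b\<close> vanish at the origin, and then invariance of \<open>g\<close> makes
  \<open>a\<close> vanish too. The remaining case follows by exchanging the coordinates.\<close>

lemma regular_leaf_dvd:
  assumes "\<not> singular \<omega>" "val g = 0" "val (dx g) \<noteq> 0 \<or> val (dy g) \<noteq> 0"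
    "invariant \<omega> g" "invariant \<omega> f" "val f = 0"
  shows "g dvd f"
proof -
  have main: "g dvd f" if ns: "\<not> singular \<omega>" and g: "val g = 0" "val (dy g) \<noteq> 0" "invariant \<omega> g"
    and f: "invariant \<omega> f" "val f = 0" for \<omega> g f
  proof (rule ccontr)
    assume n: "\<not> g dvd f"
    obtain a b where ab: "\<omega> = (a, b)" by fastforce
    obtain m u h where m: "val u \<noteq> 0" "g dvd b * (of_nat (Suc m) * u + X * dx u) + X * u * h"
      using invariant_remainder[of g a b f] g f n ab by metis
    have "val (b * (of_nat (Suc m) * u + X * dx u) + X * u * h) = 0"
      using val_dvd[OF m(2)] g(1) by blast
    then have "val b * of_nat (Suc m) = 0" using m(1) by (simp add: of_nat_const del: of_nat_Suc)
    then have b: "val b = 0" by (simp del: of_nat_Suc)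
    have "val (wedge \<omega> g) = 0" using g by (auto simp: invariant_def elim!: dvdE)
    then have "val a = 0" using b g(2) by (simp add: wedge_def ab)
    then show False using ns b by (simp add: singular_def ab)
  qed
  show ?thesis
  proof (cases "val (dy g) = 0")
    case True
    moreover have "\<not> singular (sw \<omega>)" using assms(1) by (auto simp: singular_def sw_def)
    ultimately have "swap g dvd swap f"
      using assms by (intro main[of "sw \<omega>"]) (auto simp: dy_swap invariant_sw)
    then show ?thesis by simp
  qed (use main assms in blast)
qed

text \<open>A third invariant branch gives two relations, one from the remainder modulo
  \<open>g\<close> and one from the restriction to \<open>x = 0\<close>. Together they make the
  eigenvalues \<open>val b1\<close> and \<open>- val (dy a)\<close> proportional to the positive
  integers \<open>d\<close> and \<open>Suc m\<close>, against simplicity.\<close>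

lemma simple_leaves_dvd:
  assumes sr: "sred \<omega>" and e: "invariant \<omega> X" and g: "val g = 0" "val (dy g) \<noteq> 0" "invariant \<omega> g"
    and f: "invariant \<omega> f" "val f = 0" "\<not> X dvd f"
  shows "g dvd f"
proof (rule ccontr)
  assume n: "\<not> g dvd f"
  obtain a b where ab: "\<omega> = (a, b)" by fastforce
  have "X dvd b" using e by (simp add: invariant_def wedge_def ab)
  then obtain b1 where b1: "b = X * b1" by (auto elim: dvdE)
  obtain m u h where m: "val u \<noteq> 0" "wedge (a, b) f = f * h" "g dvd b * (of_nat (Suc m) * u + X * dx u) + X * u * h"
    using invariant_remainder[of g a b f] g f n ab by metis
  have "g dvd X * (b1 * (of_nat (Suc m) * u + X * dx u) + u * h)"
    using m(3) b1 by (simp add: algebra_simps)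
  then have "g dvd b1 * (of_nat (Suc m) * u + X * dx u) + u * h"
    using irreducible_dvd_mult[OF smooth_irreducible] g smooth_not_dvd_X by blast
  then have "val (b1 * (of_nat (Suc m) * u + X * dx u) + u * h) = 0" using val_dvd g(1) by blast
  then have "val u * (val b1 * of_nat (Suc m) + val h) = 0"
    by (simp add: of_nat_const algebra_simps del: of_nat_Suc)
  then have 1: "val b1 * of_nat (Suc m) + val h = 0" using m(1) by simp
  have "val (wedge \<omega> g) = 0" using g by (auto simp: invariant_def elim!: dvdE)
  then have a0: "val a = 0" using g(2) by (simp add: wedge_def ab b1)
  define d where "d = subdegree (rX f)"
  have f0: "rX f \<noteq> 0" using f(3) by (simp add: X_dvd_iff)
  have d0: "d > 0"
    using f0 f(2) nth_subdegree_nonzero[OF f0] by (cases d) (auto simp: d_def val_def)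
  have "rX (dy f) = fps_deriv (rX f)" by (simp add: fps_eq_iff)
  then have e: "rX a * fps_deriv (rX f) = rX f * rX h"
    using arg_cong[OF m(2), of rX] by (simp add: wedge_def b1 rX_mult rX_minus)
  have "(rX a * fps_deriv (rX f)) $ d = val (dy a) * of_nat d * rX f $ d"
  proof -
    have "(rX a * fps_deriv (rX f)) $ d = (\<Sum>i\<in>{0..d}. rX a $ i * (fps_deriv (rX f) $ (d - i)))"
      by (rule fps_mult_nth)
    also have "\<dots> = (\<Sum>i\<in>{1}. rX a $ i * (fps_deriv (rX f) $ (d - i)))"
    proof (rule sum.mono_neutral_right)
      show "\<forall>i\<in>{0..d} - {1}. rX a $ i * (fps_deriv (rX f) $ (d - i)) = 0"
      proof
        fix i assume i: "i \<in> {0..d} - {1}"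
        show "rX a $ i * (fps_deriv (rX f) $ (d - i)) = 0"
        proof (cases "i = 0")
          case True
          then show ?thesis using a0 by (simp add: val_def)
        next
          case False
          then have "Suc (d - i) < subdegree (rX f)" using i d_def by auto
          then have "rX f $ Suc (d - i) = 0" by (rule nth_less_subdegree_zero)
          then show ?thesis by simp
        qed
      qed
    qed (use d0 in auto)
    also have "\<dots> = val (dy a) * of_nat d * rX f $ d"
      using d0 by (simp add: val_def)
    finally show ?thesis .
  qed
  moreover have "(rX f * rX h) $ d = rX f $ d * val h"
  proof -
    have "(rX f * rX h) $ d = (\<Sum>i\<in>{0..d}. rX f $ i * rX h $ (d - i))" by (rule fps_mult_nth)
    also have "\<dots> = (\<Sum>i\<in>{d}. rX f $ i * rX h $ (d - i))"
    proof (rule sum.mono_neutral_right)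
      show "\<forall>i\<in>{0..d} - {d}. rX f $ i * rX h $ (d - i) = 0"
      proof
        fix i assume "i \<in> {0..d} - {d}"
        then have "i < subdegree (rX f)" using d_def by auto
        then have "rX f $ i = 0" by (rule nth_less_subdegree_zero)
        then show "rX f $ i * rX h $ (d - i) = 0" by (simp only: mult_zero_left)
      qed
    qed auto
    finally show ?thesis by (simp add: val_def)
  qed
  moreover have "rX f $ d \<noteq> 0" using f0 by (simp add: d_def del: rX_nth)
  ultimately have 2: "val (dy a) * of_nat d = val h" using e by simp
  have "singular \<omega>" using a0 by (simp add: singular_def ab b1)
  then have "simple_singularity \<omega>" using sr by (simp add: sred_def)
  then obtain m1 m2 where mm: "m1 + m2 = val b1 - val (dy a)" "m1 * m2 = - val b1 * val (dy a)" "m2 \<noteq> 0" "m1 / m2 \<notin> pos_rat"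
    by (auto simp: simple_singularity_def ab b1 dx_mult dy_mult)
  define N where "N = (of_nat (Suc m) :: complex)" define D where "D = (of_nat d :: complex)"
  have ND: "N \<noteq> 0" "D \<noteq> 0" using d0 by (auto simp: N_def D_def simp del: of_nat_Suc)
  have rq: "of_nat k / of_nat l \<in> pos_rat" if "k > 0" "l > 0" for k l :: nat
  proof -
    have "(of_nat k / of_nat l :: complex) = of_rat (of_nat k / of_nat l)" by (simp add: of_rat_divide)
    moreover have "(of_nat k / of_nat l :: rat) > 0" using that by simp
    ultimately show ?thesis unfolding pos_rat_def by blast
  qed
  have q: "N / D \<in> pos_rat" "D / N \<in> pos_rat"
    unfolding N_def D_def using d0 by (intro rq; simp)+
  \<comment> \<open>Trace and determinant determine the eigenvalues only up to their order.\<close>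
  have "(m2 - val b1) * (m2 + val (dy a)) = m2 * m2 - (m1 + m2) * m2 + m1 * m2"
    unfolding mm by (simp add: algebra_simps)
  then have "(m2 - val b1) * (m2 + val (dy a)) = 0" by (simp add: algebra_simps)
  then consider "m2 = val b1" | "m2 = - val (dy a)" by (auto simp: add_eq_0_iff)
  then show False
  proof cases
    case 1
    then have "m1 = - val (dy a)" using mm(1) by simp
    then have "m1 * D = m2 * N" using 1 2 \<open>val b1 * of_nat (Suc m) + val h = 0\<close>
      by (simp add: N_def D_def add_eq_0_iff2 del: of_nat_Suc)
    then have "m1 / m2 = N / D" using ND mm(3) by (simp add: field_simps)
    then show False using q mm by simp
  next
    case 2
    then have "m1 = val b1" using mm(1) by simp
    then have "m1 * N = m2 * D" using 2 \<open>val (dy a) * of_nat d = val h\<close> \<open>val b1 * of_nat (Suc m) + val h = 0\<close>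
      by (simp add: N_def D_def add_eq_0_iff del: of_nat_Suc)
    then have "m1 / m2 = D / N" using ND mm(3) by (simp add: field_simps)
    then show False using q mm by simp
  qed
qed

lemma two_leaves_dvd:
  assumes "sred \<omega>" "invariant \<omega> (exc_line t)" "val g = 0" "transverse_germs (exc_line t) g" "invariant \<omega> g"
    "invariant \<omega> f" "val f = 0" "\<not> exc_line t dvd f"
  shows "g dvd f"
proof (cases t)
  case (Slope s)
  then show ?thesis using assms by (intro simple_leaves_dvd[of \<omega>]) (auto simp: transverse_germs_def)
next
  case Vertical
  have "swap g dvd swap f"
  proof (rule simple_leaves_dvd[of "sw \<omega>"])
    show "invariant (sw \<omega>) X" using assms(2) Vertical invariant_sw[of \<omega> Y] by simp
    show "\<not> X dvd swap f" using assms(8) Vertical dvd_swap_iff[of X f] by simp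
  qed (use assms Vertical in \<open>auto simp: sred_sw invariant_sw dy_swap transverse_germs_def\<close>)
  then show ?thesis by simp
qed

section \<open>Blow-up of a reduced point\<close>

lemma blow_pair_Vertical: "blow_pair Vertical \<omega> = sw (blow_pair (Slope 0) (sw \<omega>))"
  by (cases \<omega>) (simp add: sw_def blow_vertical_swap swap_mult swap_add add.commute)

text \<open>For a triangular linear part, with the order of the eigenvalues left open:
  \<open>simple_singularity\<close> singles out one of them as non-zero.\<close>

lemma sred_eigenvalues:
  assumes "val A = 0" "val B = 0" "val (dy B) = 0" "m1 = val (dx B)" "m2 = - val (dy A)"
    "(m2 \<noteq> 0 \<and> m1 / m2 \<notin> pos_rat) \<or> (m1 \<noteq> 0 \<and> m2 / m1 \<notin> pos_rat)"
  shows "sred (A, B)"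
proof -
  have *: "m1 + m2 = val (dx B) - val (dy A)" "m1 * m2 = val (dy B) * val (dx A) - val (dx B) * val (dy A)"
    using assms by auto
  then have "m2 + m1 = val (dx B) - val (dy A)" "m2 * m1 = val (dy B) * val (dx A) - val (dx B) * val (dy A)"
    by (simp_all add: add.commute mult.commute)
  then have "simple_singularity (A, B)"
    using * assms(1,2,6) unfolding simple_singularity_def by (auto simp: singular_def)
  then show ?thesis by (simp add: sred_def)
qed

lemma pos_rat_add_1: "x \<in> pos_rat \<Longrightarrow> x + 1 \<in> pos_rat" and pos_rat_inverse: "x \<in> pos_rat \<Longrightarrow> 1 / x \<in> pos_rat"
  and one_pos_rat: "1 \<in> pos_rat" and zero_not_pos_rat: "0 \<notin> pos_rat" and neg_one_not_pos_rat: "- 1 \<notin> pos_rat"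
proof -
  show "x + 1 \<in> pos_rat" if x: "x \<in> pos_rat"
  proof -
    obtain r where "x = of_rat r" "r > 0" using x by (auto simp: pos_rat_def)
    then show ?thesis by (auto simp: pos_rat_def of_rat_add intro!: exI[of _ "r + 1"])
  qed
  show "1 / x \<in> pos_rat" if x: "x \<in> pos_rat"
  proof -
    obtain r where "x = of_rat r" "r > 0" using x by (auto simp: pos_rat_def)
    then show ?thesis by (auto simp: pos_rat_def of_rat_divide intro!: exI[of _ "1 / r"])
  qed
  show "1 \<in> pos_rat" by (auto simp: pos_rat_def intro!: exI[of _ 1])
  show "0 \<notin> pos_rat" by (auto simp: pos_rat_def)
  show "- 1 \<notin> pos_rat"
  proof
    assume "- 1 \<in> pos_rat"
    then obtain r :: rat where r: "of_rat r = (- 1 :: complex)" "r > 0" by (auto simp: pos_rat_def)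
    then have "r = - 1" by (metis of_rat_eq_iff of_rat_minus of_rat_1)
    then show False using r by simp
  qed
qed

lemma blow_slope_smooth:
  assumes "val f = 0"
  obtains f1 where "blow_slope s f = X * f1" "rX f1 = fps_const (val (dx f) + s * val (dy f)) + fps_const (val (dy f)) * fps_X"
proof -
  have "vanish 1 f" using assms by (auto simp: vanish_def val_def)
  then have "X dvd blow_slope s f" using vanish_dvd[of 1 f s] by simp
  then obtain f1 where f1: "blow_slope s f = X * f1" by (auto elim: dvdE)
  have "rX f1 $ j = (fps_const (val (dx f) + s * val (dy f)) + fps_const (val (dy f)) * fps_X) $ j" for j
  proof -
    have "rX f1 $ j = coeff2 (blow_slope s f) 1 j" unfolding f1 by (simp add: X_mult)
    also have "\<dots> = coeff2 f 1 0 * (of_nat (0 choose j) * s ^ (0 - j)) + coeff2 f 0 1 * (of_nat (1 choose j) * s ^ (1 - j))"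
      by (simp add: coeff2_blow_slope)
    also have "\<dots> = (fps_const (val (dx f) + s * val (dy f)) + fps_const (val (dy f)) * fps_X) $ j"
      by (cases j; cases "j - 1") (auto simp: val_def algebra_simps)
    finally show ?thesis .
  qed
  then show ?thesis using that f1 by (simp add: fps_eq_iff)
qed

text \<open>Over a regular point a singular direction has eigenvalues of ratio \<open>- 1\<close>.
  Over a simple singularity, at a singular direction \<open>s\<close> the number \<open>l\<close> is
  the eigenvalue belonging to this direction, and the new eigenvalues are \<open>l\<close> and
  \<open>\<mu> - l\<close>; \<open>X dvd A\<close> would force both old ones to equal
  \<open>l\<close>, that is ratio \<open>1\<close>.\<close>

lemma blow_sred_Slope:
  assumes "sred (a, b)"
  obtains m A B where "blow_pair (Slope s) (a, b) = (X ^ m * A, X ^ m * B)" "sred (A, B)" "\<not> X dvd A" "X dvd B"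
proof (cases "singular (a, b)")
  case False
  define A where "A = blow_slope s a + (Y + const s) * blow_slope s b"
  define B where "B = X * blow_slope s b"
  have vb: "val (blow_slope s f) = val f" "val (dy (blow_slope s f)) = 0" for f
    by (simp_all add: dy_blow_slope) (simp add: val_def coeff2_blow_slope)
  have rb: "rX (blow_slope s f) = fps_const (val f)" for f
    by (simp add: fps_eq_iff coeff2_blow_slope val_def binomial_eq_0)
  have rA: "rX A = fps_const (val a + s * val b) + fps_const (val b) * fps_X"
    by (simp add: A_def rX_add rX_mult rb fps_eq_iff algebra_simps)
  have "\<not> X dvd A"
  proof
    assume "X dvd A"
    then have "rX A $ 0 = 0" "rX A $ 1 = 0" by (simp_all add: X_dvd_iff del: rX_nth)
    then have "val b = 0" "val a = 0" unfolding rA by auto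
    then show False using False by (simp add: singular_def)
  qed
  moreover have "sred (A, B)"
  proof (cases "val A = 0")
    case True
    then have vA: "val a + s * val b = 0" by (simp add: A_def vb)
    then have b: "val b \<noteq> 0" using False by (auto simp: singular_def)
    have "val (dx B) = val b" "val (dy B) = 0" "val (dy A) = val b" "val B = 0"
      by (simp_all add: A_def B_def dx_mult dy_mult vb)
    then show ?thesis using b True neg_one_not_pos_rat by (intro sred_eigenvalues[of A B "val b" "- val b"]) auto
  qed (simp add: sred_def singular_def)
  moreover have "blow_pair (Slope s) (a, b) = (X ^ 0 * A, X ^ 0 * B)" by (simp add: A_def B_def)
  moreover have "X dvd B" by (simp add: B_def)
  ultimately show ?thesis using that by blast
next
  case True
  then have v: "val a = 0" "val b = 0" by (auto simp: singular_def)
  obtain a1 where a1: "blow_slope s a = X * a1" "rX a1 = fps_const (val (dx a) + s * val (dy a)) + fps_const (val (dy a)) * fps_X"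
    using blow_slope_smooth v by blast
  obtain b1 where b1: "blow_slope s b = X * b1" "rX b1 = fps_const (val (dx b) + s * val (dy b)) + fps_const (val (dy b)) * fps_X"
    using blow_slope_smooth v by blast
  define A where "A = a1 + (Y + const s) * b1"
  define B where "B = X * b1"
  have bp: "blow_pair (Slope s) (a, b) = (X ^ 1 * A, X ^ 1 * B)"
    by (simp add: a1 b1 A_def B_def algebra_simps)
  have "simple_singularity (a, b)" using assms True by (simp add: sred_def)
  then obtain m1 m2 where mm: "m1 + m2 = val (dx b) - val (dy a)"
      "m1 * m2 = val (dy b) * val (dx a) - val (dx b) * val (dy a)" "m2 \<noteq> 0" "m1 / m2 \<notin> pos_rat"
    by (auto simp: simple_singularity_def)
  define l where "l = val (dx b) + s * val (dy b)"
  have vb1: "val b1 = l" using b1(2) val_rX[of b1] by (simp add: l_def del: rX_nth)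
  have dyb1: "val (dy b1) = val (dy b)" using arg_cong[OF b1(2), of "\<lambda>f. f $ 1"] by (simp add: val_def)
  have va1: "val a1 = val (dx a) + s * val (dy a)" using a1(2) val_rX[of a1] by (simp del: rX_nth)
  have dya1: "val (dy a1) = val (dy a)" using arg_cong[OF a1(2), of "\<lambda>f. f $ 1"] by (simp add: val_def)
  have vA: "val A = val (dx a) + s * val (dy a) + s * l" by (simp add: A_def vb1 va1)
  have dyA: "val (dy A) = val (dy a) + l + s * val (dy b)" by (simp add: A_def dy_mult vb1 dyb1 dya1)
  have dB: "val (dx B) = l" "val (dy B) = 0" "val B = 0" by (simp_all add: B_def dx_mult dy_mult vb1)
  have nX: "\<not> X dvd A"
  proof
    assume "X dvd A"
    then have r0: "rX A = 0" by (simp add: X_dvd_iff)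
    have "rX A = (fps_const (val (dx a) + s * val (dy a)) + fps_const (val (dy a)) * fps_X) +
        (fps_X + fps_const s) * (fps_const l + fps_const (val (dy b)) * fps_X)"
      by (simp add: A_def rX_add rX_mult a1 b1 l_def)
    also have "\<dots> = fps_const (val A) + fps_const (val (dy A)) * fps_X + fps_const (val (dy b)) * fps_X * fps_X"
      unfolding vA dyA by (simp add: algebra_simps flip: fps_const_add fps_const_mult)
    finally have e: "fps_const (val A) + fps_const (val (dy A)) * fps_X + fps_const (val (dy b)) * fps_X * fps_X = 0" using r0 by simp
    have "val (dy b) = 0" using arg_cong[OF e, of "\<lambda>f. f $ 2"] by (simp add: numeral_2_eq_2)
    moreover have "val A = 0" "val (dy A) = 0" using \<open>X dvd A\<close> by (auto simp: dy_mult elim!: dvdE)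
    ultimately have "val (dy a) = - l" "l = val (dx b)" using dyA by (auto simp: l_def add_eq_0_iff2)
    then have "m1 + m2 = l + l" "m1 * m2 = l * l" using mm(1,2) \<open>val (dy b) = 0\<close> by simp_all
    moreover from this have m1: "m1 = l + l - m2" by (simp add: eq_diff_eq)
    ultimately have "(l + l - m2) * m2 = l * l" by simp
    then have "(m2 - l) * (m2 - l) = 0" by (simp add: algebra_simps)
    then have "m2 = l" by simp
    then have "m1 = l" using m1 by simp
    then show False using mm(3,4) one_pos_rat \<open>m2 = l\<close> by simp
  qed
  moreover have "sred (A, B)"
  proof (cases "val A = 0")
    case vA0: True
    define \<mu> where "\<mu> = m1 + m2 - l"
    have eig: "val (dy A) = l - \<mu>" unfolding dyA \<mu>_def mm(1) by (simp add: l_def algebra_simps)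
    have "(m2 - l) * (m1 - l) = (m1 * m2 - (m1 + m2) * l) + l * l" by (simp add: algebra_simps)
    also have "\<dots> = val (dy b) * (val (dx a) + s * val (dy a) + s * l)"
      unfolding mm(1,2) l_def by (simp add: algebra_simps)
    finally have "(m2 - l) * (m1 - l) = 0" using vA vA0 by simp
    then consider "l = m2" "\<mu> = m1" | "l = m1" "\<mu> = m2" by (auto simp: \<mu>_def)
    then have *: "(l \<noteq> 0 \<longrightarrow> \<mu> / l \<notin> pos_rat) \<and> (l = 0 \<longrightarrow> \<mu> \<noteq> 0)"
    proof cases
      case 2
      then show ?thesis using mm pos_rat_inverse[of "m2 / m1"] by auto
    qed (use mm in auto)
    show ?thesis
    proof (cases "l = 0")
      case True
      then show ?thesis using * eig dB vA0 zero_not_pos_rat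
        by (intro sred_eigenvalues[of A B l "\<mu> - l"]) auto
    next
      case False
      have "(\<mu> - l) / l + 1 = \<mu> / l" using False by (simp add: field_simps)
      then have "(\<mu> - l) / l \<notin> pos_rat" using * False pos_rat_add_1 by metis
      then show ?thesis using False eig dB vA0 by (intro sred_eigenvalues[of A B l "\<mu> - l"]) auto
    qed
  qed (simp add: sred_def singular_def)
  moreover have "X dvd B" by (simp add: B_def)
  ultimately show ?thesis using that bp by blast
qed

text \<open>After removing the common power of the exceptional line, the line does not divide both
  coefficients, so it cannot divide the remaining factor \<open>g\<close>; invariance therefore
  passes to the coprime pair.\<close>

lemma blow_sred:
  assumes nz: "\<eta> \<noteq> (0, 0)" and s: "sred (foliation_at \<eta> p)"
  shows "sred (foliation_at \<eta> (p @ [t]))" "invariant (foliation_at \<eta> (p @ [t])) (exc_line t)"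
proof -
  let ?\<omega> = "foliation_at \<eta> (p @ [t])"
  have "\<exists>m A B. blow_pair t (foliation_at \<eta> p) = (exc_line t ^ m * A, exc_line t ^ m * B) \<and> sred (A, B) \<and>
      \<not> (exc_line t dvd A \<and> exc_line t dvd B) \<and> exc_line t dvd wedge (A, B) (exc_line t)"
  proof (cases t)
    case (Slope z)
    obtain a b where ab: "foliation_at \<eta> p = (a, b)" by fastforce
    obtain m A B where "blow_pair (Slope z) (a, b) = (X ^ m * A, X ^ m * B)" "sred (A, B)" "\<not> X dvd A" "X dvd B"
      using blow_sred_Slope[of a b z] s ab by metis
    then show ?thesis unfolding Slope ab by (auto simp: wedge_def intro!: exI[of _ m])
  next
    case Vertical
    obtain a b where ab: "sw (foliation_at \<eta> p) = (a, b)" by fastforce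
    obtain m A B where m: "blow_pair (Slope 0) (a, b) = (X ^ m * A, X ^ m * B)" "sred (A, B)" "\<not> X dvd A" "X dvd B"
      using blow_sred_Slope[of a b 0] sred_sw[OF s] ab by metis
    have "blow_pair Vertical (foliation_at \<eta> p) = (Y ^ m * swap B, Y ^ m * swap A)"
      unfolding blow_pair_Vertical ab m(1) by (simp add: sw_def swap_mult swap_power)
    moreover have "sred (swap B, swap A)" using sred_sw[OF m(2)] by (simp add: sw_def)
    moreover have "\<not> Y dvd swap A" "Y dvd swap B"
      using m(3,4) dvd_swap_iff[of Y] by auto
    ultimately show ?thesis unfolding Vertical by (auto simp: wedge_def intro!: exI[of _ m])
  qed
  then obtain m A B where m: "blow_pair t (foliation_at \<eta> p) = (exc_line t ^ m * A, exc_line t ^ m * B)" "sred (A, B)"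
      "\<not> (exc_line t dvd A \<and> exc_line t dvd B)" "exc_line t dvd wedge (A, B) (exc_line t)" by blast
  have p1: "proportional (transform \<eta> (p @ [t])) (exc_line t ^ m * A, exc_line t ^ m * B)"
    using proportional_blow[OF fol_coprime_proportional(2)[OF nz], of t p] by (simp add: transform_snoc m)
  have p2: "proportional (transform \<eta> (p @ [t])) (A, B)"
  proof -
    have "hol (exc_line t ^ m) \<noteq> 0" by simp
    moreover have "hol (exc_line t ^ m) * (hol A * snd (transform \<eta> (p @ [t]))) = hol (exc_line t ^ m) * (hol B * fst (transform \<eta> (p @ [t])))"
      using p1 by (simp only: proportional_def fst_conv snd_conv hol_hom(4) mult.assoc)
    ultimately have "hol A * snd (transform \<eta> (p @ [t])) = hol B * fst (transform \<eta> (p @ [t]))"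
      using mult_left_cancel by blast
    then show ?thesis using p1 by (auto simp: proportional_def)
  qed
  show "sred ?\<omega>" using sred_fol[OF nz p2 m(2)] .
  obtain g where g: "A = g * fst ?\<omega>" "B = g * snd ?\<omega>" using fol_factor[OF nz p2] by blast
  have "\<not> exc_line t dvd g" using m(3) g by auto
  moreover have "exc_line t dvd g * wedge ?\<omega> (exc_line t)"
    using m(4) wedge_scale[of g "fst ?\<omega>" "snd ?\<omega>"] unfolding g by simp
  ultimately show "invariant ?\<omega> (exc_line t)"
    unfolding invariant_def using irreducible_dvd_mult[OF irreducible_exc_line] by blast
qed

section \<open>Primitives of closed forms\<close>

text \<open>Integration in \<open>x\<close>, with the part on \<open>x = 0\<close> integrated in
  \<open>y\<close>; dividing coefficients by positive integers keeps them bounded.\<close>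

lift_definition primitive :: "germ \<Rightarrow> germ \<Rightarrow> germ" is "\<lambda>u v. Abs_fps (\<lambda>j. Abs_fps (\<lambda>i.
   if i > 0 then u $ j $ (i - 1) / of_nat i else if j > 0 then v $ (j - 1) $ 0 / of_nat j else 0))"
proof -
  fix u v :: "complex fps fps" assume "conv2 u" "conv2 v"
  obtain C r where C: "C \<ge> 0" "r \<ge> 1" "\<And>i j. norm (u $ j $ i) \<le> C * r ^ (i + j)"
    using conv2E[OF \<open>conv2 u\<close>] by blast
  obtain D s where D: "D \<ge> 0" "s \<ge> 1" "\<And>i j. norm (v $ j $ i) \<le> D * s ^ (i + j)"
    using conv2E[OF \<open>conv2 v\<close>] by blast
  have le: "norm (z / of_nat n) \<le> norm z" if "n > 0" for z :: complex and n :: nat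
    using that by (simp add: norm_divide divide_le_eq mult_le_cancel_left1)
  show "conv2 (Abs_fps (\<lambda>j. Abs_fps (\<lambda>i.
     if i > 0 then u $ j $ (i - 1) / of_nat i else if j > 0 then v $ (j - 1) $ 0 / of_nat j else 0)))"
  proof (rule conv2I[where C = "C + D" and r = "max r s"])
    fix i j
    have m: "max r s \<ge> 1" using C by auto
    have 1: "norm (u $ j $ (i - 1) / of_nat i) \<le> (C + D) * max r s ^ (i + j)" if "i > 0"
    proof -
      have "norm (u $ j $ (i - 1) / of_nat i) \<le> C * r ^ (i - 1 + j)" using le[OF that] C(3) order_trans by blast
      also have "\<dots> \<le> C * max r s ^ (i - 1 + j)" using C by (intro mult_left_mono power_mono) auto
      also have "\<dots> \<le> C * max r s ^ (i + j)" using C m by (intro mult_left_mono power_increasing) auto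
      also have "\<dots> \<le> (C + D) * max r s ^ (i + j)" using D m by (intro mult_right_mono) auto
      finally show ?thesis .
    qed
    have 2: "norm (v $ (j - 1) $ 0 / of_nat j) \<le> (C + D) * max r s ^ (i + j)" if "j > 0"
    proof -
      have "norm (v $ (j - 1) $ 0 / of_nat j) \<le> D * s ^ (0 + (j - 1))" using le[OF that] D(3) order_trans by blast
      also have "\<dots> \<le> D * max r s ^ (0 + (j - 1))" using D by (intro mult_left_mono power_mono) auto
      also have "\<dots> \<le> D * max r s ^ (i + j)" using D m by (intro mult_left_mono power_increasing) auto
      also have "\<dots> \<le> (C + D) * max r s ^ (i + j)" using C m by (intro mult_right_mono) auto
      finally show ?thesis .
    qed
    have 3: "0 \<le> (C + D) * max r s ^ (i + j)" using C D m by simp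
    show "norm (Abs_fps (\<lambda>j. Abs_fps (\<lambda>i.
     if i > 0 then u $ j $ (i - 1) / of_nat i else if j > 0 then v $ (j - 1) $ 0 / of_nat j else 0)) $ j $ i) \<le> (C + D) * max r s ^ (i + j)"
      using 1 2 3 by (cases "i > 0"; cases "j > 0") (simp_all only: fps_nth_Abs_fps if_True if_False norm_zero)
  qed
qed

lemma primitive:
  assumes "dx v = dy u"
  shows "dx (primitive u v) = u" "dy (primitive u v) = v"
proof -
  have c: "coeff2 (primitive u v) i j =
      (if i > 0 then coeff2 u (i - 1) j / of_nat i else if j > 0 then coeff2 v 0 (j - 1) / of_nat j else 0)" for i j
    by transfer simp
  show "dx (primitive u v) = u" by (rule germ_eqI) (simp add: c del: of_nat_Suc)
  show "dy (primitive u v) = v"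
  proof (rule germ_eqI)
    fix i j
    have "of_nat i * coeff2 v i j = of_nat (Suc j) * coeff2 u (i - 1) (Suc j)" if "i > 0"
      using arg_cong[OF assms, of "\<lambda>f. coeff2 f (i - 1) j"] that by (simp del: of_nat_Suc)
    then show "coeff2 (dy (primitive u v)) i j = coeff2 v i j"
    proof (cases "i = 0")
      case True
      then show ?thesis by (simp add: c del: of_nat_Suc)
    next
      case False
      then have "of_nat i * coeff2 v i j = of_nat (Suc j) * coeff2 u (i - 1) (Suc j)"
        using \<open>i > 0 \<Longrightarrow> _\<close> by blast
      moreover have "coeff2 (dy (primitive u v)) i j = of_nat (Suc j) * coeff2 u (i - 1) (Suc j) / of_nat i"
        using False by (simp add: c del: of_nat_Suc)
      ultimately have "coeff2 (dy (primitive u v)) i j = of_nat i * coeff2 v i j / of_nat i" by simp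
      then show ?thesis using False by simp
    qed
  qed
qed

section \<open>Reduction at the singular points on dicritical components\<close>

text \<open>The conditions at a single point from which \<open>red\<close> is assembled, when
  \<open>D0\<close> is to be the set of non-invariant components.\<close>

definition good :: "form \<Rightarrow> point set \<Rightarrow> point \<Rightarrow> bool" where
  "good \<eta> D0 p \<longleftrightarrow> sred (foliation_at \<eta> p) \<and> (\<forall>q. through (Exc q) p \<longrightarrow>
    (if q \<in> D0 then \<not> singular (foliation_at \<eta> p) \<and> val (wedge (foliation_at \<eta> p) (loc (Exc q) p)) \<noteq> 0
     else invariant (foliation_at \<eta> p) (loc (Exc q) p)))"

definition exact_at :: "form \<Rightarrow> point \<Rightarrow> germ \<Rightarrow> bool" where
  "exact_at \<eta> p g \<longleftrightarrow> transform \<eta> p = (hol (dx g), hol (dy g))"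

lemma exact_at_snoc: "exact_at \<eta> p g \<Longrightarrow> exact_at \<eta> (p @ [t]) (blow t g)"
  unfolding exact_at_def transform_snoc
  by (cases t) (simp_all add: dx_blow_slope dy_blow_slope dx_blow_vertical dy_blow_vertical hol_hom)

lemma proportionalI:
  assumes "\<eta> \<noteq> (0, 0)" "transform \<eta> p = (hol (h * a), hol (h * b))"
  shows "proportional (transform \<eta> p) (a, b)"
proof -
  have "(hol (h * a), hol (h * b)) \<noteq> (0, 0)" using transform_neq_0[OF assms(1), of p] assms(2) by simp
  then have "(a, b) \<noteq> (0, 0)" by auto
  then show ?thesis by (simp add: proportional_def assms(2) hol_hom(4) mult_ac)
qed

lemma exact_log2:
  assumes "\<eta> \<noteq> (0, 0)" "exact_at \<eta> p (const c + f1 ^ Suc n * f2 ^ Suc m * U)" "val U \<noteq> 0"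
  shows "\<exists>u v. proportional (transform \<eta> p)
    (const (of_nat (Suc n)) * f2 * dx f1 + const (of_nat (Suc m)) * f1 * dx f2 + f1 * f2 * u,
     const (of_nat (Suc n)) * f2 * dy f1 + const (of_nat (Suc m)) * f1 * dy f2 + f1 * f2 * v)"
proof -
  have "U dvd D" for D using assms(3) is_unit_iff_val[of U] by (meson dvd_trans one_dvd)
  then obtain u v where uv: "dx U = U * u" "dy U = U * v" by (meson dvdE)
  let ?a = "const (of_nat (Suc n)) * f2 * dx f1 + const (of_nat (Suc m)) * f1 * dx f2 + f1 * f2 * u"
  let ?b = "const (of_nat (Suc n)) * f2 * dy f1 + const (of_nat (Suc m)) * f1 * dy f2 + f1 * f2 * v"
  have "dx (const c + f1 ^ Suc n * f2 ^ Suc m * U) = (f1 ^ n * f2 ^ m * U) * ?a"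
    unfolding d_simps dx_mult dx_power uv of_nat_const by (simp add: algebra_simps del: of_nat_Suc)
  moreover have "dy (const c + f1 ^ Suc n * f2 ^ Suc m * U) = (f1 ^ n * f2 ^ m * U) * ?b"
    unfolding d_simps dy_mult dy_power uv of_nat_const by (simp add: algebra_simps del: of_nat_Suc)
  ultimately have "proportional (transform \<eta> p) (?a, ?b)"
    using assms(2) by (intro proportionalI[OF assms(1), where h = "f1 ^ n * f2 ^ m * U"]) (simp add: exact_at_def)
  then show ?thesis by blast
qed

lemma exact_log1:
  assumes "\<eta> \<noteq> (0, 0)" "exact_at \<eta> p (const c + f ^ Suc n * U)" "val U \<noteq> 0"
  shows "\<exists>u v. proportional (transform \<eta> p) (const (of_nat (Suc n)) * dx f + f * u, const (of_nat (Suc n)) * dy f + f * v)"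
  using exact_log2[OF assms(1), of p c f n 1 0 U] assms(2,3) by simp

lemma neg_ratio: "- of_nat (Suc n) / of_nat (Suc m) \<notin> pos_rat"
proof
  assume "- of_nat (Suc n) / of_nat (Suc m) \<in> pos_rat"
  then obtain r :: rat where r: "of_rat r = (- of_nat (Suc n) / of_nat (Suc m) :: complex)" "r > 0"
    by (auto simp: pos_rat_def)
  moreover have "(- of_nat (Suc n) / of_nat (Suc m) :: complex) = of_rat (- of_nat (Suc n) / of_nat (Suc m))"
    by (simp add: of_rat_divide of_rat_minus del: of_nat_Suc)
  ultimately have "r = - of_nat (Suc n) / of_nat (Suc m)" using of_rat_eq_iff by metis
  moreover have "- of_nat (Suc n) / of_nat (Suc m) \<le> (0 :: rat)" by (simp add: divide_le_0_iff del: of_nat_Suc)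
  ultimately show False using r(2) by linarith
qed

text \<open>Upper bounds for the components through \<open>p\<close> and their position on the axes.
  That \<open>E\<close> or \<open>F\<close> itself passes through \<open>p\<close> is not claimed,
  which makes the bounds easy to propagate in \<open>comp_steps\<close>.\<close>

definition compX :: "point \<Rightarrow> point \<Rightarrow> bool" where
  "compX p E \<longleftrightarrow> (\<forall>q. through (Exc q) p \<longrightarrow> q = E \<and> loc (Exc q) p = X)"

definition compXY :: "point \<Rightarrow> point \<Rightarrow> point \<Rightarrow> bool" where
  "compXY p E F \<longleftrightarrow> (\<forall>q. through (Exc q) p \<longrightarrow> q = E \<and> loc (Exc q) p = X \<or> q = F \<and> loc (Exc q) p = Y)"

lemma through_Exc_snoc:
  assumes "through (Exc q) (p @ [t])"
  shows "q = p \<and> loc (Exc q) (p @ [t]) = exc_line t \<or>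
    through (Exc q) p \<and> loc (Exc q) (p @ [t]) = strict1 t (loc (Exc q) p) \<and> \<not> is_unit (strict1 t (loc (Exc q) p))"
proof (cases "q = p")
  case False
  then have "loc (Exc q) (p @ [t]) = strict1 t (loc (Exc q) p)" by (intro loc_snoc) auto
  then show ?thesis using through_snocD[OF assms] assms False by (auto simp: through_iff_not_unit)
qed simp

lemma comp_steps:
  "compX p E \<Longrightarrow> compX (p @ [Slope z]) p"
  "compX p E \<Longrightarrow> compXY (p @ [Vertical]) E p"
  "compXY p E F \<Longrightarrow> compXY (p @ [Slope 0]) p F"
  "z \<noteq> 0 \<Longrightarrow> compXY p E F \<Longrightarrow> compX (p @ [Slope z]) p"
  "compXY p E F \<Longrightarrow> compXY (p @ [Vertical]) E p"
proof -
  have X: "is_unit (strict1 (Slope z) X)" "strict1 Vertical X = X" for z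
    using strict1_exc_line_unit[of "Slope z" "Slope 0"] strict1_cont[of "Slope 0"] by simp_all
  have Y: "strict1 (Slope 0) Y = Y" "z \<noteq> 0 \<Longrightarrow> is_unit (strict1 (Slope z) Y)" "is_unit (strict1 Vertical Y)" for z
    using strict1_exc_line_unit[of "Slope z" Vertical] strict1_exc_line_unit[of Vertical Vertical] strict1_cont[of Vertical] by simp_all
  show "compX p E \<Longrightarrow> compX (p @ [Slope z]) p"
    unfolding compX_def using through_Exc_snoc[of _ p "Slope z"] X(1) by fastforce
  show "compX p E \<Longrightarrow> compXY (p @ [Vertical]) E p"
    unfolding compX_def compXY_def using through_Exc_snoc[of _ p Vertical] X(2) by fastforce
  show "compXY p E F \<Longrightarrow> compXY (p @ [Slope 0]) p F"
    unfolding compXY_def using through_Exc_snoc[of _ p "Slope 0"] X(1) Y(1) by fastforce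
  show "compX (p @ [Slope z]) p" if z: "z \<noteq> 0" and c: "compXY p E F"
    unfolding compX_def
  proof (intro allI impI)
    fix q assume q: "through (Exc q) (p @ [Slope z])"
    have "through (Exc q) p \<Longrightarrow> is_unit (strict1 (Slope z) (loc (Exc q) p))"
      using c X(1) Y(2)[OF z] by (auto simp: compXY_def)
    then show "q = p \<and> loc (Exc q) (p @ [Slope z]) = X" using through_Exc_snoc[OF q] by auto
  qed
  show "compXY (p @ [Vertical]) E p" if c: "compXY p E F"
    unfolding compXY_def
  proof (intro allI impI)
    fix q assume q: "through (Exc q) (p @ [Vertical])"
    have "through (Exc q) p \<Longrightarrow> is_unit (strict1 Vertical (loc (Exc q) p)) \<or> q = E \<and> loc (Exc q) p = X"
      using c Y(3) by (auto simp: compXY_def)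
    then show "q = E \<and> loc (Exc q) (p @ [Vertical]) = X \<or> q = p \<and> loc (Exc q) (p @ [Vertical]) = Y"
      using through_Exc_snoc[OF q] X(2) by auto
  qed
qed

section \<open>Local models of exact forms at reduced points\<close>

lemma good_X:
  assumes "\<eta> \<noteq> (0, 0)" "exact_at \<eta> p (const c + X ^ Suc i * U)" "val U \<noteq> 0" "compX p E" "E \<notin> D0"
  shows "good \<eta> D0 p \<and> \<not> singular (foliation_at \<eta> p)"
proof -
  obtain u v where uv: "proportional (transform \<eta> p) (const (of_nat (Suc i)) * dx X + X * u, const (of_nat (Suc i)) * dy X + X * v)"
    using exact_log1[OF assms(1-3)] by blast
  have "\<not> singular (foliation_at \<eta> p)" "invariant (foliation_at \<eta> p) X"
    using regular_log(1,2)[OF assms(1) uv] by (auto simp del: of_nat_Suc)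
  then show ?thesis using assms(4,5) by (auto simp: good_def sred_def compX_def)
qed

lemma good_leaf:
  assumes "\<eta> \<noteq> (0, 0)" "exact_at \<eta> p (const c + f ^ Suc i * U)" "val U \<noteq> 0" "val f = 0" "val (dy f) \<noteq> 0"
    and "compX p E" "E \<in> D0"
  shows "good \<eta> D0 p \<and> \<not> singular (foliation_at \<eta> p)"
proof -
  obtain u v where uv: "proportional (transform \<eta> p) (const (of_nat (Suc i)) * dx f + f * u, const (of_nat (Suc i)) * dy f + f * v)"
    using exact_log1[OF assms(1-3)] by blast
  have "\<not> singular (foliation_at \<eta> p)" "val (wedge (foliation_at \<eta> p) X) \<noteq> 0"
    using regular_log(1,3)[OF assms(1) uv] assms(4,5) by (auto simp del: of_nat_Suc)
  then show ?thesis using assms(6,7) by (auto simp: good_def sred_def compX_def)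
qed

text \<open>An axis of exponent zero is not a leaf but crossed by one, so the exponent tells whether
  \<open>E\<close> is dicritical. Two positive exponents give a simple singularity with negative
  rational ratio of the eigenvalues.\<close>

lemma good_XY:
  assumes "\<eta> \<noteq> (0, 0)" "exact_at \<eta> p (const c + X ^ i * Y ^ Suc j * U)" "val U \<noteq> 0" "compXY p E F"
    "E \<in> D0 \<longleftrightarrow> i = 0" "F \<notin> D0"
  shows "good \<eta> D0 p"
proof (cases i)
  case 0
  then obtain u v where uv: "proportional (transform \<eta> p) (const (of_nat (Suc j)) * dx Y + Y * u, const (of_nat (Suc j)) * dy Y + Y * v)"
    using exact_log1[OF assms(1), of p c Y j U] assms(2,3) by auto
  have "\<not> singular (foliation_at \<eta> p)" "invariant (foliation_at \<eta> p) Y" "val (wedge (foliation_at \<eta> p) X) \<noteq> 0"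
    using regular_log[OF assms(1) uv] by (auto simp del: of_nat_Suc)
  then show ?thesis using assms(4-6) 0 by (auto simp: good_def sred_def compXY_def)
next
  case (Suc k)
  then obtain u v where uv: "proportional (transform \<eta> p)
    (const (of_nat (Suc k)) * Y * dx X + const (of_nat (Suc j)) * X * dx Y + X * Y * u,
     const (of_nat (Suc k)) * Y * dy X + const (of_nat (Suc j)) * X * dy Y + X * Y * v)"
    using exact_log2[OF assms(1), of p c X k Y j U] assms(2,3) by auto
  have "simple_singularity (foliation_at \<eta> p)" "invariant (foliation_at \<eta> p) X" "invariant (foliation_at \<eta> p) Y"
    using simple_log[OF assms(1) uv] neg_ratio by (auto simp del: of_nat_Suc)
  then show ?thesis using assms(4-6) Suc by (auto simp: good_def sred_def compXY_def)
qed

lemma good_XK: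
  assumes "\<eta> \<noteq> (0, 0)" "exact_at \<eta> p (const c + X ^ Suc i * K * U)" "val U \<noteq> 0" "val K = 0" "val (dy K) \<noteq> 0"
    "compX p E" "E \<notin> D0"
  shows "good \<eta> D0 p"
proof -
  obtain u v where uv: "proportional (transform \<eta> p)
    (const (of_nat (Suc i)) * K * dx X + const (of_nat (Suc 0)) * X * dx K + X * K * u,
     const (of_nat (Suc i)) * K * dy X + const (of_nat (Suc 0)) * X * dy K + X * K * v)"
    using exact_log2[OF assms(1), of p c X i K 0 U] assms(2,3) by auto
  have "simple_singularity (foliation_at \<eta> p)" "invariant (foliation_at \<eta> p) X"
    using simple_log(1,2)[OF assms(1) uv] neg_ratio[of i 0] assms(4,5) by (auto simp del: of_nat_Suc)
  then show ?thesis using assms(6,7) by (auto simp: good_def sred_def compX_def)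
qed

lemma blow_smooth:
  assumes "val l = 0"
  obtains l1 where "blow_slope z l = X * l1" "val l1 = val (dx l) + z * val (dy l)" "val (dy l1) = val (dy l)"
proof -
  obtain l1 where l1: "blow_slope z l = X * l1"
      "rX l1 = fps_const (val (dx l) + z * val (dy l)) + fps_const (val (dy l)) * fps_X"
    using blow_slope_smooth[OF assms] .
  have "val l1 = val (dx l) + z * val (dy l)" using l1(2) val_rX[of l1] by (simp del: rX_nth)
  moreover have "val (dy l1) = val (dy l)" using arg_cong[OF l1(2), of "\<lambda>f. f $ 1"] by (simp add: val_def)
  ultimately show ?thesis using that l1 by blast
qed

lemma blow_smooth_Vertical:
  assumes "val l = 0" "val (dy l) \<noteq> 0"
  obtains l1 where "blow_vertical l = Y * l1" "val l1 \<noteq> 0"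
proof -
  have "coeff2 l 0 1 \<noteq> 0" using assms(2) by (simp add: val_def)
  then have "ord l \<le> 1" "l \<noteq> 0" using ord_leI[of l 0 1] by auto
  moreover have "ord l \<noteq> 0" using ord_eq_0_iff[of l] assms(1) \<open>l \<noteq> 0\<close> by blast
  ultimately have o: "ord l = 1" by simp
  then have "blow_vertical l = Y * strict1 Vertical l" using blow_eq[of Vertical l] by simp
  moreover have "val (strict1 Vertical l) \<noteq> 0" using \<open>coeff2 l 0 1 \<noteq> 0\<close> by (simp add: val_strict1 coeff_tc o)
  ultimately show ?thesis using that by blast
qed

lemma val_numeral: "val (numeral n) = numeral n"
  using arg_cong[OF of_nat_const[of "numeral n"], of val] unfolding val_simps by simp

lemma val_blow: "val (blow_slope z f) = val f" "val (blow_vertical f) = val f" "val (dy (blow_slope z f)) = 0"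
  by (simp_all add: dy_blow_slope) (simp_all add: val_def coeff2_blow_slope coeff2_blow_vertical)

lemma blow_vertical_hom:
  "blow_vertical (f + g) = blow_vertical f + blow_vertical g" "blow_vertical (f * g) = blow_vertical f * blow_vertical g"
  "blow_vertical (f ^ n) = blow_vertical f ^ n" "blow_vertical (const c) = const c"
  "blow_vertical X = X * Y" "blow_vertical Y = Y"
  using blow_add[of Vertical] blow_mult[of Vertical] blow_power[of Vertical] blow_const[of Vertical] blow_X[of Vertical] blow_Y[of Vertical]
  by simp_all

lemma pts_single: "pts {[]} = range (\<lambda>t. [t])"
proof (intro set_eqI iffI)
  fix r assume "r \<in> pts {[]}"
  then have "r \<noteq> []" "butlast r = []" by (auto simp: pts_def)
  then have "r = [last r]" by (metis append_butlast_last_id append_Nil)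
  then show "r \<in> range (\<lambda>t. [t])" by blast
qed (auto simp: pts_def)

lemma pts_Vertical: "pts {[], [Vertical]} = (\<lambda>z. [Slope z]) ` UNIV \<union> (\<lambda>t. [Vertical, t]) ` UNIV"
proof (intro set_eqI iffI)
  fix r assume r: "r \<in> pts {[], [Vertical]}"
  then have ne: "r \<noteq> []" "r \<noteq> [Vertical]" and b: "butlast r = [] \<or> butlast r = [Vertical]" by (auto simp: pts_def)
  have "r = butlast r @ [last r]" using ne by simp
  then have "r = [last r] \<or> r = [Vertical, last r]" using b by auto
  then show "r \<in> (\<lambda>z. [Slope z]) ` UNIV \<union> (\<lambda>t. [Vertical, t]) ` UNIV" using ne by (cases "last r") auto
qed (auto simp: pts_def)

lemma pts_Cons:
  assumes "r \<in> pts (insert [] (Cons t ` G))"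
  shows "(\<exists>s. s \<noteq> t \<and> r = [s]) \<or> (\<exists>r'\<in>pts G. r = t # r')"
proof -
  have r: "r \<notin> Cons t ` G" "r \<noteq> []" "butlast r \<in> insert [] (Cons t ` G)" using assms by (auto simp: pts_def)
  then obtain s r' where s: "r = s # r'" by (cases r) auto
  show ?thesis
  proof (cases "r' = []")
    case True
    show ?thesis
    proof (cases "s = t")
      case True
      then have "[] \<in> pts G" using r s \<open>r' = []\<close> by (auto simp: pts_def)
      then show ?thesis using s True \<open>r' = []\<close> by blast
    qed (use s True in blast)
  next
    case False
    then have "s # butlast r' \<in> Cons t ` G" using r(3) s by simp
    then have "s = t" "butlast r' \<in> G" by auto
    moreover have "r' \<notin> G" using r(1) s \<open>s = t\<close> by auto
    ultimately have "r' \<in> pts G" by (simp add: pts_def)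
    then show ?thesis using s \<open>s = t\<close> by blast
  qed
qed


definition resolved :: "form \<Rightarrow> point set \<Rightarrow> point \<Rightarrow> point set \<Rightarrow> bool" where
  "resolved \<eta> D0 p G \<longleftrightarrow> finite G \<and> closed_pts G \<and> (\<forall>r\<in>pts G. good \<eta> D0 (p @ r)) \<and>
    finite {r \<in> pts G. singular (foliation_at \<eta> (p @ r))}"

text \<open>In the notation of \<open>resolve_tangency\<close> the curve \<open>w l\<^sup>2 + x\<^sup>M u = 0\<close> has an \<open>A\<^sub>M\<^sub>-\<^sub>1\<close> singularity; blowing
  up lowers \<open>M\<close> by two.\<close>

lemma resolve_1:
  assumes nz: "\<eta> \<noteq> (0, 0)" and D0: "\<And>r. p @ r \<notin> D0"
    and ex: "exact_at \<eta> p (const c + X ^ a * (w * l\<^sup>2 + X * u))"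
    and w: "val w \<noteq> 0" and u: "val u \<noteq> 0" and l: "val l = 0" "val (dy l) \<noteq> 0"
    and E: "compX p E" "E \<in> D0 \<longleftrightarrow> a = 0"
  shows "resolved \<eta> D0 p {[], [Vertical]}"
proof -
  let ?p' = "p @ [Vertical]"
  have pD: "p \<notin> D0" "?p' \<notin> D0" using D0[of "[]"] D0[of "[Vertical]"] by simp_all
  have slope: "good \<eta> D0 (p @ [Slope z]) \<and> \<not> singular (foliation_at \<eta> (p @ [Slope z]))" for z
  proof -
    obtain l1 where l1: "blow_slope z l = X * l1" using blow_smooth[OF l(1)] by blast
    let ?U = "blow_slope z w * X * l1\<^sup>2 + blow_slope z u"
    have "blow_slope z (const c + X ^ a * (w * l\<^sup>2 + X * u)) = const c + X ^ Suc a * ?U"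
      by (simp add: blow_slope_hom l1 power2_eq_square algebra_simps)
    then have ez: "exact_at \<eta> (p @ [Slope z]) (const c + X ^ Suc a * ?U)" using exact_at_snoc[OF ex, of "Slope z"] by simp
    show ?thesis by (rule good_X[OF nz ez _ comp_steps(1)[OF E(1)] pD(1)]) (use u in \<open>simp add: val_blow\<close>)
  qed
  obtain l1 where l1: "blow_vertical l = Y * l1" "val l1 \<noteq> 0" using blow_smooth_Vertical[OF l] .
  define W where "W = blow_vertical w * l1\<^sup>2"
  define u1 where "u1 = blow_vertical u"
  have W: "val W \<noteq> 0" "val u1 \<noteq> 0" using l1 w u by (simp_all add: W_def u1_def val_blow)
  have "blow_vertical (const c + X ^ a * (w * l\<^sup>2 + X * u)) = const c + X ^ a * Y ^ Suc a * (Y * W + X * u1)"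
    by (simp add: blow_vertical_hom l1 W_def u1_def power2_eq_square power_mult_distrib algebra_simps)
  then have ex': "exact_at \<eta> ?p' (const c + X ^ a * Y ^ Suc a * (Y * W + X * u1))" using exact_at_snoc[OF ex, of Vertical] by simp
  have E': "compXY ?p' E p" using comp_steps(2)[OF E(1)] .
  \<comment> \<open>The slope at \<open>?p'\<close> of the third curve
    \<open>Y * W + X * u1 = 0\<close>, besides the two axes; the second blow-up separates the
    three.\<close>
  define z0 where "z0 = - val u1 / val W"
  have slope': "good \<eta> D0 (?p' @ [Slope z]) \<and> (z \<noteq> 0 \<longrightarrow> z \<noteq> z0 \<longrightarrow> \<not> singular (foliation_at \<eta> (?p' @ [Slope z])))" for z
  proof -
    let ?K = "(Y + const z) * blow_slope z W + blow_slope z u1"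
    have "blow_slope z (const c + X ^ a * Y ^ Suc a * (Y * W + X * u1)) =
        const c + X ^ Suc (a + a + 1) * ((Y + const z) ^ Suc a * ?K)"
    proof -
      have "X ^ a * (X * Z) ^ Suc a * (X * Z * W' + X * u') = X ^ Suc (a + a + 1) * (Z ^ Suc a * (Z * W' + u'))" for Z W' u'
        by (simp add: power_mult_distrib power_add algebra_simps)
      then show ?thesis unfolding blow_slope_hom by simp
    qed
    then have ez: "exact_at \<eta> (?p' @ [Slope z]) (const c + X ^ Suc (a + a + 1) * ((Y + const z) ^ Suc a * ?K))"
      using exact_at_snoc[OF ex', of "Slope z"] by simp
    have vK: "val ?K = z * val W + val u1" by (simp add: val_blow)
    show ?thesis
    proof (cases "z = 0")
      case True
      have ez': "exact_at \<eta> (?p' @ [Slope 0]) (const c + X ^ Suc (a + a + 1) * Y ^ Suc a * (Y * blow_slope 0 W + blow_slope 0 u1))"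
        using ez unfolding True by (simp add: mult.assoc)
      have "good \<eta> D0 (?p' @ [Slope 0])"
        by (rule good_XY[OF nz ez' _ comp_steps(3)[OF E']]) (use W pD in \<open>auto simp: val_blow\<close>)
      then show ?thesis using True by simp
    next
      case z: False
      have cz: "compX (?p' @ [Slope z]) ?p'" using comp_steps(4)[OF z E'] .
      show ?thesis
      proof (cases "val ?K = 0")
        case True
        have ez': "exact_at \<eta> (?p' @ [Slope z]) (const c + X ^ Suc (a + a + 1) * ?K * (Y + const z) ^ Suc a)"
          using ez by (simp only: mult_ac)
        have "good \<eta> D0 (?p' @ [Slope z])"
          by (rule good_XK[OF nz ez' _ True _ cz]) (use z W pD in \<open>auto simp: val_blow dy_mult\<close>)
        moreover have "z = z0" using True W unfolding vK z0_def by (simp add: field_simps add_eq_0_iff)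
        ultimately show ?thesis by simp
      next
        case False
        have "good \<eta> D0 (?p' @ [Slope z]) \<and> \<not> singular (foliation_at \<eta> (?p' @ [Slope z]))"
          by (rule good_X[OF nz ez _ cz]) (use z False pD in auto)
        then show ?thesis by simp
      qed
    qed
  qed
  have vert': "good \<eta> D0 (?p' @ [Vertical])"
  proof -
    have "blow_vertical (const c + X ^ a * Y ^ Suc a * (Y * W + X * u1)) =
        const c + X ^ a * Y ^ Suc (a + a + 1) * (blow_vertical W + X * blow_vertical u1)"
      by (simp add: blow_vertical_hom power_mult_distrib power_add algebra_simps)
    then have "exact_at \<eta> (?p' @ [Vertical]) (const c + X ^ a * Y ^ Suc (a + a + 1) * (blow_vertical W + X * blow_vertical u1))"
      using exact_at_snoc[OF ex', of Vertical] by simp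
    then show ?thesis
      by (rule good_XY[OF nz _ _ comp_steps(5)[OF E']]) (use W pD E in \<open>auto simp: val_blow\<close>)
  qed
  have "{r \<in> pts {[], [Vertical]}. singular (foliation_at \<eta> (p @ r))} \<subseteq> {[Vertical, Vertical], [Vertical, Slope 0], [Vertical, Slope z0]}"
  proof
    fix r assume r: "r \<in> {r \<in> pts {[], [Vertical]}. singular (foliation_at \<eta> (p @ r))}"
    then consider z where "r = [Slope z]" | t where "r = [Vertical, t]" by (auto simp: pts_Vertical)
    then show "r \<in> {[Vertical, Vertical], [Vertical, Slope 0], [Vertical, Slope z0]}"
    proof cases
      case 1
      then show ?thesis using r slope by simp
    next
      case 2
      then show ?thesis using r slope' by (cases t) auto
    qed
  qed
  then have "finite {r \<in> pts {[], [Vertical]}. singular (foliation_at \<eta> (p @ r))}" by (rule finite_subset) simp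
  moreover have "good \<eta> D0 (p @ r)" if r: "r \<in> pts {[], [Vertical]}" for r
  proof -
    consider z where "r = [Slope z]" | t where "r = [Vertical, t]" using r by (auto simp: pts_Vertical)
    then show ?thesis
    proof cases
      case 1
      then show ?thesis using slope by simp
    next
      case 2
      then show ?thesis using slope' vert' by (cases t) auto
    qed
  qed
  ultimately show ?thesis by (simp add: resolved_def closed_pts_def)
qed

text \<open>Both \<open>w * l^2\<close> and the power of \<open>X\<close> contain the factor
  \<open>X^2\<close> after the substitution. It is absorbed into the exponent \<open>a\<close>, so
  the slope chart keeps the shape with exponent lowered by two; the vertical chart leaves only a
  unit besides the axes.\<close>

lemma blow_cusp:
  assumes ex: "exact_at \<eta> p (const c + X ^ a * (w * l\<^sup>2 + X ^ Suc (Suc k) * u))"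
    and w: "val w \<noteq> 0" and l: "val l = 0" "val (dy l) \<noteq> 0"
  shows "\<exists>l1. val l1 = val (dx l) + z * val (dy l) \<and> val (dy l1) = val (dy l) \<and>
      exact_at \<eta> (p @ [Slope z]) (const c + X ^ Suc (Suc a) * (blow_slope z w * l1\<^sup>2 + X ^ k * blow_slope z u))"
    "\<exists>U. val U \<noteq> 0 \<and> exact_at \<eta> (p @ [Vertical]) (const c + X ^ a * Y ^ Suc (Suc a) * U)"
proof -
  obtain l1 where l1: "blow_slope z l = X * l1" "val l1 = val (dx l) + z * val (dy l)" "val (dy l1) = val (dy l)"
    using blow_smooth[OF l(1)] .
  have "blow_slope z (const c + X ^ a * (w * l\<^sup>2 + X ^ Suc (Suc k) * u)) =
      const c + X ^ Suc (Suc a) * (blow_slope z w * l1\<^sup>2 + X ^ k * blow_slope z u)"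
    by (simp add: blow_slope_hom l1 power2_eq_square algebra_simps)
  then show "\<exists>l1. val l1 = val (dx l) + z * val (dy l) \<and> val (dy l1) = val (dy l) \<and>
      exact_at \<eta> (p @ [Slope z]) (const c + X ^ Suc (Suc a) * (blow_slope z w * l1\<^sup>2 + X ^ k * blow_slope z u))"
    using exact_at_snoc[OF ex, of "Slope z"] l1 by auto
  obtain l2 where l2: "blow_vertical l = Y * l2" "val l2 \<noteq> 0" using blow_smooth_Vertical[OF l] .
  let ?U = "blow_vertical w * l2\<^sup>2 + X ^ Suc (Suc k) * Y ^ k * blow_vertical u"
  have "blow_vertical (const c + X ^ a * (w * l\<^sup>2 + X ^ Suc (Suc k) * u)) = const c + X ^ a * Y ^ Suc (Suc a) * ?U"
    by (simp add: blow_vertical_hom l2 power2_eq_square power_mult_distrib algebra_simps)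
  then have "exact_at \<eta> (p @ [Vertical]) (const c + X ^ a * Y ^ Suc (Suc a) * ?U)"
    using exact_at_snoc[OF ex, of Vertical] by simp
  moreover have "val ?U \<noteq> 0" using w l2 by (simp add: val_blow)
  ultimately show "\<exists>U. val U \<noteq> 0 \<and> exact_at \<eta> (p @ [Vertical]) (const c + X ^ a * Y ^ Suc (Suc a) * U)"
    by blast
qed

text \<open>For exponent two there are two smooth branches. Their slopes are the zeros of
  \<open>?P\<close>, which are distinct because \<open>u\<close> is a unit, so one blow-up separates
  them.\<close>

lemma resolve_2:
  assumes nz: "\<eta> \<noteq> (0, 0)" and D0: "p \<notin> D0"
    and ex: "exact_at \<eta> p (const c + X ^ a * (w * l\<^sup>2 + X ^ Suc (Suc 0) * u))"
    and w: "val w \<noteq> 0" and u: "val u \<noteq> 0" and l: "val l = 0" "val (dy l) \<noteq> 0"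
    and E: "compX p E" "E \<in> D0 \<longleftrightarrow> a = 0"
  shows "resolved \<eta> D0 p {[]}"
proof -
  let ?P = "\<lambda>z. val w * (val (dx l) + z * val (dy l))\<^sup>2 + val u"
  have slope: "good \<eta> D0 (p @ [Slope z]) \<and> (?P z \<noteq> 0 \<longrightarrow> \<not> singular (foliation_at \<eta> (p @ [Slope z])))" for z
  proof -
    obtain l1 where l1: "val l1 = val (dx l) + z * val (dy l)" "val (dy l1) = val (dy l)"
      "exact_at \<eta> (p @ [Slope z]) (const c + X ^ Suc (Suc a) * (blow_slope z w * l1\<^sup>2 + X ^ 0 * blow_slope z u))"
      using blow_cusp(1)[OF ex w l] by blast
    let ?K = "blow_slope z w * l1\<^sup>2 + blow_slope z u"
    have vK: "val ?K = ?P z" by (simp add: val_blow l1)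
    have cz: "compX (p @ [Slope z]) p" using comp_steps(1)[OF E(1)] .
    show ?thesis
    proof (cases "val ?K = 0")
      case True
      have ez: "exact_at \<eta> (p @ [Slope z]) (const c + X ^ Suc (Suc a) * ?K * 1)" using l1(3) by simp
      have "val l1 \<noteq> 0" using True u by (auto simp: val_blow)
      moreover have "val (dy ?K) = 2 * (val w * val l1 * val (dy l))"
        by (simp add: val_blow dy_mult power2_eq_square l1(2) val_numeral)
      ultimately have "val (dy ?K) \<noteq> 0" using w l by simp
      then have "good \<eta> D0 (p @ [Slope z])"
        by (rule good_XK[OF nz ez _ True _ cz D0, rotated]) simp
      then show ?thesis using True vK by simp
    next
      case False
      have ez: "exact_at \<eta> (p @ [Slope z]) (const c + X ^ Suc (Suc a) * ?K)" using l1(3) by simp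
      show ?thesis using good_X[OF nz ez False cz D0] by blast
    qed
  qed
  obtain U where U: "val U \<noteq> 0" "exact_at \<eta> (p @ [Vertical]) (const c + X ^ a * Y ^ Suc (Suc a) * U)"
    using blow_cusp(2)[OF ex w l] by blast
  have vert: "good \<eta> D0 (p @ [Vertical])" using good_XY[OF nz U(2,1) comp_steps(2)[OF E(1)] E(2) D0] .
  let ?Q = "smult (val w) ([:val (dx l), val (dy l):] ^ 2) + [:val u:]"
  have "poly ?Q (- val (dx l) / val (dy l)) = val u" using l by (simp add: power2_eq_square)
  then have "?Q \<noteq> 0" using u by (metis poly_0)
  then have fin: "finite {z. poly ?Q z = 0}" by (rule poly_roots_finite)
  have eq: "poly ?Q z = ?P z" for z by (simp add: power2_eq_square algebra_simps)
  have "{r \<in> pts {[]}. singular (foliation_at \<eta> (p @ r))} \<subseteq> insert [Vertical] ((\<lambda>z. [Slope z]) ` {z. poly ?Q z = 0})"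
  proof
    fix r assume r: "r \<in> {r \<in> pts {[]}. singular (foliation_at \<eta> (p @ r))}"
    then obtain t where t: "r = [t]" by (auto simp: pts_single)
    show "r \<in> insert [Vertical] ((\<lambda>z. [Slope z]) ` {z. poly ?Q z = 0})"
    proof (cases t)
      case (Slope z)
      then have "?P z = 0" using r t slope[of z] by auto
      then have "poly ?Q z = 0" using eq by simp
      then show ?thesis using t Slope by blast
    qed (use t in simp)
  qed
  then have "finite {r \<in> pts {[]}. singular (foliation_at \<eta> (p @ r))}" by (rule finite_subset) (use fin in simp)
  moreover have "good \<eta> D0 (p @ [t])" for t using slope vert by (cases t) auto
  ultimately show ?thesis by (auto simp: resolved_def closed_pts_def pts_single)
qed

text \<open>The induction ends in \<open>resolve_1\<close> for odd and in \<open>resolve_2\<close>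
  for even exponents \<open>Suc m\<close>. On the way only the tangent direction of \<open>l\<close>
  has to be blown up further.\<close>

lemma resolve_tangency:
  assumes nz: "\<eta> \<noteq> (0, 0)" and D0: "\<And>r. p @ r \<notin> D0"
    and ex: "exact_at \<eta> p (const c + X ^ a * (w * l\<^sup>2 + X ^ Suc m * u))"
    and w: "val w \<noteq> 0" and u: "val u \<noteq> 0" and l: "val l = 0" "val (dy l) \<noteq> 0"
    and E: "compX p E" "E \<in> D0 \<longleftrightarrow> a = 0"
  shows "\<exists>G. [] \<in> G \<and> resolved \<eta> D0 p G"
  using D0 ex w u l E
proof (induction m arbitrary: p a w l u E rule: less_induct)
  case (less m)
  have pD: "p \<notin> D0" using less.prems(1)[of "[]"] by simp
  consider "m = 0" | "m = Suc 0" | k where "m = Suc (Suc k)" by (cases m; cases "m - 1") auto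
  then show ?case
  proof cases
    case 1
    have "exact_at \<eta> p (const c + X ^ a * (w * l\<^sup>2 + X * u))" using less.prems(2) 1 by simp
    then show ?thesis using resolve_1[OF nz less.prems(1) _ less.prems(3-8)] by blast
  next
    case 2
    have "exact_at \<eta> p (const c + X ^ a * (w * l\<^sup>2 + X ^ Suc (Suc 0) * u))" using less.prems(2) 2 by simp
    then show ?thesis using resolve_2[OF nz pD _ less.prems(3-8)] by blast
  next
    case 3
    have ex: "exact_at \<eta> p (const c + X ^ a * (w * l\<^sup>2 + X ^ Suc (Suc (Suc k)) * u))"
      using less.prems(2) 3 by simp
    note bl = blow_cusp[OF ex less.prems(3,5,6)]
    define s where "s = - val (dx l) / val (dy l)"
    have s: "val (dx l) + z * val (dy l) = 0 \<longleftrightarrow> z = s" for z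
      unfolding s_def nonzero_eq_divide_eq[OF less.prems(6)] by (rule add_eq_0_iff)
    have cz: "compX (p @ [Slope z]) p" for z using comp_steps(1)[OF less.prems(7)] .
    obtain l1 where l1: "val l1 = 0" "val (dy l1) = val (dy l)"
      "exact_at \<eta> (p @ [Slope s]) (const c + X ^ Suc (Suc a) * (blow_slope s w * l1\<^sup>2 + X ^ Suc k * blow_slope s u))"
      using bl(1)[of s] s[of s] by auto
    have "\<exists>G. [] \<in> G \<and> resolved \<eta> D0 (p @ [Slope s]) G"
    proof (rule less.IH[OF _ _ l1(3)])
      show "(p @ [Slope s]) @ r \<notin> D0" for r using less.prems(1)[of "Slope s # r"] by simp
    qed (use 3 less.prems l1 cz pD in \<open>auto simp: val_blow\<close>)
    then obtain G where G: "[] \<in> G" "resolved \<eta> D0 (p @ [Slope s]) G" by blast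
    have slope: "good \<eta> D0 (p @ [Slope z]) \<and> \<not> singular (foliation_at \<eta> (p @ [Slope z]))" if z: "z \<noteq> s" for z
    proof -
      obtain l2 where l2: "val l2 = val (dx l) + z * val (dy l)"
        "exact_at \<eta> (p @ [Slope z]) (const c + X ^ Suc (Suc a) * (blow_slope z w * l2\<^sup>2 + X ^ Suc k * blow_slope z u))"
        using bl(1)[of z] by blast
      have "val (blow_slope z w * l2\<^sup>2 + X ^ Suc k * blow_slope z u) \<noteq> 0"
        using s[of z] z l2(1) less.prems(3) by (simp add: val_blow)
      then show ?thesis using good_X[OF nz l2(2) _ cz pD] by blast
    qed
    obtain U where U: "val U \<noteq> 0" "exact_at \<eta> (p @ [Vertical]) (const c + X ^ a * Y ^ Suc (Suc a) * U)"
      using bl(2) by blast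
    have vert: "good \<eta> D0 (p @ [Vertical])" using good_XY[OF nz U(2,1) comp_steps(2)[OF less.prems(7)] less.prems(8) pD] .
    let ?G = "insert [] (Cons (Slope s) ` G)"
    have cases: "(\<exists>z. z \<noteq> s \<and> r = [Slope z]) \<or> r = [Vertical] \<or> (\<exists>r'\<in>pts G. r = Slope s # r')" if r: "r \<in> pts ?G" for r
    proof -
      consider t where "t \<noteq> Slope s" "r = [t]" | r' where "r' \<in> pts G" "r = Slope s # r'" using pts_Cons[OF r] by blast
      then show ?thesis
      proof cases
        case 1
        then show ?thesis by (cases t) auto
      qed blast
    qed
    have "{r \<in> pts ?G. singular (foliation_at \<eta> (p @ r))} \<subseteq>
        insert [Vertical] (Cons (Slope s) ` {r \<in> pts G. singular (foliation_at \<eta> ((p @ [Slope s]) @ r))})"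
      using cases slope by fastforce
    then have "finite {r \<in> pts ?G. singular (foliation_at \<eta> (p @ r))}"
      by (rule finite_subset) (use G in \<open>simp add: resolved_def\<close>)
    moreover have "good \<eta> D0 (p @ r)" if r: "r \<in> pts ?G" for r
      using cases[OF r] slope vert G(2) by (fastforce simp: resolved_def)
    moreover have "closed_pts ?G"
    proof -
      have "butlast (Slope s # x) \<in> ?G" if "x \<in> G" for x
        using that G(2) by (cases "x = []") (auto simp: resolved_def closed_pts_def)
      then show ?thesis by (auto simp: closed_pts_def simp del: butlast.simps)
    qed
    moreover have "finite ?G" using G by (simp add: resolved_def)
    ultimately have "resolved \<eta> D0 p ?G" by (simp add: resolved_def)
    then show ?thesis by blast
  qed
qed

text \<open>Divide the primitive: \<open>g = q * v + r\<close> with \<open>v = dy g\<close> and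
  \<open>r\<close> depending on \<open>x\<close> only. Differentiation in \<open>y\<close> gives
  \<open>v * (1 - dy q) = q * dy v\<close>, so \<open>v\<close> divides \<open>q\<close> and
  \<open>g = w * v^2 + r\<close> with \<open>w\<close> a unit. If \<open>r = 0\<close> the foliation
  is already regular and transverse to \<open>E\<close>; otherwise \<open>r\<close> is a power of
  \<open>X\<close> times a unit.\<close>

lemma resolve_dicritical:
  assumes nz: "\<eta> \<noteq> (0, 0)" and D0: "\<And>r. p @ r \<notin> D0" and E: "compX p E" "E \<in> D0"
    and tr: "transform \<eta> p = (hol u, hol v)" "dx v = dy u" and v: "val v = 0" "val (dy v) \<noteq> 0"
  shows "\<exists>G. resolved \<eta> D0 p G"
proof -
  define g where "g = primitive u v - const (val (primitive u v))"
  have g: "dx g = u" "dy g = v" "val g = 0" using primitive[OF tr(2)] by (simp_all add: g_def)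
  obtain q r where qr: "g = q * v + r" "dy r = 0" using smooth_division[OF v] .
  have vr: "val r = 0" using g(3) v by (simp add: qr(1))
  have e: "v * (1 - dy q) = q * dy v"
    using g(2) qr by (simp add: dy_mult algebra_simps)
  have "v dvd q * dy v" by (simp flip: e)
  moreover have "\<not> v dvd dy v" using val_dvd[of v "dy v"] v by blast
  ultimately have "v dvd q" using irreducible_dvd_mult[OF smooth_irreducible[of v]] v by blast
  then obtain w where w: "q = v * w" by (auto elim: dvdE)
  have "v \<noteq> 0" using v by auto
  then have "1 - dy q = w * dy v" using e w by (simp add: mult.assoc)
  then have "1 - val (dy v) * val w = val w * val (dy v)"
    using arg_cong[of "1 - dy q" "w * dy v" val] v by (simp add: w dy_mult)
  then have w0: "val w \<noteq> 0" by auto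
  have gw: "g = w * v\<^sup>2 + r" using qr w by (simp add: power2_eq_square mult_ac)
  have ex: "exact_at \<eta> p g" using tr(1) g by (simp add: exact_at_def)
  show ?thesis
  proof (cases "r = 0")
    case True
    have "exact_at \<eta> p (const 0 + v ^ Suc 1 * w)" using ex gw True by (simp add: power2_eq_square mult_ac)
    then have "good \<eta> D0 p \<and> \<not> singular (foliation_at \<eta> p)" using good_leaf[OF nz _ w0 v E] by blast
    moreover have "pts {} = {[]}" by (auto simp: pts_def)
    ultimately have "resolved \<eta> D0 p {}" by (simp add: resolved_def closed_pts_def)
    then show ?thesis by blast
  next
    case False
    obtain k u' where k: "r = X ^ k * u'" "val u' \<noteq> 0" using X_power_form[OF False qr(2)] .
    obtain m where m: "k = Suc m" using k vr by (cases k) auto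
    have "exact_at \<eta> p (const 0 + X ^ 0 * (w * v\<^sup>2 + X ^ Suc m * u'))" using ex gw k m by simp
    then show ?thesis using resolve_tangency[OF nz D0 _ w0 k(2) v E(1)] E(2) by blast
  qed
qed

section \<open>The foliation at the last level\<close>

context triplet
begin

lemma defect_L: "defect S0 L q = 0"
  using L_Exc[of q] by (simp add: defect_def)

text \<open>The contribution of a direction may be computed right after the blow-up of
  \<open>D\<close>: later blow-ups change it by defects and by the residue of \<open>D\<close>, all
  of which are zero.\<close>

lemma acc_L:
  assumes D: "D \<in> D0"
  shows "acc S0 L D t 0 = (if t \<in> TD D then W D t * mu D else 0)"
proof -
  have DA: "D \<in> A" using D DN by blast
  have "acc S0 L D t (endk A D t) = acc S0 L D t 0"
    using acc_eq[OF finS brS, of L D t "endk A D t"] by (simp add: defect_L L_dic[OF D])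
  moreover have "acc S0 L D t (endk A D t) = (if t \<in> TD D then W D t * mu D else 0)"
  proof (cases "t \<in> TD D")
    case True
    then obtain c where c: "nbr D t c" by (auto simp: TD_def)
    show ?thesis using acc_end(1)[OF DA c, of L] L_nbr[OF DA c] D True by (simp add: ratio_def)
  next
    case False
    then have "\<not> nbr D t c" for c by (auto simp: TD_def)
    then have "acc S0 L D t (endk A D t) = 0" by (rule acc_end(2)[OF DA])
    then show ?thesis using False by simp
  qed
  ultimately show ?thesis by simp
qed

text \<open>Strict transforms meet the new line with their multiplicities, so \<open>rho\<close> is
  the intersection number \<open>acc\<close> just after the blow-up of \<open>D\<close>;
  \<open>acc_L\<close> identifies it with the weight chosen at the last level.\<close>

lemma rho_eq:
  assumes D: "D \<in> D0"
  shows "rho D s = (if Slope s \<in> TD D then W D (Slope s) * mu D else 0)"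
proof -
  have i: "L c * of_nat (iord (Slope s) (loc c (D @ [Slope s]))) =
      (if c \<in> polar_at D \<and> tslope (loc c D) = Some s then of_nat (ord (loc c D)) * L c else 0)"
    if c: "c \<in> cset S0 D" for c
  proof -
    have l: "loc c (D @ [Slope s]) = strict1 (Slope s) (loc c D)" using c by (intro loc_snoc) auto
    show ?thesis
    proof (cases "through c D")
      case True
      then have irr: "irreducible (loc c D)" using irreducible_loc cset_branches c by blast
      show ?thesis
        using tslope_Some[OF irr, of s] iord_strict1_tangent[OF irr, of "Slope s"] iord_unit l True c
        by (auto simp: polar_at_def)
    next
      case False
      then have "is_unit (loc c D)" by (simp add: through_iff_not_unit)
      then show ?thesis using iord_unit strict1_unit l False by (simp add: polar_at_def)
    qed
  qed
  have "acc S0 L D (Slope s) 0 = (\<Sum>c\<in>cset S0 D. L c * of_nat (iord (Slope s) (loc c (D @ [Slope s]))))"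
    unfolding acc_def dpt_0 cset_snoc by (intro sum.cong) auto
  also have "\<dots> = (\<Sum>c\<in>cset S0 D. if c \<in> polar_at D \<and> tslope (loc c D) = Some s then of_nat (ord (loc c D)) * L c else 0)"
    using i by (intro sum.cong) auto
  also have "\<dots> = rho D s"
  proof -
    have "{c \<in> cset S0 D. c \<in> polar_at D \<and> tslope (loc c D) = Some s} = {c. c \<in> polar_at D \<and> tslope (loc c D) = Some s}"
      by (auto simp: polar_at_def)
    then show ?thesis by (simp only: rho_def sum.inter_filter[OF finite_cset, symmetric])
  qed
  finally show ?thesis using acc_L[OF D] by simp
qed

lemma slopes_eq:
  assumes D: "D \<in> D0" shows "slopes D = {s. Slope s \<in> TD D}"
proof (intro set_eqI iffI)
  fix s assume "s \<in> slopes D"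
  then obtain c where c: "c \<in> polar_at D" "tslope (loc c D) = Some s" by (auto simp: slopes_def)
  have cD: "c \<in> cset S0 D" using c by (auto simp: polar_at_def)
  then have "loc c (D @ [Slope s]) = strict1 (Slope s) (loc c D)" by (intro loc_snoc) auto
  then have "through c (D @ [Slope s])"
    using tslope_Some[OF polar_at_irreducible[OF c(1)], of s] c(2) by (simp add: through_iff_not_unit)
  then show "s \<in> {s. Slope s \<in> TD D}" using comp_direction cD D DN by blast
next
  fix s assume "s \<in> {s. Slope s \<in> TD D}"
  then have t: "Slope s \<in> TD D" by simp
  then obtain c where "nbr D (Slope s) c" by (auto simp: TD_def)
  then have "rho D s \<noteq> 0" using rho_eq[OF D] W_nz[OF D] mu(1) t by simp
  then have "{c \<in> polar_at D. tslope (loc c D) = Some s} \<noteq> {}" unfolding rho_def by (metis (no_types, lifting) sum.empty)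
  then show "s \<in> slopes D" by (auto simp: slopes_def)
qed

lemma rho_slopes:
  assumes D: "D \<in> D0"
  shows "(\<Sum>s\<in>slopes D. rho D s * g s) = mu D * (\<Sum>s | Slope s \<in> TD D. W D (Slope s) * g s)"
  unfolding slopes_eq[OF D] sum_distrib_left by (intro sum.cong) (auto simp: rho_eq[OF D])

text \<open>The points of dicritical components at which the foliation is not transverse to them.\<close>

definition Z :: "point set" where
  "Z = {D @ [Slope z] | D z. D \<in> D0 \<and> Slope z \<notin> TD D \<and> (\<Sum>s | Slope s \<in> TD D. W D (Slope s) / (z - s)) = 0}"

lemma finite_Z: "finite Z"
proof -
  have "Z \<subseteq> (\<Union>D\<in>D0. (\<lambda>z. D @ [Slope z]) ` {z. Slope z \<notin> TD D \<and> (\<Sum>s | Slope s \<in> TD D. W D (Slope s) / (z - s)) = 0})"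
    by (auto simp: Z_def)
  moreover have "finite D0" using finA DN by (metis finite_Un)
  then have "finite (\<Union>D\<in>D0. (\<lambda>z. D @ [Slope z]) ` {z. Slope z \<notin> TD D \<and> (\<Sum>s | Slope s \<in> TD D. W D (Slope s) / (z - s)) = 0})"
  proof (rule finite_UN_I)
    fix D assume "D \<in> D0"
    then have "finite {z. Slope z \<notin> TD D \<and> (\<Sum>s | Slope s \<in> TD D. W D (Slope s) / (z - s)) = 0}"
      using W[of D] unfolding simple_weights_def by blast
    then show "finite ((\<lambda>z. D @ [Slope z]) ` {z. Slope z \<notin> TD D \<and> (\<Sum>s | Slope s \<in> TD D. W D (Slope s) / (z - s)) = 0})"
      by (rule finite_imageI)
  qed
  ultimately show ?thesis by (rule finite_subset)
qed

lemma nbr_transverse: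
  assumes "D \<in> A" "nbr D t c"
  shows "transverse_germs (exc_line t) (loc c (endpt A D t))"
proof -
  have i: "iord t (loc c (endpt A D t)) = 1" using iord_nbr[OF assms] .
  then have nz: "rl t (loc c (endpt A D t)) \<noteq> 0" by (auto simp: iord_def)
  have s: "subdegree (rl t (loc c (endpt A D t))) = 1" using i by (simp add: iord_def)
  have "rl t (loc c (endpt A D t)) $ 1 \<noteq> 0" using nth_subdegree_nonzero[OF nz] unfolding s .
  then show ?thesis by (cases t) (auto simp: rl_def transverse_germs_def val_def)
qed

lemma ex_endpt:
  assumes "p \<in> pts A"
  obtains D t where "D \<in> A" "p = endpt A D t"
proof -
  have "p \<noteq> []" using assms NilA by (auto simp: pts_def)
  then have p: "p = butlast p @ [last p]" "butlast p \<in> A" using assms by (auto simp: pts_def)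
  then have "through (Exc (butlast p)) p" using through_snoc_Exc by metis
  then show ?thesis using at_endpt[OF assms] p(2) that by blast
qed

lemma through_endpt:
  assumes "c \<in> cset S0 (endpt A D t)" "through c (endpt A D t)"
  shows "c = Exc D \<or> nbr D t c"
  using assms by (auto simp: nbr_def)

section \<open>The foliation at each kind of point of the last level\<close>

lemma polar_single:
  assumes "polar_at p = {c}" "val (dx (loc c p)) \<noteq> 0 \<or> val (dy (loc c p)) \<noteq> 0"
  shows "\<not> singular (foliation_at eta p)" "invariant (foliation_at eta p) (loc c p)"
    "transverse_germs (loc c p) g \<Longrightarrow> val (wedge (foliation_at eta p) g) \<noteq> 0"
proof -
  obtain u v where "proportional (transform eta p) (num dx p u, num dy p v)"
    using proportional_num[of p] assms(1) by auto
  then have "proportional (transform eta p) (const (L c) * dx (loc c p) + loc c p * u, const (L c) * dy (loc c p) + loc c p * v)"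
    by (simp add: num_def assms(1))
  note * = regular_log[OF eta_nz this]
  have "L c \<noteq> 0" "val (loc c p) = 0" using assms(1) by (auto simp: polar_at_def through_def)
  then show "\<not> singular (foliation_at eta p)" "invariant (foliation_at eta p) (loc c p)"
    "transverse_germs (loc c p) g \<Longrightarrow> val (wedge (foliation_at eta p) g) \<noteq> 0"
    using * assms(2) by (auto simp: transverse_germs_def)
qed

lemma polar_pair:
  assumes "polar_at p = {c, d}" "c \<noteq> d" "transverse_germs (loc c p) (loc d p)" "- L c / L d \<notin> pos_rat"
  shows "simple_singularity (foliation_at eta p)" "invariant (foliation_at eta p) (loc c p)"
    "invariant (foliation_at eta p) (loc d p)"
proof -
  obtain u v where "proportional (transform eta p) (num dx p u, num dy p v)"
    using proportional_num[of p] assms(1) by auto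
  moreover have "{c, d} - {c} = {d}" "{c, d} - {d} = {c}" using assms(2) by auto
  ultimately have "proportional (transform eta p)
    (const (L c) * loc d p * dx (loc c p) + const (L d) * loc c p * dx (loc d p) + loc c p * loc d p * u,
     const (L c) * loc d p * dy (loc c p) + const (L d) * loc c p * dy (loc d p) + loc c p * loc d p * v)"
    using assms(2) by (simp add: num_def assms(1) mult_ac)
  note * = simple_log[OF eta_nz this]
  have "L c \<noteq> 0" "val (loc c p) = 0" "L d \<noteq> 0" "val (loc d p) = 0" using assms(1) by (auto simp: polar_at_def through_def)
  then show "simple_singularity (foliation_at eta p)" "invariant (foliation_at eta p) (loc c p)"
    "invariant (foliation_at eta p) (loc d p)"
    using * assms(3,4) by (auto simp: transverse_germs_def)
qed

lemma transverse_sym: "transverse_germs f g \<longleftrightarrow> transverse_germs g f"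
  by (auto simp: transverse_germs_def algebra_simps)

lemma L_nbr_nz: "D \<in> A \<Longrightarrow> nbr D t c \<Longrightarrow> c \<in> Exc ` D0 \<longleftrightarrow> L c = 0"
proof (cases c)
  case (Sep S)
  assume "nbr D t c"
  then have "S \<in> S0" using Sep by (auto simp: nbr_def cset_def)
  then show ?thesis using Sep L_Sep by auto
next
  case (Exc v)
  assume D: "D \<in> A" "nbr D t c"
  then have "v \<in> A" using ptsD[OF closedA endptA(1)[OF D(1)]] Exc by (auto simp: nbr_def cset_def)
  then show ?thesis using Exc L_dic L_ndic DN by blast
qed

lemma polar_endpt:
  assumes "D \<in> A"
  shows "polar_at (endpt A D t) = {c. (c = Exc D \<and> D \<in> N0) \<or> (nbr D t c \<and> c \<notin> Exc ` D0)}"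
proof -
  have 1: "c \<in> polar_at (endpt A D t) \<longleftrightarrow> (c = Exc D \<or> nbr D t c) \<and> L c \<noteq> 0" for c
    using Exc_in_cset[OF endptA(2)[of D t]] endptA(2)[of D t] by (auto simp: polar_at_def nbr_def)
  have 2: "L (Exc D) \<noteq> 0 \<longleftrightarrow> D \<in> N0" using L_dic[of D] L_ndic[of D] DN assms by blast
  have "c \<in> polar_at (endpt A D t) \<longleftrightarrow> (c = Exc D \<and> D \<in> N0) \<or> (nbr D t c \<and> c \<notin> Exc ` D0)" for c
    using 1[of c] 2 L_nbr_nz[OF assms, of t c] by (cases "c = Exc D") (auto simp: nbr_def)
  then show ?thesis by blast
qed

lemma type_N:
  assumes D: "D \<in> N0" and c: "\<forall>c. nbr D t c \<longrightarrow> c \<in> Exc ` D0"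
  defines "\<omega> \<equiv> foliation_at eta (endpt A D t)"
  shows "\<not> singular \<omega>" "invariant \<omega> (exc_line t)" "transverse_germs (exc_line t) g \<Longrightarrow> val (wedge \<omega> g) \<noteq> 0"
proof -
  have "D \<in> A" using D DN by blast
  then have "polar_at (endpt A D t) = {Exc D}" using polar_endpt[of D t] D c by blast
  moreover have "val (dx (exc_line t)) \<noteq> 0 \<or> val (dy (exc_line t)) \<noteq> 0" by (cases t) auto
  ultimately show "\<not> singular \<omega>" "invariant \<omega> (exc_line t)" "transverse_germs (exc_line t) g \<Longrightarrow> val (wedge \<omega> g) \<noteq> 0"
    using polar_single[of "endpt A D t" "Exc D"] unfolding \<omega>_def by (auto simp: loc_endpt)
qed

text \<open>By the choice of the residues \<open>- L (Exc D) / L c\<close> is an index at a singular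
  point of the support, hence not a positive rational number.\<close>

lemma type_NN:
  assumes D: "D \<in> N0" and c: "nbr D t c" "c \<notin> Exc ` D0"
  defines "\<omega> \<equiv> foliation_at eta (endpt A D t)"
  shows "simple_singularity \<omega>" "invariant \<omega> (exc_line t)" "invariant \<omega> (loc c (endpt A D t))"
proof -
  have DA: "D \<in> A" "D \<notin> D0" using D DN by auto
  have "polar_at (endpt A D t) = {Exc D, c}"
    unfolding polar_endpt[OF DA(1)] using D c nbr_unique[OF DA(1) c(1)] by blast
  moreover have "Exc D \<noteq> c" using c by (auto simp: nbr_def)
  moreover have "transverse_germs (loc (Exc D) (endpt A D t)) (loc c (endpt A D t))"
    using nbr_transverse[OF DA(1) c(1)] by (simp add: loc_endpt)
  moreover have "- L (Exc D) / L c \<notin> pos_rat"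
  proof -
    have i: "idx (endpt A D t) c \<in> - {0} - pos_rat" "idx (endpt A D t) c = 1 / idx (endpt A D t) (Exc D)"
      using singular_pair(3,4)[OF D c] by auto
    have "L c = - idx (endpt A D t) (Exc D) * mu D" using L_nbr[OF DA(1) c(1)] c DA by (simp add: ratio_def)
    moreover have "L (Exc D) = mu D" using L_eq(1) DA by (simp add: M_def)
    ultimately have "- L (Exc D) / L c = idx (endpt A D t) c" using i mu(1)[of D] by simp
    then show ?thesis using i by simp
  qed
  ultimately show "simple_singularity \<omega>" "invariant \<omega> (exc_line t)" "invariant \<omega> (loc c (endpt A D t))"
    using polar_pair[of "endpt A D t" "Exc D" c] unfolding \<omega>_def by (auto simp: loc_endpt)
qed

lemma type_D:
  assumes D: "D \<in> D0" and c: "nbr D t c"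
  defines "\<omega> \<equiv> foliation_at eta (endpt A D t)"
  shows "\<not> singular \<omega>" "invariant \<omega> (loc c (endpt A D t))" "val (wedge \<omega> (exc_line t)) \<noteq> 0"
    "val (dx (loc c (endpt A D t))) \<noteq> 0 \<or> val (dy (loc c (endpt A D t))) \<noteq> 0"
proof -
  have DA: "D \<in> A" "D \<notin> N0" using D DN by auto
  have "c \<notin> Exc ` D0"
  proof
    assume "c \<in> Exc ` D0"
    then obtain v where "c = Exc v" "v \<in> D0" by blast
    then show False using nbr_dic[OF D, of t v] c DN by blast
  qed
  then have "polar_at (endpt A D t) = {c}"
    unfolding polar_endpt[OF DA(1)] using DA c nbr_unique[OF DA(1) c] by blast
  moreover have tr: "transverse_germs (exc_line t) (loc c (endpt A D t))" using nbr_transverse[OF DA(1) c(1)] .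
  moreover show "val (dx (loc c (endpt A D t))) \<noteq> 0 \<or> val (dy (loc c (endpt A D t))) \<noteq> 0"
    using tr by (auto simp: transverse_germs_def)
  ultimately show "\<not> singular \<omega>" "invariant \<omega> (loc c (endpt A D t))" "val (wedge \<omega> (exc_line t)) \<noteq> 0"
    using polar_single[of "endpt A D t" c] transverse_sym unfolding \<omega>_def by blast+
qed

lemma holomorphic_fol:
  assumes "transform eta p = (hol u, hol v)" "val u \<noteq> 0 \<or> val v \<noteq> 0"
  shows "\<not> singular (foliation_at eta p)" "val (wedge (u, v) g) \<noteq> 0 \<Longrightarrow> val (wedge (foliation_at eta p) g) \<noteq> 0"
proof -
  have "proportional (transform eta p) (u, v)" using proportionalI[OF eta_nz, of p 1 u v] assms(1) by simp
  then obtain g where g: "u = g * fst (foliation_at eta p)" "v = g * snd (foliation_at eta p)"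
    using fol_factor[OF eta_nz] by blast
  then show "\<not> singular (foliation_at eta p)" using assms(2) by (auto simp: singular_def)
  show "val (wedge (u, v) h) \<noteq> 0 \<Longrightarrow> val (wedge (foliation_at eta p) h) \<noteq> 0" for h
    unfolding g using wedge_scale[of g "fst (foliation_at eta p)" "snd (foliation_at eta p)"] by auto
qed

text \<open>Off \<open>Z\<close> the restriction of the form to \<open>D\<close> does not vanish. At
  infinity this is the condition in \<open>simple_weights\<close> for the case that
  \<open>Vertical\<close> is not a pole.\<close>

lemma type_D0:
  assumes D: "D \<in> D0" and t: "t \<notin> TD D" and z: "D @ [t] \<notin> Z"
  shows "\<not> singular (foliation_at eta (D @ [t]))" "val (wedge (foliation_at eta (D @ [t])) (exc_line t)) \<noteq> 0"
proof -
  have "\<exists>u v. transform eta (D @ [t]) = (hol u, hol v) \<and> val (wedge (u, v) (exc_line t)) \<noteq> 0"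
  proof (cases t)
    case (Slope z)
    then have zs: "z \<notin> slopes D" using t by (simp add: slopes_eq[OF D])
    obtain u v where uv: "transform eta (D @ [Slope z]) = (hol u, hol v)" "val v = (\<Sum>s\<in>slopes D. rho D s / (z - s))"
      using dicritical_slope[OF L_dic[OF D] zs] by blast
    have "val v = mu D * (\<Sum>s | Slope s \<in> TD D. W D (Slope s) / (z - s))"
      using uv(2) rho_slopes[OF D, of "\<lambda>s. 1 / (z - s)"] by simp
    then have "val v \<noteq> 0" using assms mu(1) Slope by (auto simp: Z_def)
    then show ?thesis using uv(1) Slope by (auto simp: wedge_def)
  next
    case Vertical
    have "tslope (loc c D) \<noteq> None" if c: "c \<in> polar_at D" for c
    proof
      assume n: "tslope (loc c D) = None"
      have cD: "c \<in> cset S0 D" using c by (simp add: polar_at_def)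
      obtain s where s: "\<not> is_unit (strict1 s (loc c D))" using unibranch[OF polar_at_irreducible[OF c]] by blast
      then have "s = Vertical" using n tslope_Some[OF polar_at_irreducible[OF c]] by (cases s) auto
      moreover have "loc c (D @ [s]) = strict1 s (loc c D)" using cD by (intro loc_snoc) auto
      ultimately have "through c (D @ [Vertical])" using s by (simp add: through_iff_not_unit)
      then show False using comp_direction cD t D DN Vertical by blast
    qed
    then obtain u v where uv: "transform eta (D @ [Vertical]) = (hol u, hol v)" "val u = - (\<Sum>s\<in>slopes D. rho D s * s)"
      using dicritical_vertical[OF L_dic[OF D]] by blast
    have "(\<Sum>s | Slope s \<in> TD D. W D (Slope s) * s) \<noteq> 0" using W[OF D] t Vertical by (simp add: simple_weights_def)
    then have "val u \<noteq> 0" using uv(2) rho_slopes[OF D, of "\<lambda>s. s"] mu(1) by simp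
    then show ?thesis using uv(1) Vertical by (auto simp: wedge_def)
  qed
  then obtain u v where uv: "transform eta (D @ [t]) = (hol u, hol v)" "val (wedge (u, v) (exc_line t)) \<noteq> 0" by blast
  then have "val u \<noteq> 0 \<or> val v \<noteq> 0" by (auto simp: wedge_def)
  then show "\<not> singular (foliation_at eta (D @ [t]))" "val (wedge (foliation_at eta (D @ [t])) (exc_line t)) \<noteq> 0"
    using holomorphic_fol[OF uv(1)] uv(2) by blast+
qed

lemma type_Z:
  assumes "p \<in> Z"
  obtains D u v z where "D \<in> D0" "p = D @ [Slope z]" "Slope z \<notin> TD D" "p = endpt A D (Slope z)"
    "transform eta p = (hol u, hol v)" "dx v = dy u" "val v = 0" "val (dy v) \<noteq> 0"
proof -
  obtain D z where D: "D \<in> D0" "p = D @ [Slope z]" "Slope z \<notin> TD D" "(\<Sum>s | Slope s \<in> TD D. W D (Slope s) / (z - s)) = 0"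
    using assms by (auto simp: Z_def)
  have zs: "z \<notin> slopes D" using D by (simp add: slopes_eq[OF D(1)])
  obtain u v where uv: "transform eta p = (hol u, hol v)" "dx v = dy u" "val v = (\<Sum>s\<in>slopes D. rho D s / (z - s))"
     "val (dy v) = - (\<Sum>s\<in>slopes D. rho D s / (z - s)\<^sup>2)"
    using dicritical_slope[OF L_dic[OF D(1)] zs] D(2) by blast
  have "val v = 0" using uv(3) rho_slopes[OF D(1), of "\<lambda>s. 1 / (z - s)"] D(4) by simp
  moreover have "(\<Sum>s | Slope s \<in> TD D. W D (Slope s) / (z - s)\<^sup>2) \<noteq> 0" using W[OF D(1)] D(3,4) by (simp add: simple_weights_def)
  then have "val (dy v) \<noteq> 0" using uv(4) rho_slopes[OF D(1), of "\<lambda>s. 1 / (z - s)\<^sup>2"] mu(1) by simp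
  moreover have DA: "D \<in> A" using D(1) DN by blast
  have "D @ [Slope z] \<notin> A" using blown_direction[OF DA] D(3) by blast
  then have "p = endpt A D (Slope z)" using endpt_notin[OF DA] D(2) by simp
  ultimately show ?thesis using that[OF D(1-3) _ uv(1,2)] by simp
qed

lemma Z_pts: "Z \<subseteq> pts A"
proof
  fix p assume "p \<in> Z"
  then obtain D z where D: "D \<in> D0" "p = endpt A D (Slope z)" using type_Z by metis
  then have "D \<in> A" using DN by blast
  then show "p \<in> pts A" using endptA(1) D(2) by simp
qed

lemma good_pts:
  assumes p: "p \<in> pts A" "p \<notin> Z"
  shows "good eta D0 p"
proof -
  obtain D t where D: "D \<in> A" "p = endpt A D t" using ex_endpt[OF p(1)] .
  have th: "q = D \<or> nbr D t (Exc q)" if "through (Exc q) p" for q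
    using that D Exc_in_cset[OF that] by (auto simp: nbr_def)
  have lD: "loc (Exc D) p = exc_line t" by (simp add: D loc_endpt)
  consider "D \<in> N0" "\<forall>c. nbr D t c \<longrightarrow> c \<in> Exc ` D0" | c where "D \<in> N0" "nbr D t c" "c \<notin> Exc ` D0"
    | c where "D \<in> D0" "nbr D t c" | "D \<in> D0" "t \<notin> TD D" using D DN by (auto simp: TD_def)
  then show ?thesis
  proof cases
    case 1
    note tn = type_N[OF 1]
    have "if q \<in> D0 then \<not> singular (foliation_at eta p) \<and> val (wedge (foliation_at eta p) (loc (Exc q) p)) \<noteq> 0
      else invariant (foliation_at eta p) (loc (Exc q) p)" if q: "through (Exc q) p" for q
    proof (cases "q = D")
      case True
      then show ?thesis using tn 1 DN lD D by auto
    next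
      case False
      then have n: "nbr D t (Exc q)" using th q by blast
      then have "q \<in> D0" using 1 by auto
      then show ?thesis using tn(1) tn(3)[OF nbr_transverse[OF D(1) n]] D by simp
    qed
    moreover have "sred (foliation_at eta p)" using tn(1) D by (simp add: sred_def)
    ultimately show ?thesis unfolding good_def by auto
  next
    case 2
    note tn = type_NN[OF 2]
    have "q \<notin> D0 \<and> invariant (foliation_at eta p) (loc (Exc q) p)" if q: "through (Exc q) p" for q
    proof (cases "q = D")
      case True
      then show ?thesis using tn 2 DN lD D by auto
    next
      case False
      then have n: "nbr D t (Exc q)" using th q by blast
      then have "Exc q = c" using nbr_unique[OF D(1) 2(2)] by simp
      then show ?thesis using tn(3) 2 D by auto
    qed
    moreover have "sred (foliation_at eta p)" using tn(1) D by (simp add: sred_def)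
    ultimately show ?thesis unfolding good_def by auto
  next
    case 3
    note tn = type_D[OF 3]
    have "if q \<in> D0 then \<not> singular (foliation_at eta p) \<and> val (wedge (foliation_at eta p) (loc (Exc q) p)) \<noteq> 0
      else invariant (foliation_at eta p) (loc (Exc q) p)" if q: "through (Exc q) p" for q
    proof (cases "q = D")
      case True
      then show ?thesis using tn 3 lD D by auto
    next
      case False
      then have n: "nbr D t (Exc q)" using th q by blast
      then have "Exc q = c" using nbr_unique[OF D(1) 3(2)] by simp
      moreover have "q \<notin> D0" using nbr_dic[OF 3(1) n] DN by blast
      ultimately show ?thesis using tn(2) D by auto
    qed
    moreover have "sred (foliation_at eta p)" using tn(1) D by (simp add: sred_def)
    ultimately show ?thesis unfolding good_def by auto
  next
    case 4
    have "D @ [t] \<notin> A" using blown_direction D 4 by blast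
    then have pe: "p = D @ [t]" using endpt_notin D by simp
    note tn = type_D0[OF 4]
    have "q = D" if q: "through (Exc q) p" for q using th[OF q] 4 by (auto simp: TD_def)
    moreover have "\<not> singular (foliation_at eta p)" "val (wedge (foliation_at eta p) (loc (Exc D) p)) \<noteq> 0"
      using tn p(2) pe unfolding lD by blast+
    ultimately show ?thesis unfolding good_def sred_def using 4(1) by metis
  qed
qed

lemma singular_pts: "finite {p \<in> pts A. singular (foliation_at eta p)}"
proof -
  have "{p \<in> pts A. singular (foliation_at eta p)} \<subseteq> Z \<union> (\<Union>D\<in>A. endpt A D ` TD D)"
  proof
    fix p assume p: "p \<in> {p \<in> pts A. singular (foliation_at eta p)}"
    then obtain D t where D: "D \<in> A" "p = endpt A D t" using ex_endpt by blast
    have "p \<in> Z" if t: "t \<notin> TD D"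
    proof (rule ccontr)
      assume "p \<notin> Z"
      moreover have "p = D @ [t]" using endpt_notin[OF D(1)] blown_direction[OF D(1)] t D by blast
      moreover have "\<not> nbr D t c" for c using t by (auto simp: TD_def)
      ultimately have "\<not> singular (foliation_at eta p)"
        using type_N(1)[of D t] type_D0(1)[of D t] D DN t by (cases "D \<in> D0") auto
      then show False using p by simp
    qed
    then show "p \<in> Z \<union> (\<Union>D\<in>A. endpt A D ` TD D)" using D by blast
  qed
  moreover have "finite (Z \<union> (\<Union>D\<in>A. endpt A D ` TD D))" using finite_Z finite_TD by auto
  ultimately show ?thesis by (rule finite_subset)
qed

lemma resolve_Z:
  assumes p: "p \<in> Z" shows "\<exists>G. resolved eta D0 p G"
proof -
  obtain D u v z where D: "D \<in> D0" "p = D @ [Slope z]" "Slope z \<notin> TD D" "p = endpt A D (Slope z)"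
    "transform eta p = (hol u, hol v)" "dx v = dy u" "val v = 0" "val (dy v) \<noteq> 0" using type_Z[OF p] .
  have DA: "D \<in> A" using D DN by blast
  have "q = D" if q: "through (Exc q) p" for q
    using D(3,4) Exc_in_cset[OF q] q by (auto simp: nbr_def TD_def)
  moreover have "loc (Exc D) p = X" unfolding D(2) by simp
  ultimately have "compX p D" unfolding compX_def by blast
  moreover have "p @ r \<notin> D0" for r
  proof
    assume "p @ r \<in> D0"
    then have "p @ r \<in> A" using DN by blast
    then have "p \<in> A" using closed_ptsD[OF closedA] by (metis prefixI)
    then show False using p Z_pts by (auto simp: pts_def)
  qed
  ultimately show ?thesis using resolve_dicritical[OF eta_nz _ _ D(1,5-8)] by blast
qed

text \<open>On a non-dicritical component, or on another curve through a point of a dicritical one,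
  the known leaves exhaust the invariant branches: one of them would divide the equation of
  \<open>S\<close>. Only points of a dicritical component without neighbour remain.\<close>

lemma new_separatrix:
  assumes S: "S \<in> branches" "S \<notin> S0" "invariant (foliation_at eta []) (eqn S)" and p: "p \<in> pts A" "through (Sep S) p"
  shows "\<exists>D\<in>D0. comps_at (centres \<Delta>) p = {D} \<and> support_branches \<Delta> \<Sigma> (height \<Delta>) p = {}"
proof -
  obtain D t where D: "D \<in> A" "p = endpt A D t" using ex_endpt[OF p(1)] .
  have inv: "invariant (foliation_at eta p) (loc (Sep S) p)" using invariant_Sep[OF eta_nz S(1,3) p(2)] .
  have v: "val (loc (Sep S) p) = 0" using p(2) by (simp add: through_def)
  have lD: "loc (Exc D) p = exc_line t" by (simp add: D loc_endpt)
  have nD: "\<not> exc_line t dvd loc (Sep S) p" using Exc_not_dvd_Sep[OF S(1), of D p] lD endptA(2)[of D t] D by simp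
  have nc: "\<not> loc c p dvd loc (Sep S) p" if c: "nbr D t c" for c
  proof (cases c)
    case (Sep S')
    then have S': "S' \<in> S0" "through (Sep S') p" using c D by (auto simp: nbr_def cset_def)
    then show ?thesis using Sep_loc_inj[of S' S p] S brS Sep by blast
  next
    case (Exc q)
    then show ?thesis using Exc_not_dvd_Sep[OF S(1), of q p] c D by (auto simp: nbr_def)
  qed
  have "D \<in> D0 \<and> t \<notin> TD D"
  proof (rule ccontr)
    assume "\<not> (D \<in> D0 \<and> t \<notin> TD D)"
    then consider "D \<in> N0" "\<forall>c. nbr D t c \<longrightarrow> c \<in> Exc ` D0" | c where "D \<in> N0" "nbr D t c" "c \<notin> Exc ` D0"
      | c where "D \<in> D0" "nbr D t c" using D DN by (auto simp: TD_def)
    then show False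
    proof cases
      case 1
      have "val (dx (exc_line t)) \<noteq> 0 \<or> val (dy (exc_line t)) \<noteq> 0" by (cases t) auto
      then have "exc_line t dvd loc (Sep S) p"
        using regular_leaf_dvd[of "foliation_at eta p" "exc_line t" "loc (Sep S) p"] type_N(1,2)[OF 1] D inv v by simp
      then show False using nD by blast
    next
      case 2
      have "val (loc c p) = 0" using 2(2) D by (simp add: nbr_def through_def)
      then have "loc c p dvd loc (Sep S) p"
        using two_leaves_dvd[of "foliation_at eta p" t "loc c p" "loc (Sep S) p"] type_NN[OF 2] D inv v nD nbr_transverse[OF D(1) 2(2)]
        by (simp add: sred_def)
      then show False using nc 2 by blast
    next
      case 3
      have "val (loc c p) = 0" using 3(2) D by (simp add: nbr_def through_def)
      then have "loc c p dvd loc (Sep S) p"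
        using regular_leaf_dvd[of "foliation_at eta p" "loc c p" "loc (Sep S) p"] type_D[OF 3] D inv v by simp
      then show False using nc 3 by blast
    qed
  qed
  note D0 = this
  have "c = Exc D" if "c \<in> cset S0 p" "through c p" for c
    using that D0 through_endpt[of c D t] D by (auto simp: TD_def)
  moreover have "through (Exc D) p" using endptA(2) D by simp
  ultimately have "comps_at (centres \<Delta>) p = {D}" "{c \<in> cset S0 p. through c p \<and> c \<notin> Exc ` D0} = {}"
    using comps_at_eq[OF p(1)] Exc_in_cset D0 by blast+
  then show ?thesis using D0 support_branches_eq[OF p(1)] by auto
qed

text \<open>On a dicritical component the rational function has finitely many zeros, so some slope
  shows that the restriction of the form is not zero.\<close>

lemma faithful_A:
  assumes q: "q \<in> A" "polar_at q \<noteq> {}"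
  shows "one_faithful (transform eta q)"
proof (rule one_faithful_transform[OF q(2)])
  show "L (Exc q) \<noteq> 0 \<or> (\<exists>z. z \<notin> slopes q \<and> (\<Sum>s\<in>slopes q. rho q s / (z - s)) \<noteq> 0)"
  proof (cases "q \<in> D0")
    case True
    let ?P = "\<lambda>z. \<Sum>s | Slope s \<in> TD q. W q (Slope s) / (z - s)"
    have "finite ({z. Slope z \<notin> TD q \<and> ?P z = 0} \<union> slopes q)" using W[OF True] by (simp add: simple_weights_def)
    then obtain z where "z \<notin> {z. Slope z \<notin> TD q \<and> ?P z = 0} \<union> slopes q"
      using ex_new_if_finite[OF infinite_UNIV_char_0] by blast
    then have z: "z \<notin> slopes q" "?P z \<noteq> 0" by (auto simp: slopes_eq[OF True])
    have "(\<Sum>s\<in>slopes q. rho q s / (z - s)) = mu q * ?P z" using rho_slopes[OF True, of "\<lambda>s. 1 / (z - s)"] by simp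
    then show ?thesis using z mu(1) by auto
  qed (use q DN L_ndic in blast)
qed

end

section \<open>Minimal reduction\<close>

text \<open>Used in both directions: components created over a reduced point are invariant, and so a
  dicritical component is never created there.\<close>

lemma over_reduced:
  assumes nz: "\<eta> \<noteq> (0, 0)" and s: "sred (foliation_at \<eta> p)"
  shows "sred (foliation_at \<eta> (p @ w)) \<and> (\<forall>r. prefix p r \<longrightarrow> through (Exc r) (p @ w) \<longrightarrow>
    invariant (foliation_at \<eta> (p @ w)) (loc (Exc r) (p @ w)))"
proof (induction w rule: rev_induct)
  case Nil
  have "\<not> through (Exc r) p" if "prefix p r" for r
    using that through_Exc_strict_prefix[of r p] by (meson prefix_order.less_le_not_le)
  then show ?case using s by simp
next
  case (snoc t w)
  let ?p = "p @ w"
  have sr: "sred (foliation_at \<eta> ?p)" using snoc by blast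
  have "invariant (foliation_at \<eta> (?p @ [t])) (loc (Exc r) (?p @ [t]))" if r: "prefix p r" "through (Exc r) (?p @ [t])" for r
  proof (cases "r = ?p")
    case True
    show ?thesis unfolding True loc_Exc_snoc by (rule blow_sred(2)[OF nz sr])
  next
    case False
    then have "through (Exc r) ?p" using through_snocD[OF r(2)] by auto
    then have i: "invariant (foliation_at \<eta> ?p) (loc (Exc r) ?p)" using snoc r(1) by blast
    show ?thesis by (rule invariant_loc[OF nz _ _ i r(2)]) (use False in auto)
  qed
  then show ?case using blow_sred(1)[OF nz sr, of t] unfolding append_assoc by blast
qed

lemma ex_blowup_list:
  assumes "finite B" "closed_pts B" "blowup_seq \<pi>" "set \<pi> \<subseteq> B"
  shows "\<exists>\<sigma>. blowup_seq (\<pi> @ \<sigma>) \<and> set (\<pi> @ \<sigma>) = B"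
  using assms(3,4)
proof (induction "card (B - set \<pi>)" arbitrary: \<pi>)
  case 0
  then have "set \<pi> = B" using assms(1) by auto
  then show ?case using 0 by (intro exI[of _ "[]"]) simp
next
  case (Suc n)
  have ne: "B - set \<pi> \<noteq> {}" using Suc(2) by (metis card.empty nat.distinct(1))
  obtain x where x: "x \<in> B - set \<pi>" "\<And>y. y \<in> B - set \<pi> \<Longrightarrow> length x \<le> length y"
    using ex_min_if_finite[of "length ` (B - set \<pi>)"] ne assms(1) by (auto simp: not_less)
  have "x \<noteq> []" using x blowup_seq_closed[OF Suc(3)] by auto
  then have "butlast x \<in> B" "length (butlast x) < length x" using assms(2) x by (auto simp: closed_pts_def)
  then have "butlast x \<in> set \<pi>" using x(2)[of "butlast x"] by fastforce
  then have bs: "blowup_seq (\<pi> @ [x])" using Suc(3) x by (simp add: blowup_seq_snoc pts_def)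
  have "n = card (B - set (\<pi> @ [x]))"
  proof -
    have "B - set (\<pi> @ [x]) = (B - set \<pi>) - {x}" by auto
    then have "card (B - set (\<pi> @ [x])) = card (B - set \<pi>) - 1" by (simp only: card_Diff_singleton[OF x(1)])
    then show ?thesis by (simp flip: Suc(2))
  qed
  then obtain \<sigma> where "blowup_seq ((\<pi> @ [x]) @ \<sigma>)" "set ((\<pi> @ [x]) @ \<sigma>) = B"
    using Suc(1)[OF _ bs] Suc(4) x by auto
  then show ?case by (intro exI[of _ "x # \<sigma>"]) simp
qed

lemma smooth_tangent:
  assumes "ord f = 1"
  shows "is_unit (strict1 (Slope z) f) \<longleftrightarrow> val (dx f) + z * val (dy f) \<noteq> 0"
    "is_unit (strict1 Vertical f) \<longleftrightarrow> val (dy f) \<noteq> 0"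
proof -
  have "tc f = [:val (dx f), val (dy f):]"
    by (rule poly_eqI) (simp add: coeff_tc assms coeff_pCons val_def split: nat.split)
  then show "is_unit (strict1 (Slope z) f) \<longleftrightarrow> val (dx f) + z * val (dy f) \<noteq> 0"
    "is_unit (strict1 Vertical f) \<longleftrightarrow> val (dy f) \<noteq> 0"
    unfolding is_unit_iff_val val_strict1 by (simp_all add: assms)
qed

lemma ord_1_iff: "val f = 0 \<Longrightarrow> ord f = 1 \<Longrightarrow> f \<noteq> 0 \<Longrightarrow> val (dx f) \<noteq> 0 \<or> val (dy f) \<noteq> 0"
proof -
  assume f: "val f = 0" "ord f = 1" "f \<noteq> 0"
  obtain j where "j \<le> ord f" "coeff2 f (ord f - j) j \<noteq> 0" using coeff2_ord_nonzero[OF f(3)] .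
  then have "coeff2 f 1 0 \<noteq> 0 \<or> coeff2 f 0 1 \<noteq> 0" using f(2) by (cases j) auto
  then show ?thesis by (auto simp: val_def)
qed

lemma same_tangent:
  assumes f: "f \<noteq> 0" "val f = 0" "ord f = 1" and g: "g \<noteq> 0" "val g = 0" "ord g = 1"
    and t: "\<not> is_unit (strict1 t f)" and n: "\<not> transverse_germs f g"
  shows "\<not> is_unit (strict1 t g)"
proof -
  have J: "val (dx f) * val (dy g) = val (dy f) * val (dx g)" using n by (simp add: transverse_germs_def)
  have nz: "val (dx f) \<noteq> 0 \<or> val (dy f) \<noteq> 0" using ord_1_iff f by blast
  show ?thesis
  proof (cases t)
    case (Slope z)
    then have e: "val (dx f) = - z * val (dy f)" using t smooth_tangent(1)[OF f(3), of z] by (simp add: add_eq_0_iff2)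
    then have "val (dy f) \<noteq> 0" using nz by auto
    moreover have "val (dy f) * (val (dx g) + z * val (dy g)) = val (dy f) * val (dx g) - (- z * val (dy f)) * val (dy g)"
      by (simp add: algebra_simps)
    then have "val (dy f) * (val (dx g) + z * val (dy g)) = 0" using J unfolding e by (simp only: diff_self)
    ultimately show ?thesis using smooth_tangent(1)[OF g(3), of z] Slope by simp
  next
    case Vertical
    then have "val (dy f) = 0" using t smooth_tangent(2)[OF f(3)] by simp
    then have "val (dy g) = 0" using J nz by simp
    then show ?thesis using smooth_tangent(2)[OF g(3)] Vertical by simp
  qed
qed

text \<open>Invariance and the conditions of a reduction depend on the set of centres only;
  \<open>invariant_comp_iff\<close> and \<open>reduces_iff\<close> translate between sets and
  sequences.\<close>

definition inv_on :: "form \<Rightarrow> point set \<Rightarrow> point \<Rightarrow> bool" where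
  "inv_on \<eta> B D \<longleftrightarrow> (\<forall>p\<in>pts B. through (Exc D) p \<longrightarrow> invariant (foliation_at \<eta> p) (loc (Exc D) p))"

definition red :: "form \<Rightarrow> point set \<Rightarrow> bool" where
  "red \<eta> B \<longleftrightarrow> finite {p \<in> pts B. singular (foliation_at \<eta> p)} \<and> (\<forall>p\<in>pts B. sred (foliation_at \<eta> p)) \<and>
    (\<forall>D\<in>B. \<not> inv_on \<eta> B D \<longrightarrow> (\<forall>p\<in>pts B. through (Exc D) p \<longrightarrow>
      \<not> singular (foliation_at \<eta> p) \<and> val (wedge (foliation_at \<eta> p) (loc (Exc D) p)) \<noteq> 0)) \<and>
    (\<forall>D\<in>B. \<forall>E\<in>B. \<not> inv_on \<eta> B D \<longrightarrow> \<not> inv_on \<eta> B E \<longrightarrow> D \<noteq> E \<longrightarrow>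
      \<not> (\<exists>p\<in>pts B. through (Exc D) p \<and> through (Exc E) p))"

lemma points_all: "points \<pi> (length \<pi>) = pts (set \<pi>)" and components_all: "components \<pi> (length \<pi>) = set \<pi>"
  by (simp_all add: points_eq components_def)

lemma invariant_comp_iff: "invariant_comp \<eta> \<pi> D \<longleftrightarrow> inv_on \<eta> (set \<pi>) D"
  by (simp add: invariant_comp_def inv_on_def points_all)

lemma reduces_iff: "reduces \<eta> \<pi> \<longleftrightarrow> \<eta> \<noteq> (0, 0) \<and> blowup_seq \<pi> \<and> red \<eta> (set \<pi>)"
  unfolding reduces_def red_def Let_def points_all components_all invariant_comp_iff intersecting_def sred_def
  by blast

context triplet
begin

definition \<gamma> :: "point \<Rightarrow> point set" where
  "\<gamma> p = (SOME G. resolved eta D0 p G)"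

lemma \<gamma>: "p \<in> Z \<Longrightarrow> resolved eta D0 p (\<gamma> p)"
  unfolding \<gamma>_def using resolve_Z by (rule someI_ex)

text \<open>\<open>R\<close> reduces the foliation, and \<open>B\<close> below is a smallest part of it that still does.\<close>

definition R :: "point set" where
  "R = A \<union> (\<Union>p\<in>Z. (@) p ` \<gamma> p)"

lemma finite_R: "finite R" and A_R: "A \<subseteq> R"
  using finite_Z \<gamma> by (auto simp: R_def resolved_def)

lemma R_prefix: "q \<in> R \<Longrightarrow> q \<notin> A \<Longrightarrow> \<exists>p\<in>Z. prefix p q"
  unfolding R_def by (auto intro: prefixI)

lemma closed_R: "closed_pts R"
  unfolding closed_pts_def
proof (intro ballI impI)
  fix x assume x: "x \<in> R" "x \<noteq> []"
  show "butlast x \<in> R"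
  proof (cases "x \<in> A")
    case True
    then show ?thesis using closedA x by (auto simp: closed_pts_def R_def)
  next
    case False
    then obtain p r where p: "p \<in> Z" "r \<in> \<gamma> p" "x = p @ r" using x by (auto simp: R_def)
    show ?thesis
    proof (cases "r = []")
      case True
      then have "x \<in> pts A" using p Z_pts by auto
      then show ?thesis using x A_R by (auto simp: pts_def)
    next
      case False
      then have "butlast r \<in> \<gamma> p" using \<gamma>[OF p(1)] p(2) by (auto simp: resolved_def closed_pts_def)
      then have "p @ butlast r \<in> R" using p(1) by (auto simp: R_def)
      then show ?thesis using p False by (simp add: butlast_append)
    qed
  qed
qed

lemma pts_R:
  assumes p: "p \<in> pts R"
  shows "(p \<in> pts A \<and> p \<notin> Z) \<or> (\<exists>z\<in>Z. \<exists>r\<in>pts (\<gamma> z). p = z @ r)"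
proof (cases "p \<in> pts A")
  case True
  show ?thesis
  proof (cases "p \<in> Z")
    case z: True
    have "p \<notin> R" using p by (simp add: pts_def)
    then have "[] \<notin> \<gamma> p" using z by (force simp: R_def)
    then have "[] \<in> pts (\<gamma> p)" by (simp add: pts_def)
    then show ?thesis using z by force
  qed (use True in blast)
next
  case False
  have pR: "p \<notin> R" "p \<notin> A" using p A_R by (auto simp: pts_def)
  then have ne: "p \<noteq> []" using NilA by auto
  then have b: "butlast p \<in> R" "butlast p \<notin> A" using p pR False by (auto simp: pts_def)
  then obtain z r where z: "z \<in> Z" "r \<in> \<gamma> z" "butlast p = z @ r" by (auto simp: R_def)
  have e: "p = z @ (r @ [last p])" using ne z(3) by (metis append_assoc append_butlast_last_id)
  then have "r @ [last p] \<notin> \<gamma> z" using pR z(1) by (auto simp: R_def)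
  then have "r @ [last p] \<in> pts (\<gamma> z)" using z(2) by (simp add: pts_def)
  then show ?thesis using z(1) e by blast
qed

lemma good_R: "p \<in> pts R \<Longrightarrow> good eta D0 p"
  using pts_R good_pts \<gamma> unfolding resolved_def by blast

lemma singular_R: "finite {p \<in> pts R. singular (foliation_at eta p)}"
proof -
  have "{p \<in> pts R. singular (foliation_at eta p)} \<subseteq> {p \<in> pts A. singular (foliation_at eta p)} \<union>
      (\<Union>z\<in>Z. (@) z ` {r \<in> pts (\<gamma> z). singular (foliation_at eta (z @ r))})"
    using pts_R by blast
  moreover have "finite ({p \<in> pts A. singular (foliation_at eta p)} \<union>
      (\<Union>z\<in>Z. (@) z ` {r \<in> pts (\<gamma> z). singular (foliation_at eta (z @ r))}))"
    using singular_pts finite_Z \<gamma> by (auto simp: resolved_def)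
  ultimately show ?thesis by (rule finite_subset)
qed

text \<open>A finite set of centres misses almost all directions. A point of \<open>D\<close>
  untouched by every blow-up decides whether \<open>D\<close> is invariant.\<close>

lemma generic_direction:
  obtains t where "D @ [t] \<notin> R"
proof -
  have "inj (\<lambda>t. D @ [t])" by (auto simp: inj_def)
  moreover have "infinite (UNIV :: direction set)"
    using infinite_UNIV_char_0[where 'a = complex] finite_imageD[of Slope UNIV] finite_subset[OF subset_UNIV]
    by (metis direction.inject(1) injI)
  ultimately have "infinite (range (\<lambda>t. D @ [t]))" using finite_imageD by blast
  then have "\<not> range (\<lambda>t. D @ [t]) \<subseteq> R" using finite_R finite_subset by blast
  then show ?thesis using that by blast
qed

lemma D0_wedge: "D \<in> D0 \<Longrightarrow> p \<in> pts R \<Longrightarrow> through (Exc D) p \<Longrightarrow>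
    \<not> singular (foliation_at eta p) \<and> val (wedge (foliation_at eta p) (loc (Exc D) p)) \<noteq> 0"
  and N_invariant: "D \<notin> D0 \<Longrightarrow> p \<in> pts R \<Longrightarrow> through (Exc D) p \<Longrightarrow> invariant (foliation_at eta p) (loc (Exc D) p)"
  using good_R unfolding good_def by auto

lemma wedge_not_invariant: "val (wedge \<omega> f) \<noteq> 0 \<Longrightarrow> val f = 0 \<Longrightarrow> \<not> invariant \<omega> f"
  using val_dvd by (auto simp: invariant_def)

lemma inv_R: "D \<in> R \<Longrightarrow> inv_on eta R D \<longleftrightarrow> D \<notin> D0"
proof
  assume D: "D \<in> R"
  show "inv_on eta R D" if "D \<notin> D0" using N_invariant[OF that] by (simp add: inv_on_def)
  assume i: "inv_on eta R D"
  obtain t where "D @ [t] \<notin> R" using generic_direction .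
  then have p: "D @ [t] \<in> pts R" "through (Exc D) (D @ [t])" using D by (auto simp: pts_def)
  then show "D \<notin> D0" using i D0_wedge[of D "D @ [t]"] wedge_not_invariant[of "foliation_at eta (D @ [t])" "loc (Exc D) (D @ [t])"]
    unfolding inv_on_def through_def by blast
qed

lemma red_R: "red eta R"
proof -
  \<comment> \<open>A common point after the blow-ups in \<open>R\<close> lies over a point of the
    last level of \<open>\<Delta>\<close>, through which both components already pass.\<close>
  have "D = E" if DE: "D \<in> D0" "E \<in> D0" "p \<in> pts R" "through (Exc D) p" "through (Exc E) p" for D E p
  proof -
    have "p \<notin> A" using DE(3) A_R by (auto simp: pts_def)
    then obtain q where q: "prefix q p" "q \<in> pts A" using ex_prefix_pts by blast
    have "through (Exc F) q" if F: "F \<in> D0" "through (Exc F) p" for F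
    proof -
      have "F \<in> A" "strict_prefix F p" using F DN through_Exc_strict_prefix by blast+
      moreover have "\<not> prefix q F" using closed_ptsD[OF closedA \<open>F \<in> A\<close>] q(2) by (auto simp: pts_def)
      moreover have "q \<noteq> F" using \<open>F \<in> A\<close> q(2) by (auto simp: pts_def)
      ultimately have "strict_prefix F q" using prefix_same_cases[OF q(1), of F] by (auto simp: strict_prefix_def)
      then show ?thesis using through_ExcD[OF F(2) q(1)] by blast
    qed
    then show ?thesis using dicritical_disjoint[OF DE(1,2) q(2)] DE by blast
  qed
  note DE = this
  show ?thesis
    unfolding red_def
  proof (intro conjI ballI impI)
    show "finite {p \<in> pts R. singular (foliation_at eta p)}" by (rule singular_R)
    show "sred (foliation_at eta p)" if "p \<in> pts R" for p using good_R[OF that] by (simp add: good_def)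
    show "\<not> singular (foliation_at eta p)" "val (wedge (foliation_at eta p) (loc (Exc D) p)) \<noteq> 0"
      if "D \<in> R" "\<not> inv_on eta R D" "p \<in> pts R" "through (Exc D) p" for D p
      using D0_wedge[of D p] inv_R[of D] that by blast+
    show "\<not> (\<exists>p\<in>pts R. through (Exc D) p \<and> through (Exc E) p)"
      if "D \<in> R" "E \<in> R" "\<not> inv_on eta R D" "\<not> inv_on eta R E" "D \<noteq> E" for D E
      using DE[of D E] inv_R[of D] inv_R[of E] that by blast
  qed
qed

text \<open>A generic point of \<open>D\<close> belongs to the divisors of both \<open>B\<close> and
  \<open>R\<close>, and the foliation there is either transverse to \<open>D\<close> or leaves it
  invariant.\<close>

lemma inv_iff:
  assumes B: "B \<subseteq> R" "red eta B" "D \<in> B"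
  shows "inv_on eta B D \<longleftrightarrow> D \<notin> D0"
proof -
  obtain t where t: "D @ [t] \<notin> R" using generic_direction .
  let ?p = "D @ [t]"
  have p: "?p \<in> pts R" "?p \<in> pts B" "through (Exc D) ?p" using t B by (auto simp: pts_def)
  have v: "val (loc (Exc D) ?p) = 0" using p(3) by (simp add: through_def)
  show ?thesis
  proof
    assume "inv_on eta B D"
    then show "D \<notin> D0" using D0_wedge[OF _ p(1,3)] wedge_not_invariant[OF _ v] p unfolding inv_on_def by blast
  next
    assume D: "D \<notin> D0"
    show "inv_on eta B D"
    proof (rule ccontr)
      assume "\<not> inv_on eta B D"
      then have "val (wedge (foliation_at eta ?p) (loc (Exc D) ?p)) \<noteq> 0"
        using B p unfolding red_def by blast
      then show False using wedge_not_invariant[OF _ v] N_invariant[OF D p(1,3)] by blast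
    qed
  qed
qed

text \<open>Least cardinality gives minimality for inclusion, which is how factorizations compare;
  \<open>[] \<in> B\<close> is kept because sequences of blow-ups are non-empty.\<close>

definition B :: "point set" where
  "B = (ARG_MIN card B. B \<subseteq> R \<and> closed_pts B \<and> [] \<in> B \<and> red eta B)"

lemma B: "B \<subseteq> R" "closed_pts B" "[] \<in> B" "red eta B"
  and B_least: "\<And>C. C \<subseteq> B \<Longrightarrow> closed_pts C \<Longrightarrow> [] \<in> C \<Longrightarrow> red eta C \<Longrightarrow> C = B"
proof -
  let ?P = "\<lambda>B. B \<subseteq> R \<and> closed_pts B \<and> [] \<in> B \<and> red eta B"
  have "?P R" using closed_R NilA A_R red_R by auto
  then have *: "?P B \<and> (\<forall>C. ?P C \<longrightarrow> card B \<le> card C)"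
    unfolding B_def by (rule arg_min_nat_lemma)
  then show P: "B \<subseteq> R" "closed_pts B" "[] \<in> B" "red eta B" by auto
  fix C assume C: "C \<subseteq> B" "closed_pts C" "[] \<in> C" "red eta C"
  then have "card B \<le> card C" using * P by blast
  then show "C = B" using card_seteq[OF finite_subset[OF P(1) finite_R] C(1)] by blast
qed

lemma finite_B: "finite B"
  using finite_subset[OF B(1) finite_R] .

lemma inv_B: "D \<in> B \<Longrightarrow> inv_on eta B D \<longleftrightarrow> D \<notin> D0"
  using inv_iff B by blast

text \<open>A component outside \<open>B\<close> is created at or over a point of the divisor of
  \<open>B\<close>. Such a point is reduced, so the component is invariant by
  \<open>over_reduced\<close>, unlike a dicritical one.\<close>

lemma D0_B: "D0 \<subseteq> B"
proof (rule ccontr)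
  assume "\<not> D0 \<subseteq> B"
  then obtain D where D: "D \<in> D0" "D \<notin> B" by blast
  obtain q where q: "prefix q D" "q \<in> pts B" using ex_prefix_pts D(2) by blast
  obtain t where t: "D @ [t] \<notin> R" using generic_direction .
  have "D \<in> R" using D(1) DN A_R by blast
  then have p: "D @ [t] \<in> pts R" "through (Exc D) (D @ [t])" using t by (auto simp: pts_def)
  obtain w where w: "D @ [t] = q @ w" using q(1) by (metis prefixE prefix_snoc)
  have "sred (foliation_at eta q)" using B(4) q(2) unfolding red_def by blast
  then have "invariant (foliation_at eta (D @ [t])) (loc (Exc D) (D @ [t]))"
    using over_reduced[OF eta_nz, of q w] q(1) p(2) w by simp
  then show False using D0_wedge[OF D(1) p] wedge_not_invariant p(2) unfolding through_def by blast
qed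

end

section \<open>Separatrices through reduced points\<close>

context triplet
begin

lemma Sep_invariant: "S \<in> S0 \<Longrightarrow> through (Sep S) p \<Longrightarrow> invariant (foliation_at eta p) (loc (Sep S) p)"
  using invariant_Sep[OF eta_nz] S0_invariant brS by blast

lemma loc_Exc_cases: "through (Exc E) p \<Longrightarrow> \<exists>t. loc (Exc E) p = exc_line t"
  by (auto simp: through_Exc_iff)

text \<open>Transversality is pulled down through one blow-up. If the separatrix were tangent to an
  invariant \<open>E\<close> at \<open>r\<close>, both would pass through the same point above;
  there \<open>E\<close> would be a third leaf besides the exceptional line and the
  separatrix.\<close>

lemma descend:
  assumes S: "S \<in> S0" "through (Sep S) (r @ [t])" and sr: "sred (foliation_at eta r)"
    and tr: "transverse_germs (loc (Sep S) (r @ [t])) (exc_line t)"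
  shows "ord (loc (Sep S) r) = 1" "through (Exc E) r \<Longrightarrow> invariant (foliation_at eta r) (loc (Exc E) r) \<Longrightarrow>
    transverse_germs (loc (Sep S) r) (loc (Exc E) r)"
proof -
  let ?f = "loc (Sep S) r" and ?f1 = "loc (Sep S) (r @ [t])" and ?e = "loc (Exc E) r"
  have Sb: "S \<in> branches" using S brS by blast
  have l: "?f1 = strict1 t ?f" by (rule loc_snoc) simp
  have thr: "through (Sep S) r" using through_snocD[OF S(2)] by simp
  have irr: "irreducible ?f" "irreducible ?f1" using irreducible_loc[of "Sep S"] Sb thr S(2) by auto
  have nu: "\<not> is_unit (strict1 t ?f)" using S(2) l by (simp add: through_iff_not_unit)
  have v: "val ?f = 0" "val ?f1 = 0" using thr S(2) by (simp_all add: through_def)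
  show o: "ord ?f = 1" using iord_transverse[OF v(2) tr] iord_strict1_tangent[OF irr(1) nu] l by simp
  show "transverse_germs ?f ?e" if E: "through (Exc E) r" "invariant (foliation_at eta r) ?e"
  proof (rule ccontr)
    assume n: "\<not> transverse_germs ?f ?e"
    obtain s where s: "?e = exc_line s" using loc_Exc_cases[OF E(1)] by blast
    have "?f \<noteq> 0" using irr by (auto simp: irreducible_def)
    then have ne: "\<not> is_unit (strict1 t ?e)" using same_tangent[OF _ v(1) o _ _ _ nu n] s by simp
    have "E \<noteq> r" using E(1) through_Exc_strict_prefix by blast
    then have le: "loc (Exc E) (r @ [t]) = strict1 t ?e" by (intro loc_snoc) auto
    have the: "through (Exc E) (r @ [t])" using ne le by (simp add: through_iff_not_unit)
    have ie: "invariant (foliation_at eta (r @ [t])) (strict1 t ?e)"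
      using invariant_loc[OF eta_nz _ _ E(2) the] \<open>E \<noteq> r\<close> le by simp
    have "?f1 dvd strict1 t ?e"
    proof (rule two_leaves_dvd[of "foliation_at eta (r @ [t])" t])
      show "val (strict1 t ?e) = 0" using the le by (simp add: through_def)
      show "\<not> exc_line t dvd strict1 t ?e" using exc_line_not_dvd_strict1 s by simp
    qed (use blow_sred[OF eta_nz sr] v tr transverse_sym Sep_invariant[OF S] ie in auto)
    moreover have "irreducible (strict1 t ?e)" using irreducible_strict1[OF irreducible_exc_line] ne s by simp
    ultimately have "strict1 t ?e dvd ?f1" using irreducible_dvd_irreducible irr(2) by blast
    then show False using Exc_not_dvd_Sep[OF Sb the] le by simp
  qed
qed

lemma sred_B: "p \<in> pts B \<Longrightarrow> sred (foliation_at eta p)"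
  using B(4) unfolding red_def by blast

lemma through_B: "p \<in> pts B \<Longrightarrow> through (Exc E) p \<Longrightarrow> E \<in> B"
  using ptsD[OF B(2)] through_Exc_strict_prefix by blast

lemma B_dichotomy:
  assumes "p \<in> pts B" "through (Exc E) p"
  shows "E \<notin> D0 \<Longrightarrow> invariant (foliation_at eta p) (loc (Exc E) p)"
    "E \<in> D0 \<Longrightarrow> \<not> singular (foliation_at eta p) \<and> val (wedge (foliation_at eta p) (loc (Exc E) p)) \<noteq> 0"
proof -
  have E: "E \<in> B" using through_B assms by blast
  show "E \<notin> D0 \<Longrightarrow> invariant (foliation_at eta p) (loc (Exc E) p)"
    using inv_B[OF E] assms unfolding inv_on_def by blast
  show "E \<in> D0 \<Longrightarrow> \<not> singular (foliation_at eta p) \<and> val (wedge (foliation_at eta p) (loc (Exc E) p)) \<noteq> 0"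
    using inv_B[OF E] assms B(4) E unfolding red_def by blast
qed

text \<open>Descent with \<open>descend\<close> from the point \<open>sp S\<close>, where
  transversality is given, down to \<open>s\<close>; all components created at or over
  \<open>s\<close> are invariant because \<open>s\<close> is reduced.\<close>

lemma smooth_at_reduced:
  assumes S: "S \<in> S0" "through (Sep S) s" and s: "s \<in> A" "s \<in> pts B"
  shows "ord (loc (Sep S) s) = 1" "through (Exc E) s \<Longrightarrow> E \<notin> D0 \<Longrightarrow> transverse_germs (loc (Sep S) s) (loc (Exc E) s)"
proof -
  have Sb: "S \<in> branches" using S brS by blast
  note e = sp[OF S(1)]
  have nA: "sp S \<notin> A" using e(1) by (simp add: pts_def)
  have ps: "prefix s (sp S)"
    using Sep_path_unique[OF Sb S(2) e(2)] Sep_path_unique[OF Sb e(2) S(2)] closed_ptsD[OF closedA s(1)] nA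
    by (meson linear)
  have over: "sred (foliation_at eta (s @ u))"
    "prefix s F \<Longrightarrow> through (Exc F) (s @ u) \<Longrightarrow> invariant (foliation_at eta (s @ u)) (loc (Exc F) (s @ u))" for u F
    using over_reduced[OF eta_nz sred_B[OF s(2)]] by blast+
  have thu: "through (Sep S) (s @ u)" if "sp S = (s @ u) @ v" for u v
    using through_SepD[OF e(2)] that by (metis prefixI)
  have P: "prefix s F \<Longrightarrow> through (Exc F) (s @ u) \<Longrightarrow> transverse_germs (loc (Sep S) (s @ u)) (loc (Exc F) (s @ u))"
    if "sp S = (s @ u) @ v" for u v F
    using that
  proof (induction v arbitrary: u F)
    case Nil
    then show ?case using e(3,5) by simp
  next
    case (Cons t v)
    then have e': "sp S = (s @ (u @ [t])) @ v" by simp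
    have "prefix s (s @ u)" "through (Exc (s @ u)) (s @ (u @ [t]))"
      using through_snoc_Exc[of "s @ u" t] by simp_all
    then have "transverse_germs (loc (Sep S) (s @ (u @ [t]))) (loc (Exc (s @ u)) (s @ (u @ [t])))"
      using Cons.IH[OF _ _ e'] by blast
    then have tr: "transverse_germs (loc (Sep S) ((s @ u) @ [t])) (exc_line t)"
      using loc_Exc_snoc[of "s @ u" t] by simp
    have th: "through (Sep S) ((s @ u) @ [t])" using thu[OF e'] by simp
    show ?case using descend(2)[OF S(1) th over(1) tr Cons.prems(2) over(2)[OF Cons.prems(1,2)]] .
  qed
  obtain w where w: "sp S = s @ w" using ps by (auto elim: prefixE)
  have "w \<noteq> []" using w nA s(1) by auto
  then obtain t v where tv: "w = t # v" by (cases w) auto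
  have e1: "sp S = (s @ [t]) @ v" using w tv by simp
  have th: "through (Sep S) (s @ [t])" using thu[OF e1] .
  have tr: "transverse_germs (loc (Sep S) (s @ [t])) (exc_line t)"
    using P[OF e1, of s] by simp
  have sr: "sred (foliation_at eta s)" using sred_B s by blast
  show "ord (loc (Sep S) s) = 1" using descend(1)[OF S(1) th sr tr] .
  show "transverse_germs (loc (Sep S) s) (loc (Exc E) s)" if E: "through (Exc E) s" "E \<notin> D0"
    using descend(2)[OF S(1) th sr tr E(1) B_dichotomy(1)[OF s(2) E]] .
qed

text \<open>At a dicritical component the foliation is regular and transverse to it, whereas the
  separatrix is a leaf; elementary linear algebra then excludes a common tangent.\<close>

lemma transverse_at_reduced:
  assumes S: "S \<in> S0" "through (Sep S) s" and s: "s \<in> A" "s \<in> pts B" and E: "through (Exc E) s"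
  shows "transverse_germs (loc (Sep S) s) (loc (Exc E) s)"
proof (cases "E \<in> D0")
  case True
  let ?f = "loc (Sep S) s" and ?e = "loc (Exc E) s"
  obtain a b where ab: "foliation_at eta s = (a, b)" by fastforce
  have "irreducible ?f" using irreducible_loc[of "Sep S" s] S brS by blast
  then have f: "?f \<noteq> 0" "val ?f = 0" using S(2) by (auto simp: irreducible_def through_def)
  have "val (dx ?f) \<noteq> 0 \<or> val (dy ?f) \<noteq> 0" using ord_1_iff[OF f(2) smooth_at_reduced(1)[OF S s] f(1)] .
  moreover have "val (wedge (a, b) ?f) = 0"
    using Sep_invariant[OF S] ab val_dvd f(2) by (auto simp: invariant_def)
  then have "val a * val (dy ?f) = val b * val (dx ?f)" by (simp add: wedge_def)
  moreover have "val a * val (dy ?e) \<noteq> val b * val (dx ?e)"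
    using B_dichotomy(2)[OF s(2) E True] ab by (simp add: wedge_def)
  ultimately show ?thesis unfolding transverse_germs_def
  proof -
    define x y p q where d: "x = val (dx ?f)" "y = val (dy ?f)" "p = val (dx ?e)" "q = val (dy ?e)"
    assume *: "val (dx ?f) \<noteq> 0 \<or> val (dy ?f) \<noteq> 0" "val a * val (dy ?f) = val b * val (dx ?f)"
      "val a * val (dy ?e) \<noteq> val b * val (dx ?e)"
    have "x * q - y * p \<noteq> 0"
    proof
      assume J: "x * q - y * p = 0"
      have "y * (val a * q - val b * p) = 0"
      proof -
        have "y * (val a * q - val b * p) = (val a * y) * q - val b * (y * p)" by (simp add: algebra_simps)
        also have "\<dots> = val b * (x * q - y * p)" using *(2) unfolding d[symmetric] by (simp add: algebra_simps)
        finally show ?thesis using J by simp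
      qed
      moreover have "x * (val a * q - val b * p) = 0"
      proof -
        have "x * (val a * q - val b * p) = val a * (x * q) - (val b * x) * p" by (simp add: algebra_simps)
        also have "\<dots> = val a * (x * q - y * p)" using *(2) unfolding d[symmetric] by (simp add: algebra_simps)
        finally show ?thesis using J by simp
      qed
      ultimately show False using *(1,3) unfolding d[symmetric] by auto
    qed
    then show "val (dx ?f * dy ?e - dy ?f * dx ?e) \<noteq> 0" by (simp add: d)
  qed
qed (use smooth_at_reduced(2)[OF S s E] in blast)

text \<open>Two invariant components leave no room for the separatrix as a third leaf; with an
  invariant and a dicritical one the point is regular and the invariant one is its leaf; two
  dicritical ones do not meet after the blow-ups in \<open>B\<close>.\<close>

lemma single_comp_at_reduced:
  assumes S: "S \<in> S0" "through (Sep S) s" and s: "s \<in> A" "s \<in> pts B"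
  shows "\<exists>E. \<forall>F. through (Exc F) s \<longleftrightarrow> F = E"
proof -
  have Sb: "S \<in> branches" using S brS by blast
  have v: "val (loc (Sep S) s) = 0" using S by (simp add: through_def)
  note inv = Sep_invariant[OF S]
  have nd: "\<not> loc (Exc E) s dvd loc (Sep S) s" if "through (Exc E) s" for E
    using Exc_not_dvd_Sep[OF Sb that] .
  have smooth: "val (dx (loc (Exc E) s)) \<noteq> 0 \<or> val (dy (loc (Exc E) s)) \<noteq> 0" if E: "through (Exc E) s" for E
  proof -
    obtain t where "loc (Exc E) s = exc_line t" using loc_Exc_cases[OF E] by blast
    then show ?thesis by (cases t) auto
  qed
  have reg: "False" if E: "through (Exc E) s" "E \<notin> D0" and F: "through (Exc F) s" "F \<in> D0" for E F
  proof -
    have "loc (Exc E) s dvd loc (Sep S) s"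
      using regular_leaf_dvd[of "foliation_at eta s" "loc (Exc E) s" "loc (Sep S) s"] B_dichotomy(2)[OF s(2) F]
        B_dichotomy(1)[OF s(2) E] smooth[OF E(1)] inv v E(1) by (simp add: through_def)
    then show False using nd E by blast
  qed
  have "E = F" if EF: "through (Exc E) s" "through (Exc F) s" "length E \<le> length F" for E F
  proof (rule ccontr)
    assume ne: "E \<noteq> F"
    obtain t where t: "loc (Exc E) s = exc_line t" "loc (Exc F) s = exc_line (cont t)"
      using two_comps(2)[OF EF(1,2) ne EF(3)] by blast
    consider "E \<in> D0" "F \<in> D0" | "E \<notin> D0" "F \<notin> D0" | "E \<in> D0" "F \<notin> D0" | "E \<notin> D0" "F \<in> D0" by blast
    then show False
    proof cases
      case 1
      have "E \<in> B" "F \<in> B" using through_B s(2) EF by blast+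
      then show False using 1 inv_B ne EF s(2) B(4) unfolding red_def by blast
    next
      case 2
      have tr: "transverse_germs (exc_line t) (exc_line (cont t))" by (cases t) (auto simp: transverse_germs_def)
      have "exc_line (cont t) dvd loc (Sep S) s"
      proof (rule two_leaves_dvd[of "foliation_at eta s" t])
        show "invariant (foliation_at eta s) (exc_line t)" "invariant (foliation_at eta s) (exc_line (cont t))"
          using B_dichotomy(1)[OF s(2)] EF 2 t by metis+
        show "\<not> exc_line t dvd loc (Sep S) s" using nd[OF EF(1)] t by simp
      qed (use sred_B[OF s(2)] inv v tr in simp_all)
      then show False using nd[OF EF(2)] t by simp
    qed (use reg EF in blast)+
  qed
  then have "E = F" if "through (Exc E) s" "through (Exc F) s" for E F using that linear by metis
  moreover have "s \<noteq> []" using s B(3) by (auto simp: pts_def)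
  then have "through (Exc (butlast s)) s" by (metis append_butlast_last_id through_snoc_Exc)
  ultimately show ?thesis by blast
qed

text \<open>On a dicritical component the point is regular and has one leaf; on an invariant one
  there is only one leaf besides the component.\<close>

lemma unique_at_reduced:
  assumes S: "S \<in> S0" "through (Sep S) s" and S': "S' \<in> S0" "through (Sep S') s" and s: "s \<in> A" "s \<in> pts B"
  shows "S = S'"
proof -
  let ?f = "loc (Sep S) s"
  obtain E where E: "through (Exc E) s" using single_comp_at_reduced[OF S s] by blast
  have b: "S \<in> branches" "S' \<in> branches" using S S' brS by auto
  have v: "val ?f = 0" "val (loc (Sep S') s) = 0" using S S' by (simp_all add: through_def)
  have "?f dvd loc (Sep S') s"
  proof (cases "E \<in> D0")
    case True
    have "irreducible ?f" using irreducible_loc[of "Sep S" s] S b by blast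
    then have "?f \<noteq> 0" by (auto simp: irreducible_def)
    then have "val (dx ?f) \<noteq> 0 \<or> val (dy ?f) \<noteq> 0" using ord_1_iff[OF v(1) smooth_at_reduced(1)[OF S s]] by blast
    then show ?thesis
      using regular_leaf_dvd[of "foliation_at eta s"] B_dichotomy(2)[OF s(2) E True] Sep_invariant S S' v by blast
  next
    case False
    obtain t where t: "loc (Exc E) s = exc_line t" using loc_Exc_cases[OF E] by blast
    show ?thesis
    proof (rule two_leaves_dvd[of "foliation_at eta s" t])
      show "invariant (foliation_at eta s) (exc_line t)" using B_dichotomy(1)[OF s(2) E False] t by simp
      show "transverse_germs (exc_line t) ?f" using transverse_at_reduced[OF S s E] t transverse_sym by simp
      show "\<not> exc_line t dvd loc (Sep S') s" using Exc_not_dvd_Sep[OF b(2) E] t by simp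
    qed (use sred_B[OF s(2)] Sep_invariant S S' v in simp_all)
  qed
  then show ?thesis using Sep_loc_inj b S(2) by blast
qed

text \<open>The centres of \<open>\<Delta>\<close> lying in \<open>B\<close> already realize the dicritical components and the separatrices, so that
  (S.4) applies: a blow-up over a reduced point creates invariant components only, and the
  separatrices through a reduced point are smooth, transverse and disjoint.\<close>

lemma A_B: "A \<subseteq> B"
proof -
  let ?\<tau> = "filter (\<lambda>x. x \<in> B) (centres \<Delta>)"
  have st: "set ?\<tau> = A \<inter> B" by (auto simp: A_def)
  have bt: "blowup_seq ?\<tau>" using blowup_seq_filter[OF bs B(2,3)] .
  have ft: "factors (centres \<Delta>) ?\<tau>" using factors_filter[OF bs B(2,3)] .
  have cl: "closed_pts (A \<inter> B)" using closedA B(2) by (auto simp: closed_pts_def)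
  \<comment> \<open>Either a point of the last level of \<open>\<Delta>\<close>, or a centre of
    \<open>\<Delta>\<close> not blown up in \<open>B\<close>; the latter is reduced, and the
    preceding lemmas apply to it.\<close>
  have new: "p \<in> pts A \<or> p \<in> A \<and> p \<in> pts B" if "p \<in> pts (A \<inter> B)" for p
    using that by (auto simp: pts_def)
  have comps: "through (Exc E) p \<Longrightarrow> E \<in> A \<inter> B" if "p \<in> pts (A \<inter> B)" for p E
    using ptsD[OF cl that] through_Exc_strict_prefix by blast
  have "realizes_kappa (centres \<Delta>) D0 ?\<tau>"
    unfolding realizes_kappa_def
  proof (intro conjI ballI impI)
    show "blowup_seq ?\<tau>" by (rule bt)
    fix D assume D: "D \<in> D0"
    then show "(?\<tau>, D) \<in> kappa (centres \<Delta>) D"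
      using bt ft D0_B DN st by (auto simp: kappa_def components_all)
    fix E assume E: "E \<in> D0" "D \<noteq> E"
    show "\<not> intersecting ?\<tau> D E"
    proof
      assume "intersecting ?\<tau> D E"
      then obtain p where p: "p \<in> pts (A \<inter> B)" "through (Exc D) p" "through (Exc E) p"
        unfolding intersecting_def points_all st by blast
      from new[OF p(1)] show False
      proof
        assume "p \<in> pts A"
        then show False using dicritical_disjoint[OF D E(1)] p E by blast
      next
        assume "p \<in> A \<and> p \<in> pts B"
        moreover have "D \<in> B" "E \<in> B" using D E D0_B by auto
        ultimately show False using inv_B D E p B(4) unfolding red_def by blast
      qed
    qed
  qed
  moreover have "realizes_eps S0 ?\<tau>"
    unfolding realizes_eps_def
  proof (intro conjI ballI impI)
    show "blowup_seq ?\<tau>" by (rule bt)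
    fix S assume S: "S \<in> S0"
    have Sb: "S \<in> branches" using S brS by blast
    obtain q where "prefix q (sp S)" "q \<in> pts (A \<inter> B)"
      using ex_prefix_pts[of "sp S" "A \<inter> B"] sp(1)[OF S] by (auto simp: pts_def)
    then have q: "q \<in> pts (A \<inter> B)" "through (Sep S) q" using through_SepD[OF sp(2)[OF S]] by auto
    have "\<exists>E. (\<forall>F. through (Exc F) q \<longleftrightarrow> F = E) \<and> ord (loc (Sep S) q) = 1 \<and> transverse_germs (loc (Sep S) q) (loc (Exc E) q)"
      using new[OF q(1)]
    proof
      assume "q \<in> pts A"
      then have "q = sp S" using sp_iff[OF S] q by blast
      then show ?thesis using sp[OF S] by blast
    next
      assume "q \<in> A \<and> q \<in> pts B"
      then show ?thesis
        using single_comp_at_reduced[OF S q(2)] smooth_at_reduced(1)[OF S q(2)] transverse_at_reduced[OF S q(2)] by metis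
    qed
    then obtain E where E: "\<And>F. through (Exc F) q \<longleftrightarrow> F = E" "ord (loc (Sep S) q) = 1" "transverse_germs (loc (Sep S) q) (loc (Exc E) q)"
      by blast
    have "comps_at ?\<tau> q = {E}" using E(1) comps[OF q(1)] unfolding comps_at_def components_all st by blast
    then show "transverse ?\<tau> S"
      unfolding transverse_def trace_point_def points_all st using q E by (intro exI[of _ q] exI[of _ E]) simp
    fix S' assume S': "S' \<in> S0" "S \<noteq> S'"
    show "\<not> (\<exists>p\<in>points ?\<tau> (length ?\<tau>). through (Sep S) p \<and> through (Sep S') p)"
    proof
      assume "\<exists>p\<in>points ?\<tau> (length ?\<tau>). through (Sep S) p \<and> through (Sep S') p"
      then obtain p where p: "p \<in> pts (A \<inter> B)" "through (Sep S) p" "through (Sep S') p"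
        unfolding points_all st by blast
      from new[OF p(1)] show False
      proof
        assume "p \<in> pts A"
        then show False using sp_iff[OF S] sp_iff[OF S'(1)] sp_inj[OF S S'(1)] p S'(2) by metis
      next
        assume "p \<in> A \<and> p \<in> pts B"
        then show False using unique_at_reduced[OF S p(2) S'(1) p(3)] S'(2) by blast
      qed
    qed
  qed
  ultimately have "iso_over (centres \<Delta>) ?\<tau>"
    using framed ft unfolding framed_def minimal_seq_def S0_def[symmetric] D0_def[symmetric] by blast
  then show ?thesis unfolding iso_over_def st by (auto simp: A_def)
qed

end

section \<open>Closedness of the form, and poles after further blow-ups\<close>

lemma closed_form_add:
  assumes "closed_form \<eta>" "closed_form \<theta>"
  shows "closed_form (fst \<eta> + fst \<theta>, snd \<eta> + snd \<theta>)"
proof -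
  obtain a b h where 1: "h \<noteq> 0" "\<eta> = (Fract a h, Fract b h)" "h * (dx b - dy a) = dx h * b - dy h * a"
    using assms(1) by (auto simp: closed_form_def)
  obtain c d k where 2: "k \<noteq> 0" "\<theta> = (Fract c k, Fract d k)" "k * (dx d - dy c) = dx k * d - dy k * c"
    using assms(2) by (auto simp: closed_form_def)
  have "(h * k) * (dx (b * k + d * h) - dy (a * k + c * h)) =
      k * k * (h * (dx b - dy a)) + h * h * (k * (dx d - dy c)) + h * k * (b * dx k + d * dx h - a * dy k - c * dy h)"
    by (simp add: dx_mult dy_mult algebra_simps)
  also have "\<dots> = dx (h * k) * (b * k + d * h) - dy (h * k) * (a * k + c * h)"
    unfolding 1(3) 2(3) by (simp add: dx_mult dy_mult algebra_simps)
  finally show ?thesis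
    unfolding closed_form_def using 1 2
    by (intro exI[of _ "a * k + c * h"] exI[of _ "b * k + d * h"] exI[of _ "h * k"]) (simp add: add_fract)
qed

lemma closed_form_dl:
  assumes "f \<noteq> 0"
  shows "closed_form (hol (const c) * Fract (dx f) f, hol (const c) * Fract (dy f) f)"
  unfolding closed_form_def using assms
  by (intro exI[of _ "const c * dx f"] exI[of _ "const c * dy f"] exI[of _ f])
    (simp add: mult_fract dx_mult dy_mult dx_dy algebra_simps)

lemma closed_form_sum:
  assumes "finite S" "\<And>x. x \<in> S \<Longrightarrow> closed_form (a x, b x)"
  shows "closed_form (sum a S, sum b S)"
  using assms
proof (induction S rule: finite_induct)
  case empty
  show ?case unfolding closed_form_def by (intro exI[of _ 0] exI[of _ 0] exI[of _ 1]) (simp add: Zero_fract_def)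
next
  case (insert x F)
  then show ?case using closed_form_add[of "(a x, b x)" "(sum a F, sum b F)"] by simp
qed

lemma polar_branches_hol: "polar_branches (hol a, hol b) = {}"
proof -
  have "1 \<notin> S" if "S \<in> branches" for S
    using eqn[OF that] by (auto simp: curve_def irreducible_def)
  then show ?thesis by (auto simp: polar_branches_def)
qed

lemma transform_hol_append: "transform \<eta> p = (hol a, hol b) \<Longrightarrow> \<exists>c d. transform \<eta> (p @ r) = (hol c, hol d)"
proof (induction r rule: rev_induct)
  case (snoc t r)
  then obtain c d where "transform \<eta> (p @ r) = (hol c, hol d)" by blast
  then have "transform \<eta> ((p @ r) @ [t]) = blow_form t (hol c, hol d)" unfolding transform_snoc by simp
  moreover have "\<exists>e f. blow_form t (hol c, hol d) = (hol e, hol f)"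
    by (cases t) (auto simp flip: hol_hom)
  ultimately show ?case by simp
qed auto

section \<open>The duplet of the form and its dominance\<close>

context triplet
begin

lemma closed_eta: "closed_form eta"
proof -
  have "eqn S \<noteq> 0" if "S \<in> S0" for S using eqn[of S] that brS by (auto simp: irreducible_def)
  then show ?thesis unfolding eta_def using finS by (intro closed_form_sum closed_form_dl) auto
qed

text \<open>The centres of \<open>\<Delta>\<close> come first and in their own order, since
  dominance compares initial segments.\<close>

definition \<pi>' :: "point list" where
  "\<pi>' = (SOME \<pi>. take (height \<Delta>) \<pi> = centres \<Delta> \<and> blowup_seq \<pi> \<and> set \<pi> = B)"

lemma \<pi>': "take (height \<Delta>) \<pi>' = centres \<Delta>" "blowup_seq \<pi>'" "set \<pi>' = B"
proof -
  obtain \<sigma> where "blowup_seq (centres \<Delta> @ \<sigma>)" "set (centres \<Delta> @ \<sigma>) = B"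
    using ex_blowup_list[OF finite_B B(2) bs] A_B by (auto simp: A_def)
  then have "take (height \<Delta>) (centres \<Delta> @ \<sigma>) = centres \<Delta> \<and> blowup_seq (centres \<Delta> @ \<sigma>) \<and> set (centres \<Delta> @ \<sigma>) = B"
    by (simp add: height_def)
  then have "take (height \<Delta>) \<pi>' = centres \<Delta> \<and> blowup_seq \<pi>' \<and> set \<pi>' = B"
    unfolding \<pi>'_def by (rule someI)
  then show "take (height \<Delta>) \<pi>' = centres \<Delta>" "blowup_seq \<pi>'" "set \<pi>' = B" by auto
qed

lemma invariant_comp_\<pi>': "D \<in> B \<Longrightarrow> invariant_comp eta \<pi>' D \<longleftrightarrow> D \<notin> D0"
  by (simp add: invariant_comp_iff \<pi>' inv_B)

lemma points_\<pi>': "points \<pi>' (length \<pi>') = pts B" and components_\<pi>': "components \<pi>' (length \<pi>') = B"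
  by (simp_all add: points_all components_all \<pi>')

lemma minimal_\<pi>': "minimal_reduction eta \<pi>'"
  unfolding minimal_reduction_def minimal_seq_def
proof (intro conjI allI impI)
  show "reduces eta \<pi>'" using reduces_iff eta_nz \<pi>' B(4) by simp
  fix \<tau> assume t: "reduces eta \<tau> \<and> factors \<pi>' \<tau>"
  then have "set \<tau> \<subseteq> B" "red eta (set \<tau>)" "closed_pts (set \<tau>)" "[] \<in> set \<tau>"
    using factorsD[of \<pi>' \<tau>] \<pi>'(3) blowup_seq_closed[of \<tau>] by (auto simp: reduces_iff)
  then show "iso_over \<pi>' \<tau>" using B_least[of "set \<tau>"] \<pi>'(3) by (simp add: iso_over_def)
qed

text \<open>The blow-ups after those of \<open>\<Delta>\<close> take place at and over points of
  \<open>Z\<close> only.\<close>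

lemma pts_A_B: "p \<in> pts A \<Longrightarrow> p \<notin> Z \<Longrightarrow> p \<in> pts B"
proof -
  assume p: "p \<in> pts A" "p \<notin> Z"
  have "p \<notin> B"
  proof
    assume "p \<in> B"
    then have "p \<in> R" "p \<notin> A" using B(1) p by (auto simp: pts_def)
    then obtain z where z: "z \<in> Z" "prefix z p" using R_prefix by blast
    then have "z = p" using pts_antichain[OF closedA p(1)] Z_pts by blast
    then show False using p z by blast
  qed
  then show "p \<in> pts B" using p A_B by (auto simp: pts_def)
qed

lemma sp_notin_Z: "S \<in> S0 \<Longrightarrow> sp S \<notin> Z"
proof
  assume S: "S \<in> S0" "sp S \<in> Z"
  obtain D u v z where D: "D \<in> D0" "Slope z \<notin> TD D" "sp S = endpt A D (Slope z)"
    using type_Z[OF S(2)] by metis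
  have "nbr D (Slope z) (Sep S)" using sp(2)[OF S(1)] S(1) D by (simp add: nbr_def cset_def)
  then show False using D by (auto simp: TD_def)
qed

lemma meets_\<pi>': "S \<in> S0 \<Longrightarrow> meets \<pi>' S D \<longleftrightarrow> D = sD S"
proof -
  assume S: "S \<in> S0"
  have Sb: "S \<in> branches" using S brS by blast
  have p: "sp S \<in> pts B" using pts_A_B sp(1)[OF S] sp_notin_Z[OF S] by blast
  have u: "p = sp S" if "p \<in> pts B" "through (Sep S) p" for p
    using pts_antichain[OF B(2)] Sep_path_unique[OF Sb] that p sp(2)[OF S] by (metis linear)
  have "sD S \<in> B" using sD_in[OF S] A_B by blast
  then show ?thesis
    unfolding meets_def comps_at_def points_\<pi>' components_\<pi>' using u p sp(2,3)[OF S] by blast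
qed

definition \<Delta>' :: dic_struct where
  "\<Delta>' = \<lparr>centres = \<pi>', dic = (\<lambda>j. {D \<in> components \<pi>' j. \<not> invariant_comp eta \<pi>' D}),
     ndic = (\<lambda>j. {D \<in> components \<pi>' j. invariant_comp eta \<pi>' D})\<rparr>"

definition T :: "branch set" where
  "T = S0 \<union> isolated_separatrices eta \<pi>'"

definition \<Sigma>' :: separatrices where
  "\<Sigma>' = \<lparr>dsep = {S \<in> T. \<exists>D. meets \<pi>' S D \<and> \<not> invariant_comp eta \<pi>' D},
     isep = {S \<in> T. \<exists>D. meets \<pi>' S D \<and> invariant_comp eta \<pi>' D}\<rparr>"

lemma all_sep_\<Sigma>': "all_sep \<Sigma>' = T"
proof -
  have "\<exists>D. meets \<pi>' S D" if "S \<in> T" for S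
    using that meets_\<pi>' by (auto simp: T_def isolated_separatrices_def)
  then show ?thesis by (auto simp: all_sep_def \<Sigma>'_def)
qed

lemma is_DD_eta: "is_DD eta \<Delta>' \<Sigma>'"
  unfolding is_DD_def Let_def all_sep_\<Sigma>'
  using minimal_\<pi>' polar_branches_eta by (simp add: \<Delta>'_def \<Sigma>'_def T_def)

lemma height_\<Delta>': "height \<Delta>' = length \<pi>'" "height \<Delta> \<le> length \<pi>'"
proof -
  have "length (take (height \<Delta>) \<pi>') = height \<Delta>" by (simp only: \<pi>'(1)) (simp add: height_def)
  then show "height \<Delta> \<le> length \<pi>'" by simp
qed (simp add: height_def \<Delta>'_def)

lemma dominates_struct_\<Delta>': "dominates_struct \<Delta>' \<Delta>"
  unfolding dominates_struct_def
proof (intro conjI ballI allI impI)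
  show "height \<Delta> \<le> height \<Delta>'" using height_\<Delta>' by simp
  show "take (height \<Delta>) (centres \<Delta>') = centres \<Delta>" using \<pi>' by (simp add: \<Delta>'_def)
  fix j assume "j \<in> {1..height \<Delta>}"
  then have j: "j \<le> height \<Delta>" by simp
  have "take j \<pi>' = take j (centres \<Delta>)" using \<pi>'(1) j by (metis min.absorb1 take_take)
  then have c: "components \<pi>' j = set (take j (centres \<Delta>))" by (simp add: components_def)
  have sub: "set (take j (centres \<Delta>)) \<subseteq> A" by (simp add: A_def set_take_subset)
  then have i: "invariant_comp eta \<pi>' D \<longleftrightarrow> D \<notin> D0" if "D \<in> set (take j (centres \<Delta>))" for D
    using invariant_comp_\<pi>' A_B that by blast
  show "dic \<Delta>' j = dic \<Delta> j" unfolding \<Delta>'_def dic_level(1)[OF j] using c i by auto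
  have "N0 \<inter> set (take j (centres \<Delta>)) = {D \<in> set (take j (centres \<Delta>)). D \<notin> D0}" using sub DN by blast
  then show "ndic \<Delta>' j = ndic \<Delta> j" unfolding \<Delta>'_def dic_level(2)[OF j] using c i by auto
next
  fix k assume k: "height \<Delta> \<le> k \<and> k < height \<Delta>'"
  let ?q = "\<pi>' ! k"
  have ck: "centres \<Delta>' ! k = ?q" by (simp add: \<Delta>'_def)
  have kl: "k < length \<pi>'" using k height_\<Delta>' by simp
  have qB: "?q \<in> B" using kl \<pi>'(3) nth_mem by blast
  have nA: "?q \<notin> A"
  proof
    assume "?q \<in> A"
    then have "?q \<in> set (take (height \<Delta>) \<pi>')" using \<pi>'(1) by (simp add: A_def)
    then obtain i where i: "i < height \<Delta>" "\<pi>' ! i = ?q" by (auto simp: in_set_conv_nth)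
    have "distinct \<pi>'" using blowup_seq_closed \<pi>'(2) by blast
    then show False using i k kl by (simp add: nth_eq_iff_index_eq)
  qed
  have "?q \<notin> D0" using nA DN by blast
  then have "?q \<in> ndic \<Delta>' (Suc k)"
    using invariant_comp_\<pi>'[OF qB] kl by (simp add: \<Delta>'_def components_def take_Suc_conv_app_nth)
  then show "centres \<Delta>' ! k \<in> ndic \<Delta>' (Suc k)" using ck by simp
  obtain p where p: "p \<in> Z" "prefix p ?q" using R_prefix[of ?q] qB B(1) nA by blast
  obtain D u v z where D: "D \<in> D0" "Slope z \<notin> TD D" "p = endpt A D (Slope z)" using type_Z[OF p(1)] by metis
  have pA: "p \<in> pts A" using p Z_pts by blast
  have th: "through (Exc D) p" using endptA(2) D(3) by simp
  have "E = D" if "through (Exc E) p" for E using that Exc_in_cset[OF that] D(2,3) by (auto simp: nbr_def TD_def)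
  then have "comps_at (centres \<Delta>) p = {D}" using comps_at_eq[OF pA] th by blast
  then have "trace_point (centres \<Delta>) p" using pA by (simp add: trace_point_def points_n)
  then show "\<exists>p. prefix p (centres \<Delta>' ! k) \<and> trace_point (centres \<Delta>) p \<and> (\<exists>D\<in>dic \<Delta> (height \<Delta>). through (Exc D) p)"
    using p ck th D(1) unfolding D0_def by metis
qed

lemma dominates_eta: "dominates \<Delta>' \<Sigma>' \<Delta> \<Sigma>"
  unfolding dominates_def all_sep_\<Sigma>' S0_def[symmetric] points_n
proof (intro conjI ballI)
  show "dominates_struct \<Delta>' \<Delta>" by (rule dominates_struct_\<Delta>')
  show "S0 \<subseteq> T" by (simp add: T_def)
  show "T - S0 \<subseteq> isep \<Sigma>'" by (auto simp: T_def \<Sigma>'_def isolated_separatrices_def)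
next
  fix S assume S: "S \<in> S0"
  have D: "sD S \<in> A" "sD S \<in> B" using sD_in[OF S] A_B by auto
  have "S \<in> dsep \<Sigma>' \<longleftrightarrow> sD S \<in> D0" "S \<in> isep \<Sigma>' \<longleftrightarrow> sD S \<notin> D0"
    using meets_\<pi>'[OF S] S invariant_comp_\<pi>'[OF D(2)] by (auto simp: \<Sigma>'_def T_def)
  moreover have "sD S \<notin> D0 \<longleftrightarrow> sD S \<in> N0" using D(1) DN by blast
  ultimately show "S \<in> dsep \<Sigma> \<longleftrightarrow> S \<in> dsep \<Sigma>'" "S \<in> isep \<Sigma> \<longleftrightarrow> S \<in> isep \<Sigma>'" using sep_types[OF S] by auto
next
  fix S assume "S \<in> T - S0"
  then have S: "S \<in> branches" "S \<notin> S0" "invariant (foliation_at eta []) (eqn S)"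
    by (auto simp: T_def isolated_separatrices_def)
  obtain p where p: "p \<in> pts A" "through (Sep S) p"
  proof -
    \<comment> \<open>A path longer than every centre has left \<open>A\<close>, so one of its
      initial parts ends at the last level.\<close>
    define m where "m = Suc (Max (length ` A))"
    obtain p where p: "length p = m" "through (Sep S) p" using Sep_path_exists[OF S(1)] by blast
    have "p \<notin> A"
    proof
      assume "p \<in> A"
      then have "length p \<le> Max (length ` A)" by simp
      then show False using p(1) by (simp add: m_def)
    qed
    then obtain q where "prefix q p" "q \<in> pts A" using ex_prefix_pts by blast
    then show ?thesis using that through_SepD[OF p(2)] by blast
  qed
  then show "\<exists>p\<in>pts A. through (Sep S) p \<and> (\<exists>D\<in>dic \<Delta> (height \<Delta>). comps_at (centres \<Delta>) p = {D}) \<and>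
      support_branches \<Delta> \<Sigma> (height \<Delta>) p = {}"
    using new_separatrix[OF S p] unfolding D0_def by blast
qed

text \<open>At and over the points of \<open>Z\<close> the form is holomorphic, so the only centres
  with poles are centres of \<open>\<Delta>\<close>.\<close>

lemma faithful_eta: "faithful eta"
  unfolding faithful_def
proof (intro exI[of _ \<pi>'] conjI ballI impI)
  show "minimal_reduction eta \<pi>'" by (rule minimal_\<pi>')
  fix q assume q: "q \<in> set \<pi>'" "polar_branches (transform eta q) \<noteq> {}"
  have "q \<in> A"
  proof (rule ccontr)
    assume "q \<notin> A"
    then obtain p where p: "p \<in> Z" "prefix p q" using R_prefix[of q] q(1) \<pi>'(3) B(1) by blast
    obtain u v where "transform eta p = (hol u, hol v)" using type_Z[OF p(1)] by metis
    then obtain c d where "transform eta q = (hol c, hol d)" using transform_hol_append p(2) by (metis prefixE)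
    then show False using q(2) polar_branches_hol by simp
  qed
  moreover have "polar_at q \<noteq> {}" using q(2) polar_branches_transform by auto
  ultimately show "one_faithful (transform eta q)" by (rule faithful_A)
qed

lemma logarithmic: "Q_logarithmic \<Delta> \<Sigma> I (\<lambda>j. L) eta"
  unfolding Q_logarithmic_def S0_def[symmetric]
proof (intro conjI)
  show "\<exists>F a b. (\<forall>S\<in>S0. is_equation S (F S)) \<and> closed_holo a b \<and>
      fst eta = (\<Sum>S\<in>S0. hol (const (L (Sep S))) * Fract (dx (F S)) (F S)) + hol a \<and>
      snd eta = (\<Sum>S\<in>S0. hol (const (L (Sep S))) * Fract (dy (F S)) (F S)) + hol b"
    using eqn brS
    by (intro exI[of _ eqn] exI[of _ 0]) (auto simp: eta_def closed_holo_def is_equation_def hol_hom)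
qed (use quadruplet closed_eta is_DD_eta dominates_eta faithful_eta in blast)+

end

theorem theorem1:
  fixes \<Delta> :: dic_struct and \<Sigma> :: separatrices
    and \<Upsilon> :: "nat \<Rightarrow> point \<Rightarrow> branch \<Rightarrow> complex"
  assumes "dicritical_triplet \<Delta> \<Sigma> \<Upsilon>"
  shows "\<exists>\<Lambda>. dicritical_quadruplet \<Delta> \<Sigma> \<Upsilon> \<Lambda> \<and> (\<exists>\<eta>. Q_logarithmic \<Delta> \<Sigma> \<Upsilon> \<Lambda> \<eta>)"
proof -
  interpret triplet \<Delta> \<Sigma> \<Upsilon> using assms by unfold_locales
  show ?thesis using quadruplet logarithmic by blast
qed

end
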